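(* Let $(A,\mathfrak{m})$ be a local complete intersection ring. Let $M$ and $N$ be finitely generated $A$-modules, and let $I$ be an ideal of $A$. Then there exist two non-negative integers $n_0$ and $i_0$ such that for all $n \ge n_0$ and $i \ge i_0$, $$\mathrm{Ass}_A\left(\mathrm{Ext}_A^{2i}(M,N/I^nN)\right) = \mathrm{Ass}_A\left(\mathrm{Ext}_A^{2 i_0}(M,N/I^{n_0}N)\right),$$ $$\mathrm{Ass}_A\left(\mathrm{Ext}_A^{2i+1}(M,N/I^nN)\right) = \mathrm{Ass}_A\left(\mathrm{Ext}_A^{2 i_0 + 1}(M,N/I^{n_0}N)\right).$$
   Context: All rings are commutative Noetherian with identity. A local ring $A$ is a local complete intersection ring if its $\mathfrak{m}$-adic completion is $\widehat{A} = Q/(\mathbf{f})$, where $Q$ is a complete regular local ring and $\mathbf{f}=f_1,\ldots,f_c$ is a $Q$-regular sequence. $\mathrm{Ass}_A(E)$ denotes the set of associated prime ideals of an $A$-module $E$. *)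

theory Defs
  imports "HOL-Algebra.Algebra" "HOL-Library.Extended_Nat"
begin

section \<open>Local rings, completion, complete intersections\<close>

definition noetherian_local_ring :: "('a, 'k) ring_scheme \<Rightarrow> 'a set \<Rightarrow> bool" where
  "noetherian_local_ring A \<mm> \<longleftrightarrow>
     cring A \<and> noetherian_ring A \<and> maximalideal \<mm> A \<and> (\<forall>J. maximalideal J A \<longrightarrow> J = \<mm>)"

text \<open>Powers of ideals are taken in the monoid of ideals, so the zeroth power is the whole ring.\<close>

abbreviation ideal_pow :: "('a, 'k) ring_scheme \<Rightarrow> 'a set \<Rightarrow> nat \<Rightarrow> 'a set" where
  "ideal_pow A I n \<equiv> I [^]\<^bsub>ideals_set A\<^esub> n"

text \<open>The \<open>I\<close>-adic completion is the inverse limit of the rings \<open>A Quot I\<^sup>n\<close>; the transition map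
  from \<open>A Quot I\<^sup>n\<^sup>+\<^sup>1\<close> to \<open>A Quot I\<^sup>n\<close> sends a coset \<open>C\<close> to \<open>I\<^sup>n + C\<close>.\<close>

definition completion :: "('a, 'k) ring_scheme \<Rightarrow> 'a set \<Rightarrow> (nat \<Rightarrow> 'a set) ring" where
  "completion A I =
    \<lparr>carrier = {x. \<forall>n. x n \<in> carrier (A Quot ideal_pow A I n)
                     \<and> ideal_pow A I n <+>\<^bsub>A\<^esub> x (Suc n) = x n},
     monoid.mult = (\<lambda>x y n. x n \<otimes>\<^bsub>A Quot ideal_pow A I n\<^esub> y n),
     one = (\<lambda>n. \<one>\<^bsub>A Quot ideal_pow A I n\<^esub>),
     ring.zero = (\<lambda>n. \<zero>\<^bsub>A Quot ideal_pow A I n\<^esub>),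
     add = (\<lambda>x y n. x n \<oplus>\<^bsub>A Quot ideal_pow A I n\<^esub> y n)\<rparr>"

definition complete_ring :: "('a, 'k) ring_scheme \<Rightarrow> 'a set \<Rightarrow> bool" where
  "complete_ring A I \<longleftrightarrow>
     bij_betw (\<lambda>a n. ideal_pow A I n +>\<^bsub>A\<^esub> a) (carrier A) (carrier (completion A I))"

definition krull_dim :: "('a, 'k) ring_scheme \<Rightarrow> enat" where
  "krull_dim A = Sup {enat n | n.
     \<exists>P :: nat \<Rightarrow> 'a set. (\<forall>i\<le>n. primeideal (P i) A) \<and> (\<forall>i<n. P i \<subset> P (Suc i))}"

definition min_generators :: "('a, 'k) ring_scheme \<Rightarrow> 'a set \<Rightarrow> nat" where
  "min_generators A I = (LEAST k. \<exists>S. S \<subseteq> carrier A \<and> finite S \<and> card S = k \<and> genideal A S = I)"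

definition regular_local_ring :: "('a, 'k) ring_scheme \<Rightarrow> 'a set \<Rightarrow> bool" where
  "regular_local_ring A \<mm> \<longleftrightarrow>
     noetherian_local_ring A \<mm> \<and> krull_dim A = enat (min_generators A \<mm>)"

definition regular_sequence :: "('a, 'k) ring_scheme \<Rightarrow> 'a list \<Rightarrow> bool" where
  "regular_sequence A fs \<longleftrightarrow>
     set fs \<subseteq> carrier A \<and> genideal A (set fs) \<noteq> carrier A \<and>
     (\<forall>i<length fs. \<forall>x\<in>carrier A.
        fs ! i \<otimes>\<^bsub>A\<^esub> x \<in> genideal A (set (take i fs)) \<longrightarrow> x \<in> genideal A (set (take i fs)))"

text \<open>The type argument only provides a home for the regular ring \<open>Q\<close>. In a hypothesis it acts as
  an existential quantifier over all types as long as \<open>'q\<close> does not occur elsewhere.\<close>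

definition local_complete_intersection ::
    "'q itself \<Rightarrow> ('a, 'k) ring_scheme \<Rightarrow> 'a set \<Rightarrow> bool" where
  "local_complete_intersection TYPE('q) A \<mm> \<longleftrightarrow>
     noetherian_local_ring A \<mm> \<and>
     (\<exists>(Q :: 'q ring) \<nn> fs.
        regular_local_ring Q \<nn> \<and> complete_ring Q \<nn> \<and> regular_sequence Q fs \<and>
        completion A \<mm> \<simeq> Q Quot genideal Q (set fs))"


section \<open>Modules\<close>

text \<open>The record type of modules extends that of rings; the fields \<open>mult\<close> and \<open>one\<close> play no
  role for modules and are left undefined below.\<close>

definition mod_span ::
    "('a, 'k) ring_scheme \<Rightarrow> ('a, 'm, 'l) module_scheme \<Rightarrow> 'm set \<Rightarrow> 'm set" where
  "mod_span A M S = \<Inter>{H. submodule H A M \<and> S \<subseteq> H}"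

definition finitely_generated ::
    "('a, 'k) ring_scheme \<Rightarrow> ('a, 'm, 'l) module_scheme \<Rightarrow> bool" where
  "finitely_generated A M \<longleftrightarrow> (\<exists>S. S \<subseteq> carrier M \<and> finite S \<and> mod_span A M S = carrier M)"

definition ideal_smult ::
    "('a, 'k) ring_scheme \<Rightarrow> 'a set \<Rightarrow> ('a, 'm, 'l) module_scheme \<Rightarrow> 'm set" where
  "ideal_smult A I M = mod_span A M {a \<odot>\<^bsub>M\<^esub> x | a x. a \<in> I \<and> x \<in> carrier M}"

definition quot_module :: "('a, 'm, 'l) module_scheme \<Rightarrow> 'm set \<Rightarrow> ('a, 'm set) module" where
  "quot_module M H =
    \<lparr>carrier = a_rcosets\<^bsub>M\<^esub> H, monoid.mult = undefined, one = undefined,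
     ring.zero = H, add = set_add M,
     smult = (\<lambda>a C. \<Union>x\<in>C. H +>\<^bsub>M\<^esub> (a \<odot>\<^bsub>M\<^esub> x))\<rparr>"

definition mod_hom ::
    "('a, 'k) ring_scheme \<Rightarrow> ('a, 'm, 'l) module_scheme \<Rightarrow> ('a, 'n, 'j) module_scheme
      \<Rightarrow> ('m \<Rightarrow> 'n) set" where
  "mod_hom A M N = {f \<in> carrier M \<rightarrow> carrier N.
     (\<forall>x\<in>carrier M. \<forall>y\<in>carrier M. f (x \<oplus>\<^bsub>M\<^esub> y) = f x \<oplus>\<^bsub>N\<^esub> f y) \<and>
     (\<forall>a\<in>carrier A. \<forall>x\<in>carrier M. f (a \<odot>\<^bsub>M\<^esub> x) = a \<odot>\<^bsub>N\<^esub> f x)}"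

definition Hom_module ::
    "('a, 'k) ring_scheme \<Rightarrow> ('a, 'm, 'l) module_scheme \<Rightarrow> ('a, 'n, 'j) module_scheme
      \<Rightarrow> ('a, 'm \<Rightarrow> 'n) module" where
  "Hom_module A M N =
    \<lparr>carrier = mod_hom A M N \<inter> extensional (carrier M), monoid.mult = undefined, one = undefined,
     ring.zero = (\<lambda>x\<in>carrier M. \<zero>\<^bsub>N\<^esub>),
     add = (\<lambda>f g. \<lambda>x\<in>carrier M. f x \<oplus>\<^bsub>N\<^esub> g x),
     smult = (\<lambda>a f. \<lambda>x\<in>carrier M. a \<odot>\<^bsub>N\<^esub> f x)\<rparr>"

definition mod_kernel ::
    "('a, 'm, 'l) module_scheme \<Rightarrow> ('a, 'n, 'j) module_scheme \<Rightarrow> ('m \<Rightarrow> 'n) \<Rightarrow> 'm set" where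
  "mod_kernel M N f = {x \<in> carrier M. f x = \<zero>\<^bsub>N\<^esub>}"

definition free_module :: "('a, 'k) ring_scheme \<Rightarrow> nat \<Rightarrow> ('a, nat \<Rightarrow> 'a) module" where
  "free_module A k =
    \<lparr>carrier = {..<k} \<rightarrow>\<^sub>E carrier A, monoid.mult = undefined, one = undefined,
     ring.zero = (\<lambda>j\<in>{..<k}. \<zero>\<^bsub>A\<^esub>),
     add = (\<lambda>v w. \<lambda>j\<in>{..<k}. v j \<oplus>\<^bsub>A\<^esub> w j),
     smult = (\<lambda>a v. \<lambda>j\<in>{..<k}. a \<otimes>\<^bsub>A\<^esub> v j)\<rparr>"

definition associated_primes ::
    "('a, 'k) ring_scheme \<Rightarrow> ('a, 'm, 'l) module_scheme \<Rightarrow> 'a set set" where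
  "associated_primes A E =
     {P. primeideal P A \<and> (\<exists>x\<in>carrier E. P = {a \<in> carrier A. a \<odot>\<^bsub>E\<^esub> x = \<zero>\<^bsub>E\<^esub>})}"


section \<open>Ext\<close>

text \<open>A resolution \<open>\<dots> \<rightarrow> A\<^bsup>b 2\<^esup> \<rightarrow> A\<^bsup>b 1\<^esup> \<rightarrow> A\<^bsup>b 0\<^esup> \<rightarrow> M \<rightarrow> 0\<close> by finitely generated free modules, with
  \<open>d i\<close> mapping from degree \<open>i + 1\<close> to degree \<open>i\<close>.\<close>

definition free_resolution ::
    "('a, 'k) ring_scheme \<Rightarrow> ('a, 'm, 'l) module_scheme \<Rightarrow> (nat \<Rightarrow> nat)
      \<Rightarrow> (nat \<Rightarrow> (nat \<Rightarrow> 'a) \<Rightarrow> (nat \<Rightarrow> 'a)) \<Rightarrow> ((nat \<Rightarrow> 'a) \<Rightarrow> 'm) \<Rightarrow> bool" where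
  "free_resolution A M b d \<epsilon> \<longleftrightarrow>
     \<epsilon> \<in> mod_hom A (free_module A (b 0)) M \<and>
     (\<forall>i. d i \<in> mod_hom A (free_module A (b (Suc i))) (free_module A (b i))) \<and>
     \<epsilon> ` carrier (free_module A (b 0)) = carrier M \<and>
     d 0 ` carrier (free_module A (b 1)) = mod_kernel (free_module A (b 0)) M \<epsilon> \<and>
     (\<forall>i. d (Suc i) ` carrier (free_module A (b (Suc (Suc i)))) =
          mod_kernel (free_module A (b (Suc i))) (free_module A (b i)) (d i))"

text \<open>\<open>coboundary\<close> is the map \<open>Hom (A\<^bsup>b i\<^esup>, N) \<rightarrow> Hom (A\<^bsup>b (i + 1)\<^esup>, N)\<close> induced by \<open>d i\<close>.\<close>

definition coboundary ::
    "('a, 'k) ring_scheme \<Rightarrow> (nat \<Rightarrow> nat) \<Rightarrow> (nat \<Rightarrow> (nat \<Rightarrow> 'a) \<Rightarrow> (nat \<Rightarrow> 'a))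
      \<Rightarrow> nat \<Rightarrow> ((nat \<Rightarrow> 'a) \<Rightarrow> 'n) \<Rightarrow> ((nat \<Rightarrow> 'a) \<Rightarrow> 'n)" where
  "coboundary A b d i f = compose (carrier (free_module A (b (Suc i)))) f (d i)"

definition cocycles ::
    "('a, 'k) ring_scheme \<Rightarrow> ('a, 'n, 'j) module_scheme \<Rightarrow> (nat \<Rightarrow> nat)
      \<Rightarrow> (nat \<Rightarrow> (nat \<Rightarrow> 'a) \<Rightarrow> (nat \<Rightarrow> 'a)) \<Rightarrow> nat \<Rightarrow> ((nat \<Rightarrow> 'a) \<Rightarrow> 'n) set" where
  "cocycles A N b d i =
     mod_kernel (Hom_module A (free_module A (b i)) N) (Hom_module A (free_module A (b (Suc i))) N)
       (coboundary A b d i)"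

fun coboundaries ::
    "('a, 'k) ring_scheme \<Rightarrow> ('a, 'n, 'j) module_scheme \<Rightarrow> (nat \<Rightarrow> nat)
      \<Rightarrow> (nat \<Rightarrow> (nat \<Rightarrow> 'a) \<Rightarrow> (nat \<Rightarrow> 'a)) \<Rightarrow> nat \<Rightarrow> ((nat \<Rightarrow> 'a) \<Rightarrow> 'n) set" where
  "coboundaries A N b d 0 = {\<zero>\<^bsub>Hom_module A (free_module A (b 0)) N\<^esub>}"
| "coboundaries A N b d (Suc i) =
     coboundary A b d i ` carrier (Hom_module A (free_module A (b i)) N)"

definition Hom_cohomology ::
    "('a, 'k) ring_scheme \<Rightarrow> ('a, 'n, 'j) module_scheme \<Rightarrow> (nat \<Rightarrow> nat)
      \<Rightarrow> (nat \<Rightarrow> (nat \<Rightarrow> 'a) \<Rightarrow> (nat \<Rightarrow> 'a)) \<Rightarrow> nat \<Rightarrow> ('a, ((nat \<Rightarrow> 'a) \<Rightarrow> 'n) set) module" where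
  "Hom_cohomology A N b d i =
     quot_module (Hom_module A (free_module A (b i)) N\<lparr>carrier := cocycles A N b d i\<rparr>)
       (coboundaries A N b d i)"

text \<open>For every \<open>M\<close> one resolution is fixed, which then serves all \<open>N\<close> and all degrees. The
  definition is meant for finitely generated modules over Noetherian rings, where a resolution of
  this form exists; see \<open>free_resolution_exists\<close> below.\<close>

definition Ext ::
    "('a, 'k) ring_scheme \<Rightarrow> nat \<Rightarrow> ('a, 'm, 'l) module_scheme \<Rightarrow> ('a, 'n, 'j) module_scheme
      \<Rightarrow> ('a, ((nat \<Rightarrow> 'a) \<Rightarrow> 'n) set) module" where
  "Ext A i M N =
     (let (b, d) = (SOME (b, d). \<exists>\<epsilon>. free_resolution A M b d \<epsilon>) in Hom_cohomology A N b d i)"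


section \<open>Existence of the resolutions\<close>

context module
begin

lemma mod_span_submodule:
  assumes "S \<subseteq> carrier M" shows "submodule (mod_span R M S) R M"
proof (rule submoduleI)
  have c: "submodule (carrier M) R M" by (rule carrier_is_submodule)
  show "mod_span R M S \<subseteq> carrier M" using c assms by (auto simp: mod_span_def)
  show "\<zero>\<^bsub>M\<^esub> \<in> mod_span R M S"
    by (auto simp: mod_span_def) (metis submodule_def subgroup.one_closed monoid.simps(2) add.is_monoid)
qed (auto simp: mod_span_def dest: submoduleE)

lemma mod_span_incl: "S \<subseteq> mod_span R M S"
  by (auto simp: mod_span_def)

lemma mod_span_min: "submodule H R M \<Longrightarrow> S \<subseteq> H \<Longrightarrow> mod_span R M S \<subseteq> H"
  by (auto simp: mod_span_def)

lemma submodule_zero: "submodule H R M \<Longrightarrow> \<zero>\<^bsub>M\<^esub> \<in> H"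
  using subgroup.one_closed[of H "add_monoid M"] by (simp add: submodule_def)

lemma mod_span_empty: "mod_span R M {} = {\<zero>\<^bsub>M\<^esub>}"
proof
  have "submodule {\<zero>\<^bsub>M\<^esub>} R M" by (rule submoduleI) auto
  thus "mod_span R M {} \<subseteq> {\<zero>\<^bsub>M\<^esub>}" by (rule mod_span_min) simp
  show "{\<zero>\<^bsub>M\<^esub>} \<subseteq> mod_span R M {}"
    using submodule_zero[OF mod_span_submodule] by simp
qed

lemma mod_span_insert:
  assumes S: "S \<subseteq> carrier M" and x: "x \<in> carrier M"
  shows "mod_span R M (insert x S) = {a \<odot>\<^bsub>M\<^esub> x \<oplus>\<^bsub>M\<^esub> y | a y. a \<in> carrier R \<and> y \<in> mod_span R M S}"
    (is "_ = ?T")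
proof
  note sub = mod_span_submodule[OF S]
  note E = submoduleE[OF sub]
  have Sc: "\<And>y. y \<in> mod_span R M S \<Longrightarrow> y \<in> carrier M" using E(1) by auto
  have "submodule ?T R M"
  proof (rule submoduleI)
    show "?T \<subseteq> carrier M" using Sc x by auto
    show "\<zero>\<^bsub>M\<^esub> \<in> ?T"
      using submodule_zero[OF sub] x by (auto intro!: exI[of _ "\<zero>\<^bsub>R\<^esub>"] exI[of _ "\<zero>\<^bsub>M\<^esub>"])
  next
    fix u assume "u \<in> ?T"
    then obtain a y where u: "u = a \<odot>\<^bsub>M\<^esub> x \<oplus>\<^bsub>M\<^esub> y" "a \<in> carrier R" "y \<in> mod_span R M S" by auto
    have "\<ominus>\<^bsub>M\<^esub> u = (\<ominus>\<^bsub>R\<^esub> a) \<odot>\<^bsub>M\<^esub> x \<oplus>\<^bsub>M\<^esub> (\<ominus>\<^bsub>M\<^esub> y)"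
      using u x Sc by (simp add: smult_l_minus M.minus_add)
    thus "\<ominus>\<^bsub>M\<^esub> u \<in> ?T" using u E(3) by blast
  next
    fix u v assume "u \<in> ?T" "v \<in> ?T"
    then obtain a y b z where u: "u = a \<odot>\<^bsub>M\<^esub> x \<oplus>\<^bsub>M\<^esub> y" "a \<in> carrier R" "y \<in> mod_span R M S"
      and v: "v = b \<odot>\<^bsub>M\<^esub> x \<oplus>\<^bsub>M\<^esub> z" "b \<in> carrier R" "z \<in> mod_span R M S" by auto
    have "u \<oplus>\<^bsub>M\<^esub> v = (a \<oplus>\<^bsub>R\<^esub> b) \<odot>\<^bsub>M\<^esub> x \<oplus>\<^bsub>M\<^esub> (y \<oplus>\<^bsub>M\<^esub> z)"
      using u v x Sc by (simp add: smult_l_distr M.a_ac)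
    thus "u \<oplus>\<^bsub>M\<^esub> v \<in> ?T" using u v E(5) by blast
  next
    fix c u assume c: "c \<in> carrier R" and "u \<in> ?T"
    then obtain a y where u: "u = a \<odot>\<^bsub>M\<^esub> x \<oplus>\<^bsub>M\<^esub> y" "a \<in> carrier R" "y \<in> mod_span R M S" by auto
    have "c \<odot>\<^bsub>M\<^esub> u = (c \<otimes>\<^bsub>R\<^esub> a) \<odot>\<^bsub>M\<^esub> x \<oplus>\<^bsub>M\<^esub> (c \<odot>\<^bsub>M\<^esub> y)"
      using u c x Sc by (simp add: smult_r_distr smult_assoc1)
    thus "c \<odot>\<^bsub>M\<^esub> u \<in> ?T" using u c E(4) by blast
  qed
  moreover have "insert x S \<subseteq> ?T"
  proof -
    have "x = \<one>\<^bsub>R\<^esub> \<odot>\<^bsub>M\<^esub> x \<oplus>\<^bsub>M\<^esub> \<zero>\<^bsub>M\<^esub>" using x by simp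
    hence "x \<in> ?T" using submodule_zero[OF sub] by blast
    moreover have "s \<in> ?T" if "s \<in> S" for s
    proof -
      have "s = \<zero>\<^bsub>R\<^esub> \<odot>\<^bsub>M\<^esub> x \<oplus>\<^bsub>M\<^esub> s" using x S that by auto
      thus ?thesis using that mod_span_incl[of S] by blast
    qed
    ultimately show ?thesis by blast
  qed
  ultimately show "mod_span R M (insert x S) \<subseteq> ?T" by (rule mod_span_min)
  have sub': "submodule (mod_span R M (insert x S)) R M" using S x by (intro mod_span_submodule) auto
  have "mod_span R M S \<subseteq> mod_span R M (insert x S)" by (auto simp: mod_span_def)
  moreover have "x \<in> mod_span R M (insert x S)" by (auto simp: mod_span_def)
  ultimately show "?T \<subseteq> mod_span R M (insert x S)"
    using submoduleE(4,5)[OF sub'] by blast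
qed

lemma noetherian_submodule:
  assumes noeth: "noetherian_ring R" and "finite S" "S \<subseteq> carrier M"
    and "submodule H R M" "H \<subseteq> mod_span R M S"
  shows "\<exists>T. finite T \<and> T \<subseteq> H \<and> mod_span R M T = H"
  using assms(2-)
proof (induction arbitrary: H rule: finite_induct)
  case empty
  hence "H = {\<zero>\<^bsub>M\<^esub>}" using submodule_zero[of H] by (auto simp: mod_span_empty)
  thus ?case by (intro exI[of _ "{}"]) (simp add: mod_span_empty)
next
  case (insert x S)
  have S: "S \<subseteq> carrier M" and x: "x \<in> carrier M" using insert.prems by auto
  let ?P = "mod_span R M S"
  note subP = mod_span_submodule[OF S]
  note P = submoduleE[OF subP] submodule_zero[OF subP]
  note H = submoduleE[OF insert.prems(2)] submodule_zero[OF insert.prems(2)]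
  have Pc: "\<And>y. y \<in> ?P \<Longrightarrow> y \<in> carrier M" using P(1) by auto
  have Hc: "\<And>y. y \<in> H \<Longrightarrow> y \<in> carrier M" using H(1) by auto
  define lead where "lead = (\<lambda>G. {a \<in> carrier R. \<exists>y\<in>?P. a \<odot>\<^bsub>M\<^esub> x \<oplus>\<^bsub>M\<^esub> y \<in> G})"
  have lead_ideal: "ideal (lead G) R" if G: "submodule G R M" for G
  proof -
    note GE = submoduleE[OF G] submodule_zero[OF G]
    show ?thesis
    proof (rule idealI)
      show "ring R" by (rule R.ring_axioms)
      show "subgroup (lead G) (add_monoid R)"
      proof (rule R.add.subgroupI)
        show "lead G \<subseteq> carrier R" by (auto simp: lead_def)
        have "\<zero>\<^bsub>R\<^esub> \<in> lead G" using x GE P by (auto simp: lead_def intro!: bexI[of _ "\<zero>\<^bsub>M\<^esub>"])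
        thus "lead G \<noteq> {}" by auto
      next
        fix a assume "a \<in> lead G"
        then obtain y where a: "a \<in> carrier R" "y \<in> ?P" "a \<odot>\<^bsub>M\<^esub> x \<oplus>\<^bsub>M\<^esub> y \<in> G" by (auto simp: lead_def)
        have "\<ominus>\<^bsub>M\<^esub> (a \<odot>\<^bsub>M\<^esub> x \<oplus>\<^bsub>M\<^esub> y) = (\<ominus>\<^bsub>R\<^esub> a) \<odot>\<^bsub>M\<^esub> x \<oplus>\<^bsub>M\<^esub> (\<ominus>\<^bsub>M\<^esub> y)"
          using a x Pc by (simp add: smult_l_minus M.minus_add)
        thus "\<ominus>\<^bsub>R\<^esub> a \<in> lead G" using GE(3)[OF a(3)] P(3)[OF a(2)] a by (auto simp: lead_def)
      next
        fix a b assume "a \<in> lead G" "b \<in> lead G"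
        then obtain y z where a: "a \<in> carrier R" "y \<in> ?P" "a \<odot>\<^bsub>M\<^esub> x \<oplus>\<^bsub>M\<^esub> y \<in> G"
          and b: "b \<in> carrier R" "z \<in> ?P" "b \<odot>\<^bsub>M\<^esub> x \<oplus>\<^bsub>M\<^esub> z \<in> G" by (auto simp: lead_def)
        have "(a \<odot>\<^bsub>M\<^esub> x \<oplus>\<^bsub>M\<^esub> y) \<oplus>\<^bsub>M\<^esub> (b \<odot>\<^bsub>M\<^esub> x \<oplus>\<^bsub>M\<^esub> z)
            = (a \<oplus>\<^bsub>R\<^esub> b) \<odot>\<^bsub>M\<^esub> x \<oplus>\<^bsub>M\<^esub> (y \<oplus>\<^bsub>M\<^esub> z)"
          using a b x Pc by (simp add: smult_l_distr M.a_ac)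
        thus "a \<oplus>\<^bsub>R\<^esub> b \<in> lead G"
          using GE(5)[OF a(3) b(3)] P(5)[OF a(2) b(2)] a b by (auto simp: lead_def)
      qed
    next
      fix a c assume al: "a \<in> lead G" and c: "c \<in> carrier R"
      then obtain y where a: "a \<in> carrier R" "y \<in> ?P" "a \<odot>\<^bsub>M\<^esub> x \<oplus>\<^bsub>M\<^esub> y \<in> G" by (auto simp: lead_def)
      have "c \<odot>\<^bsub>M\<^esub> (a \<odot>\<^bsub>M\<^esub> x \<oplus>\<^bsub>M\<^esub> y) = (c \<otimes>\<^bsub>R\<^esub> a) \<odot>\<^bsub>M\<^esub> x \<oplus>\<^bsub>M\<^esub> (c \<odot>\<^bsub>M\<^esub> y)"
        using a c x Pc by (simp add: smult_r_distr smult_assoc1)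
      thus "c \<otimes>\<^bsub>R\<^esub> a \<in> lead G"
        using GE(4)[OF c a(3)] P(4)[OF c a(2)] a c by (auto simp: lead_def)
      thus "a \<otimes>\<^bsub>R\<^esub> c \<in> lead G" using a c by (simp add: R.m_comm)
    qed
  qed
  obtain L where L: "L \<subseteq> carrier R" "finite L" "lead H = genideal R L"
    using noetherian_ring.finetely_gen[OF noeth lead_ideal[OF insert.prems(2)]] by blast
  have "\<forall>a\<in>L. \<exists>y\<in>?P. a \<odot>\<^bsub>M\<^esub> x \<oplus>\<^bsub>M\<^esub> y \<in> H"
    using L R.genideal_self[OF L(1)] by (auto simp: lead_def)
  then obtain y where y: "\<And>a. a \<in> L \<Longrightarrow> y a \<in> ?P \<and> a \<odot>\<^bsub>M\<^esub> x \<oplus>\<^bsub>M\<^esub> y a \<in> H" by metis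
  define U where "U = (\<lambda>a. a \<odot>\<^bsub>M\<^esub> x \<oplus>\<^bsub>M\<^esub> y a) ` L"
  have U: "finite U" "U \<subseteq> H" using L y by (auto simp: U_def)
  have "submodule (H \<inter> ?P) R M"
    by (rule submoduleI) (use H P in auto)
  then obtain V where V: "finite V" "V \<subseteq> H \<inter> ?P" "mod_span R M V = H \<inter> ?P"
    using insert.IH[OF S, of "H \<inter> ?P"] by auto
  have subUV: "submodule (mod_span R M (U \<union> V)) R M"
    using U V Hc by (intro mod_span_submodule) auto
  note UV = submoduleE[OF subUV]
  have UVH: "mod_span R M (U \<union> V) \<subseteq> H"
    using U V insert.prems(2) by (intro mod_span_min) auto
  have VUV: "H \<inter> ?P \<subseteq> mod_span R M (U \<union> V)"
    unfolding V(3)[symmetric] by (auto simp: mod_span_def)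
  have "L \<subseteq> lead (mod_span R M (U \<union> V))"
    using L(1) y mod_span_incl[of "U \<union> V"] by (fastforce simp: lead_def U_def)
  hence lead_sub: "lead H \<subseteq> lead (mod_span R M (U \<union> V))"
    unfolding L(3) by (rule R.genideal_minimal[OF lead_ideal[OF subUV]])
  have "h \<in> mod_span R M (U \<union> V)" if h: "h \<in> H" for h
  proof -
    obtain a z where az: "h = a \<odot>\<^bsub>M\<^esub> x \<oplus>\<^bsub>M\<^esub> z" "a \<in> carrier R" "z \<in> ?P"
      using h insert.prems(3) unfolding mod_span_insert[OF S x] by auto
    hence "a \<in> lead (mod_span R M (U \<union> V))" using h lead_sub by (auto simp: lead_def)
    then obtain w where w: "w \<in> ?P" "a \<odot>\<^bsub>M\<^esub> x \<oplus>\<^bsub>M\<^esub> w \<in> mod_span R M (U \<union> V)" by (auto simp: lead_def)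
    let ?g = "a \<odot>\<^bsub>M\<^esub> x \<oplus>\<^bsub>M\<^esub> w"
    have ax: "a \<odot>\<^bsub>M\<^esub> x \<in> carrier M" "w \<in> carrier M" "z \<in> carrier M" using az w x Pc by auto
    have "h \<oplus>\<^bsub>M\<^esub> \<ominus>\<^bsub>M\<^esub> ?g = z \<oplus>\<^bsub>M\<^esub> \<ominus>\<^bsub>M\<^esub> w"
    proof -
      have "h \<oplus>\<^bsub>M\<^esub> \<ominus>\<^bsub>M\<^esub> ?g = (a \<odot>\<^bsub>M\<^esub> x \<oplus>\<^bsub>M\<^esub> \<ominus>\<^bsub>M\<^esub> (a \<odot>\<^bsub>M\<^esub> x)) \<oplus>\<^bsub>M\<^esub> (z \<oplus>\<^bsub>M\<^esub> \<ominus>\<^bsub>M\<^esub> w)"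
        using ax unfolding az(1) by (simp add: M.minus_add M.a_ac del: M.r_neg)
      thus ?thesis using ax by (simp add: M.r_neg)
    qed
    moreover have "z \<oplus>\<^bsub>M\<^esub> \<ominus>\<^bsub>M\<^esub> w \<in> ?P" using az w P by blast
    moreover have "h \<oplus>\<^bsub>M\<^esub> \<ominus>\<^bsub>M\<^esub> ?g \<in> H" using h w UVH H by blast
    ultimately have "h \<oplus>\<^bsub>M\<^esub> \<ominus>\<^bsub>M\<^esub> ?g \<in> mod_span R M (U \<union> V)" using VUV by auto
    hence "(h \<oplus>\<^bsub>M\<^esub> \<ominus>\<^bsub>M\<^esub> ?g) \<oplus>\<^bsub>M\<^esub> ?g \<in> mod_span R M (U \<union> V)" using w UV(5) by blast
    moreover have "(h \<oplus>\<^bsub>M\<^esub> \<ominus>\<^bsub>M\<^esub> ?g) \<oplus>\<^bsub>M\<^esub> ?g = h"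
      using Hc[OF h] ax by (simp add: M.a_assoc M.l_neg)
    ultimately show ?thesis by simp
  qed
  thus ?case using U V UVH by (intro exI[of _ "U \<union> V"]) auto
qed

end

lemma free_module_simps:
  "carrier (free_module A k) = {..<k} \<rightarrow>\<^sub>E carrier A"
  "\<zero>\<^bsub>free_module A k\<^esub> = (\<lambda>j\<in>{..<k}. \<zero>\<^bsub>A\<^esub>)"
  "v \<oplus>\<^bsub>free_module A k\<^esub> w = (\<lambda>j\<in>{..<k}. v j \<oplus>\<^bsub>A\<^esub> w j)"
  "a \<odot>\<^bsub>free_module A k\<^esub> v = (\<lambda>j\<in>{..<k}. a \<otimes>\<^bsub>A\<^esub> v j)"
  by (simp_all add: free_module_def)

lemma free_module_is_module:
  fixes A (structure)
  assumes "cring A" shows "module A (free_module A k)"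
proof -
  interpret cring A by fact
  have "abelian_group (free_module A k)"
  proof (rule abelian_groupI)
    fix v assume v: "v \<in> carrier (free_module A k)"
    show "\<exists>w\<in>carrier (free_module A k). w \<oplus>\<^bsub>free_module A k\<^esub> v = \<zero>\<^bsub>free_module A k\<^esub>"
      using v by (intro bexI[of _ "\<lambda>j\<in>{..<k}. \<ominus> v j"])
        (auto simp: free_module_simps PiE_iff extensional_def l_neg restrict_def fun_eq_iff)
  qed (auto simp: free_module_simps PiE_iff extensional_def a_ac restrict_def fun_eq_iff)
  thus ?thesis
    by (intro moduleI)
      (auto simp: free_module_simps PiE_iff extensional_def restrict_def fun_eq_iff
        l_distr r_distr m_assoc intro: assms)
qed

lemma free_module_finitely_generated:
  fixes A (structure)
  assumes "cring A" shows "finitely_generated A (free_module A k)"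
proof -
  interpret cring A by fact
  interpret F: module A "free_module A k" by (rule free_module_is_module[OF assms])
  define e where "e = (\<lambda>i. \<lambda>j\<in>{..<k}. if j = i then \<one> else \<zero>)"
  have e: "e ` B \<subseteq> carrier (free_module A k)" for B
    by (auto simp: e_def free_module_simps PiE_iff extensional_def restrict_def split: if_splits)
  have key: "v \<in> mod_span A (free_module A k) (e ` {..<n})"
    if "n \<le> k" "v \<in> carrier (free_module A k)" "\<forall>j. n \<le> j \<and> j < k \<longrightarrow> v j = \<zero>" for n v
    using that
  proof (induction n arbitrary: v)
    case 0
    hence "v = \<zero>\<^bsub>free_module A k\<^esub>"
      by (auto simp: free_module_simps PiE_iff extensional_def fun_eq_iff)
    thus ?case by (simp add: F.mod_span_empty)
  next
    case (Suc n)
    define w where "w = v(n := \<zero>)"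
    have w: "w \<in> carrier (free_module A k)"
      using Suc.prems by (auto simp: w_def free_module_simps PiE_iff extensional_def)
    have "w j = \<zero>" if "n \<le> j" "j < k" for j
      using Suc.prems(3) that by (cases "j = n") (simp_all add: w_def)
    hence "w \<in> mod_span A (free_module A k) (e ` {..<n})"
      using Suc.prems(1) w by (intro Suc.IH) simp_all
    moreover have "v = v n \<odot>\<^bsub>free_module A k\<^esub> e n \<oplus>\<^bsub>free_module A k\<^esub> w"
      using Suc.prems
      by (auto simp: w_def e_def free_module_simps PiE_iff extensional_def fun_eq_iff)
    moreover have "v n \<in> carrier A" using Suc.prems by (auto simp: free_module_simps)
    ultimately show ?case
      using F.mod_span_insert[OF e[of "{..<n}"], of "e n"] e[of "{n}"]
      by (auto simp: lessThan_Suc)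
  qed
  have "carrier (free_module A k) \<subseteq> mod_span A (free_module A k) (e ` {..<k})"
    by (intro subsetI key) auto
  moreover have "mod_span A (free_module A k) (e ` {..<k}) \<subseteq> carrier (free_module A k)"
    by (rule F.mod_span_min[OF F.carrier_is_submodule e])
  ultimately show ?thesis using e by (auto simp: finitely_generated_def intro!: exI[of _ "e ` {..<k}"])
qed

lemma (in module) free_cover:
  assumes "finite S" "S \<subseteq> carrier M"
  shows "\<exists>k f. f \<in> mod_hom R (free_module R k) M \<and> f ` carrier (free_module R k) = mod_span R M S"
  using assms
proof (induction rule: finite_induct)
  case empty
  show ?case
    by (intro exI[of _ 0] exI[of _ "\<lambda>_. \<zero>\<^bsub>M\<^esub>"])
      (auto simp: mod_span_empty mod_hom_def free_module_simps)
next
  case (insert x S)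
  have S: "S \<subseteq> carrier M" and x: "x \<in> carrier M" using insert.prems by auto
  obtain k f where f: "f \<in> mod_hom R (free_module R k) M"
    "f ` carrier (free_module R k) = mod_span R M S" using insert.IH S by auto
  define g where "g = (\<lambda>v. v k \<odot>\<^bsub>M\<^esub> x \<oplus>\<^bsub>M\<^esub> f (restrict v {..<k}))"
  let ?F = "free_module R k" and ?G = "free_module R (Suc k)"
  have r: "restrict v {..<k} \<in> carrier ?F" "v k \<in> carrier R" if "v \<in> carrier ?G" for v
    using that by (auto simp: free_module_simps PiE_iff)
  have fc: "f v \<in> carrier M" if "v \<in> carrier ?F" for v using f(1) that by (auto simp: mod_hom_def)
  have "g \<in> mod_hom R ?G M"
    unfolding mod_hom_def
  proof (intro CollectI conjI ballI)
    show "g \<in> carrier ?G \<rightarrow> carrier M" using r fc x by (auto simp: g_def)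
  next
    fix v w assume vw: "v \<in> carrier ?G" "w \<in> carrier ?G"
    have "restrict (v \<oplus>\<^bsub>?G\<^esub> w) {..<k} = restrict v {..<k} \<oplus>\<^bsub>?F\<^esub> restrict w {..<k}"
      by (auto simp: free_module_simps restrict_def)
    hence "f (restrict (v \<oplus>\<^bsub>?G\<^esub> w) {..<k}) = f (restrict v {..<k}) \<oplus>\<^bsub>M\<^esub> f (restrict w {..<k})"
      using f(1) r vw by (simp add: mod_hom_def)
    moreover have "(v \<oplus>\<^bsub>?G\<^esub> w) k = v k \<oplus>\<^bsub>R\<^esub> w k" by (simp add: free_module_simps)
    ultimately show "g (v \<oplus>\<^bsub>?G\<^esub> w) = g v \<oplus>\<^bsub>M\<^esub> g w"
      using r[OF vw(1)] r[OF vw(2)] fc x by (simp add: g_def smult_l_distr M.a_ac)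
  next
    fix a v assume av: "a \<in> carrier R" "v \<in> carrier ?G"
    have "restrict (a \<odot>\<^bsub>?G\<^esub> v) {..<k} = a \<odot>\<^bsub>?F\<^esub> restrict v {..<k}"
      by (auto simp: free_module_simps restrict_def)
    hence "f (restrict (a \<odot>\<^bsub>?G\<^esub> v) {..<k}) = a \<odot>\<^bsub>M\<^esub> f (restrict v {..<k})"
      using f(1) r av by (simp add: mod_hom_def)
    moreover have "(a \<odot>\<^bsub>?G\<^esub> v) k = a \<otimes>\<^bsub>R\<^esub> v k" by (simp add: free_module_simps)
    ultimately show "g (a \<odot>\<^bsub>?G\<^esub> v) = a \<odot>\<^bsub>M\<^esub> g v"
      using r[OF av(2)] av fc x by (simp add: g_def smult_r_distr smult_assoc1)
  qed
  moreover have "g ` carrier ?G = mod_span R M (insert x S)"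
  proof
    show "g ` carrier ?G \<subseteq> mod_span R M (insert x S)"
      unfolding mod_span_insert[OF S x] f(2)[symmetric] using r by (auto simp: g_def)
    show "mod_span R M (insert x S) \<subseteq> g ` carrier ?G"
    proof
      fix u assume "u \<in> mod_span R M (insert x S)"
      then obtain a v where av: "u = a \<odot>\<^bsub>M\<^esub> x \<oplus>\<^bsub>M\<^esub> f v" "a \<in> carrier R" "v \<in> carrier ?F"
        unfolding mod_span_insert[OF S x] f(2)[symmetric] by auto
      have "restrict (v(k := a)) {..<k} = v"
        using av(3) by (auto simp: free_module_simps PiE_iff extensional_def fun_eq_iff)
      moreover have "v(k := a) \<in> carrier ?G"
        using av by (auto simp: free_module_simps PiE_iff extensional_def less_Suc_eq)
      ultimately show "u \<in> g ` carrier ?G"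
        using av by (intro image_eqI[of _ _ "v(k := a)"]) (simp_all add: g_def)
    qed
  qed
  ultimately show ?case by blast
qed

lemma mod_kernel_submodule:
  assumes "module A M" "module A N" "f \<in> mod_hom A M N"
  shows "submodule (mod_kernel M N f) A M"
proof -
  interpret M: module A M by fact
  interpret N: module A N by fact
  have f: "\<And>x. x \<in> carrier M \<Longrightarrow> f x \<in> carrier N"
    "\<And>x y. x \<in> carrier M \<Longrightarrow> y \<in> carrier M \<Longrightarrow> f (x \<oplus>\<^bsub>M\<^esub> y) = f x \<oplus>\<^bsub>N\<^esub> f y"
    "\<And>a x. a \<in> carrier A \<Longrightarrow> x \<in> carrier M \<Longrightarrow> f (a \<odot>\<^bsub>M\<^esub> x) = a \<odot>\<^bsub>N\<^esub> f x"
    using assms(3) by (auto simp: mod_hom_def)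
  have 0: "f \<zero>\<^bsub>M\<^esub> = \<zero>\<^bsub>N\<^esub>" using f(3)[of "\<zero>\<^bsub>A\<^esub>" "\<zero>\<^bsub>M\<^esub>"] f(1) by simp
  show ?thesis
  proof (rule M.submoduleI)
    fix x assume x: "x \<in> mod_kernel M N f"
    hence "\<ominus>\<^bsub>M\<^esub> x = (\<ominus>\<^bsub>A\<^esub> \<one>\<^bsub>A\<^esub>) \<odot>\<^bsub>M\<^esub> x" by (simp add: M.smult_l_minus mod_kernel_def)
    hence "f (\<ominus>\<^bsub>M\<^esub> x) = (\<ominus>\<^bsub>A\<^esub> \<one>\<^bsub>A\<^esub>) \<odot>\<^bsub>N\<^esub> f x" using x f by (simp add: mod_kernel_def)
    thus "\<ominus>\<^bsub>M\<^esub> x \<in> mod_kernel M N f" using x by (simp add: mod_kernel_def)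
  qed (auto simp: mod_kernel_def f 0)
qed

lemma syzygy_cover:
  assumes "cring A" "noetherian_ring A" "module A N" "f \<in> mod_hom A (free_module A n) N"
  shows "\<exists>k g. g \<in> mod_hom A (free_module A k) (free_module A n) \<and>
    g ` carrier (free_module A k) = mod_kernel (free_module A n) N f"
proof -
  interpret F: module A "free_module A n" by (rule free_module_is_module[OF assms(1)])
  let ?K = "mod_kernel (free_module A n) N f"
  have sub: "submodule ?K A (free_module A n)"
    by (rule mod_kernel_submodule[OF F.module_axioms assms(3,4)])
  obtain S where S: "S \<subseteq> carrier (free_module A n)" "finite S"
    "mod_span A (free_module A n) S = carrier (free_module A n)"
    using free_module_finitely_generated[OF assms(1), of n] by (auto simp: finitely_generated_def)
  have "?K \<subseteq> mod_span A (free_module A n) S" unfolding S(3) by (auto simp: mod_kernel_def)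
  then obtain T where T: "finite T" "T \<subseteq> ?K" "mod_span A (free_module A n) T = ?K"
    using F.noetherian_submodule[OF assms(2) S(2,1) sub] by blast
  have "T \<subseteq> carrier (free_module A n)" using T(2) by (auto simp: mod_kernel_def)
  from F.free_cover[OF T(1) this] show ?thesis unfolding T(3) .
qed

theorem free_resolution_exists:
  assumes A: "cring A" "noetherian_ring A" and M: "module A M" "finitely_generated A M"
  shows "\<exists>b d \<epsilon>. free_resolution A M b d \<epsilon>"
proof -
  interpret M: module A M by fact
  let ?F = "free_module A"
  obtain n\<^sub>0 \<epsilon> where \<epsilon>: "\<epsilon> \<in> mod_hom A (?F n\<^sub>0) M" "\<epsilon> ` carrier (?F n\<^sub>0) = carrier M"
  proof -
    obtain S where S: "S \<subseteq> carrier M" "finite S" "mod_span A M S = carrier M"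
      using M(2) by (auto simp: finitely_generated_def)
    show thesis using M.free_cover[OF S(2,1)] S(3) that by auto
  qed
  define P where "P = (\<lambda>i (n, k, g). g \<in> mod_hom A (?F k) (?F n) \<and>
     (i = (0 :: nat) \<longrightarrow> n = n\<^sub>0 \<and> g ` carrier (?F k) = mod_kernel (?F n\<^sub>0) M \<epsilon>))"
  define Q where "Q = (\<lambda>(_ :: nat) (n, k, g) (n', k', g'). n' = k \<and>
     g' ` carrier (?F k') = mod_kernel (?F k) (?F n) g)"
  have "\<exists>s. \<forall>i. P i (s i) \<and> Q i (s i) (s (Suc i))"
  proof (rule dependent_nat_choice)
    show "\<exists>s. P 0 s" using syzygy_cover[OF A M(1) \<epsilon>(1)] by (auto simp: P_def)
  next
    fix s i assume "P i s"
    then obtain n k g where s: "s = (n, k, g)" "g \<in> mod_hom A (?F k) (?F n)"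
      by (cases s) (auto simp: P_def)
    obtain k' g' where "g' \<in> mod_hom A (?F k') (?F k)"
      "g' ` carrier (?F k') = mod_kernel (?F k) (?F n) g"
      using syzygy_cover[OF A free_module_is_module[OF A(1)] s(2)] by blast
    thus "\<exists>t. P (Suc i) t \<and> Q i s t"
      by (intro exI[of _ "(k, k', g')"]) (simp add: P_def Q_def s(1))
  qed
  then obtain s where s: "\<And>i. P i (s i)" "\<And>i. Q i (s i) (s (Suc i))" by blast
  define b where "b = (\<lambda>i. fst (s i))"
  define d where "d = (\<lambda>i. snd (snd (s i)))"
  have step: "s i = (b i, b (Suc i), d i)" for i
    using s(2)[of i] by (cases "s i"; cases "s (Suc i)") (auto simp: Q_def b_def d_def)
  have "b 0 = n\<^sub>0" using s(1)[of 0] by (simp add: step P_def)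
  hence "free_resolution A M b d \<epsilon>"
    using s \<epsilon> by (simp add: free_resolution_def step P_def Q_def)
  thus ?thesis by blast
qed


section \<open>Ext is a module\<close>

lemma (in module) quot_module_is_module:
  assumes H: "submodule H R M" shows "module R (quot_module M H)"
proof -
  note E = submoduleE[OF H]
  interpret S: additive_subgroup H M
    using H by (intro additive_subgroup.intro) (simp add: submodule_def)
  interpret S: abelian_subgroup H M
    by (rule abelian_subgroupI3) (rule S.additive_subgroup_axioms, rule M.abelian_group_axioms)
  have add: "(H +>\<^bsub>M\<^esub> u) <+>\<^bsub>M\<^esub> (H +>\<^bsub>M\<^esub> v) = H +>\<^bsub>M\<^esub> (u \<oplus>\<^bsub>M\<^esub> v)"
    if "u \<in> carrier M" "v \<in> carrier M" for u v
    using that by (rule S.a_rcos_sum)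
  have sm: "(\<Union>x\<in>H +>\<^bsub>M\<^esub> u. H +>\<^bsub>M\<^esub> (a \<odot>\<^bsub>M\<^esub> x)) = H +>\<^bsub>M\<^esub> (a \<odot>\<^bsub>M\<^esub> u)"
    if a: "a \<in> carrier R" and u: "u \<in> carrier M" for a u
  proof -
    have "H +>\<^bsub>M\<^esub> (a \<odot>\<^bsub>M\<^esub> x) = H +>\<^bsub>M\<^esub> (a \<odot>\<^bsub>M\<^esub> u)" if x: "x \<in> H +>\<^bsub>M\<^esub> u" for x
    proof -
      obtain h where h: "h \<in> H" "x = h \<oplus>\<^bsub>M\<^esub> u" using x by (auto simp: a_r_coset_def r_coset_def)
      have "a \<odot>\<^bsub>M\<^esub> x = a \<odot>\<^bsub>M\<^esub> h \<oplus>\<^bsub>M\<^esub> a \<odot>\<^bsub>M\<^esub> u" using h a u E(1) by (auto simp: smult_r_distr)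
      hence "a \<odot>\<^bsub>M\<^esub> x \<in> H +>\<^bsub>M\<^esub> (a \<odot>\<^bsub>M\<^esub> u)" using E(4)[OF a h(1)] by (auto simp: a_r_coset_def r_coset_def)
      thus ?thesis using M.a_repr_independence[of "a \<odot>\<^bsub>M\<^esub> x" H "a \<odot>\<^bsub>M\<^esub> u"] a u by (simp add: S.a_subgroup)
    qed
    moreover have "u \<in> H +>\<^bsub>M\<^esub> u" using u by (rule S.a_rcos_self)
    ultimately show ?thesis by blast
  qed
  have rep: "\<exists>u\<in>carrier M. C = H +>\<^bsub>M\<^esub> u" if "C \<in> carrier (quot_module M H)" for C
    using that by (auto simp: quot_module_def A_RCOSETS_def' )
  have in_carr: "H +>\<^bsub>M\<^esub> u \<in> carrier (quot_module M H)" if "u \<in> carrier M" for u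
    using that by (auto simp: quot_module_def A_RCOSETS_def')
  have q: "a \<odot>\<^bsub>quot_module M H\<^esub> (H +>\<^bsub>M\<^esub> u) = H +>\<^bsub>M\<^esub> (a \<odot>\<^bsub>M\<^esub> u)"
    if "a \<in> carrier R" "u \<in> carrier M" for a u using sm[OF that] by (simp add: quot_module_def)
  have p: "(H +>\<^bsub>M\<^esub> u) \<oplus>\<^bsub>quot_module M H\<^esub> (H +>\<^bsub>M\<^esub> v) = H +>\<^bsub>M\<^esub> (u \<oplus>\<^bsub>M\<^esub> v)"
    if "u \<in> carrier M" "v \<in> carrier M" for u v using add[OF that] by (simp add: quot_module_def)
  have z: "\<zero>\<^bsub>quot_module M H\<^esub> = H +>\<^bsub>M\<^esub> \<zero>\<^bsub>M\<^esub>"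
    using E(1) by (simp add: quot_module_def M.a_coset_add_zero)
  have ag: "abelian_group (quot_module M H)"
  proof (rule abelian_groupI)
    fix C D K assume "C \<in> carrier (quot_module M H)" "D \<in> carrier (quot_module M H)"
      "K \<in> carrier (quot_module M H)"
    then obtain u v w where "u \<in> carrier M" "C = H +>\<^bsub>M\<^esub> u" "v \<in> carrier M" "D = H +>\<^bsub>M\<^esub> v"
      "w \<in> carrier M" "K = H +>\<^bsub>M\<^esub> w" using rep by metis
    thus "C \<oplus>\<^bsub>quot_module M H\<^esub> D \<oplus>\<^bsub>quot_module M H\<^esub> K =
        C \<oplus>\<^bsub>quot_module M H\<^esub> (D \<oplus>\<^bsub>quot_module M H\<^esub> K)"
      by (simp add: p M.a_assoc)
  next
    fix C D assume "C \<in> carrier (quot_module M H)" "D \<in> carrier (quot_module M H)"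
    then obtain u v where uv: "u \<in> carrier M" "C = H +>\<^bsub>M\<^esub> u" "v \<in> carrier M" "D = H +>\<^bsub>M\<^esub> v"
      using rep by metis
    thus "C \<oplus>\<^bsub>quot_module M H\<^esub> D \<in> carrier (quot_module M H)"
      by (simp add: p in_carr)
    show "C \<oplus>\<^bsub>quot_module M H\<^esub> D = D \<oplus>\<^bsub>quot_module M H\<^esub> C"
      using uv by (simp add: p M.a_comm)
  next
    fix C assume "C \<in> carrier (quot_module M H)"
    then obtain u where u: "u \<in> carrier M" "C = H +>\<^bsub>M\<^esub> u" using rep by metis
    thus "\<zero>\<^bsub>quot_module M H\<^esub> \<oplus>\<^bsub>quot_module M H\<^esub> C = C" by (simp add: p z)
    show "\<exists>D\<in>carrier (quot_module M H). D \<oplus>\<^bsub>quot_module M H\<^esub> C = \<zero>\<^bsub>quot_module M H\<^esub>"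
      using u by (intro bexI[of _ "H +>\<^bsub>M\<^esub> (\<ominus>\<^bsub>M\<^esub> u)"]) (simp_all add: p z in_carr M.l_neg)
  next
    show "\<zero>\<^bsub>quot_module M H\<^esub> \<in> carrier (quot_module M H)" by (simp add: z in_carr)
  qed
  show ?thesis
  proof (rule moduleI[OF R.cring_axioms ag])
    fix a C D
    assume a: "a \<in> carrier R"
      and C: "C \<in> carrier (quot_module M H)" and D: "D \<in> carrier (quot_module M H)"
    obtain u v where u: "u \<in> carrier M" "C = H +>\<^bsub>M\<^esub> u" and v: "v \<in> carrier M" "D = H +>\<^bsub>M\<^esub> v"
      using rep[OF C] rep[OF D] by blast
    show "a \<odot>\<^bsub>quot_module M H\<^esub> (C \<oplus>\<^bsub>quot_module M H\<^esub> D) =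
        a \<odot>\<^bsub>quot_module M H\<^esub> C \<oplus>\<^bsub>quot_module M H\<^esub> a \<odot>\<^bsub>quot_module M H\<^esub> D"
      using a u v by (simp add: p q smult_r_distr)
  next
    fix a b C
    assume a: "a \<in> carrier R" and b: "b \<in> carrier R" and C: "C \<in> carrier (quot_module M H)"
    obtain u where u: "u \<in> carrier M" "C = H +>\<^bsub>M\<^esub> u" using rep[OF C] by blast
    show "(a \<oplus>\<^bsub>R\<^esub> b) \<odot>\<^bsub>quot_module M H\<^esub> C =
        a \<odot>\<^bsub>quot_module M H\<^esub> C \<oplus>\<^bsub>quot_module M H\<^esub> b \<odot>\<^bsub>quot_module M H\<^esub> C"
      using a b u by (simp add: p q smult_l_distr)
    show "(a \<otimes>\<^bsub>R\<^esub> b) \<odot>\<^bsub>quot_module M H\<^esub> C = a \<odot>\<^bsub>quot_module M H\<^esub> (b \<odot>\<^bsub>quot_module M H\<^esub> C)"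
      using a b u by (simp add: q smult_assoc1)
  next
    fix C assume C: "C \<in> carrier (quot_module M H)"
    obtain u where u: "u \<in> carrier M" "C = H +>\<^bsub>M\<^esub> u" using rep[OF C] by blast
    show "\<one>\<^bsub>R\<^esub> \<odot>\<^bsub>quot_module M H\<^esub> C = C" using u by (simp add: q)
    fix a assume a: "a \<in> carrier R"
    show "a \<odot>\<^bsub>quot_module M H\<^esub> C \<in> carrier (quot_module M H)" using a u by (simp add: q in_carr)
  qed
qed

lemma Hom_module_simps:
  "carrier (Hom_module A M N) = mod_hom A M N \<inter> extensional (carrier M)"
  "\<zero>\<^bsub>Hom_module A M N\<^esub> = (\<lambda>x\<in>carrier M. \<zero>\<^bsub>N\<^esub>)"
  "f \<oplus>\<^bsub>Hom_module A M N\<^esub> g = (\<lambda>x\<in>carrier M. f x \<oplus>\<^bsub>N\<^esub> g x)"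
  "a \<odot>\<^bsub>Hom_module A M N\<^esub> f = (\<lambda>x\<in>carrier M. a \<odot>\<^bsub>N\<^esub> f x)"
  by (simp_all add: Hom_module_def)

lemma Hom_module_is_module:
  assumes "module A M" "module A N" shows "module A (Hom_module A M N)"
proof -
  interpret M: module A M by fact
  interpret N: module A N by fact
  let ?H = "Hom_module A M N"
  have E: "f = g" if "f \<in> carrier ?H" "g \<in> carrier ?H" "\<And>x. x \<in> carrier M \<Longrightarrow> f x = g x" for f g
    using that by (intro extensionalityI[of _ "carrier M"]) (auto simp: Hom_module_simps)
  have c: "f x \<in> carrier N" if "f \<in> carrier ?H" "x \<in> carrier M" for f x
    using that by (auto simp: Hom_module_simps mod_hom_def)
  have add: "f \<oplus>\<^bsub>?H\<^esub> g \<in> carrier ?H" if "f \<in> carrier ?H" "g \<in> carrier ?H" for f g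
    using that c[OF that(1)] c[OF that(2)]
    by (auto simp: Hom_module_simps mod_hom_def N.M.a_ac N.smult_r_distr)
  have zero: "\<zero>\<^bsub>?H\<^esub> \<in> carrier ?H"
    by (auto simp: Hom_module_simps mod_hom_def)
  have smult: "a \<odot>\<^bsub>?H\<^esub> f \<in> carrier ?H" if "a \<in> carrier A" "f \<in> carrier ?H" for a f
    using that c[OF that(2)]
    by (auto simp: Hom_module_simps mod_hom_def N.smult_r_distr M.R.m_comm
        simp flip: N.smult_assoc1)
  have vals: "\<And>x. x \<in> carrier M \<Longrightarrow> \<zero>\<^bsub>?H\<^esub> x = \<zero>\<^bsub>N\<^esub>"
    "\<And>f g x. x \<in> carrier M \<Longrightarrow> (f \<oplus>\<^bsub>?H\<^esub> g) x = f x \<oplus>\<^bsub>N\<^esub> g x"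
    "\<And>a f x. x \<in> carrier M \<Longrightarrow> (a \<odot>\<^bsub>?H\<^esub> f) x = a \<odot>\<^bsub>N\<^esub> f x"
    by (simp_all add: Hom_module_simps)
  have ag: "abelian_group ?H"
  proof (rule abelian_groupI)
    fix f assume f: "f \<in> carrier ?H"
    show "\<exists>g\<in>carrier ?H. g \<oplus>\<^bsub>?H\<^esub> f = \<zero>\<^bsub>?H\<^esub>"
    proof (rule bexI)
      show "(\<ominus>\<^bsub>A\<^esub> \<one>\<^bsub>A\<^esub>) \<odot>\<^bsub>?H\<^esub> f \<in> carrier ?H" using f by (intro smult) simp_all
      then show "(\<ominus>\<^bsub>A\<^esub> \<one>\<^bsub>A\<^esub>) \<odot>\<^bsub>?H\<^esub> f \<oplus>\<^bsub>?H\<^esub> f = \<zero>\<^bsub>?H\<^esub>"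
        using f by (intro E add zero) (simp_all add: vals c N.smult_l_minus N.M.l_neg)
    qed
  next
    fix f g h assume f: "f \<in> carrier ?H" and g: "g \<in> carrier ?H" and h: "h \<in> carrier ?H"
    show "f \<oplus>\<^bsub>?H\<^esub> g \<oplus>\<^bsub>?H\<^esub> h = f \<oplus>\<^bsub>?H\<^esub> (g \<oplus>\<^bsub>?H\<^esub> h)"
      using f g h by (intro E add) (simp_all add: vals c N.M.a_assoc)
  next
    fix f g assume f: "f \<in> carrier ?H" and g: "g \<in> carrier ?H"
    show "f \<oplus>\<^bsub>?H\<^esub> g = g \<oplus>\<^bsub>?H\<^esub> f" using f g by (intro E add) (simp_all add: vals c N.M.a_comm)
  next
    fix f assume f: "f \<in> carrier ?H"
    show "\<zero>\<^bsub>?H\<^esub> \<oplus>\<^bsub>?H\<^esub> f = f" using f by (intro E add zero) (simp_all add: vals c)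
  qed (use add zero in auto)
  show ?thesis
  proof (rule moduleI[OF M.R.cring_axioms ag smult])
    fix a b f assume a: "a \<in> carrier A" and b: "b \<in> carrier A" and f: "f \<in> carrier ?H"
    show "(a \<oplus>\<^bsub>A\<^esub> b) \<odot>\<^bsub>?H\<^esub> f = a \<odot>\<^bsub>?H\<^esub> f \<oplus>\<^bsub>?H\<^esub> b \<odot>\<^bsub>?H\<^esub> f"
      using a b f by (intro E add smult) (simp_all add: vals c N.smult_l_distr)
    show "(a \<otimes>\<^bsub>A\<^esub> b) \<odot>\<^bsub>?H\<^esub> f = a \<odot>\<^bsub>?H\<^esub> (b \<odot>\<^bsub>?H\<^esub> f)"
      using a b f by (intro E smult) (simp_all add: vals c N.smult_assoc1)
  next
    fix a f g assume a: "a \<in> carrier A" and f: "f \<in> carrier ?H" and g: "g \<in> carrier ?H"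
    show "a \<odot>\<^bsub>?H\<^esub> (f \<oplus>\<^bsub>?H\<^esub> g) = a \<odot>\<^bsub>?H\<^esub> f \<oplus>\<^bsub>?H\<^esub> a \<odot>\<^bsub>?H\<^esub> g"
      using a f g by (intro E add smult) (simp_all add: vals c N.smult_r_distr)
  next
    fix f assume f: "f \<in> carrier ?H"
    show "\<one>\<^bsub>A\<^esub> \<odot>\<^bsub>?H\<^esub> f = f" using f by (intro E smult) (simp_all add: vals c)
  qed
qed

lemma mod_image_submodule:
  assumes "module A M" "module A N" "f \<in> mod_hom A M N"
  shows "submodule (f ` carrier M) A N"
proof -
  interpret M: module A M by fact
  interpret N: module A N by fact
  have f: "\<And>x. x \<in> carrier M \<Longrightarrow> f x \<in> carrier N"
    "\<And>x y. x \<in> carrier M \<Longrightarrow> y \<in> carrier M \<Longrightarrow> f x \<oplus>\<^bsub>N\<^esub> f y = f (x \<oplus>\<^bsub>M\<^esub> y)"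
    "\<And>a x. a \<in> carrier A \<Longrightarrow> x \<in> carrier M \<Longrightarrow> a \<odot>\<^bsub>N\<^esub> f x = f (a \<odot>\<^bsub>M\<^esub> x)"
    using assms(3) by (auto simp: mod_hom_def)
  have 0: "\<zero>\<^bsub>N\<^esub> = f \<zero>\<^bsub>M\<^esub>" using f(3)[of "\<zero>\<^bsub>A\<^esub>" "\<zero>\<^bsub>M\<^esub>"] f(1) by simp
  show ?thesis
  proof (rule N.submoduleI)
    fix y assume "y \<in> f ` carrier M"
    then obtain x where x: "x \<in> carrier M" "y = f x" by auto
    hence "\<ominus>\<^bsub>N\<^esub> y = (\<ominus>\<^bsub>A\<^esub> \<one>\<^bsub>A\<^esub>) \<odot>\<^bsub>N\<^esub> f x" using f(1) by (simp add: N.smult_l_minus)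
    thus "\<ominus>\<^bsub>N\<^esub> y \<in> f ` carrier M" using x by (simp add: f(3))
  qed (auto simp: f 0)
qed

lemma coboundary_hom:
  assumes "cring A" "module A N" "free_resolution A M b d \<epsilon>"
  shows "coboundary A b d i \<in> mod_hom A (Hom_module A (free_module A (b i)) N)
           (Hom_module A (free_module A (b (Suc i))) N)"
proof -
  interpret F: module A "free_module A (b i)" by (rule free_module_is_module[OF assms(1)])
  interpret G: module A "free_module A (b (Suc i))" by (rule free_module_is_module[OF assms(1)])
  have d: "d i \<in> mod_hom A (free_module A (b (Suc i))) (free_module A (b i))"
    using assms(3) by (simp add: free_resolution_def)
  hence dc: "d i v \<in> carrier (free_module A (b i))" if "v \<in> carrier (free_module A (b (Suc i)))" for v
    using that by (auto simp: mod_hom_def)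
  show ?thesis
    unfolding mod_hom_def[of _ "Hom_module _ _ _"] coboundary_def
  proof (intro CollectI conjI ballI Pi_I)
    fix f assume f: "f \<in> carrier (Hom_module A (free_module A (b i)) N)"
    show "compose (carrier (free_module A (b (Suc i)))) f (d i)
        \<in> carrier (Hom_module A (free_module A (b (Suc i))) N)"
      using f d by (simp add: Hom_module_simps mod_hom_def compose_def Pi_iff)
  qed (auto simp: Hom_module_simps compose_def dc restrict_def)
qed

lemma coboundaries_subset_cocycles:
  assumes "cring A" "module A N" "free_resolution A M b d \<epsilon>"
  shows "coboundaries A N b d i \<subseteq> cocycles A N b d i"
proof (cases i)
  case 0
  interpret N: module A N by fact
  interpret H: module A "Hom_module A (free_module A (b 0)) N"
    by (intro Hom_module_is_module free_module_is_module assms)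
  have "coboundary A b d 0 \<in> mod_hom A (Hom_module A (free_module A (b 0)) N)
           (Hom_module A (free_module A (b (Suc 0))) N)"
    by (rule coboundary_hom[OF assms])
  note mod_kernel_submodule[OF H.module_axioms Hom_module_is_module[OF free_module_is_module[OF assms(1)] assms(2)] this]
  thus ?thesis using H.submodule_zero by (simp add: 0 cocycles_def)
next
  case (Suc k)
  interpret N: module A N by fact
  interpret F: module A "free_module A (b k)" by (rule free_module_is_module[OF assms(1)])
  have d: "d j \<in> mod_hom A (free_module A (b (Suc j))) (free_module A (b j))" for j
    using assms(3) by (simp add: free_resolution_def)
  have dd: "d k (d (Suc k) v) = \<zero>\<^bsub>free_module A (b k)\<^esub>" if "v \<in> carrier (free_module A (b (Suc (Suc k))))" for v
  proof -
    have "d (Suc k) v \<in> mod_kernel (free_module A (b (Suc k))) (free_module A (b k)) (d k)"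
      using assms(3) that unfolding free_resolution_def by blast
    thus ?thesis by (simp add: mod_kernel_def)
  qed
  have hom0: "f \<zero>\<^bsub>free_module A (b k)\<^esub> = \<zero>\<^bsub>N\<^esub>" if "f \<in> mod_hom A (free_module A (b k)) N" for f
  proof -
    have z: "\<zero>\<^bsub>free_module A (b k)\<^esub> \<in> carrier (free_module A (b k))" by simp
    have "\<forall>a\<in>carrier A. \<forall>x\<in>carrier (free_module A (b k)).
        f (a \<odot>\<^bsub>free_module A (b k)\<^esub> x) = a \<odot>\<^bsub>N\<^esub> f x"
      using that by (simp add: mod_hom_def)
    from this[rule_format, OF N.R.zero_closed z] show ?thesis
      using that z by (simp add: mod_hom_def Pi_iff)
  qed
  show ?thesis
  proof
    fix g assume "g \<in> coboundaries A N b d i"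
    then obtain f where f: "f \<in> carrier (Hom_module A (free_module A (b k)) N)"
      "g = coboundary A b d k f" by (auto simp: Suc)
    have "g \<in> carrier (Hom_module A (free_module A (b (Suc k))) N)"
      using coboundary_hom[OF assms, of k] f by (auto simp: mod_hom_def[of _ "Hom_module _ _ _"])
    moreover have "coboundary A b d (Suc k) g = \<zero>\<^bsub>Hom_module A (free_module A (b (Suc (Suc k)))) N\<^esub>"
    proof (rule extensionalityI)
      fix v assume v: "v \<in> carrier (free_module A (b (Suc (Suc k))))"
      have dv: "d (Suc k) v \<in> carrier (free_module A (b (Suc k)))"
        using d[of "Suc k"] v by (auto simp: mod_hom_def)
      have "f \<in> mod_hom A (free_module A (b k)) N" using f(1) by (simp add: Hom_module_simps)
      thus "coboundary A b d (Suc k) g v = \<zero>\<^bsub>Hom_module A (free_module A (b (Suc (Suc k)))) N\<^esub> v"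
        using v dv by (simp add: coboundary_def f(2) compose_def Hom_module_simps dd hom0)
    qed (simp_all add: coboundary_def Hom_module_simps)
    ultimately show "g \<in> cocycles A N b d i" by (simp add: cocycles_def mod_kernel_def Suc)
  qed
qed

lemma Hom_cohomology_is_module:
  assumes "cring A" "module A N" "free_resolution A M b d \<epsilon>"
  shows "module A (Hom_cohomology A N b d i)"
proof -
  have mH: "module A (Hom_module A (free_module A (b j)) N)" for j
    by (intro Hom_module_is_module free_module_is_module assms)
  interpret H: module A "Hom_module A (free_module A (b i)) N" by (rule mH)
  let ?Z = "Hom_module A (free_module A (b i)) N\<lparr>carrier := cocycles A N b d i\<rparr>"
  have Zs: "submodule (cocycles A N b d i) A (Hom_module A (free_module A (b i)) N)"
    unfolding cocycles_def by (rule mod_kernel_submodule[OF mH mH coboundary_hom[OF assms]])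
  have Bs: "submodule (coboundaries A N b d i) A (Hom_module A (free_module A (b i)) N)"
  proof (cases i)
    case 0
    have "submodule {\<zero>\<^bsub>Hom_module A (free_module A (b i)) N\<^esub>} A (Hom_module A (free_module A (b i)) N)"
      by (rule H.submoduleI) auto
    thus ?thesis by (simp add: 0)
  next
    case (Suc k)
    show ?thesis
      using mod_image_submodule[OF mH mH coboundary_hom[OF assms, of k]] by (simp add: Suc)
  qed
  interpret Z: module A ?Z by (rule submodule.submodule_is_module[OF Zs H.module_axioms])
  have "module A (?Z\<lparr>carrier := coboundaries A N b d i\<rparr>)"
    using submodule.submodule_is_module[OF Bs H.module_axioms] by simp
  hence "submodule (coboundaries A N b d i) A ?Z"
    using coboundaries_subset_cocycles[OF assms] by (intro Z.module_incl_imp_submodule) simp_all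
  thus ?thesis unfolding Hom_cohomology_def by (rule Z.quot_module_is_module)
qed

theorem Ext_is_module:
  assumes "cring A" "noetherian_ring A" "module A M" "finitely_generated A M" "module A N"
  shows "module A (Ext A i M N)"
proof -
  obtain b d \<epsilon> where bd: "free_resolution A M b d \<epsilon>"
    using free_resolution_exists[OF assms(1-4)] by blast
  define s where "s = (SOME (b, d). \<exists>\<epsilon>. free_resolution A M b d \<epsilon>)"
  have "case s of (b, d) \<Rightarrow> \<exists>\<epsilon>. free_resolution A M b d \<epsilon>"
    unfolding s_def by (rule someI[of _ "(b, d)"]) (use bd in auto)
  thus ?thesis
    using Hom_cohomology_is_module[OF assms(1,5)] unfolding Ext_def s_def[symmetric]
    by (cases s) auto
qed

end

theory Submission
 imports Defs "HOL-Library.Function_Algebras" "HOL-Library.Set_Algebras" "HOL-Library.Multiset"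
begin

text \<open>Let \<open>Q\<close> be the regular ring and \<open>J\<close> the ideal of the regular sequence. A module over \<open>Q/J\<close> with a finite
 free resolution over \<open>Q\<close> has a resolution over \<open>Q/J\<close> with a divided power structure (Shamash, Eisenbud),
 so the cochains of a fixed parity with values in \<open>N\<close> form a finitely generated module over the polynomial
 ring in the cohomology operators, and so do the cocycles and the coboundaries. An Artin--Rees argument,
 bigraded in the power \<open>n\<close> of \<open>I\<close> and the degree \<open>i\<close>, controls the cocycles and the coboundaries modulo \<open>I\<^sup>n N\<close>
 for large \<open>n\<close>, and finite generation over the Rees algebra shows that only finitely many primes occur and
 that each of them either persists or disappears. Associated primes descend from the completion to \<open>A\<close>,
 because passing to the completion preserves and reflects all the membership relations involved.

 To avoid quotients, every ring is represented by a ring with a distinguished ideal, every module by a module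
 of vectors with a distinguished submodule, and all conditions are imposed modulo these. The ring \<open>A\<close> of the
 theorem is presented as a free commutative ring modulo the kernel of evaluation.\<close>

section \<open>Groups with operators\<close>

text \<open>The associated primes of Ext are not visibly monotone in \<open>n\<close> or
  \<open>i\<close>. For a fixed prime p the question is therefore whether all cocycles modulo I^n
  that are killed by p vanish after localisation at p. By Artin-Rees these cocycles have the form
  I^k Y + Z with Y and Z independent of k, so the question splits into one about I^k Y and one about
  Z. Each of the two, once answered positively, stays so when the indices grow, and is eventually
  constant. Uniformity in p comes from the finiteness of the set of primes that occur: every prime
  of L / I^n L already occurs in a layer I^j L / I^(j+1) L, and all layers form one bigraded module.
  The operators raise the degree by 2 and generate only above the length of the finite resolution
  over \<open>Q\<close>, hence the two families \<open>2 * i + e\<close> with large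
  \<open>e\<close>. They live over the completion whereas Ext is taken over \<open>A\<close>, hence
  the descent. A ring map out of a free ring is prescribed by values at the variables; this gives
  the map from \<open>A\<close> to its completion on the level of presentations.\<close>

definition addm :: "('v::ab_group_add => 'w::ab_group_add) => bool" where
 "addm f \<longleftrightarrow> (ALL x y. f (x + y) = f x + f y)"

lemma addmD: "addm f ==> f (x + y) = f x + f y"
 by(simp add: addm_def)

lemma addm_zero: "addm f ==> f 0 = 0"
 using addmD[of f 0 0] by simp

lemma addm_minus: "addm f ==> f (- x) = - f x"
 using addmD[of f x "- x"] addm_zero[of f] by(simp add: eq_neg_iff_add_eq_0 add.commute)

lemma addm_diff: "addm f ==> f (x - y) = f x - f y"
 using addmD[of f x "- y"] addm_minus[of f y] by simp

lemma addm_sum: "addm f ==> f (sum g S) = (SUM x:S. f (g x))"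
 by(induction S rule: infinite_finite_induct) (simp_all add: addm_zero addmD)

text \<open>Ideals, submodules, graded families of cochains and bigraded Rees modules are all
  additive subgroups stable under suitable operators; the Noetherian arguments are carried out once
  at this level.\<close>

definition ops :: "('v::ab_group_add => 'v) set => 'v set => bool" where
 "ops Om E \<longleftrightarrow> 0 : E & (ALL x:E. ALL y:E. x - y : E) & (ALL om:Om. ALL x:E. om x : E)"

lemma ops_zero: "ops Om E ==> 0 : E"
 and ops_diff: "ops Om E ==> x : E ==> y : E ==> x - y : E"
 and ops_op: "ops Om E ==> om : Om ==> x : E ==> om x : E"
 by(simp_all add: ops_def)

lemma ops_minus: "ops Om E ==> x : E ==> - x : E"
 using ops_diff[of Om E 0 x] ops_zero by auto

lemma ops_add: "ops Om E ==> x : E ==> y : E ==> x + y : E"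
 using ops_diff[of Om E x "- y"] ops_minus by auto

lemma ops_sum: "ops Om E ==> (!!x. x : S ==> f x : E) ==> sum f S : E"
 by(induction S rule: infinite_finite_induct) (auto simp: ops_zero ops_add)

lemma ops_cong: "ops Om E ==> x - y : E ==> x : E \<longleftrightarrow> y : E"
 using ops_diff[of Om E x "x - y"] ops_add[of Om E "x - y" y] by auto

lemma ops_mono: "ops Om E ==> Om' <= Om ==> ops Om' E"
 by(auto simp: ops_def)

lemma ops_Inter: "(!!E. E : S ==> ops Om E) ==> ops Om (\<Inter>S)"
 by(auto simp: ops_def)

lemma ops_Int: "ops Om E ==> ops Om F ==> ops Om (E Int F)"
 by(auto simp: ops_def)

lemma ops_UNIV: "ops Om UNIV"
 by(simp add: ops_def)

lemma ops_0: "(!!om. om : Om ==> addm om) ==> ops Om {0}"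
 by(simp add: ops_def addm_zero)

lemma set_plusI: "x = a + b ==> a : A ==> b : B ==> x : A + B"
 by(auto simp: set_plus_def)

lemma ops_plus:
 assumes "!!om. om : Om ==> addm om" "ops Om E" "ops Om F"
 shows "ops Om (E + F)"
 unfolding ops_def
proof (intro conjI ballI)
 show "0 : E + F" using assms(2,3) set_plus_intro[of 0 E 0 F] by(simp add: ops_zero)
 fix x assume "x : E + F"
 then obtain e f where x: "x = e + f" "e : E" "f : F" by(auto elim: set_plus_elim)
 show "om x : E + F" if "om : Om" for om
  using that x assms by(auto simp: addmD ops_op)
 fix y assume "y : E + F"
 then obtain e' f' where y: "y = e' + f'" "e' : E" "f' : F" by(auto elim: set_plus_elim)
 have "x - y = (e - e') + (f - f')" unfolding x(1) y(1) by(simp add: algebra_simps)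
 thus "x - y : E + F"
  by(rule set_plusI) (rule ops_diff[OF assms(2) x(2) y(2)] ops_diff[OF assms(3) x(3) y(3)])+
qed

lemma ops_image:
 assumes "ops Om E" "addm f" "!!om' x. om' : Om' ==> x : E ==> EX om:Om. om' (f x) = f (om x)"
 shows "ops Om' (f ` E)"
 unfolding ops_def
proof (intro conjI ballI)
 show "0 : f ` E" using assms addm_zero ops_zero by(metis image_eqI)
 fix x assume "x : f ` E"
 then obtain e where e: "x = f e" "e : E" by auto
 show "om x : f ` E" if "om : Om'" for om
  using assms(3)[OF that e(2)] e assms(1) by(auto simp: ops_op)
 fix y assume "y : f ` E"
 then obtain e' where e': "y = f e'" "e' : E" by auto
 have "x - y = f (e - e')" using e e' assms(2) by(simp add: addm_diff)
 thus "x - y : f ` E" using e e' assms(1) ops_diff by blast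
qed

lemma ops_vimage:
 assumes "ops Om' E" "addm f" "!!om x. om : Om ==> f x : E ==> f (om x) : E"
 shows "ops Om {x. f x : E}"
 using assms by(auto simp: ops_def addm_zero addm_diff)

section \<open>Generated subgroups and the Noetherian condition modulo a subgroup\<close>

definition gen :: "('v::ab_group_add => 'v) set => 'v set => 'v set" where
 "gen Om F = \<Inter>{E. ops Om E & F <= E}"

lemma ops_gen: "ops Om (gen Om F)"
 unfolding gen_def by(rule ops_Inter) auto

lemma gen_inc: "F <= gen Om F"
 by(auto simp: gen_def)

lemma gen_least: "ops Om E ==> F <= E ==> gen Om F <= E"
 by(auto simp: gen_def)

lemma gen_mono: "F <= G ==> gen Om F <= gen Om G"
 by(auto simp: gen_def)

lemma gen_opsub: "ops Om E ==> gen Om E = E"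
 using gen_inc gen_least by blast

lemma plus_ge1: "0 : F ==> E <= E + (F::'v::monoid_add set)"
 by(auto intro: set_plusI[of _ _ 0])

lemma plus_ge2: "0 : E ==> F <= E + (F::'v::monoid_add set)"
 by(auto intro: set_plusI[of _ 0])

lemma plus_least: "ops Om G ==> E <= G ==> F <= G ==> E + F <= G"
 by(auto elim!: set_plus_elim intro: ops_add)

text \<open>The quotient \<open>(T + U) / U\<close> is Noetherian; its submodules are represented by
  the stable subgroups between \<open>U\<close> and \<open>T + U\<close>.\<close>

definition opnoeth :: "('v::ab_group_add => 'v) set => 'v set => 'v set => bool" where
 "opnoeth Om T U \<longleftrightarrow> (ALL E. ops Om E & U <= E & E <= T + U -->
   (EX F. finite F & F <= E & E <= gen Om (F Un U)))"

lemma opnoethD: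
 assumes "opnoeth Om T U" "ops Om E" "U <= E" "E <= T + U"
 shows "EX F. finite F & F <= E & E <= gen Om (F Un U)"
 using assms by(auto simp: opnoeth_def)

text \<open>The union of the chain is stable because the chain is directed. Its finitely many
  generators lie in one term, and from there on nothing is added.\<close>

lemma opnoeth_chain:
 fixes E :: "nat => _"
 assumes "opnoeth Om T U" "!!k. ops Om (E k)" "!!k. U <= E k" "!!k. E k <= T + U"
  "!!k. E k <= E (Suc k)"
 shows "EX k0. ALL k>=k0. E k = E k0"
proof -
 have mono: "E k <= E l" if "k <= l" for k l
  using that assms(5) by(rule lift_Suc_mono_le[rotated])
 have "ops Om (\<Union>k. E k)"
  unfolding ops_def
 proof (intro conjI ballI)
  show "0 : (\<Union>k. E k)" using assms(2) ops_zero by blast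
  fix x assume "x : (\<Union>k. E k)"
  then obtain k where k: "x : E k" by auto
  show "om x : (\<Union>k. E k)" if "om : Om" for om using that k assms(2) ops_op by blast
  fix y assume "y : (\<Union>k. E k)"
  then obtain l where l: "y : E l" by auto
  have "x - y : E (max k l)"
   using k l mono[of k "max k l"] mono[of l "max k l"] assms(2) by(auto intro: ops_diff)
  thus "x - y : (\<Union>k. E k)" by blast
 qed
 then obtain F where F: "finite F" "F <= (\<Union>k. E k)" "(\<Union>k. E k) <= gen Om (F Un U)"
  using opnoethD[OF assms(1), of "\<Union>k. E k"] SUP_least[of UNIV E, OF assms(4)] SUP_upper2[of 0 UNIV U E] assms(3)[of 0]
  by auto
 have "EX k. F <= E k" using F(1,2)
 proof (induction F rule: finite_induct)
  case (insert x F)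
  then obtain k l where "F <= E k" "x : E l" by auto
  hence "insert x F <= E (max k l)" using mono[of k "max k l"] mono[of l "max k l"] by auto
  thus ?case ..
 qed auto
 then obtain k0 where k0: "F <= E k0" ..
 have "gen Om (F Un U) <= E k0" using k0 assms(2,3) by(intro gen_least) auto
 thus ?thesis using F(3) mono by blast
qed

text \<open>Generators of the preimage of \<open>E\<close> map to generators of \<open>E\<close>.
  The operators on the two sides may be of different kinds, provided each one of \<open>Om\<close>
  is matched by one of \<open>Om'\<close>, and \<open>f\<close> has to reach \<open>T'\<close> only
  modulo \<open>U'\<close>.\<close>

lemma opnoeth_image:
 assumes noeth: "opnoeth Om T U" and T: "ops Om T" and U: "ops Om U" and U': "ops Om' U'"
  and f: "addm f" "T' <= f ` T + U'" "f ` U <= U'"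
  and ops: "!!om. om : Om ==> addm om & (EX om':Om'. ALL x. f (om x) = om' (f x))"
  and ops': "!!om. om : Om' ==> addm om"
 shows "opnoeth Om' T' U'"
 unfolding opnoeth_def
proof (intro allI impI)
 fix E assume E: "ops Om' E & U' <= E & E <= T' + U'"
 have "ops Om ({x. f x : E} Int (T + U))"
  using E ops by(intro ops_Int ops_vimage[of Om' E] ops_plus T U f) (auto, metis ops_op)
 moreover have "U <= {x. f x : E} Int (T + U)"
  using f E ops_zero[OF T] plus_ge2[of T U] by auto
 ultimately obtain F where F: "finite F" "F <= {x. f x : E} Int (T + U)"
  "{x. f x : E} Int (T + U) <= gen Om (F Un U)"
  using opnoethD[OF noeth, of "{x. f x : E} Int (T + U)"] by auto
 let ?G = "gen Om' (f ` F Un U')"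
 have "ops Om {x. f x : ?G}"
  using ops ops_op[OF ops_gen[of Om' "f ` F Un U'"]] by(intro ops_vimage[OF ops_gen f(1)]) metis
 hence *: "gen Om (F Un U) <= {x. f x : ?G}"
  using f(3) gen_inc[of "f ` F Un U'" Om'] by(intro gen_least) auto
 have "E <= ?G"
 proof
  fix e assume e: "e : E"
  hence "e : (f ` T + U') + U'" using E set_plus_mono2[OF f(2) order_refl, of U'] by auto
  then obtain t u v where t: "t : T" "u : U'" "v : U'" "e = (f t + u) + v" by(auto elim!: set_plus_elim)
  hence uv: "u + v : U'" using U' ops_add by blast
  hence "f t : E" using t e E ops_diff[of Om' E e "u + v"] by(auto simp: algebra_simps)
  moreover have "t : T + U" using plus_ge1[OF ops_zero[OF U]] t by auto
  ultimately have "f t : ?G" using F(3) * by blast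
  moreover have "u + v : ?G" using uv gen_inc[of "f ` F Un U'" Om'] by auto
  ultimately have "f t + (u + v) : ?G" by(rule ops_add[OF ops_gen])
  thus "e : ?G" using t by(simp add: add.assoc)
 qed
 thus "EX F. finite F & F <= E & E <= gen Om' (F Un U')"
  using F(1,2) by(intro exI[of _ "f ` F"]) (simp add: image_subset_iff subset_iff, blast)
qed

lemma opnoeth_subset: "opnoeth Om T U ==> T' <= T ==> opnoeth Om T' U"
 unfolding opnoeth_def using set_plus_mono2[of T' T U U] by(meson order_refl order_trans)

text \<open>\<open>E\<close> is generated by lifts of generators of its image modulo
  \<open>T'\<close> together with generators of its intersection with \<open>T'\<close>.\<close>

lemma opnoeth_extension:
 assumes add: "!!om. om : Om ==> addm om"
  and sub: "ops Om T'" "ops Om U" "T' <= T"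
  and n: "opnoeth Om T' U" "opnoeth Om T (T' + U)"
 shows "opnoeth Om T U"
 unfolding opnoeth_def
proof (intro allI impI)
 fix E assume E: "ops Om E & U <= E & E <= T + U"
 have TU: "ops Om (T' + U)" by(intro ops_plus add sub)
 have "ops Om (E + (T' + U))" by(intro ops_plus add sub TU) (use E in auto)
 moreover have "E + (T' + U) <= T + (T' + U)"
 proof
  fix x assume "x : E + (T' + U)"
  hence "x : (T + U) + (T' + U)" using E set_plus_mono2[of E "T + U" "T' + U" "T' + U"] by auto
  then obtain t u v w where *: "t : T" "u : U" "v : T'" "w : U" "x = (t + u) + (v + w)"
   by(auto elim!: set_plus_elim)
  hence "x = t + (v + (u + w))" by(simp add: algebra_simps)
  thus "x : T + (T' + U)" using * ops_add[OF sub(2) *(2,4)] set_plus_intro by blast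
 qed
 ultimately obtain F where F: "finite F" "F <= E + (T' + U)" "E + (T' + U) <= gen Om (F Un (T' + U))"
  using opnoethD[OF n(2), of "E + (T' + U)"] plus_ge2[of E "T' + U"] E ops_zero[of Om E] by auto
 have "EX e:E. f - e : T' + U" if "f : F" for f
 proof -
  have "f : E + (T' + U)" using F(2) that by auto
  then obtain e g where "f = e + g" "e : E" "g : T' + U" by(rule set_plus_elim)
  thus ?thesis by(intro bexI[of _ e]) auto
 qed
 then obtain e where e: "!!f. f : F ==> e f : E & f - e f : T' + U" by metis
 have "ops Om ((E Int T') + U)" by(intro ops_plus ops_Int add sub) (use E in auto)
 moreover have "(E Int T') + U <= T' + U" by(rule set_plus_mono2) auto
 moreover have "U <= (E Int T') + U"
  using plus_ge2[of "E Int T'" U] E ops_zero[of Om E] ops_zero[OF sub(1)] by auto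
 ultimately obtain G where G: "finite G" "G <= (E Int T') + U" "(E Int T') + U <= gen Om (G Un U)"
  using opnoethD[OF n(1), of "(E Int T') + U"] by auto
 have GE: "G <= E" using G(2) plus_least[of Om E "E Int T'" U] E by auto
 let ?H = "gen Om (e ` F Un G Un U)"
 have HE: "?H <= E" using e GE E by(intro gen_least) auto
 have "E <= ?H"
 proof
  fix x assume x: "x : E"
  have "gen Om (F Un (T' + U)) <= ?H + (T' + U)"
  proof (rule gen_least)
   show "ops Om (?H + (T' + U))" by(rule ops_plus[OF add ops_gen TU])
   have "F <= ?H + (T' + U)"
   proof
    fix f assume f: "f : F"
    have "e f : ?H" using gen_inc[of "e ` F Un G Un U" Om] f by auto
    hence "e f + (f - e f) : ?H + (T' + U)" using e[OF f] by(intro set_plus_intro) auto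
    thus "f : ?H + (T' + U)" by simp
   qed
   thus "F Un (T' + U) <= ?H + (T' + U)"
    using plus_ge2[of ?H "T' + U"] ops_zero[OF ops_gen] by blast
  qed
  moreover have "x : E + (T' + U)" using x plus_ge1[OF ops_zero[OF TU], of E] by auto
  ultimately obtain h t u where h: "h : ?H" "t : T'" "u : U" "x = h + (t + u)"
   using F(3) by(auto elim!: set_plus_elim dest!: subsetD)
  have uE: "u : E" using h E by auto
  have "t = x - (h + u)" using h(4) by(simp add: algebra_simps)
  hence "t : E Int T'" using h x HE E uE ops_diff[of Om E x "h + u"] ops_add[of Om E h u] by auto
  hence "t + u : (E Int T') + U" using h by(intro set_plus_intro)
  hence "t + u : gen Om (G Un U)" using G(3) by auto
  hence "t + u : ?H" using gen_mono[of "G Un U" "e ` F Un G Un U" Om] by blast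
  thus "x : ?H" using h ops_add[OF ops_gen] by blast
 qed
 thus "EX F. finite F & F <= E & E <= gen Om (F Un U)"
  using F(1) G(1) e GE by(intro exI[of _ "e ` F Un G"]) auto
qed

lemma addm_funpow: "addm (t :: 'v::ab_group_add => 'v) ==> addm (t ^^ k)"
 by(induction k) (simp_all add: addm_def)

lemma ops_funpow: "ops Om E ==> t : Om ==> x : E ==> (t ^^ k) x : E"
 by(induction k) (simp_all add: ops_op)

text \<open>Hilbert's basis theorem, by the usual comparison of leading coefficients; \<open>t\<close> plays the role
 of the polynomial variable, and no polynomial module has to be constructed.\<close>

lemma opnoeth_hilbert:
 assumes add: "!!om. om : Om ==> addm om" and t: "addm t"
  and comm: "!!om x. om : Om ==> t (om x) = om (t x)"
  and T0: "ops Om T0" and noeth: "opnoeth Om T0 U" and U: "ops (insert t Om) U"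
 shows "opnoeth (insert t Om) (gen (insert t Om) T0) U"
proof -
 \<comment> \<open>\<open>G k\<close> plays the role of the polynomials of degree below
   \<open>k\<close>: it is the sum of the images of \<open>T0\<close> under \<open>t ^^ j\<close>
   for \<open>j < k\<close>.\<close>
 define G where "G = rec_nat {0} (%k S. S + (t ^^ k) ` T0)"
 have G0: "G 0 = {0}" and GS: "G (Suc k) = G k + (t ^^ k) ` T0" for k by(simp_all add: G_def)
 have tk: "addm (t ^^ k)" for k using t by(rule addm_funpow)
 have commk: "(t ^^ k) (om x) = om ((t ^^ k) x)" if "om : Om" for k om x
  by(induction k) (simp_all add: comm that)
 have UOm: "ops Om U" using U by(rule ops_mono) auto
 have tkT0: "ops Om ((t ^^ k) ` T0)" for k
  by(rule ops_image[OF T0 tk]) (metis commk)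
 have G: "ops Om (G k)" for k
 proof (induction k)
  case 0 show ?case unfolding G0 by(rule ops_0[OF add])
 next
  case (Suc k) show ?case unfolding GS by(rule ops_plus[OF add Suc tkT0])
 qed
 have Gmono1: "G k <= G (Suc k)" for k
  unfolding GS by(rule plus_ge1[OF ops_zero[OF tkT0]])
 have Gmono: "G k <= G l" if "k <= l" for k l
  using that Gmono1 by(rule lift_Suc_mono_le[rotated])
 have tG: "t x : G (Suc k)" if "x : G k" for k x
  using that
 proof (induction k arbitrary: x)
  case 0 thus ?case using G0 addm_zero[OF t] ops_zero[OF G] by auto
 next
  case (Suc k)
  then obtain g y where x: "x = g + (t ^^ k) y" "g : G k" "y : T0"
   unfolding GS by(auto elim!: set_plus_elim)
  have "t x = t g + (t ^^ Suc k) y" using x t by(simp add: addmD)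
  thus ?case unfolding GS[of "Suc k"]
   by(rule set_plusI[OF _ Suc.IH[OF x(2)] imageI[OF x(3)]])
 qed
 have tjG: "(t ^^ j) x : G (j + k)" if "x : G k" for j k x
  using that by(induction j) (auto intro: tG)
 have GU: "ops Om (G k + U)" for k by(rule ops_plus[OF add G UOm])
 have UGU: "U <= G k + U" for k by(rule plus_ge2[OF ops_zero[OF G]])
 have Utk: "(t ^^ j) u : U" if "u : U" for j u using U that by(auto intro: ops_funpow)
 have tjGU: "(t ^^ j) x : G (j + k) + U" if "x : G k + U" for j k x
  using that tjG Utk tk by(auto elim!: set_plus_elim simp: addmD intro!: set_plus_intro)
 have T0G: "T0 <= G 1" using G0 by(simp add: GS)
 have T: "gen (insert t Om) T0 <= (\<Union>k. G k)"
 proof (rule gen_least)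
  show "T0 <= (\<Union>k. G k)" using T0G by blast
  show "ops (insert t Om) (\<Union>k. G k)"
   unfolding ops_def
  proof (intro conjI ballI)
   show "0 : (\<Union>k. G k)" using ops_zero[OF G] by blast
   fix x assume "x : (\<Union>k. G k)"
   then obtain k where k: "x : G k" by auto
   show "om x : (\<Union>k. G k)" if "om : insert t Om" for om
   proof (cases "om = t")
    case True thus ?thesis using tG[OF k] by blast
   next
    case False
    hence "om x : G k" using ops_op[OF G _ k] that by simp
    thus ?thesis by blast
   qed
   fix y assume "y : (\<Union>k. G k)"
   then obtain l where l: "y : G l" by auto
   have "x - y : G (max k l)"
    using k l Gmono[of k "max k l"] Gmono[of l "max k l"] by(intro ops_diff[OF G]) auto
   thus "x - y : (\<Union>k. G k)" by blast
  qed
 qed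
 show ?thesis unfolding opnoeth_def
 proof (intro allI impI)
  fix E assume "ops (insert t Om) E & U <= E & E <= gen (insert t Om) T0 + U"
  hence E: "ops (insert t Om) E" "U <= E" "E <= gen (insert t Om) T0 + U" by auto
  have EOm: "ops Om E" using E(1) by(rule ops_mono) auto
  \<comment> \<open>\<open>L k\<close> consists of the leading coefficients of the elements of
    \<open>E\<close> of degree \<open>k\<close>, modulo \<open>U\<close>. Applying \<open>t\<close>
    to \<open>e\<close> shows that the chain increases.\<close>
  define L where "L k = {x : T0. EX e:E. e - (t ^^ k) x : G k + U}" for k
  have L: "ops Om (L k)" for k
   unfolding ops_def
  proof (intro conjI ballI)
   show "0 : L k"
    using ops_zero[OF T0] ops_zero[OF E(1)] ops_zero[OF GU[of k]] addm_zero[OF tk[of k]]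
    by(auto simp: L_def)
   fix x assume "x : L k"
   then obtain e where x: "x : T0" "e : E" "e - (t ^^ k) x : G k + U" by(auto simp: L_def)
   show "om x : L k" if w: "om : Om" for om
   proof -
    have "om e - (t ^^ k) (om x) : G k + U"
     using ops_op[OF GU w x(3)] by(simp add: commk w addm_diff[OF add[OF w]])
    thus ?thesis using ops_op[OF T0 w x(1)] ops_op[OF EOm w x(2)] by(auto simp: L_def)
   qed
   fix y assume "y : L k"
   then obtain e' where y: "y : T0" "e' : E" "e' - (t ^^ k) y : G k + U" by(auto simp: L_def)
   have "(e - e') - (t ^^ k) (x - y) : G k + U"
    using ops_diff[OF GU x(3) y(3)] by(simp add: addm_diff[OF tk] algebra_simps)
   thus "x - y : L k"
    using ops_diff[OF T0 x(1) y(1)] ops_diff[OF EOm x(2) y(2)] by(auto simp: L_def)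
  qed
  have Lmono: "L k <= L (Suc k)" for k
  proof
   fix x assume "x : L k"
   then obtain e where x: "x : T0" "e : E" "e - (t ^^ k) x : G k + U" by(auto simp: L_def)
   have "t e - (t ^^ Suc k) x : G (Suc k) + U"
    using tjGU[OF x(3), of 1] by(simp add: addm_diff[OF t])
   moreover have "t e : E" using ops_op[OF E(1) _ x(2)] by auto
   ultimately show "x : L (Suc k)" using x by(auto simp: L_def)
  qed
  have LU: "ops Om (L k + U)" for k by(rule ops_plus[OF add L UOm])
  have ULU: "U <= L k + U" for k by(rule plus_ge2[OF ops_zero[OF L]])
  have LUT: "L k + U <= T0 + U" for k by(rule set_plus_mono2) (auto simp: L_def)
  \<comment> \<open>Above \<open>k0\<close> no new leading coefficients appear, so generators for
    the \<open>k <= k0\<close> suffice; each is represented by an element \<open>e k y\<close> of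
    \<open>E\<close>.\<close>
  have "EX k0. ALL k>=k0. L k + U = L k0 + U"
   using opnoeth_chain[OF noeth LU ULU LUT] set_plus_mono2[OF Lmono order_refl] .
  then obtain k0 where k0: "!!k. k >= k0 ==> L k + U = L k0 + U" by blast
  have "EX F. finite F & F <= L k + U & L k + U <= gen Om (F Un U)" for k
   by(rule opnoethD[OF noeth LU ULU LUT])
  then obtain Xs where Xs: "!!k. finite (Xs k)" "!!k. Xs k <= L k + U" "!!k. L k + U <= gen Om (Xs k Un U)"
   by metis
  have "EX e:E. e - (t ^^ k) y : G k + U" if "y : L k + U" for k y
  proof -
   obtain x u where y: "y = x + u" "x : L k" "u : U" using \<open>y : L k + U\<close> by(rule set_plus_elim)
   then obtain e where e: "e : E" "e - (t ^^ k) x : G k + U" by(auto simp: L_def)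
   have "(t ^^ k) u : G k + U" using Utk[OF y(3)] UGU by blast
   from ops_diff[OF GU e(2) this] have "e - (t ^^ k) y : G k + U"
    by(simp add: y addmD[OF tk] algebra_simps)
   thus ?thesis using e by blast
  qed
  hence "ALL k y. EX e. y : L k + U --> e : E & e - (t ^^ k) y : G k + U" by blast
  then obtain e where e: "!!k y. y : L k + U ==> e k y : E & e k y - (t ^^ k) y : G k + U"
   unfolding choice_iff by blast
  define F where "F = (\<Union>k\<le>k0. e k ` Xs k)"
  have F: "finite F" "F <= E" using Xs(1) e Xs(2) by(auto simp: F_def subset_iff)
  define H where "H = gen (insert t Om) (F Un U)"
  have H: "ops (insert t Om) H" unfolding H_def by(rule ops_gen)
  have HOm: "ops Om H" using H by(rule ops_mono) auto
  have FH: "F <= H" "U <= H" using gen_inc[of "F Un U" "insert t Om"] by(auto simp: H_def)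
  have HE: "H <= E" unfolding H_def using F E by(intro gen_least) auto
  have A: "EX h:H. h - (t ^^ k) y : G k + U" if k: "k <= k0" and y: "y : L k + U" for k y
  proof -
   define Q where "Q = {y. EX h:H. h - (t ^^ k) y : G k + U}"
   have "ops Om Q" unfolding ops_def
   proof (intro conjI ballI)
    show "0 : Q" using ops_zero[OF H] ops_zero[OF GU[of k]] addm_zero[OF tk[of k]] by(auto simp: Q_def)
    fix x assume "x : Q"
    then obtain h where x: "h : H" "h - (t ^^ k) x : G k + U" by(auto simp: Q_def)
    show "om x : Q" if w: "om : Om" for om
    proof -
     have "om h - (t ^^ k) (om x) : G k + U"
      using ops_op[OF GU w x(2)] by(simp add: commk w addm_diff[OF add[OF w]])
     thus ?thesis using ops_op[OF HOm w x(1)] by(auto simp: Q_def)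
    qed
    fix y assume "y : Q"
    then obtain h' where y: "h' : H" "h' - (t ^^ k) y : G k + U" by(auto simp: Q_def)
    have "(h - h') - (t ^^ k) (x - y) : G k + U"
     using ops_diff[OF GU x(2) y(2)] by(simp add: addm_diff[OF tk] algebra_simps)
    thus "x - y : Q" using ops_diff[OF H x(1) y(1)] by(auto simp: Q_def)
   qed
   moreover have "Xs k <= Q"
   proof
    fix y assume "y : Xs k"
    hence "e k y : H" "e k y - (t ^^ k) y : G k + U"
     using FH e Xs(2)[of k] k by(auto simp: F_def)
    thus "y : Q" by(auto simp: Q_def)
   qed
   moreover have "U <= Q"
   proof
    fix u assume "u : U"
    hence "(t ^^ k) u : H" "(t ^^ k) u - (t ^^ k) u : G k + U"
     using Utk FH ops_zero[OF GU] by auto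
    thus "u : Q" unfolding Q_def by blast
   qed
   ultimately have "gen Om (Xs k Un U) <= Q" by(intro gen_least) auto
   thus ?thesis using Xs(3) y by(auto simp: Q_def subset_iff)
  qed
  have B: "EX h:H. h - (t ^^ k) y : G k + U" if y: "y : L k + U" for k y
  proof (cases "k <= k0")
   case True thus ?thesis using A y by blast
  next
   case False
   hence "y : L k0 + U" using k0[of k] y by simp
   then obtain h where h: "h : H" "h - (t ^^ k0) y : G k0 + U" using A by blast
   have k: "k = (k - k0) + k0" using False by simp
   have "(t ^^ (k - k0)) h - (t ^^ (k - k0)) ((t ^^ k0) y) : G k + U"
    using tjGU[OF h(2), of "k - k0"] k by(simp add: addm_diff[OF tk])
   also have "(t ^^ (k - k0)) ((t ^^ k0) y) = (t ^^ k) y"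
    using k by(metis comp_apply funpow_add)
   finally show ?thesis using ops_funpow[OF H _ h(1)] by blast
  qed
  \<comment> \<open>Subtracting an element of \<open>H\<close> with the same leading coefficient
    lowers the degree; the induction is over the bound \<open>k\<close> on the degree.\<close>
  have C: "x : H" if "x : E" "x : G k + U" for k x
   using that
  proof (induction k arbitrary: x)
   case 0 thus ?case using G0 FH by(auto elim!: set_plus_elim)
  next
   case (Suc k)
   obtain g u where gu: "x = g + u" "g : G (Suc k)" "u : U" using Suc.prems(2) by(rule set_plus_elim)
   obtain g' y where g: "g = g' + (t ^^ k) y" "g' : G k" "y : T0"
    using gu(2) unfolding GS by(auto elim!: set_plus_elim)
   have g'u: "g' + u : G k + U" using g gu by(intro set_plus_intro)
   have "x - (t ^^ k) y : G k + U" using g'u by(simp add: gu g algebra_simps)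
   hence "y : L k" using Suc.prems(1) g(3) by(auto simp: L_def)
   hence "y : L k + U" using plus_ge1[OF ops_zero[OF UOm]] by blast
   then obtain h where h: "h : H" "h - (t ^^ k) y : G k + U" using B by blast
   have "x - h = (g' + u) - (h - (t ^^ k) y)" by(simp add: gu g algebra_simps)
   hence "x - h : G k + U" using ops_diff[OF GU g'u h(2)] by metis
   moreover have "x - h : E" using ops_diff[OF E(1) Suc.prems(1)] h(1) HE by blast
   ultimately have "x - h : H" using Suc.IH by blast
   hence "(x - h) + h : H" using h(1) by(rule ops_add[OF H])
   thus ?case by simp
  qed
  have "E <= H"
  proof
   fix x assume x: "x : E"
   then obtain y u where "x = y + u" "y : gen (insert t Om) T0" "u : U"
    using E(3) by(auto elim!: set_plus_elim dest!: subsetD)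
   moreover then obtain k where "y : G k" using T by auto
   ultimately show "x : H" using C[OF x, of k] by auto
  qed
  thus "EX F. finite F & F <= E & E <= gen (insert t Om) (F Un U)"
   using F H_def by blast
 qed
qed

text \<open>One application of \<open>opnoeth_hilbert\<close> per operator. The result is Hilbert's
  theorem for modules over a polynomial ring in several variables.\<close>

lemma opnoeth_finite_ops:
 assumes "finite \<Theta>" "!!om. om : Om Un \<Theta> ==> addm om"
  and "!!te om x. te : \<Theta> ==> om : Om Un \<Theta> ==> te (om x) = om (te x)"
  and "ops Om T0" "opnoeth Om T0 U" "ops (Om Un \<Theta>) U"
 shows "opnoeth (Om Un \<Theta>) (gen (Om Un \<Theta>) T0) U"
 using assms
proof (induction \<Theta> rule: finite_induct)
 case empty
 thus ?case by(simp add: gen_opsub)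
next
 case (insert t \<Theta>)
 have "ops (Om Un \<Theta>) U" using insert.prems(5) by(rule ops_mono) auto
 hence "opnoeth (Om Un \<Theta>) (gen (Om Un \<Theta>) T0) U"
  using insert.prems by(intro insert.IH) auto
 hence "opnoeth (insert t (Om Un \<Theta>)) (gen (insert t (Om Un \<Theta>)) (gen (Om Un \<Theta>) T0)) U"
  using insert.prems by(intro opnoeth_hilbert ops_gen) auto
 moreover have "gen (insert t (Om Un \<Theta>)) T0 <= gen (insert t (Om Un \<Theta>)) (gen (Om Un \<Theta>) T0)"
  by(intro gen_mono gen_inc)
 ultimately show ?case using opnoeth_subset by(metis Un_insert_right)
qed

section \<open>Modules over a ring, modulo a submodule\<close>

locale smod =
 fixes sc :: "'p::comm_ring_1 => 'v::ab_group_add => 'v"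
 assumes sc_add: "sc a (x + y) = sc a x + sc a y"
  and sc_plus: "sc (a + b) x = sc a x + sc b x"
  and sc_sc: "sc a (sc b x) = sc (a * b) x"
  and sc_1: "sc 1 x = x"
begin

lemma sc_addm: "addm (sc a)"
 by(simp add: addm_def sc_add)

lemma sc_0 [simp]: "sc 0 x = 0"
 using sc_plus[of 0 0 x] by simp

lemma sc_zero [simp]: "sc a 0 = 0"
 by(rule addm_zero[OF sc_addm])

lemma sc_diff: "sc a (x - y) = sc a x - sc a y"
 and sc_sum: "sc a (sum g S) = (SUM x:S. sc a (g x))"
 by(rule addm_diff[OF sc_addm] addm_sum[OF sc_addm])+

lemma sc_diff_left: "sc (a - b) x = sc a x - sc b x"
 using sc_plus[of "a - b" b x] by simp

lemma sc_minus_left: "sc (- a) x = - sc a x"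
 using sc_diff_left[of 0 a x] by simp

lemma sc_commute: "sc a (sc b x) = sc b (sc a x)"
 by(simp add: sc_sc mult.commute)

lemma ops_sc: "ops (range sc) E ==> x : E ==> sc a x : E"
 by(rule ops_op) auto

lemma ops_rangeI:
 assumes "0 : E" "!!x y. x : E ==> y : E ==> x + y : E" "!!a x. x : E ==> sc a x : E"
 shows "ops (range sc) E"
 unfolding ops_def
proof (intro conjI ballI)
 fix x y assume "x : E" "y : E"
 hence "x + sc (- 1) y : E" using assms by blast
 thus "x - y : E" by(simp add: sc_minus_left sc_1)
qed (use assms in auto)

lemma ops_range_plus: "ops (range sc) E ==> ops (range sc) F ==> ops (range sc) (E + F)"
 by(rule ops_plus) (auto simp: sc_addm)

lemma gen_finite:
 assumes F: "finite F" and U: "ops (range sc) U" and x: "x : gen (range sc) (F Un U)"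
 shows "EX a. x - (SUM g:F. sc (a g) g) : U"
proof -
 let ?E = "{x. EX a. x - (SUM g:F. sc (a g) g) : U}"
 have "ops (range sc) ?E"
 proof (rule ops_rangeI)
  show "0 : ?E" using ops_zero[OF U] by(auto intro!: exI[of _ "%_. 0"])
  fix x y assume "x : ?E" "y : ?E"
  then obtain a b where "x - (SUM g:F. sc (a g) g) : U" "y - (SUM g:F. sc (b g) g) : U" by auto
  from ops_add[OF U this] have "x + y - (SUM g:F. sc (a g + b g) g) : U"
   by(simp add: sc_plus sum.distrib algebra_simps)
  thus "x + y : ?E" by(auto intro!: exI[of _ "%g. a g + b g"])
 next
  fix c x assume "x : ?E"
  then obtain a where "x - (SUM g:F. sc (a g) g) : U" by auto
  from ops_sc[OF U this, of c] have "sc c x - (SUM g:F. sc (c * a g) g) : U"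
   by(simp add: sc_diff sc_sum sc_sc)
  thus "sc c x : ?E" by(auto intro!: exI[of _ "%g. c * a g"])
 qed
 moreover have "F Un U <= ?E"
 proof
  fix x assume x: "x : F Un U"
  show "x : ?E"
  proof (cases "x : F")
   case True
   have "(SUM g:F. sc (if g = x then 1 else 0) g) = (SUM g:F. if g = x then x else 0)"
    by(rule sum.cong) (auto simp: sc_1)
   thus ?thesis using True F ops_zero[OF U]
    by(auto intro!: exI[of _ "%g. if g = x then 1 else 0"])
  next
   case False
   thus ?thesis using x by(auto intro!: exI[of _ "%g. 0"])
  qed
 qed
 ultimately have "gen (range sc) (F Un U) <= ?E" by(rule gen_least)
 thus ?thesis using x by auto
qed

text \<open>The scalars that work for the finitely many generators are multiplied together. With
  \<open>S\<close> the complement of a prime this turns a statement about localisations into one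
  with a single denominator.\<close>

lemma uniform_scalar:
 assumes F: "finite F" "E <= gen (range sc) (F Un U)" "F <= E" and U: "ops (range sc) U" "U <= U'"
  and U': "ops (range sc) U'" and S: "1 : S" "!!s t. s : S ==> t : S ==> s * t : S"
  and E: "!!x. x : E ==> EX s:S. sc s x : U'"
 shows "EX s:S. ALL x:E. sc s x : U'"
proof -
 have "EX s:S. ALL x:F. sc s x : U'" using F(1,3)
 proof (induction F rule: finite_induct)
  case empty thus ?case using S by auto
 next
  case (insert x F)
  then obtain s t where st: "s : S" "ALL x:F. sc s x : U'" "t : S" "sc t x : U'" using E[of x] by auto
  have "ALL y:insert x F. sc (s * t) y : U'"
   using st(2,4) ops_sc[OF U', of _ s] ops_sc[OF U', of _ t]
   by(metis insert_iff sc_commute sc_sc)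
  thus ?case using S(2) st by blast
 qed
 then obtain s where s: "s : S" "ALL x:F. sc s x : U'" by blast
 have "ops (range sc) {x. sc s x : U'}"
  by(rule ops_vimage[OF U' sc_addm]) (auto simp: sc_commute[of s] intro: ops_sc[OF U'])
 moreover have "F Un U <= {x. sc s x : U'}" using s U(2) ops_sc[OF U'] by auto
 ultimately have "gen (range sc) (F Un U) <= {x. sc s x : U'}" by(rule gen_least)
 thus ?thesis using s F(2) by blast
qed

text \<open>Nakayama's lemma. For \<open>S\<close> the complement of a prime ideal containing \<open>\<aa>\<close> it is the version
 localised at that prime.\<close>

lemma nakayama_aux:
 assumes "finite F" and U: "ops (range sc) U" and a: "ops (range (*)) \<aa>"
  and S: "!!s t. s : S ==> t : S ==> s * t : S" "!!s m. s : S ==> m : \<aa> ==> s - m : S"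
  and "s : S" "!!f. f : F ==> EX m. range m <= \<aa> & sc s f - (SUM g:F. sc (m g) g) : U"
 shows "EX s:S. ALL f:F. sc s f : U"
 using assms(1,6-)
proof (induction F arbitrary: s rule: finite_induct)
 case empty thus ?case by auto
next
 case (insert f F)
 obtain m where m: "range m <= \<aa>" "sc s f - (SUM g:insert f F. sc (m g) g) : U"
  using insert.prems(2)[of f] by auto
 define r where "r = s - m f"
 have r: "r : S" unfolding r_def using m(1) by(intro S(2) insert.prems) auto
 have rf: "sc r f - (SUM g:F. sc (m g) g) : U"
  using m(2) insert.hyps by(simp add: r_def sc_diff_left algebra_simps)
 have al: "a * x : \<aa>" if "x : \<aa>" for a x using ops_op[OF a _ that] by auto
 have "EX s:S. ALL f:F. sc s f : U"
 proof (rule insert.IH)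
  show "r * s : S" using r insert.prems(1) by(rule S)
  fix h assume h: "h : F"
  obtain n where n: "range n <= \<aa>" "sc s h - (SUM g:insert f F. sc (n g) g) : U"
   using insert.prems(2)[of h] h by auto
  have "sc r (sc s h - (SUM g:insert f F. sc (n g) g)) + sc (n f) (sc r f - (SUM g:F. sc (m g) g)) : U"
   by(intro ops_add[OF U] ops_sc[OF U] n rf)
  also have "sc r (sc s h - (SUM g:insert f F. sc (n g) g)) + sc (n f) (sc r f - (SUM g:F. sc (m g) g))
    = sc (r * s) h - (SUM g:F. sc (r * n g + n f * m g) g)"
   using insert.hyps by(simp add: sc_diff sc_add sc_sc sc_sum sc_plus sum.distrib mult.commute algebra_simps)
  finally have "sc (r * s) h - (SUM g:F. sc (r * n g + n f * m g) g) : U" .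
  moreover have "range (%g. r * n g + n f * m g) <= \<aa>"
   using n(1) m(1) by(auto intro!: ops_add[OF a] al)
  ultimately show "EX m. range m <= \<aa> & sc (r * s) h - (SUM g:F. sc (m g) g) : U"
   by(intro exI[of _ "%g. r * n g + n f * m g"]) auto
 qed
 then obtain s' where s': "s' : S" "ALL f:F. sc s' f : U" by blast
 have "sc (r * s') h : U" if "h : insert f F" for h
 proof (cases "h = f")
  case True
  have "(SUM g:F. sc (m g) (sc s' g)) : U" using s' by(intro ops_sum[OF U] ops_sc[OF U, of "sc s' _"]) auto
  hence "sc s' (SUM g:F. sc (m g) g) : U" by(simp add: sc_sum sc_commute[of s'])
  moreover have "sc s' (sc r f) - sc s' (SUM g:F. sc (m g) g) : U"
   using ops_sc[OF U rf, of s'] by(simp add: sc_diff)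
  ultimately have "sc s' (sc r f) : U" using ops_cong[OF U] by blast
  thus ?thesis using True by(simp add: sc_sc mult.commute)
 next
  case False
  hence "sc s' h : U" using that s' by auto
  thus ?thesis using ops_sc[OF U, of "sc s' h" r] by(simp add: sc_sc)
 qed
 moreover have "r * s' : S" using r s' by(intro S)
 ultimately show ?case by blast
qed

lemma nakayama:
 assumes F: "finite F" "F <= E" "E <= gen (range sc) (F Un U)"
  and U: "ops (range sc) U" and a: "ops (range (*)) \<aa>"
  and S: "!!s t. s : S ==> t : S ==> s * t : S" "!!s m. s : S ==> m : \<aa> ==> s - m : S"
  and s: "s : S" and E: "!!x. x : E ==> sc s x : gen (range sc) {sc m y |m y. m : \<aa> & y : E} + U"
 shows "EX s:S. ALL x:E. sc s x : U"
proof -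
 have al: "b * x : \<aa>" if "x : \<aa>" for b x using ops_op[OF a _ that] by auto
 \<comment> \<open>\<open>?D\<close> collects the elements that are combinations of the generators
   with coefficients in the ideal. It contains the product of the ideal with \<open>E\<close>, so
   the hypothesis becomes a system of relations of the kind solved in
   \<open>nakayama_aux\<close>.\<close>
 let ?D = "{x. EX m. range m <= \<aa> & x - (SUM g:F. sc (m g) g) : U}"
 have "ops (range sc) ?D"
 proof (rule ops_rangeI)
  show "0 : ?D" using ops_zero[OF U] ops_zero[OF a] by(auto intro!: exI[of _ "%_. 0"])
  fix x y assume "x : ?D" "y : ?D"
  then obtain b c where b: "range b <= \<aa>" "range c <= \<aa>"
   and bc: "x - (SUM g:F. sc (b g) g) : U" "y - (SUM g:F. sc (c g) g) : U" by auto
  from ops_add[OF U bc] have "x + y - (SUM g:F. sc (b g + c g) g) : U"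
   by(simp add: sc_plus sum.distrib algebra_simps)
  moreover have "range (%g. b g + c g) <= \<aa>" using b by(auto intro!: ops_add[OF a])
  ultimately show "x + y : ?D" by(auto intro!: exI[of _ "%g. b g + c g"])
 next
  fix c x assume "x : ?D"
  then obtain b where b: "range b <= \<aa>" "x - (SUM g:F. sc (b g) g) : U" by auto
  from ops_sc[OF U b(2), of c] have "sc c x - (SUM g:F. sc (c * b g) g) : U"
   by(simp add: sc_diff sc_sum sc_sc)
  moreover have "range (%g. c * b g) <= \<aa>" using b by(auto intro!: al)
  ultimately show "sc c x : ?D" by(auto intro!: exI[of _ "%g. c * b g"])
 qed
 moreover have "{sc m y |m y. m : \<aa> & y : E} <= ?D"
 proof clarify
  fix m y assume m: "m : \<aa>" and "y : E"
  then obtain b where "y - (SUM g:F. sc (b g) g) : U"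
   using gen_finite[OF F(1) U] F(3) by blast
  from ops_sc[OF U this, of m] have "sc m y - (SUM g:F. sc (b g * m) g) : U"
   by(simp add: sc_diff sc_sum sc_sc mult.commute)
  moreover have "range (%g. b g * m) <= \<aa>" using m by(auto intro!: al)
  ultimately show "EX n. range n <= \<aa> & sc m y - (SUM g:F. sc (n g) g) : U"
   by(auto intro!: exI[of _ "%g. b g * m"])
 qed
 ultimately have gD: "gen (range sc) {sc m y |m y. m : \<aa> & y : E} <= ?D" by(rule gen_least)
 have "EX s:S. ALL f:F. sc s f : U"
 proof (rule nakayama_aux[OF F(1) U a S s])
  fix f assume "f : F"
  hence "sc s f : gen (range sc) {sc m y |m y. m : \<aa> & y : E} + U" using E F(2) by auto
  then obtain d u where du: "sc s f = d + u" "d : ?D" "u : U" using gD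
   by(meson set_plus_elim subsetD)
  then obtain m where m: "range m <= \<aa>" "d - (SUM g:F. sc (m g) g) : U" by auto
  from ops_add[OF U m(2) du(3)] have "sc s f - (SUM g:F. sc (m g) g) : U"
   by(simp add: du algebra_simps)
  thus "EX m. range m <= \<aa> & sc s f - (SUM g:F. sc (m g) g) : U" using m by auto
 qed
 then obtain s where s: "s : S" "ALL f:F. sc s f : U" by blast
 have "ops (range sc) {x. sc s x : U}"
  by(rule ops_vimage[OF U sc_addm]) (auto simp: sc_commute[of s] intro: ops_sc[OF U])
 moreover have "F Un U <= {x. sc s x : U}" using s ops_sc[OF U] by auto
 ultimately have "gen (range sc) (F Un U) <= {x. sc s x : U}" by(rule gen_least)
 thus ?thesis using s F(3) by blast
qed

end

interpretation rmod: smod "(*) :: 'p::comm_ring_1 => 'p => 'p"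
 by unfold_locales (simp_all add: algebra_simps)

definition smul :: "'p::comm_ring_1 => ('x => 'p) => 'x => 'p" (infixr \<open>*s\<close> 75) where
 "a *s v = (%x. a * v x)"

lemma smul_apply [simp]: "(a *s v) x = a * v x"
 by(simp add: smul_def)

interpretation vmod: smod "smul :: 'p::comm_ring_1 => ('x => 'p) => 'x => 'p"
 by unfold_locales (simp_all add: fun_eq_iff algebra_simps)

lemma minus_fun_apply' [simp]: "(f - g) x = f x - (g x :: 'v::ab_group_add)"
 by(simp add: fun_diff_def)

lemma uminus_fun_apply' [simp]: "(- f) x = - (f x :: 'v::ab_group_add)"
 by(simp add: fun_Compl_def)

lemma sum_fun_apply: "(sum f S) x = (SUM i:S. f i x)" for f :: "'i => 'x => 'v::comm_monoid_add"
 by(induction S rule: infinite_finite_induct) simp_all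

abbreviation idl :: "'p::comm_ring_1 set => bool" where
 "idl J \<equiv> ops (range (*)) J"

abbreviation smd :: "('x => 'p::comm_ring_1) set => bool" where
 "smd E \<equiv> ops (range smul) E"

text \<open>The free module on \<open>B\<close>, as functions supported on \<open>B\<close>. Free
  modules of all ranks live in one type, so that complexes need no dependent types.\<close>

definition Vs :: "'x set => ('x => 'p::comm_ring_1) set" where
 "Vs B = {v. ALL x. x ~: B --> v x = 0}"

text \<open>The relations of the free module over the ring modulo \<open>J\<close>.\<close>

definition JV :: "'p::comm_ring_1 set => ('x => 'p) set" where
 "JV J = {v. ALL x. v x : J}"

lemma idl_mult: "idl J ==> x : J ==> a * x : J"
 and idl_mult_right: "idl J ==> x : J ==> x * a : J"
 using rmod.ops_sc[of J x a] by(auto simp: mult.commute)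

lemma smd_Vs: "smd (Vs B)"
 by(rule vmod.ops_rangeI) (auto simp: Vs_def)

lemma smd_JV: "idl J ==> smd (JV J)"
 by(rule vmod.ops_rangeI) (auto simp: JV_def ops_zero ops_add idl_mult)

definition rnoeth :: "'p::comm_ring_1 set => bool" where
 "rnoeth J \<longleftrightarrow> opnoeth (range (*)) UNIV J"

text \<open>One coordinate is added at a time: modulo the vectors on \<open>B\<close>, those on
  \<open>insert b B\<close> are an image of the ring itself.\<close>

lemma noeth_vectors:
 assumes J: "idl J" "rnoeth J" and "finite B"
 shows "opnoeth (range smul) (Vs B) (JV J :: ('x => 'p::comm_ring_1) set)"
 using assms(3)
proof (induction B rule: finite_induct)
 case empty
 have "E <= JV J" if "E <= Vs {} + JV J" for E :: "('x => 'p) set"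
 proof
  fix e assume "e : E"
  then obtain a b where "e = a + b" "a : Vs {}" "b : JV J" using \<open>E <= _\<close> by(meson set_plus_elim subsetD)
  thus "e : JV J" by(auto simp: Vs_def JV_def)
 qed
 thus ?case
  unfolding opnoeth_def using gen_inc[of "JV J" "range smul"] by(intro allI impI exI[of _ "{}"]) auto
next
 case (insert b B)
 show ?case
 proof (rule opnoeth_extension[OF _ smd_Vs smd_JV[OF J(1)] _ insert.IH])
  show "addm om" if "om : range (smul :: 'p => ('x => 'p) => _)" for om using that vmod.sc_addm by auto
  show "Vs B <= (Vs (insert b B) :: ('x => 'p) set)" by(auto simp: Vs_def)
  define f where "f a = (%x. if x = b then a else 0)" for a :: 'p
  have U': "smd (Vs B + JV J :: ('x => 'p) set)" by(intro vmod.ops_range_plus smd_Vs smd_JV J)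
  show "opnoeth (range smul) (Vs (insert b B)) (Vs B + JV J :: ('x => 'p) set)"
  proof (rule opnoeth_image[OF J(2)[unfolded rnoeth_def] ops_UNIV J(1) U', where f = f])
   show "addm f" by(auto simp: addm_def f_def fun_eq_iff)
   show "Vs (insert b B) <= range f + (Vs B + JV J)"
   proof
    fix v :: "'x => 'p" assume v: "v : Vs (insert b B)"
    have "v = f (v b) + (v(b := 0) + 0)" by(auto simp: f_def)
    moreover have "v(b := 0) : Vs B" using v by(auto simp: Vs_def)
    moreover have "0 : JV J" using ops_zero[OF smd_JV[OF J(1)]] .
    ultimately show "v : range f + (Vs B + JV J)" by(intro set_plusI[OF _ rangeI set_plus_intro])
   qed
   have "f a : JV J" if "a : J" for a using that ops_zero[OF J(1)] by(auto simp: f_def JV_def)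
   thus "f ` J <= Vs B + JV J" using plus_ge2[OF ops_zero[OF smd_Vs[of B]], of "JV J"] by auto
   show "addm om & (EX om':range smul. ALL x. f (om x) = om' (f x))" if w: "om : range ((*) :: 'p => _)" for om
   proof -
    obtain a where a: "om = (*) a" using w by(rule rangeE)
    have "f (om x) = a *s f x" for x by(simp add: a f_def fun_eq_iff)
    thus ?thesis using a rmod.sc_addm by auto
   qed
   show "addm om" if "om : range (smul :: 'p => ('x => 'p) => _)" for om using that vmod.sc_addm by auto
  qed
 qed
qed

section \<open>Artin--Rees for bigraded families\<close>

text \<open>For multiplications by generators of an ideal I and a submodule \<open>E\<close> this is
  I \<open>E\<close>, since scalar coefficients can be absorbed in the \<open>y k\<close>. For the
  cohomology operators it is the part of the next degree generated by \<open>E\<close>.\<close>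

definition lsum :: "('i => 'v => 'w::ab_group_add) => 'i set => 'v set => 'w set" where
 "lsum ta K E = {SUM k:K. ta k (y k) | y. ALL k:K. y k : E}"

lemma lsumI: "(!!k. k : K ==> y k : E) ==> (SUM k:K. ta k (y k)) : lsum ta K E"
 by(auto simp: lsum_def)

lemma lsumE:
 assumes "x : lsum ta K E" obtains y where "x = (SUM k:K. ta k (y k))" "ALL k:K. y k : E"
 using assms by(auto simp: lsum_def)

lemma lsum_mono: "E <= F ==> lsum ta K E <= lsum ta K F"
 by(auto simp: lsum_def)

lemma lsum_least: "ops Om F ==> (!!k x. k : K ==> x : E ==> ta k x : F) ==> lsum ta K E <= F"
 by(auto elim!: lsumE intro!: ops_sum)

lemma lsum_single:
 assumes "finite K" "k : K" "x : E" "0 : E" "!!k. k : K ==> addm (ta k)"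
 shows "ta k x : lsum ta K E"
proof -
 have "(SUM j:K. ta j (if j = k then x else 0)) = (SUM j:K. if j = k then ta k x else 0)"
  using assms(5) by(intro sum.cong) (auto simp: addm_zero)
 also have "... = ta k x" using assms by simp
 finally show ?thesis using lsumI[of K "%j. if j = k then x else 0" E ta] assms by auto
qed

lemma lsum_map:
 assumes "x : lsum ta K E" "addm g" "!!k y. k : K ==> g (ta k y) = ta' k (h y)" "!!y. y : E ==> h y : E'"
 shows "g x : lsum ta' K E'"
proof -
 obtain y where y: "x = (SUM k:K. ta k (y k))" "ALL k:K. y k : E" using assms(1) by(rule lsumE)
 have "g x = (SUM k:K. ta' k (h (y k)))" using y assms by(simp add: addm_sum)
 thus ?thesis using lsumI[of K "%k. h (y k)" E' ta'] y assms by auto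
qed

lemma lsum_plus:
 assumes "!!k. k : K ==> addm (ta k)"
 shows "lsum ta K (E + F) <= lsum ta K E + lsum ta K F"
proof
 fix x assume "x : lsum ta K (E + F)"
 then obtain y where y: "x = (SUM k:K. ta k (y k))" "ALL k:K. y k : E + F" by(rule lsumE)
 have "ALL k. EX e f. k : K --> e : E & f : F & y k = e + f" using y(2) by(meson set_plus_elim)
 then obtain e f where ef: "!!k. k : K ==> e k : E & f k : F & y k = e k + f k" by metis
 have "x = (SUM k:K. ta k (e k)) + (SUM k:K. ta k (f k))"
  unfolding y(1) sum.distrib[symmetric] using ef assms by(intro sum.cong) (auto simp: addmD)
 thus "x : lsum ta K E + lsum ta K F" by(rule set_plusI) (use ef in \<open>auto intro!: lsumI\<close>)
qed

lemma lsum_swap: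
 assumes "finite K" "finite L" "0 : E" "!!k. k : K ==> addm (ta k)" "!!l. l : L ==> addm (sg l)"
  "!!k l x. k : K ==> l : L ==> ta k (sg l x) = sg l (ta k x)"
 shows "lsum ta K (lsum sg L E) <= lsum sg L (lsum ta K E)"
proof
 fix x assume "x : lsum ta K (lsum sg L E)"
 then obtain y where y: "x = (SUM k:K. ta k (y k))" "ALL k:K. y k : lsum sg L E" by(rule lsumE)
 have "ALL k. EX z. k : K --> y k = (SUM l:L. sg l (z l)) & (ALL l:L. z l : E)"
 proof
  fix k show "EX z. k : K --> y k = (SUM l:L. sg l (z l)) & (ALL l:L. z l : E)"
   using y(2) unfolding lsum_def by blast
 qed
 then obtain z where z: "!!k. k : K ==> y k = (SUM l:L. sg l (z k l)) & (ALL l:L. z k l : E)" by metis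
 have "x = (SUM k:K. SUM l:L. sg l (ta k (z k l)))"
  using y(1) z assms by(simp add: addm_sum)
 also have "... = (SUM l:L. SUM k:K. sg l (ta k (z k l)))" by(rule sum.swap)
 also have "... = (SUM l:L. sg l (SUM k:K. ta k (z k l)))" using assms(5) by(simp add: addm_sum)
 finally show "x : lsum sg L (lsum ta K E)"
  using z by(auto intro!: lsumI)
qed

text \<open>The \<open>al l\<close> stand for generators of the ideal I and the \<open>tt j\<close>
  for the cohomology operators. The module is a whole type; gradings are imposed afterwards by
  families of subgroups.\<close>

locale tmod = smod sc for sc :: "'p::comm_ring_1 => 'v::ab_group_add => 'v" +
 fixes tt :: "nat => 'v => 'v" and c :: nat and al :: "nat => 'p" and m :: nat
 assumes tt_addm: "j < c ==> addm (tt j)"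
  and tt_sc: "j < c ==> tt j (sc a x) = sc a (tt j x)"
  and tt_comm: "i < c ==> j < c ==> tt i (tt j x) = tt j (tt i x)"
begin

abbreviation imul :: "'v set => 'v set" where
 "imul \<equiv> lsum (%l. sc (al l)) {..<m}"

abbreviation tsum :: "'v set => 'v set" where
 "tsum \<equiv> lsum tt {..<c}"

abbreviation IP :: "nat => 'v set => 'v set" where
 "IP n \<equiv> imul ^^ n"

abbreviation osub :: "'v set => bool" where
 "osub \<equiv> ops (range sc)"

lemma osub_lsum:
 assumes "osub E" "!!k. k : K ==> addm (ta k)" "!!k a x. k : K ==> ta k (sc a x) = sc a (ta k x)"
 shows "osub (lsum ta K E)"
proof (rule ops_rangeI)
 show "0 : lsum ta K E"
  using lsumI[of K "%_. 0" E ta] ops_zero[OF assms(1)] assms(2) by(simp add: addm_zero)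
 show "sc a x : lsum ta K E" if "x : lsum ta K E" for a x
  by(rule lsum_map[OF that sc_addm, where h = "sc a"]) (use assms in \<open>auto intro: ops_sc\<close>)
 fix x y assume "x : lsum ta K E" "y : lsum ta K E"
 then obtain u v where "x = (SUM k:K. ta k (u k))" "ALL k:K. u k : E"
  "y = (SUM k:K. ta k (v k))" "ALL k:K. v k : E" by(auto elim!: lsumE)
 hence "x + y = (SUM k:K. ta k (u k + v k))" "!!k. k : K ==> u k + v k : E"
  using assms(1,2) by(auto simp: addmD sum.distrib intro: ops_add)
 thus "x + y : lsum ta K E" by(auto simp: lsum_def)
qed

lemma osub_imul: "osub E ==> osub (imul E)"
 by(rule osub_lsum) (auto simp: sc_addm sc_commute)

lemma osub_IP: "osub E ==> osub (IP n E)"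
 by(induction n) (auto intro: osub_imul)

lemma osub_tsum: "osub E ==> osub (tsum E)"
 by(rule osub_lsum) (auto simp: tt_addm tt_sc)

lemma IP_mono: "E <= F ==> IP n E <= IP n F"
 by(induction n) (auto intro: lsum_mono[THEN subsetD])

lemma IP_subset: "osub E ==> IP n E <= E"
proof (induction n)
 case (Suc n)
 hence "imul (IP n E) <= imul E" by(intro lsum_mono) auto
 also have "imul E <= E" using Suc.prems by(intro lsum_least) (auto intro: ops_sc)
 finally show ?case by simp
qed auto

lemma IP_decr: "osub E ==> n <= k ==> IP k E <= IP n E"
proof -
 assume "osub E" "n <= k"
 have "IP k E = IP (k - n) (IP n E)"
  using \<open>n <= k\<close> by(metis comp_apply funpow_add le_add_diff_inverse2)
 thus ?thesis using IP_subset[OF osub_IP[OF \<open>osub E\<close>]] by simp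
qed

lemma IP_map:
 assumes "addm g" "!!a x. g (sc a x) = sc a (g x)" "!!x. x : E ==> g x : F" "x : IP n E"
 shows "g x : IP n F"
 using assms(4)
proof (induction n arbitrary: x)
 case (Suc n)
 hence "x : imul (IP n E)" by simp
 hence "g x : imul (IP n F)" by(rule lsum_map[where h = g]) (use assms Suc.IH in auto)
 thus ?case by simp
qed (use assms in auto)

lemma tt_IP: "j < c ==> (!!x. x : E ==> tt j x : F) ==> x : IP n E ==> tt j x : IP n F"
 by(rule IP_map[of "tt j" E F]) (auto simp: tt_addm tt_sc)

lemma sc_imul: "l < m ==> osub E ==> x : E ==> sc (al l) x : imul E"
 by(rule lsum_single[of _ l x E "%l. sc (al l)"]) (auto simp: sc_addm ops_zero)

lemma tt_tsum: "j < c ==> osub E ==> x : E ==> tt j x : tsum E"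
 by(rule lsum_single[of _ j x E tt]) (auto simp: tt_addm ops_zero)

text \<open>A function on \<open>nat * nat\<close> is an element of a bigraded module.
  \<open>TT\<close> raises the second index, the cohomological degree. \<open>AA\<close> multiplies
  by a generator of I and raises the first index, which is the action of the Rees algebra.\<close>

definition SC :: "'p => (nat * nat => 'v) => nat * nat => 'v" where
 "SC a f = (%q. sc a (f q))"

definition TT :: "nat => (nat * nat => 'v) => nat * nat => 'v" where
 "TT j f = (%(n, i). case i of 0 => 0 | Suc i' => tt j (f (n, i')))"

definition AA :: "nat => (nat * nat => 'v) => nat * nat => 'v" where
 "AA l f = (%(n, i). case n of 0 => 0 | Suc n' => sc (al l) (f (n', i)))"

definition OPS where
 "OPS = range SC Un (TT ` {..<c} Un AA ` {..<m})"

definition pt :: "nat => nat => 'v => nat * nat => 'v" where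
 "pt n i x = (%q. if q = (n, i) then x else 0)"

lemma pt_addm: "addm (pt n i)"
 by(simp add: addm_def pt_def fun_eq_iff)

lemma OPS_cases:
 assumes "om : OPS"
 obtains a where "om = SC a" | j where "j < c" "om = TT j" | l where "l < m" "om = AA l"
 using assms by(auto simp: OPS_def)

lemma ops_SC: "ops OPS E ==> f : E ==> SC a f : E"
 and ops_TT: "ops OPS E ==> j < c ==> f : E ==> TT j f : E"
 and ops_AA: "ops OPS E ==> l < m ==> f : E ==> AA l f : E"
 by(auto simp: ops_def OPS_def)

lemma hat_apply [simp]: "SC a f q = sc a (f q)"
 "TT j f (n, 0) = 0" "TT j f (n, Suc i) = tt j (f (n, i))"
 "AA l f (0, i) = 0" "AA l f (Suc n, i) = sc (al l) (f (n, i))"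
 by(simp_all add: SC_def TT_def AA_def)

lemma SC_addm: "addm (SC a)"
 by(simp add: addm_def fun_eq_iff sc_add)

lemma TT_addm: "j < c ==> addm (TT j)"
 unfolding addm_def
 by(intro allI ext) (auto simp: TT_def addmD[OF tt_addm] split: nat.split)

lemma AA_addm: "addm (AA l)"
 unfolding addm_def by(intro allI ext) (auto simp: AA_def sc_add split: nat.split)

lemma OPS_addm: "om : OPS ==> addm om"
 by(erule OPS_cases) (auto simp: SC_addm TT_addm AA_addm)

lemma SC_comm: "om : OPS ==> SC a (om f) = om (SC a f)"
 by(erule OPS_cases) (auto simp: fun_eq_iff SC_def TT_def AA_def tt_sc sc_commute split: nat.split)

lemma TT_comm: "j < c ==> om : OPS ==> TT j (om f) = om (TT j f)"
 by(erule OPS_cases) (auto simp: fun_eq_iff SC_def TT_def AA_def tt_sc sc_commute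
   tt_comm addm_zero[OF tt_addm] split: nat.split)

lemma AA_comm: "om : OPS ==> AA l (om f) = om (AA l f)"
 by(erule OPS_cases) (auto simp: fun_eq_iff SC_def TT_def AA_def tt_sc sc_commute
   addm_zero[OF tt_addm] split: nat.split)

lemma OPS_opsubI:
 assumes "0 : E" "!!f g. f : E ==> g : E ==> f - g : E" "!!a f. f : E ==> SC a f : E"
  "!!j f. j < c ==> f : E ==> TT j f : E" "!!l f. l < m ==> f : E ==> AA l f : E"
 shows "ops OPS E"
 using assms unfolding ops_def OPS_def by blast

lemma OPS_opsub_family:
 assumes "!!n i. osub (U n i)"
  and "!!n i j x. j < c ==> x : U n i ==> tt j x : U n (Suc i)"
  and "!!n i l x. l < m ==> x : U n i ==> sc (al l) x : U (Suc n) i"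
 shows "ops OPS {f. ALL n i. f (n, i) : U n i}"
proof (rule OPS_opsubI)
 fix j f assume j: "j < c" "f : {f. ALL n i. f (n, i) : U n i}"
 have "TT j f (n, i) : U n i" for n i using j assms(2) ops_zero[OF assms(1)] by(cases i) auto
 thus "TT j f : {f. ALL n i. f (n, i) : U n i}" by auto
next
 fix l f assume l: "l < m" "f : {f. ALL n i. f (n, i) : U n i}"
 have "AA l f (n, i) : U n i" for n i using l assms(3) ops_zero[OF assms(1)] by(cases n) auto
 thus "AA l f : {f. ALL n i. f (n, i) : U n i}" by auto
qed (use ops_zero[OF assms(1)] ops_diff[OF assms(1)] ops_sc[OF assms(1)] in auto)

text \<open>The module generated by \<open>L 0\<close> in bidegree (0, 0) is finitely generated over
  a polynomial ring in \<open>c + m\<close> variables, so \<open>opnoeth_finite_ops\<close> applies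
  as soon as the relations \<open>U\<close> are stable under all the operators.\<close>

lemma rees_noeth:
 assumes L: "osub (L 0)" and U: "!!n i. osub (U n i)"
  "!!n i j x. j < c ==> x : U n i ==> tt j x : U n (Suc i)"
  "!!n i l x. l < m ==> x : U n i ==> sc (al l) x : U (Suc n) i"
  and noeth: "opnoeth (range sc) (L 0) (U 0 0)"
 shows "opnoeth OPS (gen OPS (pt 0 0 ` L 0)) {f. ALL n i. f (n, i) : U n i}"
 unfolding OPS_def
proof (rule opnoeth_finite_ops)
 show "finite (TT ` {..<c} Un AA ` {..<m})" by auto
 show "addm om" if "om : range SC Un (TT ` {..<c} Un AA ` {..<m})" for om
  using that OPS_addm by(simp add: OPS_def)
 show "te (om x) = om (te x)"
  if "te : TT ` {..<c} Un AA ` {..<m}" "om : range SC Un (TT ` {..<c} Un AA ` {..<m})" for te om x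
  using that TT_comm AA_comm by(auto simp flip: OPS_def)
 have SCat: "SC a (pt 0 0 x) = pt 0 0 (sc a x)" for a x by(auto simp: pt_def fun_eq_iff)
 show "ops (range SC) (pt 0 0 ` L 0)" using SCat by(intro ops_image[OF L pt_addm]) auto
 have sub: "ops OPS {f. ALL n i. f (n, i) : U n i}" by(rule OPS_opsub_family[of U, OF U])
 thus "ops (range SC Un (TT ` {..<c} Un AA ` {..<m})) {f. ALL n i. f (n, i) : U n i}"
  by(simp add: OPS_def)
 show "opnoeth (range SC) (pt 0 0 ` L 0) {f. ALL n i. f (n, i) : U n i}"
 proof (rule opnoeth_image[OF noeth L U(1) _ pt_addm])
  show sub': "ops (range SC) {f. ALL n i. f (n, i) : U n i}"
   using sub by(rule ops_mono) (auto simp: OPS_def)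
  show "pt 0 0 ` L 0 <= pt 0 0 ` L 0 + {f. ALL n i. f (n, i) : U n i}"
   by(rule plus_ge1[OF ops_zero[OF sub']])
  show "pt 0 0 ` U 0 0 <= {f. ALL n i. f (n, i) : U n i}"
   using ops_zero[OF U(1)] by(auto simp: pt_def)
  show "addm om & (EX om':range SC. ALL x. pt 0 0 (om x) = om' (pt 0 0 x))" if "om : range sc" for om
   using that SCat sc_addm by(auto simp: image_iff)
 qed (auto simp: SC_addm)
qed

text \<open>This is where the equality \<open>L (Suc i) = tsum (L i)\<close> enters: it makes every
  homogeneous element of I^n \<open>L i\<close> reachable from bidegree (0, 0).\<close>

lemma pt_gen:
 assumes L: "!!i. osub (L i)" "!!i. L (Suc i) = tsum (L i)" and x: "x : IP n (L i)"
 shows "pt n i x : gen OPS (pt 0 0 ` L 0)"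
proof -
 let ?T = "gen OPS (pt 0 0 ` L 0)"
 have T: "ops OPS ?T" by(rule ops_gen)
 have L0: "pt 0 i x : ?T" if "x : L i" for i x
  using that
 proof (induction i arbitrary: x)
  case 0 thus ?case using gen_inc[of "pt 0 0 ` L 0" OPS] by auto
 next
  case (Suc i)
  from Suc.prems obtain y where y: "x = (SUM j<c. tt j (y j))" "ALL j:{..<c}. y j : L i"
   unfolding L(2) by(rule lsumE)
  have "TT j (pt 0 i z) = pt 0 (Suc i) (tt j z)" if "j < c" for j z
   using that by(auto simp: fun_eq_iff pt_def TT_def addm_zero[OF tt_addm] split: nat.split)
  hence "pt 0 (Suc i) x = (SUM j<c. TT j (pt 0 i (y j)))"
   using y(1) by(simp add: addm_sum[OF pt_addm])
  moreover have "(SUM j<c. TT j (pt 0 i (y j))) : ?T"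
   using Suc.IH y(2) by(auto intro!: ops_sum[OF T] ops_TT[OF T] ops_AA[OF T])
  ultimately show ?case by simp
 qed
 show ?thesis using x
 proof (induction n arbitrary: x)
  case 0 thus ?case using L0 by simp
 next
  case (Suc n)
  hence "x : imul (IP n (L i))" by simp
  then obtain y where y: "x = (SUM l<m. sc (al l) (y l))" "ALL l:{..<m}. y l : IP n (L i)"
   by(rule lsumE)
  have "AA l (pt n i z) = pt (Suc n) i (sc (al l) z)" for l z
   by(auto simp: fun_eq_iff pt_def AA_def split: nat.split)
  hence "pt (Suc n) i x = (SUM l<m. AA l (pt n i (y l)))"
   using y(1) by(simp add: addm_sum[OF pt_addm])
  moreover have "(SUM l<m. AA l (pt n i (y l))) : ?T"
   using Suc.IH y(2) by(auto intro!: ops_sum[OF T] ops_TT[OF T] ops_AA[OF T])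
  ultimately show ?case by simp
 qed
qed

text \<open>The \<open>E n i\<close> form a submodule of a finitely generated bigraded module. Its
  generators occupy finitely many bidegrees, so beyond a bound every homogeneous element comes from
  the previous bidegree. In the direction of \<open>n\<close> this is Artin-Rees, in the direction
  of \<open>i\<close> finite generation over the operators; each bound is uniform in the other
  index.\<close>

theorem artin_rees:
 assumes L: "!!i. osub (L i)" "!!i. L (Suc i) = tsum (L i)"
  and U: "!!n i. osub (U n i)"
  "!!n i j x. j < c ==> x : U n i ==> tt j x : U n (Suc i)"
  "!!n i l x. l < m ==> x : U n i ==> sc (al l) x : U (Suc n) i"
  and E: "!!n i. osub (E n i)"
  "!!n i j x. j < c ==> x : E n i ==> tt j x : E n (Suc i)"
  "!!n i l x. l < m ==> x : E n i ==> sc (al l) x : E (Suc n) i"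
  and UE: "!!n i. U n i <= E n i" "!!n i. E n i <= IP n (L i) + U n i"
  and noeth: "opnoeth (range sc) (L 0) (U 0 0)"
 shows "EX N. (ALL n>=N. ALL i. E (Suc n) i <= imul (E n i) + U (Suc n) i) &
  (ALL i>=N. ALL n. E n (Suc i) <= tsum (E n i) + U n (Suc i))"
proof -
 let ?T = "gen OPS (pt 0 0 ` L 0)"
 define Uh where "Uh = {f. ALL n i. f (n, i) : U n i}"
 define Eh' where "Eh' = {f. ALL n i. f (n, i) : E n i}"
 \<comment> \<open>Allowing only finitely many entries outside \<open>U\<close> makes each element a
   finite sum of homogeneous ones modulo \<open>Uh\<close>, hence an element of
   \<open>?T + Uh\<close>.\<close>
 define Eh where "Eh = {f : Eh'. finite {(n, i). f (n, i) ~: U n i}}"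
 have Uh: "ops OPS Uh" unfolding Uh_def by(rule OPS_opsub_family[of U, OF U])
 have Eh': "ops OPS Eh'" unfolding Eh'_def by(rule OPS_opsub_family[of E, OF E])
 have fin: "finite {(n, i). f (n, i) ~: U n i}" if "f : Eh" for f using that by(simp add: Eh_def)
 have T: "ops OPS ?T" by(rule ops_gen)
 have Eh: "ops OPS Eh"
 proof (rule OPS_opsubI)
  show "0 : Eh" using ops_zero[OF Eh'] ops_zero[OF U(1)] by(auto simp: Eh_def)
  show "f - g : Eh" if "f : Eh" "g : Eh" for f g
  proof -
   have "{(n, i). (f - g) (n, i) ~: U n i} <= {(n, i). f (n, i) ~: U n i} Un {(n, i). g (n, i) ~: U n i}"
    using ops_diff[OF U(1)] by auto
   thus ?thesis
    using that ops_diff[OF Eh'] fin[OF that(1)] fin[OF that(2)] by(auto simp: Eh_def intro: finite_subset)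
  qed
  show "SC a f : Eh" if "f : Eh" for a f
  proof -
   have "{(n, i). SC a f (n, i) ~: U n i} <= {(n, i). f (n, i) ~: U n i}"
    using ops_sc[OF U(1)] by auto
   moreover have "SC a f : Eh'" using that by(auto simp: Eh_def intro: ops_SC[OF Eh'] ops_TT[OF Eh'] ops_AA[OF Eh'])
   ultimately show ?thesis using fin[OF that] by(auto simp: Eh_def intro: finite_subset)
  qed
  show "TT j f : Eh" if "j < c" "f : Eh" for j f
  proof -
   have "{(n, i). TT j f (n, i) ~: U n i} <= (%(n, i). (n, Suc i)) ` {(n, i). f (n, i) ~: U n i}"
   proof clarify
    fix n i assume *: "TT j f (n, i) ~: U n i"
    then obtain i' where i: "i = Suc i'" using ops_zero[OF U(1)] by(cases i) auto
    hence "f (n, i') ~: U n i'" using * U(2)[OF that(1)] by auto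
    thus "(n, i) : (%(n, i). (n, Suc i)) ` {(n, i). f (n, i) ~: U n i}"
     using i by(intro image_eqI[of _ _ "(n, i')"]) auto
   qed
   moreover have "TT j f : Eh'" using that by(auto simp: Eh_def intro: ops_SC[OF Eh'] ops_TT[OF Eh'] ops_AA[OF Eh'])
   ultimately show ?thesis using fin[OF that(2)] by(auto simp: Eh_def intro: finite_subset)
  qed
  show "AA l f : Eh" if "l < m" "f : Eh" for l f
  proof -
   have "{(n, i). AA l f (n, i) ~: U n i} <= (%(n, i). (Suc n, i)) ` {(n, i). f (n, i) ~: U n i}"
   proof clarify
    fix n i assume *: "AA l f (n, i) ~: U n i"
    then obtain n' where n: "n = Suc n'" using ops_zero[OF U(1)] by(cases n) auto
    hence "f (n', i) ~: U n' i" using * U(3)[OF that(1)] by auto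
    thus "(n, i) : (%(n, i). (Suc n, i)) ` {(n, i). f (n, i) ~: U n i}"
     using n by(intro image_eqI[of _ _ "(n', i)"]) auto
   qed
   moreover have "AA l f : Eh'" using that by(auto simp: Eh_def intro: ops_SC[OF Eh'] ops_TT[OF Eh'] ops_AA[OF Eh'])
   ultimately show ?thesis using fin[OF that(2)] by(auto simp: Eh_def intro: finite_subset)
  qed
 qed
 have UhEh: "Uh <= Eh" using subsetD[OF UE(1)] by(auto simp: Uh_def Eh_def Eh'_def)
 have TUh: "ops OPS (?T + Uh)" by(rule ops_plus[OF OPS_addm T Uh])
 have atTU: "pt n i x : ?T + Uh" if x: "x : E n i" for n i x
 proof -
  have "x : IP n (L i) + U n i" using UE(2) x by auto
  then obtain y u where yu: "x = y + u" "y : IP n (L i)" "u : U n i" by(rule set_plus_elim)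
  have "pt n i u : Uh" using yu(3) ops_zero[OF U(1)] by(auto simp: Uh_def pt_def)
  moreover have "pt n i x = pt n i y + pt n i u" by(auto simp: pt_def fun_eq_iff yu(1))
  ultimately show ?thesis using pt_gen[of L, OF L yu(2)] by(intro set_plusI)
 qed
 have EhTU: "Eh <= ?T + Uh"
 proof
  fix f assume f: "f : Eh"
  let ?S = "{(n, i). f (n, i) ~: U n i}"
  have "f - (SUM q:?S. pt (fst q) (snd q) (f q)) : Uh"
  proof -
   have "(SUM q:?S. pt (fst q) (snd q) (f q)) (n, i) = (if (n, i) : ?S then f (n, i) else 0)" for n i
   proof -
    have "(SUM q:?S. pt (fst q) (snd q) (f q)) (n, i) = (SUM q:?S. if q = (n, i) then f q else 0)"
     unfolding sum_fun_apply by(rule sum.cong) (auto simp: pt_def)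
    thus ?thesis using fin[OF f] by simp
   qed
   thus ?thesis using ops_zero[OF U(1)] by(auto simp: Uh_def)
  qed
  moreover have "(SUM q:?S. pt (fst q) (snd q) (f q)) : ?T + Uh"
   using f by(intro ops_sum[OF TUh] atTU) (auto simp: Eh_def Eh'_def)
  moreover have "Uh <= ?T + Uh" by(rule plus_ge2[OF ops_zero[OF T]])
  ultimately show "f : ?T + Uh" using ops_cong[OF TUh] by blast
 qed
 have "opnoeth OPS ?T Uh" unfolding Uh_def by(rule rees_noeth[of L U, OF L(1) U noeth])
 from opnoethD[OF this Eh UhEh EhTU]
 obtain F where F: "finite F" "F <= Eh" "Eh <= gen OPS (F Un Uh)" by auto
 let ?S = "\<Union>f\<in>F. {(n, i). f (n, i) ~: U n i}"
 have "finite ?S" using F fin by blast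
 hence "finite (fst ` ?S Un snd ` ?S)" by auto
 then obtain N where N: "ALL k:fst ` ?S Un snd ` ?S. k < N"
  using finite_nat_set_iff_bounded by auto
 have FU: "f (n, i) : U n i" if "f : F" "n >= N | i >= N" for f n i
 proof (rule ccontr)
  assume "f (n, i) ~: U n i"
  hence "(n, i) : ?S" using that(1) by auto
  from imageI[OF this, of fst] imageI[OF this, of snd] have "n < N & i < N"
   using N by(simp only: fst_conv snd_conv) blast
  thus False using that(2) by auto
 qed
 have atEh: "pt n i x : Eh" if "x : E n i" for n i x
 proof -
  have "{(n', i'). pt n i x (n', i') ~: U n' i'} <= {(n, i)}"
   using ops_zero[OF U(1)] by(auto simp: pt_def split: if_splits)
  hence "finite {(n', i'). pt n i x (n', i') ~: U n' i'}" by(rule finite_subset) simp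
  moreover have "pt n i x : Eh'" using that ops_zero[OF E(1)] by(auto simp: Eh'_def pt_def)
  ultimately show ?thesis by(simp add: Eh_def)
 qed
 have iU: "osub (imul (E n i) + U (Suc n) i)" for n i
  by(intro ops_range_plus osub_imul E U)
 have tU: "osub (tsum (E n i) + U n (Suc i))" for n i
  by(intro ops_range_plus osub_tsum E U)
 have iU2: "U (Suc n) i <= imul (E n i) + U (Suc n) i" for n i
  by(rule plus_ge2[OF ops_zero[OF osub_imul[OF E(1)]]])
 have tU2: "U n (Suc i) <= tsum (E n i) + U n (Suc i)" for n i
  by(rule plus_ge2[OF ops_zero[OF osub_tsum[OF E(1)]]])
 have iE: "imul (E n i) <= imul (E n i) + U (Suc n) i" for n i
  by(rule plus_ge1[OF ops_zero[OF U(1)]])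
 have tE: "tsum (E n i) <= tsum (E n i) + U n (Suc i)" for n i
  by(rule plus_ge1[OF ops_zero[OF U(1)]])
 \<comment> \<open>\<open>H1\<close> and \<open>H2\<close> describe the families whose entries
   beyond \<open>N\<close> come from the previous index. They contain the generators, whose entries
   beyond \<open>N\<close> lie in \<open>U\<close>, and are stable under the operators, so they
   contain \<open>Eh\<close>.\<close>
 define H1 where "H1 = Eh' Int {f. ALL n>=N. ALL i. f (Suc n, i) : imul (E n i) + U (Suc n) i}"
 define H2 where "H2 = Eh' Int {f. ALL i>=N. ALL n. f (n, Suc i) : tsum (E n i) + U n (Suc i)}"
 have H1: "ops OPS H1"
 proof (rule OPS_opsubI)
  fix j f assume j: "j < c" "f : H1"
  have "tt j x : imul (E n (Suc i)) + U (Suc n) (Suc i)" if x: "x : imul (E n i) + U (Suc n) i" for x n i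
  proof -
   obtain y u where yu: "x = y + u" "y : imul (E n i)" "u : U (Suc n) i" using x by(rule set_plus_elim)
   have "tt j y : imul (E n (Suc i))"
    by(rule lsum_map[OF yu(2) tt_addm[OF j(1)], where h = "tt j"]) (auto simp: tt_sc j E(2))
   thus ?thesis using U(2)[OF j(1) yu(3)] by(intro set_plusI) (auto simp: yu(1) addmD[OF tt_addm[OF j(1)]])
  qed
  hence "TT j f (Suc n, i) : imul (E n i) + U (Suc n) i" if "n >= N" for n i
   using that j(2) ops_zero[OF iU] by(cases i) (auto simp: H1_def)
  moreover have "TT j f : Eh'" using j by(auto simp: H1_def intro: ops_SC[OF Eh'] ops_TT[OF Eh'] ops_AA[OF Eh'])
  ultimately show "TT j f : H1" by(auto simp: H1_def)
 next
  fix l f assume l: "l < m" "f : H1"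
  have "AA l f (Suc n, i) : imul (E n i) + U (Suc n) i" for n i
   using l sc_imul[OF l(1) E(1), of "f (n, i)" n i] iE by(auto simp: H1_def Eh'_def)
  moreover have "AA l f : Eh'" using l by(auto simp: H1_def intro: ops_SC[OF Eh'] ops_TT[OF Eh'] ops_AA[OF Eh'])
  ultimately show "AA l f : H1" by(auto simp: H1_def)
 next
  fix a f assume f: "f : H1"
  have "SC a f : Eh'" using f by(auto simp: H1_def intro: ops_SC[OF Eh'] ops_TT[OF Eh'] ops_AA[OF Eh'])
  thus "SC a f : H1" using f ops_sc[OF iU] by(auto simp: H1_def)
 qed (use ops_zero[OF Eh'] ops_diff[OF Eh'] ops_zero[OF iU] ops_diff[OF iU] in \<open>auto simp: H1_def\<close>)
 have H2: "ops OPS H2"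
 proof (rule OPS_opsubI)
  fix l f assume l: "l < m" "f : H2"
  have "sc (al l) x : tsum (E (Suc n) i) + U (Suc n) (Suc i)" if x: "x : tsum (E n i) + U n (Suc i)" for x n i
  proof -
   obtain y u where yu: "x = y + u" "y : tsum (E n i)" "u : U n (Suc i)" using x by(rule set_plus_elim)
   have "sc (al l) y : tsum (E (Suc n) i)"
    by(rule lsum_map[OF yu(2) sc_addm, where h = "sc (al l)"]) (auto simp: tt_sc l E(3))
   thus ?thesis using U(3)[OF l(1) yu(3)] by(intro set_plusI) (auto simp: yu(1) sc_add)
  qed
  hence "AA l f (n, Suc i) : tsum (E n i) + U n (Suc i)" if "i >= N" for n i
   using that l(2) ops_zero[OF tU] by(cases n) (auto simp: H2_def)
  moreover have "AA l f : Eh'" using l by(auto simp: H2_def intro: ops_SC[OF Eh'] ops_TT[OF Eh'] ops_AA[OF Eh'])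
  ultimately show "AA l f : H2" by(auto simp: H2_def)
 next
  fix j f assume j: "j < c" "f : H2"
  have "TT j f (n, Suc i) : tsum (E n i) + U n (Suc i)" for n i
   using j tt_tsum[OF j(1) E(1), of "f (n, i)" n i] tE by(auto simp: H2_def Eh'_def)
  moreover have "TT j f : Eh'" using j by(auto simp: H2_def intro: ops_SC[OF Eh'] ops_TT[OF Eh'] ops_AA[OF Eh'])
  ultimately show "TT j f : H2" by(auto simp: H2_def)
 next
  fix a f assume f: "f : H2"
  have "SC a f : Eh'" using f by(auto simp: H2_def intro: ops_SC[OF Eh'] ops_TT[OF Eh'] ops_AA[OF Eh'])
  thus "SC a f : H2" using f ops_sc[OF tU] by(auto simp: H2_def)
 qed (use ops_zero[OF Eh'] ops_diff[OF Eh'] ops_zero[OF tU] ops_diff[OF tU] in \<open>auto simp: H2_def\<close>)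
 have "F Un Uh <= H1" "F Un Uh <= H2"
  using F(2) FU iU2 tU2 UhEh by(auto simp: H1_def H2_def Eh_def Uh_def subset_iff)
 hence "gen OPS (F Un Uh) <= H1 Int H2" using H1 H2 by(simp add: gen_least)
 hence EH: "Eh <= H1 Int H2" using F(3) by blast
 have "E (Suc n) i <= imul (E n i) + U (Suc n) i" if "n >= N" for n i
 proof
  fix x assume "x : E (Suc n) i"
  hence "pt (Suc n) i x : H1" using atEh EH by blast
  hence "pt (Suc n) i x (Suc n, i) : imul (E n i) + U (Suc n) i" using that by(auto simp: H1_def)
  thus "x : imul (E n i) + U (Suc n) i" by(simp add: pt_def)
 qed
 moreover have "E n (Suc i) <= tsum (E n i) + U n (Suc i)" if "i >= N" for n i
 proof
  fix x assume "x : E n (Suc i)"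
  hence "pt n (Suc i) x : H2" using atEh EH by blast
  hence "pt n (Suc i) x (n, Suc i) : tsum (E n i) + U n (Suc i)" using that by(auto simp: H2_def)
  thus "x : tsum (E n i) + U n (Suc i)" by(simp add: pt_def)
 qed
 ultimately show ?thesis by blast
qed

end

section \<open>Associated primes\<close>

definition prm :: "'a::comm_ring_1 set => bool" where
 "prm p \<longleftrightarrow> idl p & 1 ~: p & (ALL a b. a * b : p --> a : p | b : p)"

lemma prmD: "prm p ==> idl p" "prm p ==> 1 ~: p" "prm p ==> a * b : p ==> a : p | b : p"
 by(auto simp: prm_def)

lemma prm_mult_iff: "prm p ==> a * b : p \<longleftrightarrow> a : p | b : p"
 by(auto simp: prm_def idl_mult idl_mult_right)

lemma prm_power: "prm p ==> a ^ n : p ==> a : p"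
 by(induction n) (auto simp: prm_mult_iff prmD(2))

lemma opnoeth_maximal:
 assumes noeth: "opnoeth Om T U" and "E0 : \<F>"
  and F: "!!E. E : \<F> ==> ops Om E & U <= E & E <= T + U"
 shows "EX M:\<F>. ALL E:\<F>. M <= E --> E = M"
proof (rule ccontr)
 assume "~ ?thesis"
 hence "ALL M. EX E. M : \<F> --> E : \<F> & M \<subset> E" by blast
 then obtain nxt where nxt: "!!M. M : \<F> ==> nxt M : \<F> & M \<subset> nxt M" by metis
 define E where "E k = (nxt ^^ k) E0" for k
 have E: "E k : \<F>" for k by(induction k) (use assms(2) nxt in \<open>auto simp: E_def\<close>)
 have lt: "E k \<subset> E (Suc k)" for k using nxt[OF E[of k]] by(simp add: E_def)
 have "EX k0. ALL k>=k0. E k = E k0"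
  by(rule opnoeth_chain[OF noeth]) (use F[OF E] psubset_imp_subset[OF lt] in auto)
 thus False using lt by(metis le_SucI order_refl psubset_eq)
qed

lemma opnoeth_mod_mono:
 assumes "opnoeth Om T U" "U <= U'" "ops Om T" "ops Om U" "ops Om U'" "!!om. om : Om ==> addm om"
 shows "opnoeth Om T U'"
proof (rule opnoeth_image[OF assms(1,3,4,5), where f = "%x. x"])
 show "T <= (%x. x) ` T + U'" using plus_ge1[OF ops_zero[OF assms(5)]] by simp
qed (use assms in \<open>auto simp: addm_def\<close>)

lemma (in smod) idl_annihilator:
 "ops (range sc) U ==> idl {a. sc a x : U}"
 by(rule rmod.ops_rangeI) (auto simp: ops_zero sc_plus ops_add simp flip: sc_sc intro: ops_sc)

text \<open>The submodule \<open>E\<close> below is maximal with finitely many associated primes. If it were proper,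
 adjoining an element \<open>x\<close> whose annihilator modulo \<open>E\<close> is maximal would only contribute that
 annihilator, because every element of the enlarged module outside \<open>E\<close> is annihilated by it.\<close>

lemma (in smod) finite_ass:
 assumes Om: "range sc <= Om" "!!om. om : Om ==> addm om" "!!om a x. om : Om ==> om (sc a x) = sc a (om x)"
  and T: "ops Om T" and U: "ops Om U" and noeth: "opnoeth Om T U"
  and J: "rnoeth J" "idl J" "!!a x. a : J ==> x : T ==> sc a x : U"
 shows "finite {p. prm p & (EX x:T. p = {a. sc a x : U})}"
proof -
 define Ass where "Ass E = {p. prm p & (EX x:E. p = {a. sc a x : U})}" for E
 have TU: "ops Om (T + U)" by(rule ops_plus[OF Om(2) T U])
 have UTU: "U <= T + U" by(rule plus_ge2[OF ops_zero[OF T]])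
 have sub: "ops (range sc) E" if "ops Om E" for E using that Om(1) by(rule ops_mono)
 define \<F> where "\<F> = {E. ops Om E & U <= E & E <= T + U & finite (Ass E)}"
 have "Ass U = {}"
 proof -
  have "{a. sc a x : U} = UNIV" if "x : U" for x using that ops_sc[OF sub[OF U]] by auto
  thus ?thesis by(auto simp: Ass_def prm_def)
 qed
 hence "U : \<F>" using U UTU by(auto simp: \<F>_def)
 have "EX M:\<F>. ALL E:\<F>. M <= E --> E = M"
  by(rule opnoeth_maximal[OF noeth \<open>U : \<F>\<close>]) (simp add: \<F>_def)
 then obtain E where E: "E : \<F>" and max: "!!E'. E' : \<F> ==> E <= E' ==> E' = E"
  by blast
 have E': "ops Om E" "U <= E" "E <= T + U" "finite (Ass E)" using E by(auto simp: \<F>_def)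
 note Esc = sub[OF E'(1)]
 have "E = T + U"
 proof (rule ccontr)
  assume "E \<noteq> T + U"
  then obtain x0 where x0: "x0 : T + U" "x0 ~: E" using E'(3) by blast
  define I where "I x = {a. sc a x : E}" for x
  have "EX M:I ` (T + U - E). ALL K:I ` (T + U - E). M <= K --> K = M"
  proof (rule opnoeth_maximal[OF J(1)[unfolded rnoeth_def]])
   show "I x0 : I ` (T + U - E)" using x0 by auto
   fix K assume "K : I ` (T + U - E)"
   then obtain x where x: "K = I x" "x : T + U" by auto
   have "idl K" unfolding x(1) I_def using Esc by(rule idl_annihilator)
   moreover have "J <= K"
   proof
    fix a assume a: "a : J"
    obtain t u where tu: "x = t + u" "t : T" "u : U" using x(2) by(rule set_plus_elim)
    have "sc a x : U" unfolding tu(1) sc_add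
     using J(3)[OF a tu(2)] ops_sc[OF sub[OF U] tu(3)] by(rule ops_add[OF U])
    thus "a : K" using E'(2) by(auto simp: x(1) I_def)
   qed
   moreover have "K <= UNIV + J" using plus_ge1[OF ops_zero[OF J(2)], of UNIV] by auto
   ultimately show "idl K & J <= K & K <= UNIV + J" by auto
  qed
  then obtain x where x: "x : T + U" "x ~: E"
   and xmax: "!!y. y : T + U ==> y ~: E ==> I x <= I y ==> I y = I x" by blast
  define E2 where "E2 = gen Om (insert x E)"
  have E2: "ops Om E2" "insert x E <= E2" unfolding E2_def by(rule ops_gen gen_inc)+
  have E2T: "E2 <= T + U" unfolding E2_def using x E' TU by(intro gen_least) auto
  have "E2 <= {y. ALL a:I x. sc a y : E}"
   unfolding E2_def
  proof (rule gen_least)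
   show "insert x E <= {y. ALL a:I x. sc a y : E}" using ops_sc[OF Esc] by(auto simp: I_def)
   show "ops Om {y. ALL a:I x. sc a y : E}"
    using E'(1) by(auto simp: ops_def sc_diff simp flip: Om(3))
  qed
  hence IE2: "I y = I x" if "y : E2" "y ~: E" for y
   using that E2T by(intro xmax) (auto simp: I_def)
  have "Ass E2 <= insert (I x) (Ass E)"
  proof
   fix p assume "p : Ass E2"
   then obtain y where p: "prm p" "y : E2" "p = {a. sc a y : U}" by(auto simp: Ass_def)
   show "p : insert (I x) (Ass E)"
   \<comment> \<open>If a multiple \<open>sc b y\<close> with \<open>b\<close> outside
     \<open>p\<close> falls into \<open>E\<close>, its annihilator is still \<open>p\<close>.
     Otherwise passing from \<open>U\<close> to \<open>E\<close> does not enlarge the annihilator of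
     \<open>y\<close>.\<close>
   proof (cases "EX b. b ~: p & sc b y : E")
    case True
    then obtain b where b: "b ~: p" "sc b y : E" by auto
    have "p = {a. sc a (sc b y) : U}"
    proof
     show "p <= {a. sc a (sc b y) : U}"
      using p(3) idl_mult_right[OF prmD(1)[OF p(1)]] by(auto simp: sc_sc)
     show "{a. sc a (sc b y) : U} <= p"
     proof
      fix a assume "a : {a. sc a (sc b y) : U}"
      hence "a * b : p" using p(3) by(auto simp: sc_sc)
      thus "a : p" using b prmD(3)[OF p(1)] by blast
     qed
    qed
    thus ?thesis using p(1) b by(auto simp: Ass_def)
   next
    case False
    hence "y ~: E" using prmD(2)[OF p(1)] sc_1[of y] by metis
    moreover have "p = I y" using False p(3) E'(2) by(auto simp: I_def)
    ultimately show ?thesis using IE2 p(2) by auto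
   qed
  qed
  hence "E2 : \<F>" using E2 E2T E' by(auto simp: \<F>_def intro: finite_subset)
  hence "E2 = E" using E2 by(intro max) auto
  thus False using E2 x by auto
 qed
 hence "T <= E" using plus_ge1[OF ops_zero[OF U]] by auto
 hence "{p. prm p & (EX x:T. p = {a. sc a x : U})} <= Ass E" by(auto simp: Ass_def)
 thus ?thesis using E'(4) finite_subset by auto
qed

section \<open>Artin-Rees for finitely many linear maps at once\<close>

context tmod begin

lemma tsum_least: "osub F ==> (!!j x. j < c ==> x : E ==> tt j x : F) ==> tsum E <= F"
 by(rule lsum_least) auto

lemma imul_least: "osub F ==> (!!l x. l < m ==> x : E ==> sc (al l) x : F) ==> imul E <= F"
 by(rule lsum_least) auto

lemma imul_osub: "osub E ==> imul E <= E"
 by(rule imul_least) (auto intro: ops_sc)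

text \<open>Families indexed by \<open>nat\<close> form the product module in which several
  conditions are collected into one.\<close>

definition sc2 :: "'p => (nat => 'v) => nat => 'v" where "sc2 a w = (%s. sc a (w s))"
definition tt2 :: "nat => (nat => 'v) => nat => 'v" where "tt2 j w = (%s. tt j (w s))"

lemma sc2_apply [simp]: "sc2 a w s = sc a (w s)" and tt2_apply [simp]: "tt2 j w s = tt j (w s)"
 by(simp_all add: sc2_def tt2_def)

lemma tmod2: "tmod sc2 tt2 c"
 by unfold_locales
  (auto simp: fun_eq_iff sc_add sc_plus sc_sc sc_1 addm_def addmD[OF tt_addm] tt_sc tt_comm)

definition prod2 :: "nat set => (nat => 'v set) => (nat => 'v) set" where
 "prod2 S K = {w. ALL s. if s : S then w s : K s else w s = 0}"

lemma lsum_prod2: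
 assumes "x : prod2 S (%s. lsum ta K (E s))"
  and "!!k w s. ta2 k w s = ta k (w s)" "!!k. k : K ==> addm (ta k)"
 shows "x : lsum ta2 K (prod2 S E)"
proof -
 have "ALL s. EX y. s : S --> x s = (SUM k:K. ta k (y k)) & (ALL k:K. y k : E s)"
  using assms(1) by(auto simp: prod2_def lsum_def split: if_splits)
 then obtain y where y: "!!s. s : S ==> x s = (SUM k:K. ta k (y s k)) & (ALL k:K. y s k : E s)" by metis
 have "x = (SUM k:K. ta2 k (%s. if s : S then y s k else 0))"
 proof
  fix s
  show "x s = (SUM k:K. ta2 k (%s. if s : S then y s k else 0)) s"
   using y assms by(cases "s : S") (auto simp: sum_fun_apply prod2_def addm_zero)
 qed
 also have "... : lsum ta2 K (prod2 S E)" using y by(intro lsumI) (auto simp: prod2_def)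
 finally show ?thesis .
qed

lemma IP_prod2: "x : prod2 S (%s. IP n (E s)) ==> x : tmod.IP sc2 al m n (prod2 S E)"
proof (induction n arbitrary: x)
 case (Suc n)
 interpret P: tmod sc2 tt2 c al m by(rule tmod2)
 have "x : P.imul (prod2 S (%s. IP n (E s)))"
  using Suc.prems by(intro lsum_prod2[of x S "%l. sc (al l)"]) (auto simp: sc_addm)
 hence "x : P.imul (P.IP n (prod2 S E))" using lsum_mono[of "prod2 S (%s. IP n (E s))"] Suc.IH by blast
 thus ?case by(simp only: funpow.simps comp_apply)
qed auto

lemma osub_prod2: "(!!s. osub (E s)) ==> ops (range sc2) (prod2 S E)"
 by(auto simp: ops_def prod2_def)

lemma opnoeth_prod2:
 assumes E: "!!s. osub (E s)" and R: "!!s. osub (R s)"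
  and n: "!!s. s : S0 ==> opnoeth (range sc) (E s) (R s)" and S: "finite S" "S <= S0"
 shows "opnoeth (range sc2) (prod2 S E) {w. ALL s:S0. w s : R s}"
 using S
proof (induction S rule: finite_induct)
 case empty
 have "prod2 {} E = {0}" by(auto simp: prod2_def fun_eq_iff)
 hence *: "prod2 {} E + F = F" for F by simp
 show ?case
  unfolding opnoeth_def *
 proof (intro allI impI exI[of _ "{}"])
  fix E assume E: "ops (range sc2) E & {w. ALL s:S0. w s : R s} <= E & E <= {w. ALL s:S0. w s : R s}"
  hence "E <= gen (range sc2) {w. ALL s:S0. w s : R s}"
   using gen_inc[of "{w. ALL s:S0. w s : R s}" "range sc2"] by(meson order_trans)
  thus "finite {} & {} <= E & E <= gen (range sc2) ({} Un {w. ALL s:S0. w s : R s})" by simp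
 qed
next
 case (insert s0 S)
 interpret P: tmod sc2 tt2 c al m by(rule tmod2)
 let ?U = "{w. ALL s:S0. w s : R s}"
 have U: "ops (range sc2) ?U" using R by(auto simp: ops_def)
 show ?case
 proof (rule opnoeth_extension[OF _ osub_prod2[OF E] U _ insert.IH])
  show "prod2 S E <= prod2 (insert s0 S) E"
   using ops_zero[OF E] insert.hyps by(auto simp: prod2_def)
  define f where "f x = (%s. if s = s0 then x else 0 :: 'v)" for x
  have U': "ops (range sc2) (prod2 S E + ?U)" by(rule P.ops_range_plus[OF osub_prod2[OF E] U])
  show "opnoeth (range sc2) (prod2 (insert s0 S) E) (prod2 S E + ?U)"
  proof (rule opnoeth_image[OF n E R U', where f = f])
   show "s0 : S0" using insert.prems by auto
   show "prod2 (insert s0 S) E <= f ` E s0 + (prod2 S E + ?U)"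
   proof
    fix w assume w: "w : prod2 (insert s0 S) E"
    have "w = f (w s0) + (w(s0 := 0) + 0)" by(auto simp: f_def)
    moreover have "w(s0 := 0) : prod2 S E" "w s0 : E s0"
     using w insert.hyps by(auto simp: prod2_def split: if_splits)
    ultimately show "w : f ` E s0 + (prod2 S E + ?U)"
     using ops_zero[OF U] by(intro set_plusI[OF _ imageI set_plus_intro])
   qed
   have "f ` R s0 <= ?U" using ops_zero[OF R] by(auto simp: f_def)
   thus "f ` R s0 <= prod2 S E + ?U"
    by(rule order_trans[OF _ plus_ge2[OF ops_zero[OF osub_prod2[OF E]]]])
   show "addm f" by(auto simp: addm_def f_def fun_eq_iff)
   show "addm om & (EX om':range sc2. ALL x. f (om x) = om' (f x))" if w: "om : range sc" for om
   proof -
    obtain a where a: "om = sc a" using w by(rule rangeE)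
    have "f (om x) = sc2 a (f x)" for x by(simp add: a f_def fun_eq_iff)
    thus ?thesis using a sc_addm by auto
   qed
  qed (erule rangeE, simp only: P.sc_addm)
  show "addm om" if w: "om : range sc2" for om
   using w by(rule rangeE) (simp only: P.sc_addm)
  show "S <= S0" using insert.prems by auto
 qed
qed

text \<open>The maps \<open>g s\<close> are combined into one map \<open>G\<close> to a product, and
  \<open>artin_rees\<close> is applied to the image of \<open>Y\<close>. Pulling the result back
  costs the common kernel of the maps modulo \<open>R\<close>, which is the second summand.\<close>

lemma artin_rees_maps:
 fixes r :: nat
 assumes K: "!!s i. osub (K s i)" "!!s i. K s (Suc i) = tsum (K s i)"
  and R: "!!s i. osub (R s i)" "!!s i j x. j < c ==> x : R s i ==> tt j x : R s (Suc i)"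
  and noeth: "!!s. s <= r ==> opnoeth (range sc) (K s 0) (R s 0)"
  and L: "!!i. osub (L i)" "!!i j x. j < c ==> x : L i ==> tt j x : L (Suc i)"
  and g: "!!s. addm (g s)" "!!s a x. g s (sc a x) = sc a (g s x)" "!!s j x. j < c ==> g s (tt j x) = tt j (g s x)"
 defines "Y \<equiv> %n i. {z : L i. ALL s<=r. g s z : IP n (K s i) + R s i}"
 shows "EX N. ALL n>=N. ALL i. Y (Suc n) i <= imul (Y n i) + {z : L i. ALL s<=r. g s z : R s i}"
proof -
 interpret P: tmod sc2 tt2 c al m by(rule tmod2)
 define L2 where "L2 i = prod2 {..r} (%s. K s i)" for i
 define U2 where "U2 i = {w. ALL s:{..r}. w s : R s i}" for i
 define G where "G z = (%s. g s z)" for z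
 define E2 where "E2 n i = G ` Y n i + U2 i" for n i
 have IPR: "osub (IP n (K s i) + R s i)" for n s i by(intro ops_range_plus osub_IP K R)
 have G: "addm G" using g(1) by(auto simp: addm_def G_def fun_eq_iff)
 have Gsc: "G (sc a x) = sc2 a (G x)" for a x by(auto simp: G_def g)
 have Gtt: "G (tt j x) = tt2 j (G x)" if "j < c" for j x using that by(auto simp: G_def g)
 have Y: "osub (Y n i)" for n i
 proof -
  have "Y n i = L i Int (\<Inter>s\<in>{..r}. {z. g s z : IP n (K s i) + R s i})" by(auto simp: Y_def)
  moreover have "osub {z. g s z : IP n (K s i) + R s i}" for s
   by(rule ops_vimage[OF IPR g(1)]) (auto simp: g intro: ops_sc[OF IPR])
  ultimately show ?thesis by(auto intro!: ops_Int ops_Inter L)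
 qed
 have Ytt: "tt j x : Y n (Suc i)" if j: "j < c" and x: "x : Y n i" for j x n i
 proof -
  have "tt j y : IP n (K s (Suc i)) + R s (Suc i)" if y: "y : IP n (K s i) + R s i" for y s
  proof -
   obtain u v where uv: "y = u + v" "u : IP n (K s i)" "v : R s i" using y by(rule set_plus_elim)
   have "tt j u : IP n (K s (Suc i))"
    using uv(2) by(rule tt_IP[OF j, rotated]) (simp add: K(2) tt_tsum[OF j K(1)])
   thus ?thesis using R(2)[OF j uv(3)]
    by(intro set_plusI[of _ "tt j u" "tt j v"]) (auto simp: uv(1) addmD[OF tt_addm[OF j]])
  qed
  thus ?thesis using x j L(2) by(auto simp: Y_def g(3))
 qed
 have Ysc: "sc (al l) x : Y (Suc n) i" if l: "l < m" and x: "x : Y n i" for l x n i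
 proof -
  have "sc (al l) y : IP (Suc n) (K s i) + R s i" if y: "y : IP n (K s i) + R s i" for y s
  proof -
   obtain u v where uv: "y = u + v" "u : IP n (K s i)" "v : R s i" using y by(rule set_plus_elim)
   have "sc (al l) u : IP (Suc n) (K s i)" using sc_imul[OF l osub_IP[OF K(1)] uv(2)] by simp
   thus ?thesis using ops_sc[OF R(1) uv(3)]
    by(intro set_plusI[of _ "sc (al l) u" "sc (al l) v"]) (auto simp: uv(1) sc_add)
  qed
  thus ?thesis using x ops_sc[OF L(1)] by(auto simp: Y_def g(2))
 qed
 have U2: "P.osub (U2 i)" for i using R(1) by(auto simp: ops_def U2_def)
 have GY: "P.osub (G ` Y n i)" for n i
  by(rule ops_image[OF Y G]) (auto simp flip: Gsc)
 have GYE: "G y : E2 n i" if "y : Y n i" for y n i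
  using plus_ge1[OF ops_zero[OF U2]] that unfolding E2_def by blast
 have U2E: "U2 i <= E2 n i" for n i
  unfolding E2_def by(rule plus_ge2[OF ops_zero[OF GY]])
 have "EX N. (ALL n>=N. ALL i. E2 (Suc n) i <= P.imul (E2 n i) + U2 i) &
  (ALL i>=N. ALL n. E2 n (Suc i) <= P.tsum (E2 n i) + U2 (Suc i))"
 proof (rule P.artin_rees[where L = L2 and U = "%n. U2"])
  show L2: "P.osub (L2 i)" for i unfolding L2_def by(rule osub_prod2[OF K(1)])
  show "P.osub (U2 i)" for i by(rule U2)
  show "P.osub (E2 n i)" for n i unfolding E2_def by(rule P.ops_range_plus[OF GY U2])
  show "opnoeth (range sc2) (L2 0) (U2 0)"
   unfolding L2_def U2_def by(rule opnoeth_prod2[OF K(1) R(1) noeth]) auto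
  show "U2 i <= E2 n i" for n i by(rule U2E)
  show "L2 (Suc i) = P.tsum (L2 i)" for i
  proof
   show "L2 (Suc i) <= P.tsum (L2 i)"
    unfolding L2_def by(intro subsetI lsum_prod2[of _ _ tt]) (auto simp: K(2) tt_addm)
   show "P.tsum (L2 i) <= L2 (Suc i)"
    by(rule P.tsum_least[OF L2])
     (auto simp: L2_def prod2_def K(2) tt_tsum K(1) addm_zero[OF tt_addm] split: if_splits)
  qed
  show tU2: "tt2 j x : U2 (Suc i)" if "j < c" "x : U2 i" for i j x
   using that R(2) by(auto simp: U2_def)
  show sU2: "sc2 (al l) x : U2 i" if "l < m" "x : U2 i" for i l x
   using that ops_sc[OF R(1)] by(auto simp: U2_def)
  show "tt2 j x : E2 n (Suc i)" if j: "j < c" and x: "x : E2 n i" for n i j x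
  proof -
   obtain y u where yu: "x = G y + u" "y : Y n i" "u : U2 i"
    using x unfolding E2_def by(auto elim!: set_plus_elim)
   have "tt2 j x = G (tt j y) + tt2 j u" by(simp add: yu(1) Gtt j addmD[OF P.tt_addm[OF j]])
   thus ?thesis unfolding E2_def
    by(rule set_plusI[OF _ imageI[OF Ytt[OF j yu(2)]] tU2[OF j yu(3)]])
  qed
  show "sc2 (al l) x : E2 (Suc n) i" if l: "l < m" and x: "x : E2 n i" for n i l x
  proof -
   obtain y u where yu: "x = G y + u" "y : Y n i" "u : U2 i"
    using x unfolding E2_def by(auto elim!: set_plus_elim)
   have "sc2 (al l) x = G (sc (al l) y) + sc2 (al l) u" by(simp add: yu(1) Gsc P.sc_add)
   thus ?thesis unfolding E2_def
    by(rule set_plusI[OF _ imageI[OF Ysc[OF l yu(2)]] sU2[OF l yu(3)]])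
  qed
  show "E2 n i <= P.IP n (L2 i) + U2 i" for n i
  proof
   fix x assume "x : E2 n i"
   then obtain y u where yu: "x = G y + u" "y : Y n i" "u : U2 i"
    unfolding E2_def by(auto elim!: set_plus_elim)
   have "ALL s. EX a. s <= r --> a : IP n (K s i) & g s y - a : R s i"
   proof
    fix s show "EX a. s <= r --> a : IP n (K s i) & g s y - a : R s i"
    proof (cases "s <= r")
     case True
     hence "g s y : IP n (K s i) + R s i" using yu(2) by(auto simp: Y_def)
     then obtain a b where "g s y = a + b" "a : IP n (K s i)" "b : R s i" by(rule set_plus_elim)
     thus ?thesis by(intro exI[of _ a]) auto
    qed auto
   qed
   then obtain a where a: "!!s. s <= r ==> a s : IP n (K s i) & g s y - a s : R s i" by metis
   define w where "w = (%s. if s <= r then a s else 0)"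
   have "w : P.IP n (L2 i)" unfolding L2_def using a by(intro IP_prod2) (auto simp: prod2_def w_def)
   moreover have "G y - w : U2 i" using a by(auto simp: U2_def w_def G_def)
   moreover have "x = w + ((G y - w) + u)" using yu(1) by simp
   ultimately show "x : P.IP n (L2 i) + U2 i" using yu(3) ops_add[OF U2] by(metis set_plusI)
  qed
 qed
 then obtain N where N: "!!n i. n >= N ==> E2 (Suc n) i <= P.imul (E2 n i) + U2 i" by blast
 have "Y (Suc n) i <= imul (Y n i) + {z : L i. ALL s<=r. g s z : R s i}" if n: "n >= N" for n i
 proof
  fix z assume z: "z : Y (Suc n) i"
  hence "G z : P.imul (E2 n i) + U2 i" using N[OF n] GYE by blast
  then obtain e u where eu: "G z = e + u" "e : P.imul (E2 n i)" "u : U2 i" by(rule set_plus_elim)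
  obtain y where y: "e = (SUM l<m. sc2 (al l) (y l))" "ALL l:{..<m}. y l : E2 n i" using eu(2) by(rule lsumE)
  have "ALL l. EX x. l < m --> x : Y n i & y l - G x : U2 i"
  proof
   fix l show "EX x. l < m --> x : Y n i & y l - G x : U2 i"
   proof (cases "l < m")
    case True
    hence "y l : E2 n i" using y(2) by auto
    then obtain x u where "y l = G x + u" "x : Y n i" "u : U2 i"
     unfolding E2_def by(auto elim!: set_plus_elim)
    thus ?thesis by(intro exI[of _ x]) auto
   qed auto
  qed
  then obtain x where x: "!!l. l < m ==> x l : Y n i & y l - G (x l) : U2 i" by metis
  \<comment> \<open>\<open>s\<close> lies in I \<open>Y n i\<close> and has the same image as
    \<open>z\<close> modulo the relations \<open>U2\<close>; only the kernel part
    \<open>z - s\<close> remains.\<close>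
  define s where "s = (SUM l<m. sc (al l) (x l))"
  have s: "s : imul (Y n i)" unfolding s_def using x by(intro lsumI) auto
  have "G (z - s) = (SUM l<m. sc2 (al l) (y l - G (x l))) + u"
   by(simp add: addm_diff[OF G] s_def addm_sum[OF G] Gsc eu(1) y(1) P.sc_diff sum_subtractf)
  also have "... : U2 i" using x eu(3) by(intro ops_add[OF U2] ops_sum[OF U2] P.ops_sc[OF U2]) auto
  finally have "G (z - s) : U2 i" .
  moreover have "Y n i <= L i" for n by(auto simp: Y_def)
  moreover have "s : Y n i" using s imul_osub[OF Y] by blast
  ultimately have "z - s : {z : L i. ALL s<=r. g s z : R s i}"
   using z ops_diff[OF L(1), of z i s] by(auto simp: U2_def G_def)
  thus "z : imul (Y n i) + {z : L i. ALL s<=r. g s z : R s i}"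
   using s by(intro set_plusI[of z s "z - s"]) auto
 qed
 thus ?thesis by blast
qed

end

section \<open>Stability of associated primes for graded cochains\<close>

locale core = tmod sc tt c "%l. ph (gm l)" m
 for sc :: "'p::comm_ring_1 => 'v::ab_group_add => 'v" and tt c and ph :: "'a::comm_ring_1 => 'p"
  and gm :: "nat => 'a" and m +
 fixes L M U U' :: "nat => 'v set" and de :: "'v => 'v" and JA :: "'a set"
 assumes l_add: "ph (a + b) = ph a + ph b" and l_mult: "ph (a * b) = ph a * ph b" and l_1: "ph 1 = 1"
  and L: "osub (L i)" "L (Suc i) = tsum (L i)"
  and M: "osub (M i)" "M (Suc i) = tsum (M i)"
  and U: "osub (U i)" "j < c ==> x : U i ==> tt j x : U (Suc i)"
  and U': "osub (U' i)" "j < c ==> x : U' i ==> tt j x : U' (Suc i)"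
  and noeth: "opnoeth (range sc) (L 0) (U 0)" "opnoeth (range sc) (M 0) (U' 0)"
  and de: "addm de" "de (sc e x) = sc e (de x)" "j < c ==> de (tt j x) = tt j (de x)"
  and JA: "idl JA" "rnoeth JA" "a : JA ==> x : L i ==> sc (ph a) x : U i"
begin

abbreviation act :: "'a => 'v => 'v" where "act a \<equiv> sc (ph a)"

abbreviation LU where "LU n i \<equiv> IP n (L i) + U i"

text \<open>\<open>L i\<close> modulo \<open>U i\<close> stands for cochains modulo coboundaries and
  \<open>de\<close> for the differential into \<open>M i\<close> modulo \<open>U' i\<close>. Thus
  \<open>z\<close> is a cocycle modulo I^n, and \<open>p\<close> is the annihilator of its class in
  the ring acting through \<open>ph\<close>.\<close>

definition W :: "nat => nat => 'a set => bool" where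
 "W n i p \<longleftrightarrow> (EX z:L i. de z : IP n (M i) + U' i & p = {a. act a z : LU n i})"

lemma smod_act: "smod act"
 by unfold_locales (simp_all add: l_add l_mult l_1 sc_add sc_plus sc_sc sc_1)

lemma LU: "osub (LU n i)"
 by(intro ops_range_plus osub_IP L U)

lemma U_LU: "U i <= LU n i"
 by(rule plus_ge2[OF ops_zero[OF osub_IP[OF L(1)]]])

lemma IP_LU: "IP n (L i) <= LU n i"
 by(rule plus_ge1[OF ops_zero[OF U(1)]])

lemma tt_L: "j < c ==> x : L i ==> tt j x : L (Suc i)"
 by(simp add: L tt_tsum)

lemma tt_LU: "j < c ==> x : LU n i ==> tt j x : LU n (Suc i)"
proof -
 assume j: "j < c" and "x : LU n i"
 then obtain u v where uv: "x = u + v" "u : IP n (L i)" "v : U i" by(auto elim: set_plus_elim)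
 have "tt j u : IP n (L (Suc i))" using uv(2) by(rule tt_IP[OF j, rotated]) (simp add: tt_L j)
 thus ?thesis using U(2)[OF j uv(3)]
  by(intro set_plusI[of _ "tt j u" "tt j v"]) (auto simp: uv(1) addmD[OF tt_addm[OF j]])
qed

lemma sc_LU: "l < m ==> x : LU n i ==> act (gm l) x : LU (Suc n) i"
proof -
 assume l: "l < m" and "x : LU n i"
 then obtain u v where uv: "x = u + v" "u : IP n (L i)" "v : U i" by(auto elim: set_plus_elim)
 have "act (gm l) u : IP (Suc n) (L i)" using sc_imul[OF l osub_IP[OF L(1)] uv(2)] by simp
 thus ?thesis using ops_sc[OF U(1) uv(3)]
  by(intro set_plusI[of _ "act (gm l) u" "act (gm l) v"]) (auto simp: uv(1) sc_add)
qed

lemma LU_decr: "n <= k ==> LU k i <= LU n i"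
 using IP_decr[OF L(1)] by(intro set_plus_mono2) auto

text \<open>\<open>finite_ass\<close> is applied to the bigraded module whose entries are the layers
  I^n \<open>L i\<close> modulo I^(n+1) \<open>L i\<close> and \<open>U i\<close>. Shifting the
  first index of the relations by one makes all layers part of a single Noetherian module.\<close>

lemma finite_graded_ass:
 "finite {p. prm p & (EX n i. EX x:IP n (L i). p = {a. act a x : LU (Suc n) i})}" (is "finite ?A")
proof -
 let ?T = "gen OPS (pt 0 0 ` L 0)" and ?U = "{f. ALL n i. f (n, i) : LU (Suc n) i}"
 have "opnoeth (range sc) (L 0) (LU (Suc 0) 0)"
  by(rule opnoeth_mod_mono[OF noeth(1) U_LU L(1) U(1) LU]) (auto simp: sc_addm)
 hence n: "opnoeth OPS ?T ?U" by(intro rees_noeth L LU tt_LU sc_LU)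
 have U: "ops OPS ?U" by(intro OPS_opsub_family LU tt_LU sc_LU)
 interpret S: smod "%a. SC (ph a)"
  by unfold_locales (simp_all add: fun_eq_iff l_add l_mult l_1 sc_add sc_plus sc_sc sc_1)
 have JT: "SC (ph a) f : ?U" if "a : JA" "f : ?T" for a f
 proof -
  have "pt 0 0 ` L 0 <= {f. SC (ph a) f : ?U}"
   using subsetD[OF U_LU JA(3)[OF that(1)]] ops_zero[OF LU] by(auto simp: pt_def simp del: funpow.simps)
  moreover have "ops OPS {f. SC (ph a) f : ?U}"
   by(rule ops_vimage[OF U SC_addm]) (simp only: SC_comm, erule (1) ops_op[OF U])
  ultimately have "?T <= {f. SC (ph a) f : ?U}" by(intro gen_least)
  thus ?thesis using that by blast
 qed
 have "finite {p. prm p & (EX x:?T. p = {a. SC (ph a) x : ?U})}"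
  by(rule S.finite_ass[OF _ OPS_addm SC_comm[symmetric] ops_gen U n JA(2,1) JT]) (auto simp: OPS_def)
 moreover have "?A <= {p. prm p & (EX x:?T. p = {a. SC (ph a) x : ?U})}"
 proof clarify
  fix p n i x assume p: "prm {a. act a x : LU (Suc n) i}" and x: "x : IP n (L i)"
  have "pt n i x : ?T" by(rule pt_gen[OF L x])
  moreover have "{a. act a x : LU (Suc n) i} = {a. SC (ph a) (pt n i x) : ?U}"
   using ops_zero[OF LU] by(auto simp: pt_def simp del: funpow.simps)
  ultimately show "EX y:?T. {a. act a x : LU (Suc n) i} = {a. SC (ph a) y : ?U}" by blast
 qed
 ultimately show ?thesis by(rule finite_subset[rotated])
qed

text \<open>Along the filtration by powers of I there is a last step at which some multiple of
  \<open>z\<close> by an element outside \<open>p\<close> is still contained. The class of this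
  multiple in the corresponding layer again has annihilator \<open>p\<close>, because
  \<open>p\<close> is prime.\<close>

lemma finite_ass_quotients:
 "finite {p. prm p & (EX n i. W n i p)}"
proof (rule finite_subset[OF _ finite_graded_ass])
 show "{p. prm p & (EX n i. W n i p)}
  <= {p. prm p & (EX n i. EX x:IP n (L i). p = {a. act a x : LU (Suc n) i})}"
 proof clarify
  fix p n i assume p: "prm p" and "W n i p"
  then obtain z where z: "z : L i" "p = {a. act a z : LU n i}" by(auto simp: W_def)
  define P where "P j \<longleftrightarrow> (EX b. b ~: p & act b z : LU j i)" for j
  have P0: "P 0" unfolding P_def
   using z(1) IP_LU[of 0 i] prmD(2)[OF p] by(intro exI[of _ 1]) (auto simp: l_1 sc_1)
  have "~ P n" using z by(auto simp: P_def)
  hence "EX j<n. P j & ~ P (Suc j)"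
  proof (induction n)
   case (Suc n) thus ?case by(cases "P n") (auto intro: less_SucI)
  qed (use P0 in auto)
  then obtain j where j: "j < n" "P j" "~ P (Suc j)" by blast
  then obtain b where b: "b ~: p" "act b z : LU j i" by(auto simp: P_def)
  obtain x u where xu: "act b z = x + u" "x : IP j (L i)" "u : U i" using b(2) by(rule set_plus_elim)
  have *: "act a x : LU (Suc j) i \<longleftrightarrow> act (a * b) z : LU (Suc j) i" for a
  proof -
   have "act (a * b) z - act a x = act a u" by(simp add: l_mult xu(1) sc_add flip: sc_sc)
   moreover have "act a u : LU (Suc j) i" using ops_sc[OF U(1) xu(3)] U_LU by blast
   ultimately show ?thesis using ops_cong[OF LU] by metis
  qed
  have "p = {a. act a x : LU (Suc j) i}"
  proof (rule equalityI; rule subsetI)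
   fix a assume "a : p"
   hence "a * b : p" using prm_mult_iff[OF p] by blast
   hence "act (a * b) z : LU n i" using z by auto
   thus "a : {a. act a x : LU (Suc j) i}" using * LU_decr[of "Suc j" n i] j(1) by auto
  next
   fix a assume "a : {a. act a x : LU (Suc j) i}"
   hence "act (a * b) z : LU (Suc j) i" using * by auto
   hence "a * b : p" using j(3) by(auto simp: P_def)
   thus "a : p" using prm_mult_iff[OF p] b(1) by blast
  qed
  thus "EX n i. EX x:IP n (L i). p = {a. act a x : LU (Suc n) i}" using xu(2) by blast
 qed
qed

end

context core begin

text \<open>The intersections of \<open>D i + U i\<close> with \<open>LU n i\<close> form a bigraded
  family to which \<open>artin_rees\<close> applies; the second bound, taken at
  \<open>n = 0\<close>, is the generation of \<open>D\<close> itself by the operators.\<close>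

lemma family_bounded:
 assumes D: "!!i. osub (D i)" "!!i. D i <= L i" "!!i j x. j < c ==> x : D i ==> tt j x : D (Suc i)"
 shows "EX N. (ALL n>=N. ALL i. (D i + U i) Int LU (Suc n) i <= imul ((D i + U i) Int LU n i) + U i) &
  (ALL i>=N. D (Suc i) <= tsum (D i) + U (Suc i))"
proof -
 define E where "E n i = (D i + U i) Int LU n i" for n i
 have DU: "osub (D i + U i)" for i by(intro ops_range_plus D U)
 have UDU: "U i <= D i + U i" for i by(rule plus_ge2[OF ops_zero[OF D(1)]])
 have DUtt: "tt j x : D (Suc i) + U (Suc i)" if j: "j < c" and x: "x : D i + U i" for i j x
 proof -
  obtain u v where uv: "x = u + v" "u : D i" "v : U i" using x by(rule set_plus_elim)
  thus ?thesis using D(3)[OF j uv(2)] U(2)[OF j uv(3)]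
   by(intro set_plusI[of _ "tt j u" "tt j v"]) (auto simp: addmD[OF tt_addm[OF j]])
 qed
 have "EX N. (ALL n>=N. ALL i. E (Suc n) i <= imul (E n i) + U i) &
  (ALL i>=N. ALL n. E n (Suc i) <= tsum (E n i) + U (Suc i))"
 proof (rule artin_rees[where L = L and U = "%n. U", OF L U])
  show "act (gm l) x : U i" if "x : U i" for i l x using ops_sc[OF U(1) that] .
  show "osub (E n i)" for n i unfolding E_def by(rule ops_Int[OF DU LU])
  show "tt j x : E n (Suc i)" if "j < c" "x : E n i" for n i j x
   using that DUtt tt_LU unfolding E_def by blast
  show "act (gm l) x : E (Suc n) i" if "l < m" "x : E n i" for n i l x
   using that ops_sc[OF DU] sc_LU unfolding E_def by blast
  show "U i <= E n i" for n i unfolding E_def using UDU U_LU by blast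
  show "E n i <= IP n (L i) + U i" for n i unfolding E_def by blast
  show "opnoeth (range sc) (L 0) (U 0)" by(rule noeth)
 qed
 then obtain N where N: "!!n i. n >= N ==> E (Suc n) i <= imul (E n i) + U i"
  "!!i. i >= N ==> E 0 (Suc i) <= tsum (E 0 i) + U (Suc i)" by blast
 have "D (Suc i) <= tsum (D i) + U (Suc i)" if i: "i >= N" for i
 proof -
  have tU: "osub (tsum (D i) + U (Suc i))" by(intro ops_range_plus osub_tsum D U)
  have "D (Suc i) <= E 0 (Suc i)"
   unfolding E_def using plus_ge1[OF ops_zero[OF U(1)[of "Suc i"]], of "D (Suc i)"] D(2)[of "Suc i"]
    IP_LU[of 0 "Suc i"] by auto
  also have "... <= tsum (E 0 i) + U (Suc i)" by(rule N(2)[OF i])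
  also have "... <= tsum (D i) + U (Suc i)"
  proof (rule plus_least[OF tU])
   show "U (Suc i) <= tsum (D i) + U (Suc i)" by(rule plus_ge2[OF ops_zero[OF osub_tsum[OF D(1)]]])
   show "tsum (E 0 i) <= tsum (D i) + U (Suc i)"
   proof (rule tsum_least[OF tU])
    fix j x assume j: "j < c" and "x : E 0 i"
    hence "x : D i + U i" by(auto simp: E_def)
    then obtain u v where uv: "x = u + v" "u : D i" "v : U i" by(rule set_plus_elim)
    thus "tt j x : tsum (D i) + U (Suc i)"
     using tt_tsum[OF j D(1) uv(2)] U(2)[OF j uv(3)]
     by(intro set_plusI[of _ "tt j u" "tt j v"]) (auto simp: addmD[OF tt_addm[OF j]])
   qed
  qed
  finally show ?thesis .
 qed
 thus ?thesis using N(1) unfolding E_def by blast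
qed

text \<open>The elements that fall into \<open>Xs\<close> after localisation at
  \<open>p\<close>.\<close>

definition tor :: "'a set => 'v set => 'v set" where
 "tor p Xs = {z. EX s. s ~: p & act s z : Xs}"

lemma osub_tor:
 assumes p: "prm p" and Xs: "osub Xs" shows "osub (tor p Xs)"
proof (rule ops_rangeI)
 show "0 : tor p Xs" using prmD(2)[OF p] ops_zero[OF Xs] by(auto simp: tor_def)
 fix x y assume "x : tor p Xs" "y : tor p Xs"
 then obtain s t where st: "s ~: p" "act s x : Xs" "t ~: p" "act t y : Xs" by(auto simp: tor_def)
 have "act (s * t) (x + y) = sc (ph t) (act s x) + sc (ph s) (act t y)"
  by(simp add: l_mult sc_add sc_sc mult.commute)
 also have "... : Xs" by(rule ops_add[OF Xs ops_sc[OF Xs st(2)] ops_sc[OF Xs st(4)]])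
 finally show "x + y : tor p Xs" using st prm_mult_iff[OF p] by(auto simp: tor_def)
next
 fix a x assume "x : tor p Xs"
 thus "sc a x : tor p Xs" using ops_sc[OF Xs] by(auto simp: tor_def sc_commute[of _ a])
qed

lemma tor_inc: "prm p ==> Xs <= tor p Xs"
 by(auto simp: tor_def l_1 sc_1 dest: prmD(2))

lemma act_power_IP: "l < m ==> z : L i ==> act (gm l ^ n) z : IP n (L i)"
proof (induction n)
 case 0 thus ?case by(simp add: l_1 sc_1)
next
 case (Suc n)
 thus ?case using sc_imul[OF Suc.prems(1) osub_IP[OF L(1)]]
  by(simp add: l_mult flip: sc_sc)
qed

text \<open>\<open>W\<close> is rephrased as the failure of the inclusion
  \<open>Y n i <= tor p (LU n i)\<close>. For large \<open>n\<close> the left side is a sum of two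
  parts, and for each part the inclusion is inherited when the indices grow.\<close>

lemma stable_prime:
 assumes p: "prm p"
 shows "EX n0 i0. ALL n>=n0. ALL i>=i0. W n i p = W n0 i0 p"
proof (cases "(ALL l<m. gm l : p) & JA <= p")
 case False
 \<comment> \<open>A prime that occurs contains I, since \<open>gm l ^ n\<close> annihilates
   everything modulo I^n, and it contains \<open>JA\<close>. Any other prime never occurs.\<close>
 have "~ W n i p" for n i
 proof
  assume "W n i p"
  then obtain z where z: "z : L i" "p = {a. act a z : LU n i}" by(auto simp: W_def)
  have "gm l : p" if "l < m" for l
  proof -
   have "gm l ^ n : p" using act_power_IP[OF that z(1), of n] IP_LU z(2) by auto
   thus ?thesis by(rule prm_power[OF p])
  qed
  moreover have "JA <= p" using JA(3)[OF _ z(1)] z(2) U_LU by blast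
  ultimately show False using False by blast
 qed
 thus ?thesis by blast
next
 case True
 have "p <= UNIV + JA" using plus_ge1[OF ops_zero[OF JA(1)], of UNIV] by auto
 \<comment> \<open>With finitely many generators of \<open>p\<close> modulo \<open>JA\<close>, being
   killed by \<open>p\<close> becomes a condition on finitely many maps, and
   \<open>artin_rees_maps\<close> applies to them together with \<open>de\<close>.\<close>
 then obtain F where F: "finite F" "F <= p" "p <= gen (range (*)) (F Un JA)"
  using opnoethD[OF JA(2)[unfolded rnoeth_def] prmD(1)[OF p]] True by blast
 obtain xs where xs: "set xs = F" using finite_list[OF F(1)] by blast
 define r where "r = length xs"
 have Fp: "(ALL s<r. act (xs ! s) z : Xs) \<longleftrightarrow> (ALL a:p. act a z : Xs)"
  if z: "z : L i" and Xs: "osub Xs" "U i <= Xs" for z i Xs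
 proof
  interpret A: smod act by(rule smod_act)
  have "ops (range act) Xs" using Xs(1) by(rule ops_mono) auto
  hence I: "idl {a. act a z : Xs}" by(rule A.idl_annihilator)
  assume "ALL s<r. act (xs ! s) z : Xs"
  hence "F Un JA <= {a. act a z : Xs}"
   using xs JA(3)[OF _ z] Xs(2) by(auto simp: r_def set_conv_nth)
  thus "ALL a:p. act a z : Xs" using F(3) gen_least[OF I] by blast
 next
  assume "ALL a:p. act a z : Xs"
  thus "ALL s<r. act (xs ! s) z : Xs" using F(2) xs nth_mem by(auto simp: r_def subset_iff)
 qed
 define g where "g s = (case s of 0 => de | Suc s' => act (xs ! s'))" for s
 define K where "K s i = (case s of 0 => M i | Suc (s'::nat) => L i)" for s i
 define R where "R s i = (case s of 0 => U' i | Suc (s'::nat) => U i)" for s i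
 \<comment> \<open>\<open>Y n i\<close> are the cocycles modulo I^n that \<open>p\<close> kills
   modulo I^n. \<open>Yi i\<close> below is the same without powers of I, the limiting case of
   infinite \<open>n\<close>.\<close>
 define Y where "Y n i = {z : L i. ALL s<=r. g s z : IP n (K s i) + R s i}" for n i
 define Yi where "Yi i = {z : L i. ALL s<=r. g s z : R s i}" for i
 have all_le: "(ALL s<=r. P s) \<longleftrightarrow> P 0 & (ALL s<r. P (Suc s))" for P
  by(metis Suc_leI gr0_conv_Suc le0 less_Suc_eq_le not_gr_zero Suc_le_lessD)
 have Y_iff: "z : Y n i \<longleftrightarrow> z : L i & de z : IP n (M i) + U' i & (ALL a:p. act a z : LU n i)" for z n i
  unfolding Y_def using Fp[OF _ LU U_LU] by(auto simp: all_le g_def K_def R_def)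
 have Yi_iff: "z : Yi i \<longleftrightarrow> z : L i & de z : U' i & (ALL a:p. act a z : U i)" for z i
  unfolding Yi_def using Fp[OF _ U(1) order_refl] by(auto simp: all_le g_def R_def)
 have "EX N. ALL n>=N. ALL i. Y (Suc n) i <= imul (Y n i) + Yi i"
  unfolding Y_def Yi_def
 proof (rule artin_rees_maps)
  show "osub (K s i)" "K s (Suc i) = tsum (K s i)" "osub (R s i)" for s i
   by(auto simp: K_def R_def L M U U' split: nat.split)
  show "opnoeth (range sc) (K s 0) (R s 0)" for s
   by(auto simp: K_def R_def noeth split: nat.split)
  show "tt j x : R s (Suc i)" if "j < c" "x : R s i" for s i j x
   using that U U' by(auto simp: R_def split: nat.splits)
  show "addm (g s)" "g s (sc a x) = sc a (g s x)" for s a x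
   by(auto simp: g_def de sc_addm sc_commute split: nat.split)
  show "g s (tt j x) = tt j (g s x)" if "j < c" for s j x
   using that by(auto simp: g_def de tt_sc split: nat.split)
 qed (auto simp: L tt_tsum)
 then obtain N1 where N1: "!!n i. n >= N1 ==> Y (Suc n) i <= imul (Y n i) + Yi i" by blast
 have osubp: "osub {z. ALL a:p. act a z : Xs}" if "osub Xs" for Xs
  using that unfolding ops_def by(auto simp: sc_diff sc_commute)
 have MU: "osub (IP n (M i) + U' i)" for n i by(intro ops_range_plus osub_IP M U')
 have osubd: "osub {z. de z : Xs}" if "osub Xs" for Xs
  by(rule ops_vimage[OF that de(1)]) (auto simp: de intro: ops_sc[OF that])
 have Y: "osub (Y n i)" for n i
 proof -
  have "Y n i = L i Int {z. de z : IP n (M i) + U' i} Int {z. ALL a:p. act a z : LU n i}"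
   by(auto simp: Y_iff)
  thus ?thesis by(simp only:) (intro ops_Int L osubp osubd LU MU)
 qed
 have Yi: "osub (Yi i)" for i
 proof -
  have "Yi i = L i Int {z. de z : U' i} Int {z. ALL a:p. act a z : U i}" by(auto simp: Yi_iff)
  thus ?thesis by(simp only:) (intro ops_Int L osubp osubd U U')
 qed
 have U'MU: "U' i <= IP n (M i) + U' i" for n i by(rule plus_ge2[OF ops_zero[OF osub_IP[OF M(1)]]])
 have YiY: "Yi i <= Y n i" for n i using subsetD[OF U_LU] subsetD[OF U'MU] by(auto simp: Y_iff Yi_iff)
 have YL: "Y n i <= L i" "Yi i <= L i" for n i by(auto simp: Y_iff Yi_iff)
 have ttM: "tt j x : IP n (M (Suc i)) + U' (Suc i)" if j: "j < c" and x: "x : IP n (M i) + U' i" for j x n i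
 proof -
  obtain u v where uv: "x = u + v" "u : IP n (M i)" "v : U' i" using x by(rule set_plus_elim)
  have "tt j u : IP n (M (Suc i))" using uv(2) by(rule tt_IP[OF j, rotated]) (simp add: M tt_tsum j)
  thus ?thesis using U'(2)[OF j uv(3)]
   by(intro set_plusI[of _ "tt j u" "tt j v"]) (auto simp: uv(1) addmD[OF tt_addm[OF j]])
 qed
 have scM: "act (gm l) x : IP (Suc n) (M i) + U' i" if l: "l < m" and x: "x : IP n (M i) + U' i" for l x n i
 proof -
  obtain u v where uv: "x = u + v" "u : IP n (M i)" "v : U' i" using x by(rule set_plus_elim)
  have "act (gm l) u : IP (Suc n) (M i)" using sc_imul[OF l osub_IP[OF M(1)] uv(2)] by simp
  thus ?thesis using ops_sc[OF U'(1) uv(3)]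
   by(intro set_plusI[of _ "act (gm l) u" "act (gm l) v"]) (auto simp: uv(1) sc_add)
 qed
 have ttY: "tt j x : Y n (Suc i)" if "j < c" "x : Y n i" for j x n i
  using that tt_L ttM tt_LU by(auto simp: Y_iff de simp flip: tt_sc)
 have ttYi: "tt j x : Yi (Suc i)" if "j < c" "x : Yi i" for j x i
  using that tt_L U U' by(auto simp: Yi_iff de simp flip: tt_sc)
 have scY: "act (gm l) x : Y (Suc n) i" if "l < m" "x : Y n i" for l x n i
  using that ops_sc[OF L(1)] scM sc_LU unfolding Y_iff by(simp add: de sc_commute[of _ "ph (gm l)"])
 \<comment> \<open>Beyond \<open>N1\<close> the only dependence on \<open>n\<close> is the power of
   I in front of \<open>Y N1 i\<close>.\<close>
 have Ydecomp: "Y (N1 + k) i = IP k (Y N1 i) + Yi i" for k i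
 proof
  show "IP k (Y N1 i) + Yi i <= Y (N1 + k) i"
  proof (rule plus_least[OF Y _ YiY])
   show "IP k (Y N1 i) <= Y (N1 + k) i"
   proof (induction k)
    case (Suc k)
    have "imul (IP k (Y N1 i)) <= Y (N1 + Suc k) i"
     by(rule imul_least[OF Y]) (use Suc scY in auto)
    thus ?case by simp
   qed auto
  qed
  show "Y (N1 + k) i <= IP k (Y N1 i) + Yi i"
  proof (induction k)
   case 0 show ?case using plus_ge1[OF ops_zero[OF Yi], of "Y N1 i"] by simp
  next
   case (Suc k)
   have s: "osub (IP (Suc k) (Y N1 i) + Yi i)" by(intro ops_range_plus osub_IP Y Yi)
   have YiS: "Yi i <= IP (Suc k) (Y N1 i) + Yi i" by(rule plus_ge2[OF ops_zero[OF osub_IP[OF Y]]])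
   have "Y (N1 + Suc k) i <= imul (Y (N1 + k) i) + Yi i" using N1[of "N1 + k" i] by simp
   also have "... <= IP (Suc k) (Y N1 i) + Yi i"
   proof (rule plus_least[OF s _ YiS], rule imul_least[OF s])
    fix l x assume l: "l < m" and "x : Y (N1 + k) i"
    hence "x : IP k (Y N1 i) + Yi i" using Suc by auto
    then obtain u v where uv: "x = u + v" "u : IP k (Y N1 i)" "v : Yi i" by(rule set_plus_elim)
    have "act (gm l) u : IP (Suc k) (Y N1 i)" using sc_imul[OF l osub_IP[OF Y] uv(2)] by simp
    thus "act (gm l) x : IP (Suc k) (Y N1 i) + Yi i" using ops_sc[OF Yi uv(3)]
     by(intro set_plusI[of _ "act (gm l) u" "act (gm l) v"]) (auto simp: uv(1) sc_add)
   qed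
   finally show ?case .
  qed
 qed
 \<comment> \<open>Elements of \<open>Y n i\<close> are killed by \<open>p\<close>; such an
   annihilator equals \<open>p\<close> exactly when nothing outside \<open>p\<close> kills the
   element.\<close>
 have W_iff: "W n i p \<longleftrightarrow> ~ Y n i <= tor p (LU n i)" for n i
 proof
  assume "W n i p"
  thus "~ Y n i <= tor p (LU n i)" unfolding W_def tor_def subset_iff Y_iff by blast
 next
  assume "~ Y n i <= tor p (LU n i)"
  thus "W n i p" unfolding W_def tor_def subset_iff Y_iff by blast
 qed
 obtain N2 where N2: "!!n i. n >= N2 ==> (Yi i + U i) Int LU (Suc n) i <= imul ((Yi i + U i) Int LU n i) + U i"
  "!!i. i >= N2 ==> Yi (Suc i) <= tsum (Yi i) + U (Suc i)"
  using family_bounded[of Yi, OF Yi YL(2) ttYi] by blast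
 obtain N3 where N3: "!!i. i >= N3 ==> Y N1 (Suc i) <= tsum (Y N1 i) + U (Suc i)"
  using family_bounded[of "Y N1", OF Y YL(1) ttY] by blast
 \<comment> \<open>Artin-Rees puts \<open>y\<close> into I times \<open>Yi i\<close> modulo
   \<open>U i\<close>, and I is contained in \<open>p\<close>, which kills \<open>Yi i\<close>
   modulo \<open>U i\<close>. Hence for \<open>n > N2\<close> the condition on \<open>Yi\<close>
   does not depend on \<open>n\<close>.\<close>
 have YiLU: "y : U i" if n: "n > N2" and y: "y : Yi i" "y : LU n i" for n i y
 proof -
  obtain n' where n': "n = Suc n'" "n' >= N2" using n by(cases n) auto
  have "y : Yi i + U i" using plus_ge1[OF ops_zero[OF U(1)]] y(1) by blast
  hence "y : imul ((Yi i + U i) Int LU n' i) + U i" using N2(1)[OF n'(2)] y(2) n'(1) by blast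
  moreover have "imul ((Yi i + U i) Int LU n' i) <= U i"
  proof (rule imul_least[OF U(1)])
   fix l x assume l: "l < m" and "x : (Yi i + U i) Int LU n' i"
   then obtain u v where uv: "x = u + v" "u : Yi i" "v : U i" by(auto elim: set_plus_elim)
   have "act (gm l) u : U i" using uv(2) True l by(auto simp: Yi_iff)
   thus "act (gm l) x : U i"
    unfolding uv(1) sc_add using ops_sc[OF U(1) uv(3)] by(rule ops_add[OF U(1)])
  qed
  ultimately show ?thesis using plus_least[OF U(1) _ order_refl] by blast
 qed
 have P1: "Yi i <= tor p (LU n i) \<longleftrightarrow> Yi i <= tor p (U i)" if n: "n > N2" for n i
 proof
  assume *: "Yi i <= tor p (LU n i)"
  show "Yi i <= tor p (U i)"
  proof
   fix y assume y: "y : Yi i"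
   then obtain s where s: "s ~: p" "act s y : LU n i" using * by(auto simp: tor_def)
   have "act s y : U i" by(rule YiLU[OF n ops_sc[OF Yi y] s(2)])
   thus "y : tor p (U i)" using s by(auto simp: tor_def)
  qed
 next
  assume "Yi i <= tor p (U i)"
  thus "Yi i <= tor p (LU n i)" using U_LU unfolding tor_def by blast
 qed
 have tt_tor: "tt j x : tor p (LU n (Suc i))" if "j < c" "x : tor p (LU n i)" for j x n i
  using that tt_LU by(auto simp: tor_def simp flip: tt_sc)
 have tt_torU: "tt j x : tor p (U (Suc i))" if "j < c" "x : tor p (U i)" for j x i
  using that U(2) by(auto simp: tor_def simp flip: tt_sc)
 have P1_step: "Yi (Suc i) <= tor p (U (Suc i))" if "Yi i <= tor p (U i)" "i >= N2" for i
 proof -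
  have s: "osub (tor p (U (Suc i)))" by(rule osub_tor[OF p U(1)])
  have "tsum (Yi i) + U (Suc i) <= tor p (U (Suc i))"
   by(rule plus_least[OF s tsum_least[OF s] tor_inc[OF p]]) (use that tt_torU in blast)
  thus ?thesis using N2(2)[OF that(2)] by blast
 qed
 \<comment> \<open>The condition on the other part. It passes from \<open>k\<close> to
   \<open>Suc k\<close> by multiplying with the generators of I, and from \<open>i\<close> to
   \<open>Suc i\<close> by applying the operators, which generate \<open>Y N1\<close> beyond
   \<open>N3\<close>.\<close>
 define Q where "Q k i \<longleftrightarrow> IP k (Y N1 i) <= tor p (LU (N1 + k) i)" for k i
 have Q_n: "Q (Suc k) i" if q: "Q k i" for k i
 proof -
  have "imul (IP k (Y N1 i)) <= tor p (LU (N1 + Suc k) i)"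
  proof (rule imul_least[OF osub_tor[OF p LU]])
   fix l x assume l: "l < m" and "x : IP k (Y N1 i)"
   then obtain s where s: "s ~: p" "act s x : LU (N1 + k) i" using q by(auto simp: Q_def tor_def)
   have "act s (act (gm l) x) : LU (N1 + Suc k) i"
    using sc_LU[OF l s(2)] by(simp add: sc_commute[of "ph s"] del: funpow.simps)
   thus "act (gm l) x : tor p (LU (N1 + Suc k) i)" using s(1) by(auto simp: tor_def simp del: funpow.simps)
  qed
  thus ?thesis by(simp add: Q_def)
 qed
 have Q_i: "Q k (Suc i)" if q: "Q k i" and i: "i >= N3" for k i
 proof -
  have s: "osub (tor p (LU (N1 + k) (Suc i)))" by(rule osub_tor[OF p LU])
  have UT: "U (Suc i) <= tor p (LU (N1 + k) (Suc i))" using U_LU tor_inc[OF p] by blast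
  have *: "IP k (tsum (Y N1 i) + U (Suc i)) <= tsum (IP k (Y N1 i)) + U (Suc i)" for k
  proof (induction k)
   case (Suc k)
   have s': "osub (tsum (IP (Suc k) (Y N1 i)) + U (Suc i))"
    by(intro ops_range_plus osub_tsum osub_IP Y U)
   have "IP (Suc k) (tsum (Y N1 i) + U (Suc i)) <= imul (tsum (IP k (Y N1 i)) + U (Suc i))"
    using lsum_mono[OF Suc] by simp
   also have "... <= imul (tsum (IP k (Y N1 i))) + imul (U (Suc i))"
    by(rule lsum_plus) (auto simp: sc_addm)
   also have "... <= tsum (imul (IP k (Y N1 i))) + U (Suc i)"
    by(intro set_plus_mono2 lsum_swap imul_osub U) (auto simp: sc_addm tt_addm tt_sc ops_zero[OF osub_IP[OF Y]])
   finally show ?case by simp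
  qed simp
  have "IP k (Y N1 (Suc i)) <= IP k (tsum (Y N1 i) + U (Suc i))" by(rule IP_mono[OF N3[OF i]])
  also have "... <= tsum (IP k (Y N1 i)) + U (Suc i)" by(rule *)
  also have "... <= tor p (LU (N1 + k) (Suc i))"
   by(rule plus_least[OF s tsum_least[OF s] UT]) (use q tt_tor in \<open>auto simp: Q_def\<close>)
  finally show ?thesis by(simp add: Q_def)
 qed
 \<comment> \<open>A condition inherited by larger indices is eventually constant: it either never
   holds or holds from some point on.\<close>
 have "EX i1>=N2. ALL i>=i1. Yi i <= tor p (U i) \<longleftrightarrow> Yi i1 <= tor p (U i1)"
 proof (cases "EX i>=N2. Yi i <= tor p (U i)")
  case True
  then obtain i1 where i1: "i1 >= N2" "Yi i1 <= tor p (U i1)" by blast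
  have "Yi i <= tor p (U i)" if "i >= i1" for i
   using that by(induction i rule: dec_induct) (use i1 P1_step in auto)
  thus ?thesis using i1 by blast
 next
  case False thus ?thesis by(intro exI[of _ N2]) auto
 qed
 then obtain i1 where i1: "i1 >= N2" "!!i. i >= i1 ==> Yi i <= tor p (U i) \<longleftrightarrow> Yi i1 <= tor p (U i1)" by blast
 have "EX k2 i2. i2 >= N3 & (ALL k>=k2. ALL i>=i2. Q k i \<longleftrightarrow> Q k2 i2)"
 proof (cases "EX k i. i >= N3 & Q k i")
  case True
  then obtain k2 i2 where ki: "i2 >= N3" "Q k2 i2" by blast
  have "Q k i2" if "k >= k2" for k
   using that by(induction k rule: dec_induct) (use ki Q_n in auto)
  moreover have "Q k i" if "Q k i2" "i >= i2" for k i
   using that(2) by(induction i rule: dec_induct) (use ki that(1) Q_i in auto)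
  ultimately show ?thesis using ki by blast
 next
  case False thus ?thesis by(intro exI[of _ 0] exI[of _ N3]) auto
 qed
 then obtain k2 i2 where ki: "!!k i. k >= k2 ==> i >= i2 ==> Q k i \<longleftrightarrow> Q k2 i2" by blast
 \<comment> \<open>\<open>N1 + k2\<close> makes room for the exponent \<open>k >= k2\<close> of I,
   and \<open>Suc N2\<close> ensures \<open>n > N2\<close>.\<close>
 define n0 where "n0 = N1 + k2 + Suc N2"
 have "W n i p \<longleftrightarrow> ~ (Yi i1 <= tor p (U i1) & Q k2 i2)" if n: "n >= n0" and i: "i >= max i1 i2" for n i
 proof -
  obtain k where k: "n = N1 + k" "k >= k2" using n by(metis add.assoc le_Suc_ex n0_def le_add1 add_le_cancel_left)
  have "Y n i <= tor p (LU n i) \<longleftrightarrow> Yi i <= tor p (LU n i) & Q k i"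
  proof
   assume *: "Y n i <= tor p (LU n i)"
   have "IP k (Y N1 i) <= Y n i"
    unfolding k(1) Ydecomp by(rule plus_ge1[OF ops_zero[OF Yi]])
   thus "Yi i <= tor p (LU n i) & Q k i" using * YiY[of i n] unfolding Q_def k(1) by blast
  next
   assume "Yi i <= tor p (LU n i) & Q k i"
   thus "Y n i <= tor p (LU n i)"
    unfolding k(1) Ydecomp Q_def by(intro plus_least[OF osub_tor[OF p LU]]) auto
  qed
  thus ?thesis using W_iff P1[of n i] i1(2)[of i] ki[of k i] n i k(2) by(auto simp: n0_def)
 qed
 thus ?thesis by(intro exI[of _ n0] exI[of _ "max i1 i2"]) simp
qed

text \<open>The bounds of \<open>stable_prime\<close> depend on the prime. The finitely many primes
  of \<open>finite_ass_quotients\<close> have a common bound, and for the remaining ones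
  \<open>W\<close> is constantly false.\<close>

theorem stable_ass:
 "EX n0 i0. ALL n>=n0. ALL i>=i0. {p. prm p & W n i p} = {p. prm p & W n0 i0 p}"
proof -
 let ?A = "{p. prm p & (EX n i. W n i p)}"
 have "ALL p:?A. EX N. ALL n>=N. ALL i>=N. W n i p = W N N p"
 proof
  fix p assume "p : ?A"
  then obtain n0 i0 where *: "ALL n>=n0. ALL i>=i0. W n i p = W n0 i0 p" using stable_prime by blast
  have **: "W n i p = W n0 i0 p" if "n >= max n0 i0" "i >= max n0 i0" for n i
   using * that by(meson max.bounded_iff)
  have "ALL n>=max n0 i0. ALL i>=max n0 i0. W n i p = W (max n0 i0) (max n0 i0) p"
   unfolding **[OF order_refl order_refl] using ** by blast
  thus "EX N. ALL n>=N. ALL i>=N. W n i p = W N N p" ..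
 qed
 from bchoice[OF this] obtain N
  where N: "ALL p:?A. ALL n>=N p. ALL i>=N p. W n i p = W (N p) (N p) p" ..
 have "finite (N ` ?A)" by(rule finite_imageI[OF finite_ass_quotients])
 then obtain B where "ALL k:N ` ?A. k <= B" unfolding finite_nat_set_iff_bounded_le ..
 hence B: "ALL p:?A. N p <= B" by blast
 have "W n i p = W B B p" if "prm p" "n >= B" "i >= B" for n i p
 proof (cases "p : ?A")
  case True
  hence "N p <= B" using B by blast
  moreover have "ALL n>=N p. ALL i>=N p. W n i p = W (N p) (N p) p" using N True by(rule bspec)
  ultimately show ?thesis using that by(metis order_trans)
 next
  case False thus ?thesis using that(1) by blast
 qed
 thus ?thesis by(intro exI[of _ B]) auto
qed

end

section \<open>Krull's principal ideal theorem and regular local rings\<close>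

abbreviation gi :: "'p::comm_ring_1 set => 'p set" where
 "gi \<equiv> gen (range (*))"

lemma idl_gi: "idl (gi F)"
 by(rule ops_gen)

lemma gi_insert:
 assumes "idl I" shows "gi (insert x I) = {j + r * x |j r. j : I}"
proof
 show "gi (insert x I) <= {j + r * x |j r. j : I}"
 proof (rule gen_least)
  show "idl {j + r * x |j r. j : I}"
  proof (rule rmod.ops_rangeI)
   show "0 : {j + r * x |j r. j : I}" using ops_zero[OF assms] by(auto intro!: exI[of _ 0])
   fix u v assume "u : {j + r * x |j r. j : I}" "v : {j + r * x |j r. j : I}"
   then obtain j r j' r' where "u = j + r * x" "v = j' + r' * x" "j : I" "j' : I" by auto
   hence "u + v = (j + j') + (r + r') * x" "j + j' : I"
    using ops_add[OF assms] by(auto simp: algebra_simps)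
   thus "u + v : {j + r * x |j r. j : I}" by blast
  next
   fix a u assume "u : {j + r * x |j r. j : I}"
   then obtain j r where "u = j + r * x" "j : I" by auto
   hence "a * u = a * j + (a * r) * x" "a * j : I" by(simp add: algebra_simps) (rule idl_mult[OF assms \<open>j : I\<close>])
   thus "a * u : {j + r * x |j r. j : I}" by blast
  qed
  have "x = 0 + 1 * x" "0 : I" "!!y. y = y + 0 * x" using ops_zero[OF assms] by auto
  thus "insert x I <= {j + r * x |j r. j : I}" by blast
 qed
 show "{j + r * x |j r. j : I} <= gi (insert x I)"
  using gen_inc[of "insert x I" "range (*)"]
  by(auto intro!: ops_add[OF idl_gi] idl_mult[OF idl_gi])
qed

lemma rnoeth_mono: "rnoeth J ==> idl J ==> idl J' ==> J <= J' ==> rnoeth J'"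
 unfolding rnoeth_def by(rule opnoeth_mod_mono) (auto simp: ops_UNIV rmod.sc_addm)

lemma subset_UNIV_plus: "idl J ==> E <= UNIV + J"
 using plus_ge1[OF ops_zero, of "range (*)" J UNIV] by auto

lemma rnoeth_fg:
 assumes "rnoeth J" "idl J" "idl E" "J <= E"
 shows "EX F. finite F & F <= E & E = gi (F Un J)"
proof -
 obtain F where F: "finite F" "F <= E" "E <= gi (F Un J)"
  using opnoethD[OF assms(1)[unfolded rnoeth_def] assms(3,4) subset_UNIV_plus[OF assms(2)]] by blast
 moreover have "gi (F Un J) <= E" using F assms by(intro gen_least) auto
 ultimately show ?thesis by blast
qed

lemma rnoeth_maximal:
 assumes "rnoeth J" "idl J" "E0 : \<F>" "!!E. E : \<F> ==> idl E & J <= E"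
 shows "EX M:\<F>. ALL E:\<F>. M <= E --> E = M"
 by(rule opnoeth_maximal[OF assms(1)[unfolded rnoeth_def] assms(3)])
  (use assms(4) subset_UNIV_plus[OF assms(2)] in auto)

text \<open>If an ideal \<open>M\<close> maximal with \<open>D M\<close> were proper, a maximal
  annihilator \<open>K y\<close> modulo \<open>M\<close> would be prime, and the step would enlarge
  \<open>M\<close>. This induction along a prime filtration replaces arguments on the length of a
  module.\<close>

lemma filtration_induct:
 assumes J: "rnoeth J" "idl J" and I0: "idl I0" "J <= I0" "D I0"
  and step: "!!I y. idl I ==> I0 <= I ==> D I ==> y ~: I ==> prm {a. a * y : I} ==> D (gi (insert y I))"
 shows "D UNIV"
proof -
 let ?F = "{E. idl E & I0 <= E & D E}"
 have "EX M:?F. ALL E:?F. M <= E --> E = M"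
  by(rule rnoeth_maximal[OF J, of I0]) (use I0 in auto)
 then obtain M where M: "idl M" "I0 <= M" "D M"
  and max: "!!E. idl E ==> D E ==> M <= E ==> E = M" by(auto simp: subset_iff)
 have "M = UNIV"
 proof (rule ccontr)
  assume "M \<noteq> UNIV"
  then obtain y0 where y0: "y0 ~: M" by auto
  define K where "K y = {a. a * y : M}" for y
  have K: "idl (K y)" "M <= K y" for y
   unfolding K_def using rmod.idl_annihilator[OF M(1), of y] idl_mult_right[OF M(1)] by auto
  have "EX N:K ` (- M). ALL E:K ` (- M). N <= E --> E = N"
   by(rule rnoeth_maximal[OF J, of "K y0"]) (use y0 K(1) subsetD[OF subset_trans[OF subset_trans[OF I0(2) M(2)] K(2)]] in auto)
  then obtain y where y: "y ~: M" and ymax: "!!z. z ~: M ==> K y <= K z ==> K z = K y" by auto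
  have "prm (K y)" unfolding prm_def
  proof (intro conjI allI impI)
   show "1 ~: K y" using y by(simp add: K_def)
   fix a b assume ab: "a * b : K y"
   show "a : K y | b : K y"
   proof (cases "a : K y")
    case False
    hence "a * y ~: M" by(simp add: K_def)
    moreover have "K y <= K (a * y)"
    proof
     fix z assume "z : K y"
     hence "a * (z * y) : M" by(auto simp: K_def intro: idl_mult[OF M(1)])
     thus "z : K (a * y)" by(simp add: K_def ac_simps)
    qed
    ultimately have "K (a * y) = K y" by(rule ymax)
    moreover have "b : K (a * y)" using ab by(simp add: K_def ac_simps)
    ultimately show ?thesis by simp
   qed simp
  qed (rule K)
  hence "D (gi (insert y M))" using step[OF M y] by(simp add: K_def)
  moreover have *: "insert y M <= gi (insert y M)" by(rule gen_inc)
  ultimately have "gi (insert y M) = M" by(intro max idl_gi) auto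
  thus False using * y by auto
 qed
 thus ?thesis using M by simp
qed

lemma prm_compl_mult: "prm P ==> s : - P ==> t : - P ==> s * t : - P"
 by(simp add: prm_mult_iff)

lemma prm_compl_diff: "prm P ==> s : - P ==> m : P ==> s - m : - P"
 using ops_add[OF prmD(1), of P "s - m" m] by auto

definition iprod :: "'p::comm_ring_1 set => 'p set => 'p set" where
 "iprod P E = gi {m * y |m y. m : P & y : E}"

text \<open>If there were no such prime, \<open>P2\<close> would be minimal over \<open>P0\<close>
  and \<open>x\<close>. The symbolic powers of \<open>P1\<close> then become stationary modulo
  \<open>x\<close> near \<open>P2\<close>, hence stationary by Nakayama, and a second use of
  Nakayama at \<open>P1\<close> forces \<open>P1 <= P0\<close>. The form with a prime in between is
  the one that moves an element down a chain of primes.\<close>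

lemma krull_principal_ideal:
 assumes J: "rnoeth J" "idl J" and P: "prm P0" "prm P1" "prm P2" "J <= P0" "P0 \<subset> P1" "P1 \<subset> P2"
  and x: "x : P2"
 shows "EX P'. prm P' & P0 \<subset> P' & P' \<subset> P2 & x : P'"
proof (rule ccontr)
 assume no: "~ ?thesis"
 hence x1: "x ~: P1" using P by blast
 note idl = prmD(1)[OF P(1)] prmD(1)[OF P(2)] prmD(1)[OF P(3)]
 define I0 where "I0 = gi (insert x P0)"
 have I0: "idl I0" "insert x P0 <= I0" unfolding I0_def by(rule idl_gi gen_inc)+
 have I0_eq: "I0 = {j + r * x |j r. j : P0}" unfolding I0_def by(rule gi_insert[OF idl(1)])
 have uniq: "P' = P2" if "prm P'" "I0 <= P'" "P' <= P2" for P'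
 proof (rule ccontr)
  assume "P' \<noteq> P2"
  moreover have "x ~: P0" using x1 P by auto
  ultimately have "P0 \<subset> P' & P' \<subset> P2 & x : P'" using that I0(2) by auto
  thus False using no that(1) by blast
 qed
 define pw where "pw n = (iprod P1 ^^ n) UNIV" for n
 have pw0: "pw 0 = UNIV" and pwS: "pw (Suc n) = iprod P1 (pw n)" for n by(simp_all add: pw_def)
 have pw: "idl (pw n)" for n by(cases n) (auto simp: pw0 pwS iprod_def ops_UNIV idl_gi)
 have pw_decr: "pw (Suc n) <= pw n" for n
  unfolding pwS iprod_def using idl_mult[OF pw] by(intro gen_least[OF pw]) auto
 have pw_power: "a ^ n : pw n" if "a : P1" for a n
 proof (induction n)
  case (Suc n)
  hence "a * a ^ n : {m * y |m y. m : P1 & y : pw n}" using that by blast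
  hence "a * a ^ n : pw (Suc n)" unfolding pwS iprod_def by(rule subsetD[OF gen_inc])
  thus ?case by simp
 qed (simp add: pw0)
 have pwP: "idl (pw n + P0)" for n by(rule rmod.ops_range_plus[OF pw idl(1)])
 \<comment> \<open>The symbolic powers of \<open>P1\<close> modulo \<open>P0\<close>, that is, the
   contractions of the powers from the localisation at \<open>P1\<close>. They are primary to
   \<open>P1\<close>, which is \<open>q_prim\<close>.\<close>
 define q where "q n = {a. EX s. s ~: P1 & s * a : pw n + P0}" for n
 have q: "idl (q n)" for n
 proof (rule rmod.ops_rangeI)
  show "0 : q n" using ops_zero[OF pwP] prmD(2)[OF P(2)] by(auto simp: q_def)
  fix a b assume "a : q n" "b : q n"
  then obtain s t where st: "s ~: P1" "s * a : pw n + P0" "t ~: P1" "t * b : pw n + P0" by(auto simp: q_def)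
  have "(s * t) * (a + b) = t * (s * a) + s * (t * b)" by(simp add: algebra_simps)
  also have "... : pw n + P0" by(rule ops_add[OF pwP idl_mult[OF pwP st(2)] idl_mult[OF pwP st(4)]])
  finally have "(s * t) * (a + b) : pw n + P0" .
  moreover have "s * t ~: P1" using st P(2) by(auto simp: prm_mult_iff)
  ultimately show "a + b : q n" unfolding q_def by blast
 next
  fix r a assume "a : q n"
  then obtain s where "s ~: P1" "s * a : pw n + P0" by(auto simp: q_def)
  thus "r * a : q n" using idl_mult[OF pwP, of "s * a" n r] by(auto simp: q_def ac_simps)
 qed
 have q_prim: "b : q n" if ab: "a * b : q n" "a ~: P1" for a b n
 proof -
  obtain s where s: "s ~: P1" "s * (a * b) : pw n + P0" using ab(1) by(auto simp: q_def)
  hence "(s * a) * b : pw n + P0" by(simp add: mult.assoc)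
  moreover have "s * a ~: P1" using s(1) ab(2) P(2) by(auto simp: prm_mult_iff)
  ultimately show ?thesis unfolding q_def by blast
 qed
 have pw_q: "pw n + P0 <= q n" for n
  using prmD(2)[OF P(2)] by(auto simp: q_def intro!: exI[of _ 1])
 have P0q: "P0 <= q n" for n using pw_q plus_ge2[OF ops_zero[OF pw]] by blast
 have Jq: "J <= q n" for n using P0q P by blast
 have q_decr: "q (Suc n) <= q n" for n
 proof -
  have "pw (Suc n) + P0 <= pw n + P0" using pw_decr by(intro set_plus_mono2) auto
  thus ?thesis by(auto simp: q_def)
 qed
 have q_decr': "q k <= q n" if "n <= k" for n k
  using that by(induction k rule: dec_induct) (use q_decr in blast)+
 have qI: "idl (q n + I0)" for n by(rule rmod.ops_range_plus[OF q I0(1)])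
 \<comment> \<open>\<open>D I\<close> says that the parts of the \<open>q n\<close> in
   \<open>I\<close> are eventually stationary modulo \<open>I0\<close> after localisation at
   \<open>P2\<close>. For \<open>I0\<close> itself this is trivial and for \<open>UNIV\<close> it is
   the aim; it does the work of the Artinian property of the localised quotient.\<close>
 define D where "D I \<longleftrightarrow> (EX n0. ALL n>=n0. ALL a:q n Int I. EX s. s ~: P2 & s * a : q (Suc n) + I0)" for I
 have "D UNIV"
 proof (rule filtration_induct[OF J I0(1)])
  show "J <= I0" using I0(2) P by auto
  have "EX s. s ~: P2 & s * a : q (Suc n) + I0" if "a : I0" for a n
   using that plus_ge2[OF ops_zero[OF q], of I0 "Suc n"] prmD(2)[OF P(3)]
   by(intro exI[of _ 1]) auto
  thus "D I0" by(auto simp: D_def)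
 next
  fix I y assume I: "idl I" "I0 <= I" "D I" "y ~: I" "prm {a. a * y : I}"
  obtain n0 where n0: "!!n a. n >= n0 ==> a : q n ==> a : I ==> EX s. s ~: P2 & s * a : q (Suc n) + I0"
   using I(3) by(auto simp: D_def)
  note I' = gi_insert[OF I(1), of y]
  show "D (gi (insert y I))"
  \<comment> \<open>If the annihilator of \<open>y\<close> modulo \<open>I\<close> is not contained
    in \<open>P2\<close>, then \<open>y\<close> lies in \<open>I\<close> after localisation at
    \<open>P2\<close>, and nothing new arises.\<close>
  proof (cases "{a. a * y : I} <= P2")
   case False
   then obtain s where s: "s ~: P2" "s * y : I" by auto
   have "EX s. s ~: P2 & s * a : q (Suc n) + I0"
    if na: "n >= n0" "a : q n" "a : gi (insert y I)" for n a
   proof -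
    obtain j r where j: "a = j + r * y" "j : I" using \<open>a : gi _\<close> unfolding I' by auto
    have "s * a = s * j + r * (s * y)" by(simp add: j algebra_simps)
    hence "s * a : I" using j s I(1) by(auto intro: ops_add idl_mult)
    then obtain t where "t ~: P2" "t * (s * a) : q (Suc n) + I0"
     using n0[OF na(1) idl_mult[OF q na(2)]] by blast
    thus ?thesis using s P(3) by(intro exI[of _ "t * s"]) (auto simp: prm_mult_iff mult.assoc)
   qed
   thus ?thesis by(auto simp: D_def)
  next
   case True
   have "I0 <= {a. a * y : I}" using I(2) idl_mult_right[OF I(1)] by auto
   hence p': "{a. a * y : I} = P2" by(rule uniq[OF I(5) _ True])
   \<comment> \<open>The annihilator of \<open>y\<close> is now \<open>P2\<close>, so adjoining
     \<open>y\<close> adds a space of dimension one over the residue field at \<open>P2\<close>.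
     Either every \<open>q n\<close> reaches it, and the coefficient of \<open>y\<close> can be
     cancelled by an element of \<open>q (Suc n)\<close>, or from some index on the elements already
     lie in \<open>I\<close>.\<close>
   define A where "A n \<longleftrightarrow> (EX j:I. EX r. r ~: P2 & j + r * y : q n)" for n
   show ?thesis
   proof (cases "ALL n. A n")
    case False
    then obtain n1 where n1: "~ A n1" by blast
    have "EX s. s ~: P2 & s * a : q (Suc n) + I0" if n: "n >= max n0 n1" and a: "a : q n" "a : gi (insert y I)" for n a
    proof -
     obtain j r where j: "a = j + r * y" "j : I" using a(2) unfolding I' by auto
     have "a : q n1" using a(1) q_decr'[of n1 n] n by auto
     hence "r : P2" using n1 j by(auto simp: A_def)
     hence "r * y : I" using p' by auto
     hence "a : I" using j ops_add[OF I(1)] by auto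
     thus ?thesis using n0[of n a] n a by auto
    qed
    thus ?thesis unfolding D_def by(intro exI[of _ "max n0 n1"]) auto
   next
    case True
    have "EX s. s ~: P2 & s * a : q (Suc n) + I0" if n: "n >= n0" and a: "a : q n" "a : gi (insert y I)" for n a
    proof -
     obtain j r where j: "a = j + r * y" "j : I" using a(2) unfolding I' by auto
     obtain j' r' where j': "j' : I" "r' ~: P2" "j' + r' * y : q (Suc n)" using True unfolding A_def by blast
     let ?b = "r' * a - r * (j' + r' * y)"
     have "?b : q n" using a(1) j'(3) q_decr by(intro ops_diff[OF q] idl_mult[OF q]) auto
     moreover have "?b = r' * j - r * j'" by(simp add: j algebra_simps)
     hence "?b : I" using j j' by(auto intro!: ops_diff[OF I(1)] idl_mult[OF I(1)])
     ultimately obtain s where s: "s ~: P2" "s * ?b : q (Suc n) + I0" using n0[OF n] by blast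
     have "(s * r) * (j' + r' * y) : q (Suc n) + I0"
      using idl_mult[OF q j'(3), of "s * r"] plus_ge1[OF ops_zero[OF I0(1)]] by blast
     hence "s * ?b + (s * r) * (j' + r' * y) : q (Suc n) + I0" by(rule ops_add[OF qI s(2)])
     also have "s * ?b + (s * r) * (j' + r' * y) = (s * r') * a" by(simp add: algebra_simps)
     finally have "(s * r') * a : q (Suc n) + I0" .
     moreover have "s * r' ~: P2" using s(1) j'(2) P(3) by(simp add: prm_mult_iff)
     ultimately show ?thesis by blast
    qed
    thus ?thesis by(auto simp: D_def)
   qed
  qed
 qed
 then obtain n where n: "!!a. a : q n ==> EX s. s ~: P2 & s * a : q (Suc n) + I0" by(auto simp: D_def)
 let ?xq = "gi {m * y |m y. m : gi {x} & y : q n}"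
 have xq: "idl (?xq + q (Suc n))" by(rule rmod.ops_range_plus[OF idl_gi q])
 \<comment> \<open>The multiple of \<open>x\<close> occurring in \<open>s * a\<close> lies in
   \<open>q n\<close>, and so does its cofactor \<open>r\<close>, because \<open>q n\<close> is
   primary and \<open>x\<close> is outside \<open>P1\<close>.\<close>
 have "EX s:- P2. s * a : ?xq + q (Suc n)" if a: "a : q n" for a
 proof -
  obtain s where s: "s ~: P2" "s * a : q (Suc n) + I0" using n[OF a] by blast
  obtain b i where bi: "s * a = b + i" "b : q (Suc n)" "i : I0" using s(2) by(rule set_plus_elim)
  obtain j r where j: "i = j + r * x" "j : P0" using bi(3) unfolding I0_eq by auto
  have bj: "b + j : q (Suc n)" using bi(2) j(2) P0q by(intro ops_add[OF q]) auto
  have "x * r = s * a - (b + j)" unfolding bi(1) j(1) by(simp add: algebra_simps)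
  also have "... : q n" using a bj q_decr by(intro ops_diff[OF q] idl_mult[OF q]) auto
  finally have "r : q n" by(rule q_prim[OF _ x1])
  moreover have "x : gi {x}" using gen_inc[of "{x}"] by auto
  ultimately have "x * r : ?xq" using gen_inc[of "{m * y |m y. m : gi {x} & y : q n}" "range (*)"] by blast
  moreover have "s * a = x * r + (b + j)" unfolding bi(1) j(1) by(simp add: algebra_simps)
  ultimately show ?thesis using s(1) bj by(auto intro!: set_plusI)
 qed
 note loc = this
 obtain F where F: "finite F" "F <= q n" "q n = gi (F Un J)" using rnoeth_fg[OF J q Jq] by blast
 have "EX s:- P2. ALL a:q n. s * a : ?xq + q (Suc n)"
  by(rule rmod.uniform_scalar[OF F(1) eq_refl[OF F(3)] F(2) J(2)
     subset_trans[OF Jq plus_ge2[OF ops_zero[OF idl_gi]]] xq _ prm_compl_mult[OF P(3)] loc])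
   (use prmD(2)[OF P(3)] in auto)
 then obtain s where s: "s : - P2" "ALL a:q n. s * a : ?xq + q (Suc n)" by blast
 have gix: "gi {x} <= P2" using x idl by(intro gen_least) auto
 have "EX s:- P2. ALL a:q n. s * a : q (Suc n)"
 proof (rule rmod.nakayama[OF F(1,2) _ q idl_gi prm_compl_mult[OF P(3)] _ s(1)])
  show "q n <= gi (F Un q (Suc n))" unfolding F(3) using Jq by(intro gen_mono) auto
  show "s - m : - P2" if "s : - P2" "m : gi {x}" for s m
   using that gix by(intro prm_compl_diff[OF P(3)]) auto
  show "s * a : ?xq + q (Suc n)" if "a : q n" for a using s(2) that by auto
 qed
 then obtain s' where s': "s' ~: P2" "ALL a:q n. s' * a : q (Suc n)" by blast
 \<comment> \<open>The denominator \<open>s'\<close> is outside \<open>P2\<close>, hence outside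
   \<open>P1\<close>, and can be cancelled in the primary ideal \<open>q (Suc n)\<close>.\<close>
 have qq: "q n <= q (Suc n)" using s' P(6) q_prim by blast
 have JE: "J <= pw n + P0" using plus_ge2[OF ops_zero[OF pw], of P0 n] P by blast
 obtain G where G: "finite G" "G <= pw n + P0" "pw n + P0 = gi (G Un J)" using rnoeth_fg[OF J pwP JE] by blast
 have "EX s:- P1. s * a : pw (Suc n) + P0" if "a : pw n + P0" for a
 proof -
  have "a : q (Suc n)" using that pw_q qq by blast
  thus ?thesis unfolding q_def by blast
 qed
 note loc1 = this
 have "EX s:- P1. ALL a:pw n + P0. s * a : pw (Suc n) + P0"
  by(rule rmod.uniform_scalar[OF G(1) eq_refl[OF G(3)] G(2) J(2)
     subset_trans[OF P(4) plus_ge2[OF ops_zero[OF pw]]] pwP _ prm_compl_mult[OF P(2)] loc1])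
   (use prmD(2)[OF P(2)] in auto)
 then obtain t where t: "t : - P1" "ALL a:pw n + P0. t * a : pw (Suc n) + P0" by blast
 \<comment> \<open>Near \<open>P1\<close> the ordinary power \<open>pw n\<close> is contained in
   \<open>P1\<close> times itself modulo \<open>P0\<close>, so Nakayama makes it vanish
   there.\<close>
 have "EX s:- P1. ALL a:pw n + P0. s * a : P0"
 proof (rule rmod.nakayama[OF G(1,2) _ idl(1) idl(2) prm_compl_mult[OF P(2)] prm_compl_diff[OF P(2)] t(1)])
  show "pw n + P0 <= gi (G Un P0)" unfolding G(3) using P(4) by(intro gen_mono) auto
  have "pw n <= pw n + P0" by(rule plus_ge1[OF ops_zero[OF idl(1)]])
  hence "pw (Suc n) <= gi {m * y |m y. m : P1 & y : pw n + P0}"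
   unfolding pwS iprod_def by(intro gen_mono) blast
  hence "pw (Suc n) + P0 <= gi {m * y |m y. m : P1 & y : pw n + P0} + P0"
   by(intro set_plus_mono2) auto
  thus "t * a : gi {m * y |m y. m : P1 & y : pw n + P0} + P0" if "a : pw n + P0" for a
   using t(2) that by blast
 qed auto
 then obtain u where u: "u ~: P1" "ALL a:pw n + P0. u * a : P0" by blast
 have "P1 <= P0"
 proof
  fix a assume "a : P1"
  hence "a ^ n : pw n + P0" using pw_power plus_ge1[OF ops_zero[OF idl(1)]] by blast
  hence "u * a ^ n : P0" using u by blast
  moreover have "u ~: P0" using u P by blast
  ultimately show "a : P0" using prmD(3)[OF P(1)] prm_power[OF P(1)] by blast
 qed
 thus False using P by blast
qed

section \<open>Chains of primes and regular systems of parameters\<close>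

definition pchain :: "'p::comm_ring_1 set => nat => (nat => 'p set) => bool" where
 "pchain J k C \<longleftrightarrow> (ALL i<=k. prm (C i) & J <= C i) & (ALL i<k. C i \<subset> C (Suc i))"

lemma pchain_prm: "pchain J k C ==> i <= k ==> prm (C i)" "pchain J k C ==> i <= k ==> J <= C i"
 by(auto simp: pchain_def)

lemma pchain_less: "pchain J k C ==> i < k ==> C i \<subset> C (Suc i)"
 by(auto simp: pchain_def)

lemma pchain_mono: "pchain J k C ==> i <= j ==> j <= k ==> C i <= C j"
proof (induction j)
 case (Suc j)
 thus ?case using pchain_less[of J k C j] by(cases "i = Suc j") (auto simp: le_Suc_eq)
qed auto

text \<open>Krull's theorem replaces the last but one prime by one that contains \<open>x\<close>
  and keeps its neighbours in order. Repeating this down the chain moves \<open>x\<close> into the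
  second prime; without its first member the chain then survives division by
  \<open>x\<close>.\<close>

lemma chain_through:
 assumes J: "rnoeth J" "idl J" and "pchain J (Suc k) C" "x : C (Suc k)"
 shows "EX C'. pchain J (Suc k) C' & C' 0 = C 0 & C' (Suc k) = C (Suc k) & x : C' 1"
 using assms(3-)
proof (induction k arbitrary: C)
 case 0 thus ?case by(intro exI[of _ C]) auto
next
 case (Suc k)
 note C = pchain_prm[OF Suc.prems(1)] pchain_less[OF Suc.prems(1)]
 obtain P where P: "prm P" "C k \<subset> P" "P \<subset> C (Suc (Suc k))" "x : P"
  using krull_principal_ideal[OF J, of "C k" "C (Suc k)" "C (Suc (Suc k))" x] C Suc.prems(2) by auto
 have "pchain J (Suc k) (C(Suc k := P))"
  using Suc.prems(1) P subset_trans[OF C(2)[of k] psubset_imp_subset[OF P(2)]] by(auto simp: pchain_def)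
 from Suc.IH[OF this] P(4) obtain D where D: "pchain J (Suc k) D" "D 0 = C 0" "D (Suc k) = P" "x : D 1"
  by auto
 have "pchain J (Suc (Suc k)) (D(Suc (Suc k) := C (Suc (Suc k))))"
  using D(1,3) P C(1,2)[of "Suc (Suc k)"] by(auto simp: pchain_def le_Suc_eq less_Suc_eq)
 moreover have "(D(Suc (Suc k) := C (Suc (Suc k)))) 0 = C 0" "x : (D(Suc (Suc k) := C (Suc (Suc k)))) 1"
  "(D(Suc (Suc k) := C (Suc (Suc k)))) (Suc (Suc k)) = C (Suc (Suc k))" using D by simp_all
 ultimately show ?case by blast
qed

lemma pchain_shift:
 assumes C: "pchain J (Suc k) C" and x: "x : C 1"
 shows "pchain (gi (insert x J)) k (%i. C (Suc i))"
proof -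
 have "gi (insert x J) <= C (Suc i)" if "i <= k" for i
  using pchain_mono[OF C, of 1 "Suc i"] x pchain_prm[OF C, of "Suc i"] that prmD(1)
  by(intro gen_least) auto
 thus ?thesis using C by(auto simp: pchain_def)
qed

lemma gi_insert_Un: "gi (gi (insert x J) Un F) = gi (J Un insert x F)"
proof
 show "gi (gi (insert x J) Un F) <= gi (J Un insert x F)"
  using gen_mono[of "insert x J" "J Un insert x F" "range (*)"] gen_inc[of "J Un insert x F" "range (*)"]
  by(intro gen_least idl_gi) auto
 show "gi (J Un insert x F) <= gi (gi (insert x J) Un F)"
  using gen_inc[of "insert x J" "range (*)"] gen_inc[of "gi (insert x J) Un F" "range (*)"]
  by(intro gen_least idl_gi) auto
qed

lemma subset_gi_insert: "J <= gi (insert x J)"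
 using gen_inc[of "insert x J" "range (*)"] by auto

text \<open>The height theorem. Dividing by one generator shortens the chain by at most one, since
  \<open>chain_through\<close> moves that generator into all primes but the first.\<close>

lemma dim_bound:
 assumes "rnoeth J" "idl J" "pchain J k C" "C k = gi (J Un set xs)"
 shows "k <= length xs"
 using assms
proof (induction xs arbitrary: J k C)
 case Nil
 show ?case
 proof (cases k)
  case (Suc k')
  have "C k <= J" using Nil.prems(2,4) by(simp add: gen_opsub)
  thus ?thesis
   using pchain_prm(2)[OF Nil.prems(3), of k'] pchain_less[OF Nil.prems(3), of k'] Suc by auto
 qed simp
next
 case (Cons x xs)
 show ?case
 proof (cases k)
  case (Suc k')
  have "x : C k" unfolding Cons.prems(4) using gen_inc[of "J Un set (x # xs)" "range (*)"] by auto
  then obtain C' where C': "pchain J (Suc k') C'" "C' (Suc k') = C (Suc k')" "x : C' 1"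
   using chain_through[OF Cons.prems(1,2)] Cons.prems(3) Suc by blast
  have "k' <= length xs"
   by(rule Cons.IH[OF rnoeth_mono[OF Cons.prems(1,2) idl_gi subset_gi_insert] idl_gi pchain_shift[OF C'(1,3)]])
    (use Cons.prems(4) C'(2) Suc in \<open>simp add: gi_insert_Un\<close>)
  thus ?thesis using Suc by simp
 qed simp
qed

text \<open>Stronger than regularity of the sequence: every partial quotient is a domain. Minimal
  generators of the maximal ideal of a regular local ring have this property, and the induction for
  syzygies runs along it.\<close>

fun regp :: "'p::comm_ring_1 set => 'p list => bool" where
 "regp J [] = prm J"
| "regp J (x # xs) = (prm J & x ~: J & regp (gi (insert x J)) xs)"

text \<open>The ring modulo \<open>J\<close> is local with maximal ideal \<open>\<nn>\<close>;
  locality is expressed by invertibility modulo \<open>J\<close>.\<close>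

definition lcl :: "'p::comm_ring_1 set => 'p set => bool" where
 "lcl J \<nn> \<longleftrightarrow> idl \<nn> & J <= \<nn> & 1 ~: \<nn> & (ALL a. a ~: \<nn> --> (EX b. a * b - 1 : J))"

lemma lcl_prm:
 assumes "lcl J \<nn>" shows "prm \<nn>"
proof -
 have nn: "idl \<nn>" "J <= \<nn>" "1 ~: \<nn>" "!!a. a ~: \<nn> ==> EX b. a * b - 1 : J" using assms by(auto simp: lcl_def)
 have "a * b : \<nn> ==> a : \<nn> | b : \<nn>" for a b
 proof (rule ccontr)
  assume ab: "a * b : \<nn>" and "~ (a : \<nn> | b : \<nn>)"
  then obtain c d where cd: "a * c - 1 : \<nn>" "b * d - 1 : \<nn>" using nn(2,4) by blast
  have "1 = (c * d) * (a * b) - (b * d) * (a * c - 1) - (b * d - 1)" by(simp add: algebra_simps)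
  also have "... : \<nn>" by(intro ops_diff[OF nn(1)] idl_mult[OF nn(1)] ab cd)
  finally show False using nn(3) by simp
 qed
 thus ?thesis using nn by(auto simp: prm_def)
qed

lemma (in smod) lcl_unit:
 assumes "lcl J \<nn>" "s ~: \<nn>" "ops (range sc) U" "sc s x : U" "!!a. a : J ==> sc a x : U"
 shows "x : U"
proof -
 obtain b where b: "s * b - 1 : J" using assms(1,2) by(auto simp: lcl_def)
 have "sc b (sc s x) - sc (s * b - 1) x : U"
  by(intro ops_diff[OF assms(3)] ops_sc[OF assms(3)] assms(4,5) b)
 thus ?thesis by(simp add: sc_diff_left sc_sc sc_1 mult.commute)
qed

lemma lcl_nakayama:
 assumes J: "rnoeth J" "idl J" and n: "lcl J \<nn>" and E: "idl E" "J <= E" "!!x. x : E ==> x : iprod \<nn> E + J"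
 shows "E <= J"
proof -
 obtain F where F: "finite F" "F <= E" "E = gi (F Un J)" using rnoeth_fg[OF J E(1,2)] by blast
 note p = lcl_prm[OF n]
 have "EX s:- \<nn>. ALL x:E. s * x : J"
  by(rule rmod.nakayama[OF F(1,2) _ J(2) prmD(1)[OF p] prm_compl_mult[OF p] prm_compl_diff[OF p], of 1])
   (use F(3) prmD(2)[OF p] E(3) in \<open>auto simp: iprod_def\<close>)
 thus ?thesis using rmod.lcl_unit[OF n _ J(2)] idl_mult_right[OF J(2)] by blast
qed

lemma lcl_mono: "lcl J \<nn> ==> J <= J' ==> J' <= \<nn> ==> lcl J' \<nn>"
 unfolding lcl_def by(meson subsetD)

text \<open>By induction J + (x) is prime. A chain with \<open>x\<close> in its second member must
  have \<open>x\<close> outside \<open>D 0\<close> and J + (x) as \<open>D 1\<close>, since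
  otherwise it would be too long for the remaining generators. Then \<open>D 0\<close> is contained
  in \<open>x\<close> times itself modulo \<open>J\<close>, and Nakayama gives
  \<open>D 0 = J\<close>.\<close>

theorem regular_imp_regp:
 assumes "rnoeth J" "idl J" "lcl J \<nn>" "\<nn> = gi (J Un set xs)" "pchain J (length xs) C" "C (length xs) = \<nn>"
 shows "regp J xs"
 using assms
proof (induction xs arbitrary: J C)
 case Nil
 hence "C 0 = J" by(simp add: gen_opsub)
 thus ?case using pchain_prm(1)[OF Nil.prems(5), of 0] by simp
next
 case (Cons x ys)
 let ?J = "gi (insert x J)" and ?k = "length ys"
 note J = Cons.prems(1,2)
 have nn: "idl \<nn>" using Cons.prems(3) by(simp add: lcl_def)
 have x: "x : \<nn>" "J <= \<nn>"
  unfolding Cons.prems(4) using gen_inc[of "J Un set (x # ys)" "range (*)"] by auto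
 have J': "rnoeth ?J" "idl ?J" by(rule rnoeth_mono[OF J idl_gi subset_gi_insert]) (rule idl_gi)
 have nn': "\<nn> = gi (?J Un set ys)" using Cons.prems(4) by(simp add: gi_insert_Un)
 have lcl': "lcl ?J \<nn>"
  by(rule lcl_mono[OF Cons.prems(3) subset_gi_insert gen_least[OF nn]]) (use x in auto)
 obtain D where D: "pchain J (Suc ?k) D" "D (Suc ?k) = \<nn>" "x : D 1"
  using chain_through[OF J, of ?k C x] Cons.prems(5,6) x by auto
 note Dp = pchain_prm[OF D(1)]
 have reg: "regp ?J ys"
  by(rule Cons.IH[OF J' lcl' nn' pchain_shift[OF D(1,3)] D(2)])
 hence pJ': "prm ?J" by(cases ys) auto
 have x0: "x ~: D 0"
 proof
  assume x0: "x : D 0"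
  have "?J <= D i" if "i <= Suc ?k" for i
   using pchain_mono[OF D(1), of 0 i] that x0 Dp by(intro gen_least prmD(1)) auto
  hence "pchain ?J (Suc ?k) D" using D(1) by(auto simp: pchain_def)
  from dim_bound[OF J' this, of ys] show False using D(2) nn' by simp
 qed
 have J'D1: "?J <= D 1" using Dp[of 1] D(3) by(intro gen_least prmD(1)) auto
 have D1: "D 1 = ?J"
 proof (rule ccontr)
  assume ne: "D 1 \<noteq> ?J"
  \<comment> \<open>If \<open>D 1\<close> were strictly larger than the prime \<open>?J\<close>,
    putting \<open>?J\<close> below it would give a chain of length \<open>Suc ?k\<close> over
    \<open>?J\<close>, although \<open>?k\<close> further generators reach the top.\<close>
  define D' where "D' = D(0 := ?J)"
  have "pchain ?J (Suc ?k) D'"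
   unfolding pchain_def
  proof (intro conjI allI impI)
   fix i assume i: "i <= Suc ?k"
   show "prm (D' i)" using pJ' Dp(1)[OF i] by(simp add: D'_def)
   show "?J <= D' i" using pchain_mono[OF D(1), of 1 i] i J'D1 by(cases i) (auto simp: D'_def)
  next
   fix i assume i: "i < Suc ?k"
   show "D' i \<subset> D' (Suc i)" using pchain_less[OF D(1) i] J'D1 ne by(cases i) (auto simp: D'_def)
  qed
  from dim_bound[OF J' this, of ys] show False using D(2) nn' by(simp add: D'_def)
 qed
 have D0: "idl (D 0)" "J <= D 0" using Dp[of 0] prmD(1) by auto
 have "D 0 <= J"
 proof (rule lcl_nakayama[OF J Cons.prems(3) D0])
  fix a assume a: "a : D 0"
  hence "a : ?J" using pchain_less[OF D(1), of 0] D1 by auto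
  then obtain j r where j: "a = j + r * x" "j : J" unfolding gi_insert[OF J(2)] by auto
  have "r * x = a - j" using j by simp
  hence "r * x : D 0" using a j(2) D0 ops_diff[OF D0(1)] by auto
  hence "r : D 0" using prmD(3)[OF Dp(1)[of 0]] x0 by auto
  hence "x * r : iprod \<nn> (D 0)" unfolding iprod_def using x(1) by(intro subsetD[OF gen_inc]) blast
  thus "a : iprod \<nn> (D 0) + J" using j by(intro set_plusI[of _ "x * r" j]) (auto simp: algebra_simps)
 qed
 hence "D 0 = J" using D0 by auto
 thus ?case using reg x0 Dp(1)[of 0] by simp
qed

section \<open>Linear maps between free modules\<close>

declare smul_apply [simp del]
declare minus_fun_apply' [simp del]
declare uminus_fun_apply' [simp del]

text \<open>A linear map is total on the function type; only its restriction to some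
  \<open>Vs B\<close> carries information.\<close>

definition lin :: "(('x => 'p::comm_ring_1) => ('y => 'p)) => bool" where
 "lin f \<longleftrightarrow> addm f & (ALL a v. f (a *s v) = a *s f v)"

lemma linD: "lin f ==> addm f" "lin f ==> f (a *s v) = a *s f v"
 by(simp_all add: lin_def)

lemma lin_simps: "lin f ==> f (u + v) = f u + f v" "lin f ==> f (u - v) = f u - f v"
 "lin f ==> f (sum g S) = (SUM x:S. f (g x))" "lin f ==> f 0 = 0" "lin f ==> f (- v) = - f v"
 by(simp_all add: addmD addm_diff addm_sum addm_zero addm_minus linD)

lemma lin_id: "lin (%v. v)" and lin_comp: "lin f ==> lin g ==> lin (%v. f (g v))"
 and lin_zero: "lin (%v. 0)" and lin_add: "lin f ==> lin h ==> lin (%v. f v + h v)"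
 and lin_diff: "lin f ==> lin h ==> lin (%v. f v - h v)"
 and lin_smul: "lin f ==> lin (%v. a *s f v)"
 by(auto simp: lin_def addm_def vmod.sc_add vmod.sc_diff vmod.sc_commute algebra_simps)

lemma lin_sum: "(!!i. i : S ==> lin (f i)) ==> lin (%v. SUM i:S. f i v)"
 by(induction S rule: infinite_finite_induct) (simp_all add: lin_zero lin_add)

definition ev :: "'x => 'x => 'p::comm_ring_1" where
 "ev x = (%y. if y = x then 1 else 0)"

definition ext :: "'x set => ('x => 'y => 'p::comm_ring_1) => ('x => 'p) => 'y => 'p" where
 "ext B g v = (SUM x:B. v x *s g x)"

lemma lin_ext: "lin (ext B g)"
 by(simp add: lin_def addm_def ext_def vmod.sc_plus sum.distrib vmod.sc_sum vmod.sc_sc smul_apply)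

lemma ext_ev: "finite B ==> x : B ==> ext B g (ev x) = g x"
proof -
 assume "finite B" "x : B"
 have "ext B g (ev x) = (SUM y:B. if y = x then g x else 0)"
  unfolding ext_def by(rule sum.cong) (auto simp: ev_def vmod.sc_1)
 thus ?thesis using \<open>finite B\<close> \<open>x : B\<close> by simp
qed

lemma ev_Vs: "x : B ==> ev x : Vs B"
 by(auto simp: ev_def Vs_def)

lemma Vs_expand: "finite B ==> v : Vs B ==> v = (SUM x:B. v x *s ev x)"
proof
 fix y assume B: "finite B" and v: "v : Vs B"
 have "(SUM x:B. v x *s ev x) y = (SUM x:B. if x = y then v y else 0)"
  unfolding sum_fun_apply by(rule sum.cong) (auto simp: ev_def smul_apply)
 thus "v y = (SUM x:B. v x *s ev x) y" using B v by(auto simp: Vs_def)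
qed

lemma lin_expand: "finite B ==> lin f ==> v : Vs B ==> f v = (SUM x:B. v x *s f (ev x))"
 using Vs_expand[of B v] by(metis (no_types, lifting) lin_simps(3) linD(2) sum.cong)

lemma smd_smul: "smd U ==> v : U ==> a *s v : U"
 by(rule vmod.ops_sc)

lemma lin_mem: "finite B ==> lin f ==> smd U ==> (!!x. x : B ==> f (ev x) : U) ==> v : Vs B ==> f v : U"
 using lin_expand[of B f v] by(auto intro!: ops_sum smd_smul)

lemma smul_JV: "idl J ==> a : J ==> a *s v : JV J"
 by(auto simp: JV_def smul_apply intro: idl_mult_right)

lemma smd_kernel:
 assumes "lin f" "smd W" "smd U" shows "smd {v : W. f v : U}"
proof -
 have "smd {v. f v : U}"
  by(rule ops_vimage[OF assms(3) linD(1)[OF assms(1)]])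
   (auto simp: linD(2)[OF assms(1)] intro: smd_smul[OF assms(3)])
 from ops_Int[OF assms(2) this] show ?thesis by(simp add: Int_def)
qed

lemma lin_JV: "finite B ==> lin f ==> idl J ==> v : Vs B ==> v : JV J ==> f v : JV J"
 unfolding lin_expand[of B f v]
 by(intro ops_sum[OF smd_JV] smul_JV) (auto simp: JV_def[of J])

text \<open>Projectivity of free modules, modulo \<open>Z\<close>: preimages are chosen on basis
  vectors. All values of \<open>h\<close> lie in \<open>W\<close>, because \<open>h\<close> is built
  as \<open>ext B w\<close> and ignores coordinates outside \<open>B\<close>.\<close>

lemma lin_lift:
 assumes B: "finite B" and f: "lin f" and g: "lin g" and W: "smd W" and Z: "smd Z"
  and ex: "!!x. x : B ==> EX w:W. f (ev x) - g w : Z"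
 shows "EX h. lin h & (ALL v. h v : W) & (ALL v:Vs B. f v - g (h v) : Z)"
proof -
 obtain w where w: "!!x. x : B ==> w x : W & f (ev x) - g (w x) : Z" using ex by metis
 have "ext B w v : W" for v
  unfolding ext_def using w by(intro ops_sum[OF W] smd_smul[OF W]) auto
 moreover have "f v - g (ext B w v) : Z" if "v : Vs B" for v
  by(rule lin_mem[OF B lin_diff[OF f lin_comp[OF g lin_ext]] Z _ that]) (simp add: ext_ev[OF B] w)
 ultimately show ?thesis using lin_ext by blast
qed

text \<open>Repeated values in the family are handled by giving all the weight to one index for each
  value.\<close>

lemma (in smod) gen_family:
 assumes F: "finite F" and U: "ops (range sc) U" and x: "x : gen (range sc) (z ` F Un U)"
 shows "EX a. x - (SUM i:F. sc (a i) (z i)) : U"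
proof -
 obtain b where b: "x - (SUM g:z ` F. sc (b g) g) : U" using gen_finite[OF _ U x] F by blast
 have "EX G<=F. inj_on z G & z ` G = z ` F" using iffD1[OF subset_image_inj order_refl[of "z ` F"]] by metis
 then obtain G where G: "G <= F" "inj_on z G" "z ` G = z ` F" by blast
 have "(SUM g:z ` F. sc (b g) g) = (SUM i:G. sc (b (z i)) (z i))"
  unfolding G(3)[symmetric] by(simp add: sum.reindex[OF G(2)])
 also have "... = (SUM i:F. sc (if i : G then b (z i) else 0) (z i))"
  using G(1) F by(intro sum.mono_neutral_cong_left) auto
 finally show ?thesis using b by(intro exI[of _ "%i. if i : G then b (z i) else 0"]) auto
qed

lemma lcl_nakayama_vec:
 assumes J: "rnoeth J" "idl J" and n: "lcl J \<nn>" and B: "finite B"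
  and E: "smd E" "JV J <= E" "E <= Vs B + JV J" and U: "smd U" "JV J <= U"
  and x: "!!x. x : E ==> x : gen (range smul) {m *s y |m y. m : \<nn> & y : E} + U"
 shows "E <= U"
proof -
 obtain F where F: "finite F" "F <= E" "E <= gen (range smul) (F Un JV J)"
  using opnoethD[OF noeth_vectors[OF J(2,1) B] E] by blast
 have "gen (range smul) (F Un JV J) <= gen (range smul) (F Un U)" using U by(intro gen_mono) auto
 hence F': "E <= gen (range smul) (F Un U)" using F(3) by blast
 note p = lcl_prm[OF n]
 have "EX s:- \<nn>. ALL x:E. s *s x : U"
  by(rule vmod.nakayama[OF F(1,2) F' U(1) prmD(1)[OF p] prm_compl_mult[OF p] prm_compl_diff[OF p], of 1])
   (use prmD(2)[OF p] x in \<open>auto simp: vmod.sc_1\<close>)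
 thus ?thesis using vmod.lcl_unit[OF n _ U(1)] smul_JV[OF J(2)] U(2) by blast
qed

lemma plus_JV:
 assumes "idl J" "smd Z" "Z <= Vs B"
 shows "smd (Z + JV J)" "JV J <= Z + JV J" "Z + JV J <= Vs B + JV J" "Z <= Z + JV J"
 by(rule vmod.ops_range_plus[OF assms(2) smd_JV[OF assms(1)]] plus_ge2[OF ops_zero[OF assms(2)]]
   set_plus_mono2[OF assms(3) order_refl] plus_ge1[OF ops_zero[OF smd_JV[OF assms(1)]]])+

section \<open>Syzygies over a regular local ring are free\<close>

text \<open>The image of \<open>Z\<close> in the vectors over the ring modulo \<open>J\<close> is
  free on the classes of \<open>z 0\<close>, ..., \<open>z (r - 1)\<close>.\<close>

definition free_basis :: "'p::comm_ring_1 set => ('x => 'p) set => nat => (nat => 'x => 'p) => bool" where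
 "free_basis J Z r z \<longleftrightarrow> (ALL s<r. z s : Z) & (ALL v:Z. EX c. v - (SUM s<r. c s *s z s) : JV J) &
   (ALL c. (SUM s<r. c s *s z s) : JV J --> (ALL s<r. c s : J))"

text \<open>Modulo \<open>J\<close> the ring is a field. A generating family of least length is
  independent: in a relation with a coefficient outside \<open>J\<close>, one member can be
  expressed through the others and dropped.\<close>

lemma free_basis_field:
 fixes Z :: "('x => 'p::comm_ring_1) set"
 assumes J: "rnoeth J" "idl J" and n: "lcl J J" and B: "finite B" and Z: "smd Z" "Z <= Vs B"
 shows "EX r z. free_basis J Z r z"
proof -
 define P where "P (r::nat) \<longleftrightarrow> (EX z. z ` {..<r} <= Z & Z <= gen (range smul) (z ` {..<r} Un JV J))" for r
 have "EX r. P r"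
 proof -
  obtain F where F: "finite F" "F <= Z + JV J" "Z + JV J <= gen (range smul) (F Un JV J)"
   using opnoethD[OF noeth_vectors[OF J(2,1) B] plus_JV(1-3)[OF J(2) Z]] by blast
  have "ALL f:F. EX g:Z. f - g : JV J"
  proof
   fix f assume "f : F"
   hence "f : Z + JV J" using F(2) by auto
   then obtain g j where "f = g + j" "g : Z" "j : JV J" by(rule set_plus_elim)
   thus "EX g:Z. f - g : JV J" by(intro bexI[of _ g]) auto
  qed
  hence "ALL f:F. EX g. g : Z & f - g : JV J" by blast
  from bchoice[OF this] obtain g where g: "ALL f:F. g f : Z & f - g f : JV J" ..
  obtain h where h: "bij_betw h {0..<card F} F" using ex_bij_betw_nat_finite[OF F(1)] by blast
  let ?z = "%i. g (h i)"
  have "?z ` {..<card F} = g ` h ` {0..<card F}" by(simp add: image_image lessThan_atLeast0)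
  hence im: "?z ` {..<card F} = g ` F" using bij_betw_imp_surj_on[OF h] by simp
  have G: "smd (gen (range smul) (g ` F Un JV J))" by(rule ops_gen)
  have "F Un JV J <= gen (range smul) (g ` F Un JV J)"
  proof
   fix f assume f: "f : F Un JV J"
   show "f : gen (range smul) (g ` F Un JV J)"
   proof (cases "f : F")
    case True
    hence "g f + (f - g f) : gen (range smul) (g ` F Un JV J)"
     using g by(intro ops_add[OF G] subsetD[OF gen_inc]) auto
    thus ?thesis by simp
   next
    case False
    thus ?thesis using f by(intro subsetD[OF gen_inc]) auto
   qed
  qed
  hence "gen (range smul) (F Un JV J) <= gen (range smul) (g ` F Un JV J)" by(rule gen_least[OF G])
  moreover have "Z <= Z + JV J" by(rule plus_ge1[OF ops_zero[OF smd_JV[OF J(2)]]])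
  ultimately have "Z <= gen (range smul) (?z ` {..<card F} Un JV J)" unfolding im using F(3) by blast
  moreover have "?z ` {..<card F} <= Z" unfolding im using g by auto
  ultimately have "P (card F)" unfolding P_def by(intro exI[of _ ?z] conjI)
  thus ?thesis ..
 qed
 define r where "r = (LEAST r. P r)"
 have "P r" unfolding r_def using \<open>EX r. P r\<close> by(rule LeastI_ex)
 then obtain z where z: "z ` {..<r} <= Z" "Z <= gen (range smul) (z ` {..<r} Un JV J)" by(auto simp: P_def)
 have indep: "c s : J" if c: "(SUM s<r. c s *s z s) : JV J" and s: "s < r" for c s
 proof (rule ccontr)
  assume "c s ~: J"
  \<comment> \<open>The last member is moved to position \<open>s\<close>, so that the remaining
    ones are indexed by the numbers below \<open>r - 1\<close>.\<close>
  define z' where "z' = z(s := z (r - 1))"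
  define G where "G = gen (range smul) (z' ` {..<r - 1} Un JV J)"
  have G: "smd G" unfolding G_def by(rule ops_gen)
  have JG: "JV J <= G" unfolding G_def using gen_inc[of "z' ` {..<r - 1} Un JV J" "range smul"] by simp
  have zG: "z i : G" if "i < r" "i \<noteq> s" for i
  proof -
   have "EX k<r - 1. z' k = z i"
    using that s by(intro exI[of _ "if i = r - 1 then s else i"]) (auto simp: z'_def)
   hence "z i : z' ` {..<r - 1}" by(metis imageI lessThan_iff)
   thus ?thesis unfolding G_def by(intro subsetD[OF gen_inc]) auto
  qed
  have "(SUM i<r. c i *s z i) = c s *s z s + (SUM i:{..<r} - {s}. c i *s z i)"
   using s by(simp add: sum.remove)
  hence "c s *s z s = (SUM i<r. c i *s z i) - (SUM i:{..<r} - {s}. c i *s z i)" by simp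
  also have "... : G"
   by(rule ops_diff[OF G subsetD[OF JG c]]) (auto intro!: ops_sum[OF G] smd_smul[OF G] zG)
  finally have "z s : G"
   using vmod.lcl_unit[OF n \<open>c s ~: J\<close> G] smul_JV[OF J(2)] JG by blast
  hence "z ` {..<r} <= G" using zG by(metis image_subsetI lessThan_iff)
  hence "Z <= G" using z(2) gen_least[OF G, of "z ` {..<r} Un JV J"] JG by blast
  moreover have "z' ` {..<r - 1} <= Z" using z(1) s by(auto simp: z'_def)
  ultimately have "P (r - 1)" unfolding P_def G_def by blast
  hence "r <= r - 1" unfolding r_def by(rule Least_le)
  thus False using s by simp
 qed
 have "EX c. v - (SUM s<r. c s *s z s) : JV J" if "v : Z" for v
  using vmod.gen_family[OF _ smd_JV[OF J(2)], of "{..<r}" v z] z(2) that by auto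
 hence "free_basis J Z r z" using z(1) indep unfolding free_basis_def by auto
 thus ?thesis by blast
qed

lemma JV_gi_insert:
 assumes J: "idl J" and v: "v : JV (gi (insert x J))"
 shows "EX u. v - x *s u : JV J & (ALL B. v : Vs B --> u : Vs B)"
proof -
 have "ALL i. EX r. v i - x * r : J & (v i = 0 --> r = 0)"
 proof
  fix i
  have "v i : {j + r * x |j r. j : J}" using v gi_insert[OF J] by(auto simp: JV_def)
  then obtain j r where "v i = j + r * x" "j : J" by auto
  thus "EX r. v i - x * r : J & (v i = 0 --> r = 0)"
   using ops_zero[OF J] by(cases "v i = 0") (auto intro: exI[of _ r] exI[of _ 0] simp: mult.commute)
 qed
 then obtain u where "ALL i. v i - x * u i : J & (v i = 0 --> u i = 0)" by metis
 thus ?thesis by(intro exI[of _ u]) (auto simp: JV_def Vs_def smul_apply)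
qed

lemma smul_regular: "prm J ==> x ~: J ==> x *s v : JV J ==> v : JV J"
 by(auto simp: JV_def smul_apply dest: prmD(3))

lemma JV_mono: "J <= J' ==> JV J <= JV J'"
 by(auto simp: JV_def)

text \<open>A basis of the reduction of \<open>Z\<close> modulo \<open>x\<close> lifts. Nakayama
  shows that the lifts span and, applied to their relations, that they are independent. In both
  cases a factor \<open>x\<close> is cancelled: \<open>x\<close> is regular modulo \<open>J\<close>,
  and \<open>Z\<close> is saturated with respect to \<open>x\<close>.\<close>

lemma syzygy_free_lift:
 assumes J: "rnoeth J" "idl J" "prm J" "x ~: J" and n: "lcl J \<nn>" "x : \<nn>" and B: "finite B"
  and Z: "smd Z" "Z <= Vs B" and reg: "!!y j. y : Vs B ==> j : JV J ==> x *s y + j : Z ==> y : Z"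
  and basis: "free_basis (gi (insert x J)) Z' r z'"
  and Z': "Z <= Z'" "!!v. v : Z' ==> EX w. v - x *s w : Z"
 shows "EX z. free_basis J Z r z"
proof -
 let ?J = "gi (insert x J)"
 have JJ: "J <= ?J" "x : ?J" using gen_inc[of "insert x J" "range (*)"] by auto
 have xJV: "x *s w : JV ?J" for w by(rule smul_JV[OF idl_gi JJ(2)])
 have b1: "!!s. s < r ==> z' s : Z'" and b2: "!!v. v : Z' ==> EX c. v - (SUM s<r. c s *s z' s) : JV ?J"
  and b3: "!!c s. (SUM s<r. c s *s z' s) : JV ?J ==> s < r ==> c s : ?J"
  using basis by(auto simp: free_basis_def)
 have "ALL s. EX w. s < r --> z' s - x *s w : Z" using b1 Z'(2) by blast
 then obtain w where w: "!!s. s < r ==> z' s - x *s w s : Z" by metis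
 define z where "z s = z' s - x *s w s" for s
 have zZ: "z s : Z" if "s < r" for s using w[OF that] by(simp add: z_def)
 have JVs: "smd (JV J :: ('b => 'a) set)" "smd (JV ?J :: ('b => 'a) set)" by(rule smd_JV[OF J(2)] smd_JV[OF idl_gi])+
 have zz': "(SUM s<r. c s *s z' s) - (SUM s<r. c s *s z s) : JV ?J" for c
  unfolding sum_subtractf[symmetric] vmod.sc_diff[symmetric]
  by(intro ops_sum[OF JVs(2)] smd_smul[OF JVs(2)]) (simp add: z_def xJV)
 have sumZ: "(SUM s<r. c s *s z s) : Z" for c using zZ by(intro ops_sum[OF Z(1)] smd_smul[OF Z(1)]) auto
 define U where "U = gen (range smul) (z ` {..<r} Un JV J)"
 have U: "smd U" "z ` {..<r} Un JV J <= U" unfolding U_def by(rule ops_gen gen_inc)+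
 note ZJ = plus_JV[OF J(2) Z]
 have "Z + JV J <= U"
 proof (rule lcl_nakayama_vec[OF J(1,2) n(1) B ZJ(1-3) U(1)])
  show "JV J <= U" using U(2) by auto
  fix e assume "e : Z + JV J"
  then obtain v j where vj: "e = v + j" "v : Z" "j : JV J" by(rule set_plus_elim)
  obtain c where "v - (SUM s<r. c s *s z' s) : JV ?J" using b2 vj(2) Z'(1) by blast
  from ops_add[OF JVs(2) this zz'[of c]] have *: "v - (SUM s<r. c s *s z s) : JV ?J" by(simp add: algebra_simps)
  have vZ: "v - (SUM s<r. c s *s z s) : Z" by(rule ops_diff[OF Z(1) vj(2) sumZ])
  obtain y where y: "(v - (SUM s<r. c s *s z s)) - x *s y : JV J" "y : Vs B"
   using JV_gi_insert[OF J(2) *] vZ Z(2) by blast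
  have "x *s y + ((v - (SUM s<r. c s *s z s)) - x *s y) : Z" using vZ by simp
  hence yZ: "y : Z" by(rule reg[OF y(2,1)])
  have "x *s y : gen (range smul) {m *s y |m y. m : \<nn> & y : Z + JV J}"
   using n(2) yZ ZJ(4) by(intro subsetD[OF gen_inc]) blast
  moreover have "(SUM s<r. c s *s z s) + ((v - (SUM s<r. c s *s z s)) - x *s y) + j : U"
   using U(2) y(1) vj(3) by(intro ops_add[OF U(1)] ops_sum[OF U(1)] smd_smul[OF U(1)]) auto
  moreover have "e = x *s y + ((SUM s<r. c s *s z s) + ((v - (SUM s<r. c s *s z s)) - x *s y) + j)"
   by(simp add: vj(1))
  ultimately show "e : gen (range smul) {m *s y |m y. m : \<nn> & y : Z + JV J} + U"
   by(intro set_plusI)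
 qed
 hence span: "EX c. v - (SUM s<r. c s *s z s) : JV J" if "v : Z" for v
  using vmod.gen_family[OF _ JVs(1), of "{..<r}" v z] that ZJ(4) unfolding U_def by blast
 \<comment> \<open>Modulo \<open>x\<close> the coefficients of a relation vanish, so a relation is
   \<open>x\<close> times a vector, up to \<open>J\<close>, and that vector is again a
   relation.\<close>
 define R where "R = {c : Vs {..<r}. (SUM s<r. c s *s z s) : JV J}"
 have "lin (%c. SUM s<r. c s *s z s)"
  using lin_ext[of "{..<r}" z] by(simp add: ext_def[abs_def])
 hence R: "smd R" unfolding R_def by(rule smd_kernel[OF _ smd_Vs JVs(1)])
 have JVn: "smd (JV J :: (nat => 'a) set)" by(rule smd_JV[OF J(2)])
 have "R <= Vs {..<r}" by(auto simp: R_def)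
 note RJ = plus_JV[OF J(2) R this]
 have "R + JV J <= JV J"
 proof (rule lcl_nakayama_vec[OF J(1,2) n(1) _ RJ(1-3) JVn])
  fix e assume "e : R + JV J"
  then obtain c j where cj: "e = c + j" "c : R" "j : JV J" by(rule set_plus_elim)
  have "(SUM s<r. c s *s z s) : JV ?J" using cj(2) JV_mono[OF JJ(1)] by(auto simp: R_def)
  from ops_add[OF JVs(2) this zz'[of c]] have "(SUM s<r. c s *s z' s) : JV ?J" by simp
  hence "c s : ?J" for s
   using b3[of c s] cj(2) ops_zero[OF idl_gi[of "insert x J"]] by(cases "s < r") (auto simp: R_def Vs_def)
  hence "c : JV ?J" by(auto simp: JV_def)
  from JV_gi_insert[OF J(2) this] obtain y where y: "c - x *s y : JV J" "y : Vs {..<r}"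
   using cj(2) unfolding R_def by blast
  have "(SUM s<r. c s *s z s) - x *s (SUM s<r. y s *s z s) = (SUM s<r. (c s - x * y s) *s z s)"
   by(simp add: vmod.sc_sum vmod.sc_sc vmod.sc_diff_left sum_subtractf)
  also have "... : JV J" using y(1) by(intro ops_sum[OF JVs(1)] smul_JV[OF J(2)]) (simp add: JV_def smul_apply)
  finally have "x *s (SUM s<r. y s *s z s) : JV J" using cj(2) ops_cong[OF JVs(1)] by(simp add: R_def)
  hence "y : R" using smul_regular[OF J(3,4)] y(2) by(auto simp: R_def)
  hence "x *s y : gen (range smul) {m *s y |m y. m : \<nn> & y : R + JV J}"
   using n(2) RJ(4) by(intro subsetD[OF gen_inc]) blast
  moreover have "(c - x *s y) + j : JV J" using y(1) cj(3) by(rule ops_add[OF JVn])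
  moreover have "e = x *s y + ((c - x *s y) + j)" by(simp add: cj(1))
  ultimately show "e : gen (range smul) {m *s y |m y. m : \<nn> & y : R + JV J} + JV J" by(intro set_plusI)
 qed auto
 hence RJV: "R <= JV J" using RJ(4) by blast
 have "c s : J" if "(SUM s<r. c s *s z s) : JV J" "s < r" for c s
 proof -
  have "(%s. if s < r then c s else 0) : R" using that(1) by(auto simp: R_def Vs_def cong: sum.cong_simp)
  hence "(%s. if s < r then c s else 0) : JV J" using RJV by blast
  hence "(if s < r then c s else 0) : J" unfolding JV_def by blast
  thus ?thesis using that by simp
 qed
 thus ?thesis using zZ span unfolding free_basis_def by blast
qed

text \<open>Dividing by the regular element \<open>x\<close> keeps the complex exact from one
  position later on, so each generator of the maximal ideal uses up one degree. After all of them
  the ring is a field and every syzygy is free; the bases are lifted back one generator at a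
  time.\<close>

theorem syzygy_free:
 fixes d :: "nat => ('x => 'p::comm_ring_1) => 'x => 'p"
 assumes "rnoeth J" "idl J" "lcl J \<nn>" "\<nn> = gi (J Un set xs)" "regp J xs"
  and "!!i. finite (B i)" "!!i. lin (d i)" "!!i v. v : Vs (B (Suc i)) ==> d i v : Vs (B i)"
  and "!!i v. v : Vs (B (Suc (Suc i))) ==> d i (d (Suc i) v) : JV J"
  and "!!i v. i < k ==> v : Vs (B (Suc i)) ==> d i v : JV J ==> EX w:Vs (B (Suc (Suc i))). v - d (Suc i) w : JV J"
  and "length xs <= k"
 shows "EX r z. free_basis J {v : Vs (B (Suc k)). d k v : JV J} r z"
 using assms
proof (induction xs arbitrary: J B d k)
 case Nil
 hence "lcl J J" by(simp add: gen_opsub)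
 moreover have "smd {v : Vs (B (Suc k)). d k v : JV J}"
  by(rule smd_kernel[OF Nil.prems(7) smd_Vs smd_JV[OF Nil.prems(2)]])
 ultimately show ?case using Nil.prems by(intro free_basis_field[of J "B (Suc k)"]) auto
next
 case (Cons x ys)
 let ?J = "gi (insert x J)"
 note J = Cons.prems(1,2) and fin = Cons.prems(6) and ld = Cons.prems(7) and dV = Cons.prems(8)
  and dd = Cons.prems(9) and ex = Cons.prems(10)
 obtain k' where k: "k = Suc k'" using Cons.prems(11) by(cases k) auto
 have nn: "idl \<nn>" using Cons.prems(3) by(simp add: lcl_def)
 have x: "x : \<nn>" "J <= \<nn>"
  unfolding Cons.prems(4) using gen_inc[of "J Un set (x # ys)" "range (*)"] by auto
 have J': "rnoeth ?J" "idl ?J" by(rule rnoeth_mono[OF J idl_gi subset_gi_insert]) (rule idl_gi)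
 have nn': "\<nn> = gi (?J Un set ys)" using Cons.prems(4) by(simp add: gi_insert_Un)
 have lcl': "lcl ?J \<nn>"
  by(rule lcl_mono[OF Cons.prems(3) subset_gi_insert gen_least[OF nn]]) (use x in auto)
 have pJ: "prm J" "x ~: J" "regp ?J ys" using Cons.prems(5) by auto
 have JVs: "smd (JV J :: ('x => 'p) set)" by(rule smd_JV[OF J(2)])
 have xJV: "x *s w : JV ?J" for w :: "'x => 'p" by(rule smul_JV[OF idl_gi]) (use gen_inc in blast)
 have JJV: "JV J <= (JV ?J :: ('x => 'p) set)" by(rule JV_mono[OF subset_gi_insert])
 \<comment> \<open>Exactness modulo \<open>J\<close> lets a cycle modulo \<open>x\<close> be
   corrected by a multiple of \<open>x\<close> to a cycle modulo \<open>J\<close>.\<close>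
 have adj: "EX w:Vs (B (Suc (Suc i))). d (Suc i) (v - x *s w) : JV J"
  if i: "i < k" and v: "v : Vs (B (Suc (Suc i)))" "d (Suc i) v : JV ?J" for i v
 proof -
  obtain u where u: "d (Suc i) v - x *s u : JV J" "u : Vs (B (Suc i))"
   using JV_gi_insert[OF J(2) v(2)] dV[OF v(1)] by blast
  have "d i (d (Suc i) v - x *s u) : JV J"
   by(rule lin_JV[OF fin[of "Suc i"] ld J(2) _ u(1)]) (intro ops_diff[OF smd_Vs] smd_smul[OF smd_Vs] dV v u)
  hence "d i (d (Suc i) v) - d i (d (Suc i) v - x *s u) : JV J" by(rule ops_diff[OF JVs dd[OF v(1)]])
  hence "x *s d i u : JV J" by(simp add: lin_simps[OF ld] linD(2)[OF ld])
  hence "d i u : JV J" by(rule smul_regular[OF pJ(1,2)])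
  then obtain w where w: "w : Vs (B (Suc (Suc i)))" "u - d (Suc i) w : JV J" using ex[OF i u(2)] by blast
  have "d (Suc i) (v - x *s w) = (d (Suc i) v - x *s u) + x *s (u - d (Suc i) w)"
   by(simp add: lin_simps[OF ld] linD(2)[OF ld] vmod.sc_diff)
  also have "... : JV J" by(intro ops_add[OF JVs] smd_smul[OF JVs] u w)
  finally show ?thesis using w(1) by blast
 qed
 have "EX r z. free_basis ?J {v : Vs (B (Suc (Suc k'))). d (Suc k') v : JV ?J} r z"
 \<comment> \<open>The shift of \<open>d\<close> and \<open>B\<close> drops the lowest position,
   where exactness modulo \<open>x\<close> may fail.\<close>
 proof (rule Cons.IH[OF J' lcl' nn' pJ(3), where d = "%i. d (Suc i)" and B = "%i. B (Suc i)" and k = k'])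
  show "d (Suc i) (d (Suc (Suc i)) v) : JV ?J" if "v : Vs (B (Suc (Suc (Suc i))))" for i v
   using dd[OF that] JJV by blast
  fix i v assume i: "i < k'" and v: "v : Vs (B (Suc (Suc i)))" "d (Suc i) v : JV ?J"
  obtain w where w: "w : Vs (B (Suc (Suc i)))" "d (Suc i) (v - x *s w) : JV J"
   using adj[OF _ v] i k by auto
  have "v - x *s w : Vs (B (Suc (Suc i)))" by(intro ops_diff[OF smd_Vs] smd_smul[OF smd_Vs] v w)
  then obtain w' where w': "w' : Vs (B (Suc (Suc (Suc i))))" "(v - x *s w) - d (Suc (Suc i)) w' : JV J"
   using ex[OF _ _ w(2)] i k by(metis Suc_less_eq)
  have "v - d (Suc (Suc i)) w' = ((v - x *s w) - d (Suc (Suc i)) w') + x *s w" by simp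
  also have "... : JV ?J" using w'(2) JJV xJV by(intro ops_add[OF smd_JV[OF idl_gi]]) auto
  finally show "EX w:Vs (B (Suc (Suc (Suc i)))). v - d (Suc (Suc i)) w : JV ?J" using w'(1) by blast
 qed (use fin ld dV Cons.prems(11) k in auto)
 then obtain r z' where z': "free_basis ?J {v : Vs (B (Suc k)). d k v : JV ?J} r z'" using k by auto
 have "EX z. free_basis J {v : Vs (B (Suc k)). d k v : JV J} r z"
 proof (rule syzygy_free_lift[OF J pJ(1,2) Cons.prems(3) x(1) fin _ _ _ z'])
  show "smd {v : Vs (B (Suc k)). d k v : JV J}"
   by(rule smd_kernel[OF ld smd_Vs JVs])
  show "{v : Vs (B (Suc k)). d k v : JV J} <= Vs (B (Suc k))" by auto
  show "{v : Vs (B (Suc k)). d k v : JV J} <= {v : Vs (B (Suc k)). d k v : JV ?J}" using JJV by auto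
  show "y : {v : Vs (B (Suc k)). d k v : JV J}"
   if y: "y : Vs (B (Suc k))" "j : JV J" "x *s y + j : {v : Vs (B (Suc k)). d k v : JV J}" for y j
  proof -
   have "j = (x *s y + j) - x *s y" by simp
   also have "... : Vs (B (Suc k))" using y by(intro ops_diff[OF smd_Vs] smd_smul[OF smd_Vs]) auto
   finally have "d k j : JV J" by(rule lin_JV[OF fin ld J(2) _ y(2)])
   hence "x *s d k y : JV J"
    using y(3) ops_diff[OF JVs, of "d k (x *s y + j)" "d k j"] by(simp add: lin_simps[OF ld] linD(2)[OF ld])
   thus ?thesis using y(1) smul_regular[OF pJ(1,2)] by blast
  qed
  show "EX w. v - x *s w : {v : Vs (B (Suc k)). d k v : JV J}" if v: "v : {v : Vs (B (Suc k)). d k v : JV ?J}" for v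
  proof -
   obtain w where w: "w : Vs (B (Suc k))" "d k (v - x *s w) : JV J" using adj[of k' v] v k by auto
   have "v - x *s w : Vs (B (Suc k))" using v w by(intro ops_diff[OF smd_Vs] smd_smul[OF smd_Vs]) auto
   thus ?thesis using w by blast
  qed
 qed
 thus ?case by blast
qed

section \<open>Comparison of complexes of free modules\<close>

definition cplx :: "'p::comm_ring_1 set => (nat => 'x set) => (nat => ('x => 'p) => 'x => 'p) => bool" where
 "cplx J B d \<longleftrightarrow> (ALL n. finite (B n)) & (ALL n. lin (d n)) & (ALL n. ALL v:Vs (B (Suc n)). d n v : Vs (B n)) &
   (ALL n. ALL v:Vs (B (Suc (Suc n))). d n (d (Suc n) v) : JV J)"

lemma cplxD:
 assumes "cplx J B d"
 shows "finite (B n)" "lin (d n)" "v : Vs (B (Suc n)) ==> d n v : Vs (B n)"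
  "v : Vs (B (Suc (Suc n))) ==> d n (d (Suc n) v) : JV J"
 using assms by(auto simp: cplx_def)

text \<open>Exactness at the term \<open>B (Suc n)\<close>. The cokernel at \<open>B 0\<close> is
  the resolved module.\<close>

definition exact_at :: "'p::comm_ring_1 set => (nat => 'x set) => (nat => ('x => 'p) => 'x => 'p) => nat => bool" where
 "exact_at J B d n \<longleftrightarrow>
   (ALL v:Vs (B (Suc n)). d n v : JV J --> (EX w:Vs (B (Suc (Suc n))). v - d (Suc n) w : JV J))"

lemma exact_atD:
 "exact_at J B d n ==> v : Vs (B (Suc n)) ==> d n v : JV J ==> EX w:Vs (B (Suc (Suc n))). v - d (Suc n) w : JV J"
 by(simp add: exact_at_def)

text \<open>The comparison theorem for resolutions, with a prescribed map in degree 0. The last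
  clause of \<open>P\<close> records that the next extension problem is solvable.\<close>

lemma comparison:
 assumes J: "idl J" and B: "cplx J B d" and C: "cplx J C e" and ex: "!!n. exact_at J C e n"
  and a0: "lin al0" "!!v. v : Vs (B 0) ==> al0 v : Vs (C 0)"
  "!!v. v : Vs (B 1) ==> EX w:Vs (C 1). al0 (d 0 v) - e 0 w : JV J"
 shows "EX al. al 0 = al0 & (ALL n. lin (al n)) & (ALL n. ALL v:Vs (B n). al n v : Vs (C n)) &
  (ALL n. ALL v:Vs (B (Suc n)). e n (al (Suc n) v) - al n (d n v) : JV J)"
proof -
 note B = cplxD[OF B] and C = cplxD[OF C] and JVs = smd_JV[OF J]
 define P where "P n a \<longleftrightarrow> lin a & (ALL v:Vs (B n). a v : Vs (C n)) & (n = 0 --> a = al0) &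
  (ALL v:Vs (B (Suc n)). EX w:Vs (C (Suc n)). a (d n v) - e n w : JV J)" for n a
 define Q where "Q n a a' \<longleftrightarrow> (ALL v:Vs (B (Suc n)). e n (a' v) - a (d n v) : JV J)" for n a a'
 have "EX al. ALL n. P n (al n) & Q n (al n) (al (Suc n))"
 proof (rule dependent_nat_choice)
  show "EX a. P 0 a" using a0 by(auto simp: P_def)
  fix a n assume a: "P n a"
  hence la: "lin a" and ex1: "!!v. v : Vs (B (Suc n)) ==> EX w:Vs (C (Suc n)). a (d n v) - e n w : JV J"
   and aV: "!!v. v : Vs (B n) ==> a v : Vs (C n)" by(auto simp: P_def)
  obtain a' where a': "lin a'" "!!v. a' v : Vs (C (Suc n))"
   "!!v. v : Vs (B (Suc n)) ==> a (d n v) - e n (a' v) : JV J"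
   using lin_lift[OF B(1) lin_comp[OF la B(2)] C(2) smd_Vs JVs ex1[OF ev_Vs]] by blast
  have q: "e n (a' v) - a (d n v) : JV J" if "v : Vs (B (Suc n))" for v
   using ops_minus[OF JVs a'(3)[OF that]] by simp
  have "EX w:Vs (C (Suc (Suc n))). a' (d (Suc n) v) - e (Suc n) w : JV J" if v: "v : Vs (B (Suc (Suc n)))" for v
  proof (rule exact_atD[OF ex a'(2)])
   have "a (d n (d (Suc n) v)) : JV J" by(rule lin_JV[OF B(1)[of n] la J B(3)[OF B(3)[OF v]] B(4)[OF v]])
   from ops_diff[OF JVs this a'(3)[OF B(3)[OF v]]]
   show "e n (a' (d (Suc n) v)) : JV J" by simp
  qed
  hence "P (Suc n) a'" using a' by(auto simp: P_def)
  thus "EX a'. P (Suc n) a' & Q n a a'" using q by(auto simp: Q_def)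
 qed
 then obtain al where al: "!!n. P n (al n)" "!!n. Q n (al n) (al (Suc n))" by blast
 show ?thesis
  by(intro exI[of _ al]) (use al in \<open>simp add: P_def Q_def\<close>)
qed

text \<open>A chain map that raises degrees by \<open>s\<close> and is a boundary on degree 0 is
  null-homotopic. The shift \<open>s\<close> serves the construction of homotopies of higher
  order.\<close>

lemma nullhomotopy:
 assumes J: "idl J" and B: "cplx J B d" and C: "cplx J C e" and ex: "!!n. exact_at J C e (n + s)"
  and f: "!!n. lin (ph n)" "!!n v. v : Vs (B n) ==> ph n v : Vs (C (n + s))"
  "!!n v. v : Vs (B (Suc n)) ==> e (n + s) (ph (Suc n) v) - ph n (d n v) : JV J"
  and base: "!!v. v : Vs (B 0) ==> EX w:Vs (C (Suc s)). ph 0 v - e s w : JV J"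
 shows "EX h. (ALL n. lin (h n)) & (ALL n v. h n v : Vs (C (Suc (n + s)))) &
  (ALL v:Vs (B 0). ph 0 v - e s (h 0 v) : JV J) &
  (ALL n. ALL v:Vs (B (Suc n)). ph (Suc n) v - e (Suc (n + s)) (h (Suc n) v) - h n (d n v) : JV J)"
proof -
 note B = cplxD[OF B] and C = cplxD[OF C] and JVs = smd_JV[OF J]
 define P where "P n h \<longleftrightarrow> lin h & (ALL v. h v : Vs (C (Suc (n + s)))) &
  (n = 0 --> (ALL v:Vs (B 0). ph 0 v - e s (h v) : JV J)) &
  (ALL v:Vs (B (Suc n)). ph n (d n v) - e (n + s) (h (d n v)) : JV J)" for n h
 define Q where "Q n h h' \<longleftrightarrow>
  (ALL v:Vs (B (Suc n)). ph (Suc n) v - e (Suc (n + s)) (h' v) - h (d n v) : JV J)" for n h h'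
 have "EX h. ALL n. P n (h n) & Q n (h n) (h (Suc n))"
 proof (rule dependent_nat_choice)
  obtain h where "lin h" "ALL v. h v : Vs (C (Suc s))" "ALL v:Vs (B 0). ph 0 v - e s (h v) : JV J"
   using lin_lift[OF B(1) f(1) C(2) smd_Vs JVs base[OF ev_Vs]] by blast
  hence "P 0 h" using B(3) by(auto simp: P_def)
  thus "EX h. P 0 h" by blast
 next
  fix h n assume "P n h"
  hence lh: "lin h" and hV: "!!v. h v : Vs (C (Suc (n + s)))"
   and hd: "!!v. v : Vs (B (Suc n)) ==> ph n (d n v) - e (n + s) (h (d n v)) : JV J" by(auto simp: P_def)
  define \<psi> where "\<psi> v = ph (Suc n) v - h (d n v)" for v
  have l\<psi>: "lin \<psi>" unfolding \<psi>_def[abs_def] by(intro lin_diff f(1) lin_comp[OF lh B(2)])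
  have ex1: "EX w:Vs (C (Suc (Suc (n + s)))). \<psi> v - e (Suc (n + s)) w : JV J" if v: "v : Vs (B (Suc n))" for v
  proof (rule exact_atD[OF ex])
   show "\<psi> v : Vs (C (Suc (n + s)))"
    unfolding \<psi>_def using f(2)[OF v] hV by(intro ops_diff[OF smd_Vs]) auto
   from ops_add[OF JVs f(3)[OF v] hd[OF v]]
   show "e (n + s) (\<psi> v) : JV J" by(simp add: \<psi>_def lin_simps(2)[OF C(2)])
  qed
  obtain h' where h': "lin h'" "!!v. h' v : Vs (C (Suc (Suc (n + s))))"
   "!!v. v : Vs (B (Suc n)) ==> \<psi> v - e (Suc (n + s)) (h' v) : JV J"
   using lin_lift[OF B(1) l\<psi> C(2) smd_Vs JVs ex1[OF ev_Vs]] by blast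
  have q: "ph (Suc n) v - e (Suc (n + s)) (h' v) - h (d n v) : JV J" if "v : Vs (B (Suc n))" for v
   using h'(3)[OF that] by(simp add: \<psi>_def algebra_simps)
  have "ph (Suc n) (d (Suc n) v) - e (Suc (n + s)) (h' (d (Suc n) v)) : JV J"
   if v: "v : Vs (B (Suc (Suc n)))" for v
  proof -
   have "h (d n (d (Suc n) v)) : JV J" by(rule lin_JV[OF B(1)[of n] lh J B(3)[OF B(3)[OF v]] B(4)[OF v]])
   from ops_add[OF JVs q[OF B(3)[OF v]] this] show ?thesis by simp
  qed
  hence "P (Suc n) h'" using h' by(simp add: P_def)
  thus "EX h'. P (Suc n) h' & Q n h h'" using q by(auto simp: Q_def)
 qed
 then obtain h where h: "!!n. P n (h n)" "!!n. Q n (h n) (h (Suc n))" by blast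
 show ?thesis
  by(intro exI[of _ h]) (use h in \<open>simp add: P_def Q_def\<close>)
qed

section \<open>Higher homotopies\<close>

text \<open>The coefficient at \<open>al\<close> of the product of two operator-valued power series
  in commuting variables, with multisets as exponents.\<close>

definition cv :: "(nat multiset => 'v => 'w::comm_monoid_add) => (nat multiset => 'u => 'v) => nat multiset => 'u => 'w" where
 "cv s t al v = (SUM be:{be. be \<subseteq># al}. s be (t (al - be) v))"

lemma finite_bounded_msets: "finite A ==> finite {be. set_mset be <= A & size be <= k}"
proof -
 assume "finite A"
 hence "finite (\<Union>n\<le>k. {be. set_mset be <= A & size be = n})" using finite_multisets_of_size[of A] by(auto simp: multisets_of_size_def)
 thus ?thesis by(rule rev_finite_subset) auto
qed

lemma finite_submsets: "finite {be. be \<subseteq># al}"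
 by(rule finite_subset[OF _ finite_bounded_msets[of "set_mset al" "size al"]])
  (auto dest: set_mset_mono size_mset_mono)

lemma submset_add: "be \<subseteq># al ==> gm \<subseteq># al - be ==> be + gm \<subseteq># al"
 by(metis mset_subset_eq_mono_add_left_cancel subset_mset.add_diff_inverse)

lemma submset_diff: "te \<subseteq># al ==> te - be \<subseteq># al - be"
 by(simp add: subseteq_mset_def diff_le_mono)

lemma submset_double_diff: "be \<subseteq># al ==> al - (al - be) = be"
 by(auto simp: multiset_eq_iff subseteq_mset_def)

lemma cv_assoc:
 assumes "!!be. addm (s be)"
 shows "cv s (cv t u) al v = cv (cv s t) u al v"
proof -
 have "cv s (cv t u) al v = (SUM be:{be. be \<subseteq># al}. SUM gm:{gm. gm \<subseteq># al - be}. s be (t gm (u (al - be - gm) v)))"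
  by(simp add: cv_def addm_sum[OF assms])
 also have "... = (SUM (be, gm):(SIGMA be:{be. be \<subseteq># al}. {gm. gm \<subseteq># al - be}). s be (t gm (u (al - be - gm) v)))"
  by(rule sum.Sigma) (auto simp: finite_submsets)
 also have "... = (SUM (te, be):(SIGMA te:{te. te \<subseteq># al}. {be. be \<subseteq># te}). s be (t (te - be) (u (al - te) v)))"
 proof (rule sum.reindex_bij_witness[where i = "%(te, be). (be, te - be)" and j = "%(be, gm). (be + gm, be)"])
  show "(%(be, gm). (be + gm, be)) a : (SIGMA te:{te. te \<subseteq># al}. {be. be \<subseteq># te})"
   if "a : (SIGMA be:{be. be \<subseteq># al}. {gm. gm \<subseteq># al - be})" for a
   using that by(auto intro: submset_add)
  show "(%(te, be). (be, te - be)) b : (SIGMA be:{be. be \<subseteq># al}. {gm. gm \<subseteq># al - be})"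
   if "b : (SIGMA te:{te. te \<subseteq># al}. {be. be \<subseteq># te})" for b
   using that by(auto intro: subset_mset.order_trans submset_diff)
 qed (auto simp: subset_mset.add_diff_inverse)
 also have "... = (SUM te:{te. te \<subseteq># al}. SUM be:{be. be \<subseteq># te}. s be (t (te - be) (u (al - te) v)))"
  by(rule sum.Sigma[symmetric]) (auto simp: finite_submsets)
 also have "... = cv (cv s t) u al v" by(simp add: cv_def)
 finally show ?thesis .
qed

lemma cv_flip: "cv s t al v = (SUM be:{be. be \<subseteq># al}. s (al - be) (t be v))"
 unfolding cv_def
 by(rule sum.reindex_bij_witness[where i = "%be. al - be" and j = "%be. al - be"])
  (auto simp: submset_double_diff)

text \<open>Isolates the two summands in which one factor carries the whole exponent; these contain
  the unknown coefficient when a series is extended by one order.\<close>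

lemma cv_ends:
 assumes "al \<noteq> {#}"
 shows "cv s t al v = s {#} (t al v) + (s al (t {#} v) + (SUM be:{be. be \<subseteq># al} - {{#}} - {al}. s be (t (al - be) v)))"
proof -
 let ?S = "{be. be \<subseteq># al}"
 have "cv s t al v = s {#} (t (al - {#}) v) + (SUM be:?S - {{#}}. s be (t (al - be) v))"
  unfolding cv_def by(rule sum.remove) (auto simp: finite_submsets)
 also have "(SUM be:?S - {{#}}. s be (t (al - be) v))
   = s al (t (al - al) v) + (SUM be:?S - {{#}} - {al}. s be (t (al - be) v))"
  by(rule sum.remove) (use assms in \<open>auto simp: finite_submsets\<close>)
 finally show ?thesis by simp
qed

text \<open>The graded basis \<open>BG\<close> gives a finite free resolution, over the ring modulo
  \<open>JJ 0\<close>, of a module that all \<open>f j\<close> annihilate; the latter is the last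
  assumption. \<open>JJ j\<close> adds the first \<open>j\<close> elements of the regular
  sequence.\<close>

locale higher_homotopies =
 fixes JJ :: "nat => 'p::comm_ring_1 set" and BG :: "'x set" and deg :: "'x => nat"
  and d :: "('x => 'p) => 'x => 'p" and f :: "nat => 'p" and c g :: nat
 assumes JJ: "idl (JJ j)" "j < c ==> JJ (Suc j) = gi (insert (f j) (JJ j))"
  and reg: "j < c ==> f j * a : JJ j ==> a : JJ j"
  and BG: "finite BG" "x : BG ==> deg x <= g"
  and d_lin: "lin d" and d_V: "v : Vs {x : BG. deg x = Suc n} ==> d v : Vs {x : BG. deg x = n}"
  and d_V0: "v : Vs {x : BG. deg x = 0} ==> d v = 0"
  and dd: "v : Vs BG ==> d (d v) : JV (JJ 0)"
  and ex: "v : Vs {x : BG. deg x = Suc n} ==> d v : JV (JJ 0) ==>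
   EX w:Vs {x : BG. deg x = Suc (Suc n)}. v - d w : JV (JJ 0)"
  and fM: "j < c ==> v : Vs {x : BG. deg x = 0} ==>
   EX w:Vs {x : BG. deg x = 1}. f j *s v - d w : JV (JJ 0)"
begin

abbreviation V :: "nat => ('x => 'p) set" where "V n \<equiv> Vs {x : BG. deg x = n}"

lemma V_BG: "V n <= Vs BG"
 by(auto simp: Vs_def)

lemma V_big: "n > g ==> v : V n ==> v = 0"
 using BG(2) by(fastforce simp: Vs_def fun_eq_iff)

lemma ev_V: "x : BG ==> ev x : V (deg x)"
 by(rule ev_Vs) simp

lemma G_mem: "lin h ==> smd U ==> (!!n v. v : V n ==> h v : U) ==> v : Vs BG ==> h v : U"
 by(rule lin_mem[OF BG(1)]) (auto intro: ev_V)

lemma cplx_G: "cplx (JJ 0) (%n. {x : BG. deg x = n}) (%n. d)"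
 unfolding cplx_def
proof (intro conjI allI ballI)
 show "d (d v) : JV (JJ 0)" if "v : V (Suc (Suc n))" for n v using dd that V_BG by blast
qed (simp_all add: BG(1) d_lin d_V)

lemma exact_G: "exact_at (JJ 0) (%n. {x : BG. deg x = n}) (%n. d) n"
 unfolding exact_at_def using ex by blast

text \<open>The coefficient at \<open>al\<close> of the linear form with coefficients
  \<open>f j\<close>, acting by scalars.\<close>

definition wt :: "nat multiset => ('x => 'p) => 'x => 'p" where
 "wt al v = (SUM j<c. if al = {#j#} then f j *s v else 0)"

lemma wt_lin: "lin (wt al)"
proof -
 have "lin (%v. if al = {#j#} then f j *s v else 0)" for j
  by(cases "al = {#j#}") (simp_all add: lin_smul[OF lin_id] lin_zero)
 thus ?thesis unfolding wt_def[abs_def] by(intro lin_sum)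
qed

lemma wt_0: "size al \<noteq> 1 ==> wt al v = 0"
 unfolding wt_def by(rule sum.neutral) auto

lemma wt_single: "wt {#j#} v = (if j < c then f j *s v else 0)"
proof -
 have "wt {#j#} v = (SUM i<c. if i = j then f j *s v else 0)"
  unfolding wt_def by(rule sum.cong) auto
 thus ?thesis by simp
qed

lemma wt_comm: "lin h ==> h (wt al v) = wt al (h v)"
 unfolding wt_def by(simp only: lin_simps(3)) (rule sum.cong, auto simp: linD(2) lin_simps(4))

lemma wt_smd: "smd U ==> v : U ==> wt al v : U"
 unfolding wt_def by(rule ops_sum) (auto intro: smd_smul ops_zero)

text \<open>\<open>sg\<close> is a series with constant term \<open>d\<close>, truncated above order
  \<open>k\<close>, whose square is \<open>wt\<close> up to order \<open>k\<close>. The coefficient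
  at \<open>al\<close> raises degrees by \<open>2 * size al - 1\<close>; the equation
  \<open>Suc m = n + 2 * size al\<close> expresses this without subtraction.\<close>

definition good :: "nat => (nat multiset => ('x => 'p) => 'x => 'p) => bool" where
 "good k sg \<longleftrightarrow> (ALL al. lin (sg al)) & sg {#} = d & (ALL al. size al > k --> sg al = (%v. 0)) &
   (ALL al n m v. v : V n --> Suc m = n + 2 * size al --> sg al v : V m) &
   (ALL al v. size al <= k --> set_mset al <= {..<c} --> v : Vs BG --> cv sg sg al v - wt al v : JV (JJ 0))"

lemma goodD:
 assumes "good k sg"
 shows "lin (sg al)" "sg {#} = d" "size al > k ==> sg al v = 0"
  "v : V n ==> Suc m = n + 2 * size al ==> sg al v : V m"
  "size al <= k ==> set_mset al <= {..<c} ==> v : Vs BG ==> cv sg sg al v - wt al v : JV (JJ 0)"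
 using assms by(simp_all add: good_def)

lemma good_V0: "good k sg ==> v : V n ==> n + 2 * size al = 0 ==> sg al v = 0"
 using goodD(2) d_V0 by auto

lemma good_BG:
 assumes g: "good k sg" and v: "v : Vs BG" shows "sg al v : Vs BG"
proof (rule G_mem[OF goodD(1)[OF g] smd_Vs _ v])
 fix n v assume v: "v : V n"
 show "sg al v : Vs BG"
 proof (cases "n + 2 * size al")
  case 0 thus ?thesis using good_V0[OF g v] ops_zero[OF smd_Vs] by simp
 next
  case (Suc m) thus ?thesis using goodD(4)[OF g v] V_BG by(metis subsetD)
 qed
qed

lemma good_comp:
 assumes g: "good k sg" and v: "v : V n" and m: "Suc (Suc m) = n + 2 * (size be + size gm)"
 shows "sg be (sg gm v) : V m"
proof (cases "n + 2 * size gm")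
 case 0
 thus ?thesis using good_V0[OF g v] ops_zero[OF smd_Vs] lin_simps(4)[OF goodD(1)[OF g]] by simp
next
 case (Suc l)
 hence "sg gm v : V l" using goodD(4)[OF g v] by simp
 thus ?thesis using goodD(4)[OF g, of "sg gm v" l m be] m Suc by simp
qed

lemma lin_cv: "(!!be. lin (s be)) ==> (!!be. lin (t be)) ==> lin (cv s t al)"
 unfolding cv_def[abs_def] by(rule lin_sum) (rule lin_comp)

lemma size_submset_diff: "be \<subseteq># al ==> size be + size (al - be) = size al"
 using size_mset_mono[of be al] by(simp add: size_Diff_submset)

lemma proper_submset:
 assumes "be : {be. be \<subseteq># al} - {{#}} - {al}"
 shows "be \<subseteq># al" "size be < size al" "size (al - be) < size al"
proof -
 show 1: "be \<subseteq># al" using assms by simp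
 show "size be < size al" using assms by(auto intro: mset_subset_size)
 show "size (al - be) < size al" using size_submset_diff[OF 1] assms by(cases "size be") auto
qed

text \<open>Read \<open>sg\<close> as a power series in variables \<open>t\<^sub>j\<close> and put \<open>w = f\<^sub>1 t\<^sub>1 + \<dots> + f\<^sub>c t\<^sub>c\<close>. The defect of \<open>sg\<^sup>2 = w\<close>
 commutes with \<open>sg\<close>, so its lowest coefficient is a chain map. This chain map is null-homotopic, and a
 homotopy provides the next coefficient of \<open>sg\<close>.\<close>

lemma good_homotopy:
 assumes g: "good k sg" and al: "size al = Suc k" "set_mset al <= {..<c}"
 shows "EX h. lin h & (ALL n m v. v : V n --> Suc m = n + 2 * size al --> h v : V m) &
  (ALL v:Vs BG. wt al v - cv sg sg al v - d (h v) - h (d v) : JV (JJ 0))"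
proof -
 note J = smd_JV[OF JJ(1)[of 0]] and gl = goodD(1)[OF g]
 have a0: "al \<noteq> {#}" using al(1) by auto
 have sal: "sg al v = 0" for v using goodD(3)[OF g] al(1) by simp
 define R where "R be v = wt be v - cv sg sg be v" for be v
 have R_lin: "lin (R be)" for be unfolding R_def[abs_def] by(rule lin_diff[OF wt_lin lin_cv[OF gl gl]])
 have cv_BG: "cv sg sg be v : Vs BG" if "v : Vs BG" for be v
  unfolding cv_def by(intro ops_sum[OF smd_Vs] good_BG[OF g] that)
 have R_BG: "R be v : Vs BG" if "v : Vs BG" for be v
  unfolding R_def by(intro ops_diff[OF smd_Vs] wt_smd smd_Vs cv_BG that)
 have R_JV: "R be v : JV (JJ 0)" if "size be <= k" "set_mset be <= {..<c}" "v : Vs BG" for be v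
  using ops_minus[OF J goodD(5)[OF g that]] by(simp add: R_def)
 have sub_set: "set_mset be <= {..<c}" if "be \<subseteq># al" for be using set_mset_mono[OF that] al(2) by blast
 have diff_set: "set_mset (al - be) <= {..<c}" for be by(rule sub_set) simp
 \<comment> \<open>By associativity the two ways of forming the cube of \<open>sg\<close> agree, and
   scalars commute with linear maps; hence the defect \<open>R\<close> commutes with
   \<open>sg\<close>.\<close>
 have "cv sg R al v = cv R sg al v" for v
 proof -
  have "cv sg R al v = cv sg wt al v - cv sg (cv sg sg) al v"
   by(simp add: cv_def[of sg] R_def lin_simps(2)[OF gl] sum_subtractf)
  also have "cv sg wt al v = cv wt sg al v"
   unfolding cv_flip[of sg wt] by(simp add: cv_def wt_comm[OF gl])
  also have "cv sg (cv sg sg) al v = cv (cv sg sg) sg al v" by(rule cv_assoc[OF linD(1)[OF gl]])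
  also have "cv wt sg al v - cv (cv sg sg) sg al v = cv R sg al v"
   by(simp add: cv_def[of _ sg al v] R_def sum_subtractf)
  finally show ?thesis .
 qed
 note comm = this
 \<comment> \<open>In the commutation identity the terms in which \<open>R\<close> carries a proper
   part of the exponent vanish modulo \<open>JJ 0\<close>; what is left is the commutator with
   \<open>d\<close>.\<close>
 have chain: "d (R al v) - R al (d v) : JV (JJ 0)" if v: "v : Vs BG" for v
 proof -
  let ?S = "{be. be \<subseteq># al} - {{#}} - {al}"
  let ?A = "SUM be:?S. sg be (R (al - be) v)" and ?B = "SUM be:?S. R be (sg (al - be) v)"
  have "d (R al v) + (0 + ?A) = cv sg R al v"
   unfolding cv_ends[OF a0, of sg R] by(simp add: sal goodD(2)[OF g])
  also have "... = 0 + (R al (d v) + ?B)"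
   unfolding comm cv_ends[OF a0, of R sg] by(simp add: sal goodD(2)[OF g] lin_simps(4)[OF R_lin])
  finally have "d (R al v) - R al (d v) = ?B - ?A" by(simp add: algebra_simps)
  also have "... : JV (JJ 0)"
  proof (rule ops_diff[OF J]; rule ops_sum[OF J])
   fix be assume b: "be : ?S"
   note pb = proper_submset[OF b]
   show "R be (sg (al - be) v) : JV (JJ 0)"
    using pb al sub_set by(intro R_JV good_BG[OF g] v) auto
   have "R (al - be) v : JV (JJ 0)" using pb(3) al(1) diff_set by(intro R_JV v) auto
   thus "sg be (R (al - be) v) : JV (JJ 0)" by(rule lin_JV[OF BG(1) gl JJ(1) R_BG[OF v]])
  qed
  finally show ?thesis .
 qed
 have R_V: "R al v : V (n + 2 * k)" if v: "v : V n" for v n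
 proof -
  have "wt al v : V (n + 2 * k)"
  proof (cases "k = 0")
   case True thus ?thesis using wt_smd[OF smd_Vs v] by simp
  next
   case False thus ?thesis using wt_0[of al v] al(1) ops_zero[OF smd_Vs] by simp
  qed
  moreover have "cv sg sg al v : V (n + 2 * k)"
   unfolding cv_def
  proof (rule ops_sum[OF smd_Vs])
   fix be assume "be : {be. be \<subseteq># al}"
   thus "sg be (sg (al - be) v) : V (n + 2 * k)"
    using size_submset_diff[of be al] al(1) by(intro good_comp[OF g v]) simp
  qed
  ultimately show ?thesis unfolding R_def by(rule ops_diff[OF smd_Vs])
 qed
 have "EX h. (ALL n. lin (h n)) & (ALL n v. h n v : V (Suc (n + 2 * k))) &
  (ALL v:V 0. R al v - d (h 0 v) : JV (JJ 0)) &
  (ALL n. ALL v:V (Suc n). R al v - d (h (Suc n) v) - h n (d v) : JV (JJ 0))"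
 proof (rule nullhomotopy[OF JJ(1) cplx_G cplx_G exact_G R_lin])
  show "R al v : V (n + 2 * k)" if "v : V n" for n v by(rule R_V[OF that])
  show "d (R al v) - R al (d v) : JV (JJ 0)" if "v : V (Suc n)" for n v
   using chain that V_BG by blast
  \<comment> \<open>For \<open>k = 0\<close> the defect on degree 0 is multiplication by
    \<open>f j\<close>, a boundary by \<open>fM\<close>. For larger \<open>k\<close> the element
    \<open>R al v\<close> has positive degree, and exactness applies.\<close>
  show "EX w:V (Suc (2 * k)). R al v - d w : JV (JJ 0)" if v: "v : V 0" for v
  proof (cases k)
   case 0
   then obtain j where j: "al = {#j#}" using al(1) size_1_singleton_mset by auto
   have "cv sg sg al v = 0"
   proof -
    have "{be. be \<subseteq># al} - {{#}} - {al} = {}" using proper_submset(2)[of _ al] al(1) 0 by fastforce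
    thus ?thesis unfolding cv_ends[OF a0]
     by(simp only: sal sum.empty goodD(2)[OF g] lin_simps(4)[OF d_lin]) simp
   qed
   hence "R al v = f j *s v" using j al(2) by(simp add: R_def wt_single)
   thus ?thesis using fM[of j v] v j al(2) 0 by simp
  next
   case (Suc k')
   have "d (R al v) : JV (JJ 0)" using chain[of v] v V_BG d_V0[OF v] lin_simps(4)[OF R_lin] by auto
   moreover have "R al v : V (Suc (2 * k' + 1))" using R_V[OF v] Suc by simp
   ultimately show ?thesis using ex[of "R al v" "2 * k' + 1"] Suc by simp
  qed
 qed
 then obtain h where h: "!!n. lin (h n)" "!!n v. h n v : V (Suc (n + 2 * k))"
  "!!v. v : V 0 ==> R al v - d (h 0 v) : JV (JJ 0)"
  "!!n v. v : V (Suc n) ==> R al v - d (h (Suc n) v) - h n (d v) : JV (JJ 0)" by blast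
 \<comment> \<open>\<open>nullhomotopy\<close> yields one map for each degree; composing with the
   projections to the homogeneous parts glues them to a single map.\<close>
 define prj where "prj n v = (%x. if x : BG & deg x = n then v x else 0 :: 'p)" for n :: nat and v
 have prj_lin: "lin (prj n)" for n by(auto simp: lin_def addm_def prj_def fun_eq_iff smul_apply)
 have prj_V: "prj n' v = (if n' = n then v else 0)" if "v : V n" for n n' v
  using that by(auto simp: prj_def Vs_def fun_eq_iff)
 define H where "H v = (SUM n<=g. h n (prj n v))" for v
 have H_lin: "lin H" unfolding H_def[abs_def] by(rule lin_sum) (rule lin_comp[OF h(1) prj_lin])
 have H_V: "H v = h n v" if v: "v : V n" for n v
 proof (cases "n <= g")
  case True
  have "H v = (SUM n'<=g. if n' = n then h n v else 0)"
   unfolding H_def by(rule sum.cong) (auto simp: prj_V[OF v] lin_simps(4)[OF h(1)])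
  thus ?thesis using True by simp
 next
  case False
  hence "v = 0" by(intro V_big[OF _ v]) simp
  thus ?thesis by(simp add: lin_simps(4)[OF h(1)] lin_simps(4)[OF H_lin])
 qed
 have "R al v - d (H v) - H (d v) : JV (JJ 0)" if "v : Vs BG" for v
 proof (rule G_mem[OF _ J _ that])
  show "lin (%v. R al v - d (H v) - H (d v))" by(rule lin_diff[OF lin_diff[OF R_lin lin_comp[OF d_lin H_lin]] lin_comp[OF H_lin d_lin]])
  fix n v assume v: "v : V n"
  show "R al v - d (H v) - H (d v) : JV (JJ 0)"
  proof (cases n)
   case 0 thus ?thesis using h(3) v d_V0 H_V[OF v] lin_simps(4)[OF H_lin] by simp
  next
   case (Suc n')
   thus ?thesis using h(4)[of v n'] v H_V[OF v] H_V[OF d_V, of v n'] by simp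
  qed
 qed
 moreover have "H v : V m" if "v : V n" "Suc m = n + 2 * size al" for v n m
  using h(2)[of n v] H_V[OF that(1)] that(2) al(1) by simp
 ultimately show ?thesis using H_lin unfolding R_def by blast
qed

lemma good_Suc:
 assumes g: "good k sg" shows "EX sg'. good (Suc k) sg'"
proof -
 define A where "A = {al. size al = Suc k & set_mset al <= {..<c}}"
 have "ALL al:A. EX h. lin h & (ALL n m v. v : V n --> Suc m = n + 2 * size al --> h v : V m) &
  (ALL v:Vs BG. wt al v - cv sg sg al v - d (h v) - h (d v) : JV (JJ 0))"
  using good_homotopy[OF g] by(auto simp: A_def)
 from bchoice[OF this] obtain h where h: "ALL al:A. lin (h al) &
  (ALL n m v. v : V n --> Suc m = n + 2 * size al --> h al v : V m) &
  (ALL v:Vs BG. wt al v - cv sg sg al v - d (h al v) - h al (d v) : JV (JJ 0))" ..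
 define sg' where "sg' al = (if al : A then h al else sg al)" for al
 have old: "sg' al = sg al" if "size al <= k" for al using that by(simp add: sg'_def A_def)
 have "good (Suc k) sg'"
  unfolding good_def
 proof (intro conjI allI impI)
  show "lin (sg' al)" for al using h goodD(1)[OF g] by(simp add: sg'_def)
  show "sg' {#} = d" using old[of "{#}"] goodD(2)[OF g] by simp
  show "sg' al = (%v. 0)" if "size al > Suc k" for al
   using that goodD(3)[OF g, of al] by(auto simp: sg'_def A_def)
  show "sg' al v : V m" if "v : V n" "Suc m = n + 2 * size al" for al n m v
   using that h goodD(4)[OF g] by(auto simp: sg'_def)
  fix al and v :: "'x => 'p" assume al: "size al <= Suc k" "set_mset al <= {..<c}" and v: "v : Vs BG"
  show "cv sg' sg' al v - wt al v : JV (JJ 0)"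
  proof (cases "size al = Suc k")
   case False
   have "cv sg' sg' al v = cv sg sg al v"
    unfolding cv_def
   proof (rule sum.cong)
    fix be assume "be : {be. be \<subseteq># al}"
    hence "size be + size (al - be) = size al" using size_submset_diff by simp
    thus "sg' be (sg' (al - be) v) = sg be (sg (al - be) v)" using False al(1) old by simp
   qed simp
   thus ?thesis using goodD(5)[OF g _ al(2) v] False al(1) by simp
  next
   case True
   hence a0: "al \<noteq> {#}" and aA: "al : A" using al(2) by(auto simp: A_def)
   have sal: "sg al v = 0" for v using goodD(3)[OF g] True by simp
   have "(SUM be:{be. be \<subseteq># al} - {{#}} - {al}. sg' be (sg' (al - be) v))
     = (SUM be:{be. be \<subseteq># al} - {{#}} - {al}. sg be (sg (al - be) v))"
   proof (rule sum.cong)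
    fix be assume "be : {be. be \<subseteq># al} - {{#}} - {al}"
    thus "sg' be (sg' (al - be) v) = sg be (sg (al - be) v)"
     using proper_submset[of be al] True old by simp
   qed simp
   hence "cv sg' sg' al v = cv sg sg al v + d (h al v) + h al (d v)"
    unfolding cv_ends[OF a0] using aA old[of "{#}"] goodD(2)[OF g]
    by(simp add: sal lin_simps(4)[OF d_lin] sg'_def algebra_simps)
   hence "cv sg' sg' al v - wt al v = - (wt al v - cv sg sg al v - d (h al v) - h al (d v))"
    by(simp add: algebra_simps)
   thus ?thesis using h aA v ops_minus[OF smd_JV[OF JJ(1)]] by metis
  qed
 qed
 thus ?thesis by(intro exI)
qed

lemma good_exists: "EX sg. good k sg"
proof (induction k)
 case 0
 have "good 0 (%al. if al = {#} then d else (%v. 0))"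
  unfolding good_def
 proof (intro conjI allI impI)
  fix al :: "nat multiset" and v :: "'x => 'p" assume a: "size al <= (0::nat)" and v: "v : Vs BG"
  hence "al = {#}" by simp
  moreover have "cv (%al. if al = {#} then d else (%v. 0)) (%al. if al = {#} then d else (%v. 0)) {#} v = d (d v)"
   by(simp add: cv_def)
  ultimately show "cv (%al. if al = {#} then d else (%v. 0)) (%al. if al = {#} then d else (%v. 0)) al v - wt al v
    : JV (JJ 0)" using dd[OF v] wt_0[of "{#}" v] by simp
 qed (use d_lin lin_zero d_V ops_zero[OF smd_Vs] in \<open>auto simp: lin_zero\<close>)
 thus ?case by(intro exI)
qed (use good_Suc in blast)

end

locale shamash = higher_homotopies JJ BG deg d f c g
 for JJ :: "nat => 'p::comm_ring_1 set" and BG :: "'x set" and deg d f c g +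
 fixes sg :: "nat multiset => ('x => 'p) => 'x => 'p" and K :: nat
 assumes good: "good K sg" and K: "g < 2 * K"
begin

lemmas sg_lin = goodD(1)[OF good]

lemma sg_0: "sg al 0 = 0"
 by(rule lin_simps(4)[OF sg_lin])

text \<open>A solution up to order \<open>K\<close> is a solution in all orders: above
  \<open>K\<close> the coefficients of the square of \<open>sg\<close> raise degrees by at least
  \<open>2 * K\<close>, which exceeds the top degree \<open>g\<close>.\<close>

lemma cv_wt:
 assumes "set_mset te <= {..<c}" "v : Vs BG"
 shows "cv sg sg te v - wt te v : JV (JJ 0)"
proof (cases "size te <= K")
 case True thus ?thesis by(rule goodD(5)[OF good _ assms])
next
 case False
 have w0: "wt te v = 0" for v using False K by(intro wt_0) auto
 have "cv sg sg te v - wt te v : {0}"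
 proof (rule G_mem[OF _ _ _ assms(2), where h = "%v. cv sg sg te v - wt te v"])
  show "lin (%v. cv sg sg te v - wt te v)" by(rule lin_diff[OF lin_cv[OF sg_lin sg_lin] wt_lin])
  show "smd {0 :: 'x => 'p}" by(rule ops_0) (auto intro: vmod.sc_addm)
  fix n v assume v: "v : V n"
  have "sg be (sg (te - be) v) = 0" if "be \<subseteq># te" for be
  proof (rule V_big)
   show "g < n + 2 * size te - 2" using False K by simp
   show "sg be (sg (te - be) v) : V (n + 2 * size te - 2)"
    using size_submset_diff[OF that] False K by(intro good_comp[OF good v]) simp
  qed
  thus "cv sg sg te v - wt te v : {0}" by(simp add: cv_def w0)
 qed
 thus ?thesis using ops_zero[OF smd_JV[OF JJ(1)]] by simp
qed

definition MS :: "nat => nat multiset set" where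
 "MS k = {be. set_mset be <= {..<c} & size be <= k}"

lemma finite_MS: "finite (MS k)"
 unfolding MS_def by(rule finite_bounded_msets) simp

text \<open>The total complex lives on \<open>D \<otimes> G\<close>, where \<open>D\<close> is the divided power algebra on \<open>c\<close> generators of
 degree 2 with basis the multisets, and \<open>S j\<close> is the dual of multiplication by the \<open>j\<close>-th variable.\<close>

definition sl :: "(nat multiset * 'x => 'p) => nat multiset => 'x => 'p" where
 "sl u al = (%x. u (al, x))"

definition S :: "nat => (nat multiset * 'x => 'p) => nat multiset * 'x => 'p" where
 "S j u = (%(al, x). u (add_mset j al, x))"

text \<open>The series \<open>sg\<close> with its variables acting as the \<open>S j\<close>; the
  sum stops at order \<open>K\<close>, above which \<open>sg\<close> vanishes.\<close>

definition D :: "(nat multiset * 'x => 'p) => nat multiset * 'x => 'p" where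
 "D u = (%(al, x). (SUM be:MS K. sg be (sl u (al + be))) x)"

definition BT :: "nat => nat => (nat multiset * 'x) set" where
 "BT k n = {(al, x). set_mset al <= {..<k} & x : BG & 2 * size al + deg x = n}"

lemma lin_sl: "lin (%u. sl u al)"
 by(auto simp: lin_def addm_def sl_def fun_eq_iff smul_apply)

lemma lin_S: "lin (S j)"
 by(auto simp: lin_def addm_def S_def fun_eq_iff smul_apply)

lemma sl_D: "sl (D u) al = (SUM be:MS K. sg be (sl u (al + be)))"
proof
 fix x
 have "sl (D u) al x = D u (al, x)" by(simp add: sl_def)
 thus "sl (D u) al x = (SUM be:MS K. sg be (sl u (al + be))) x" by(simp add: D_def)
qed

lemma sl_eqI: "(!!al. sl u al = sl v al) ==> u = v"
 by(auto simp: sl_def fun_eq_iff)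

lemma sl_S: "sl (S j u) al = sl u (add_mset j al)"
 by(simp add: sl_def S_def)

lemma lin_D: "lin D"
 unfolding lin_def addm_def
proof (intro conjI allI)
 fix a u v
 have l: "lin (%u. sl (D u) al)" for al
  unfolding sl_D by(rule lin_sum) (rule lin_comp[OF sg_lin lin_sl])
 show "D (u + v) = D u + D v"
  by(rule sl_eqI) (simp add: lin_simps(1)[OF l] lin_simps(1)[OF lin_sl])
 show "D (a *s v) = a *s D v"
  by(rule sl_eqI) (simp add: linD(2)[OF l] linD(2)[OF lin_sl])
qed

lemma S_D: "S j (D u) = D (S j u)"
 by(rule sl_eqI) (simp add: sl_S sl_D)

lemma finite_BT: "finite (BT k n)"
proof (rule finite_subset)
 show "BT k n <= {al. set_mset al <= {..<k} & size al <= n} \<times> BG" by(auto simp: BT_def)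
 show "finite ({al. set_mset al <= {..<k} & size al <= n} \<times> BG)" by(rule finite_cartesian_product[OF finite_bounded_msets BG(1)]) simp
qed

lemma BT_mono: "k <= k' ==> BT k n <= BT k' n"
 by(fastforce simp: BT_def)

lemma Vs_mono: "B <= B' ==> v : Vs B ==> v : Vs B'"
 by(auto simp: Vs_def)

lemma Vs_BT_iff: "u : Vs (BT k n) \<longleftrightarrow>
  (ALL al. if set_mset al <= {..<k} & 2 * size al <= n then sl u al : V (n - 2 * size al) else sl u al = 0)"
 (is "?l \<longleftrightarrow> (ALL al. ?r al)")
proof
 assume l: ?l
 have "?r al" for al
 proof -
  have z: "sl u al x = 0" if "(al, x) ~: BT k n" for x using l that by(simp add: Vs_def sl_def)
  show "?r al"
  proof (cases "set_mset al <= {..<k} & 2 * size al <= n")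
   case True
   have "sl u al : V (n - 2 * size al)"
    unfolding Vs_def using True by(auto intro!: z simp: BT_def)
   thus ?thesis using True by simp
  next
   case False
   have "sl u al x = 0" for x by(rule z) (use False in \<open>auto simp: BT_def\<close>)
   thus ?thesis using False by(auto simp: fun_eq_iff)
  qed
 qed
 thus "ALL al. ?r al" ..
next
 assume r: "ALL al. ?r al"
 have "u (al, x) = 0" if "(al, x) ~: BT k n" for al x
 proof (cases "set_mset al <= {..<k} & 2 * size al <= n")
  case True
  hence "sl u al : V (n - 2 * size al)" using r by auto
  moreover have "~ (x : BG & deg x = n - 2 * size al)" using that True by(auto simp: BT_def)
  ultimately have "sl u al x = 0" unfolding Vs_def by blast
  thus ?thesis by(simp add: sl_def)
 next
  case False
  hence "sl u al = 0" using r by auto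
  thus ?thesis by(simp add: sl_def fun_eq_iff)
 qed
 thus ?l by(auto simp: Vs_def)
qed

lemma sl_BT:
 assumes "u : Vs (BT k n)"
 shows "set_mset al <= {..<k} ==> n = m + 2 * size al ==> sl u al : V m"
  "~ set_mset al <= {..<k} ==> sl u al = 0" "n < 2 * size al ==> sl u al = 0" "sl u al : Vs BG"
proof -
 note r = assms[unfolded Vs_BT_iff, rule_format, of al]
 show "set_mset al <= {..<k} ==> n = m + 2 * size al ==> sl u al : V m"
  "~ set_mset al <= {..<k} ==> sl u al = 0" "n < 2 * size al ==> sl u al = 0"
  using r by auto
 show "sl u al : Vs BG"
  using r V_BG[of "n - 2 * size al"] ops_zero[OF smd_Vs, of BG] by(auto split: if_splits)
qed

lemma D_BT:
 assumes u: "u : Vs (BT k (Suc n))" shows "D u : Vs (BT k n)"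
 unfolding Vs_BT_iff
proof
 fix al
 have out: "sg be (sl u (al + be)) = 0" if "~ set_mset al <= {..<k} | n < 2 * size al" for be
 proof (cases "set_mset al <= {..<k} & ~ Suc n < 2 * size (al + be)")
  case False
  hence "sl u (al + be) = 0" using sl_BT(2,3)[OF u, of "al + be"] by auto
  thus ?thesis by(simp add: sg_0)
 next
  case True
  \<comment> \<open>In this boundary case only the constant term \<open>d\<close> of
    \<open>sg\<close> contributes, and it vanishes on degree 0.\<close>
  with that have "Suc n = 2 * size al & size be = 0" by(auto simp del: size_eq_0_iff_empty)
  hence n: "Suc n = 2 * size al" "be = {#}" by auto
  hence "sl u (al + be) : V 0" using True by(intro sl_BT(1)[OF u]) auto
  thus ?thesis using good_V0[OF good, of _ 0 be] n(2) by simp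
 qed
 have inn: "sg be (sl u (al + be)) : V (n - 2 * size al)" if al: "2 * size al <= n" for be
 proof (cases "set_mset (al + be) <= {..<k} & ~ Suc n < 2 * size (al + be)")
  case False
  hence "sl u (al + be) = 0" using sl_BT(2,3)[OF u, of "al + be"] by auto
  thus ?thesis using ops_zero[OF smd_Vs] by(simp add: sg_0)
 next
  case True
  define m where "m = Suc n - 2 * size (al + be)"
  have "sl u (al + be) : V m" using True by(intro sl_BT(1)[OF u]) (auto simp: m_def)
  thus ?thesis using True al by(rule_tac goodD(4)[OF good]) (auto simp: m_def)
 qed
 show "if set_mset al <= {..<k} & 2 * size al <= n then sl (D u) al : V (n - 2 * size al) else sl (D u) al = 0"
  unfolding sl_D using out by(auto intro!: ops_sum[OF smd_Vs] inn sum.neutral)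
qed

lemma S_BT:
 assumes u: "u : Vs (BT k (Suc (Suc n)))" shows "S j u : Vs (BT k n)"
proof -
 have "S j u (al, x) = 0" if "(al, x) ~: BT k n" for al x
 proof -
  have "(add_mset j al, x) ~: BT k (Suc (Suc n))" using that by(auto simp: BT_def)
  thus ?thesis using u by(simp add: S_def Vs_def)
 qed
 thus ?thesis by(auto simp: Vs_def)
qed

lemma S_out: "u : Vs (BT k n) ==> k <= j ==> S j u = 0"
 by(auto simp: Vs_def BT_def S_def fun_eq_iff)

lemma JV_sl: "u : JV J \<longleftrightarrow> (ALL al. sl u al : JV J)"
 by(auto simp: JV_def sl_def)

text \<open>The square of the series is \<open>wt\<close>, whose variables act as the
  \<open>S j\<close>. The double sum over exponents of order up to \<open>K\<close> is regrouped by
  their sum, after adding vanishing terms up to order \<open>2 * K\<close>.\<close>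

lemma DD:
 assumes u: "u : Vs (BT k n)" and k: "k <= c"
 shows "D (D u) - (SUM j<c. f j *s S j u) : JV (JJ 0)"
 unfolding JV_sl
proof
 fix al
 note J = smd_JV[OF JJ(1)[of 0]] and l = lin_diff[OF lin_sl lin_sl]
 have uk: "u : Vs (BT c n)" by(rule Vs_mono[OF BT_mono[OF k] u])
 have "sl (D (D u)) al = (SUM be:MS K. SUM gm:MS K. sg be (sg gm (sl u (al + (be + gm)))))"
  by(simp add: sl_D lin_simps(3)[OF sg_lin] add.assoc)
 also have "... = (SUM (be, gm):MS K \<times> MS K. sg be (sg gm (sl u (al + (be + gm)))))"
  by(rule sum.cartesian_product)
 also have "... = (SUM (be, gm):{(be, gm). be + gm : MS (2 * K)}. sg be (sg gm (sl u (al + (be + gm)))))"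
 proof (rule sum.mono_neutral_left)
  show "finite {(be, gm). be + gm : MS (2 * K)}"
   by(rule finite_subset[of _ "MS (2 * K) \<times> MS (2 * K)"]) (auto simp: finite_MS, auto simp: MS_def)
  show "MS K \<times> MS K <= {(be, gm). be + gm : MS (2 * K)}" by(auto simp: MS_def)
  show "ALL i:{(be, gm). be + gm : MS (2 * K)} - MS K \<times> MS K.
    (case i of (be, gm) => sg be (sg gm (sl u (al + (be + gm))))) = 0"
  proof
   fix i assume a: "i : {(be, gm). be + gm : MS (2 * K)} - MS K \<times> MS K"
   obtain be gm where i: "i = (be, gm)" by(cases i)
   hence "size be > K | size gm > K" using a by(auto simp: MS_def)
   thus "(case i of (be, gm) => sg be (sg gm (sl u (al + (be + gm))))) = 0"
    by(auto simp: i goodD(3)[OF good] sg_0)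
  qed
 qed
 also have "... = (SUM (te, be):(SIGMA te:MS (2 * K). {be. be \<subseteq># te}). sg be (sg (te - be) (sl u (al + te))))"
  by(rule sum.reindex_bij_witness[where i = "%(te, be). (be, te - be)" and j = "%(be, gm). (be + gm, be)"])
   (auto simp: subset_mset.add_diff_inverse)
 also have "... = (SUM te:MS (2 * K). cv sg sg te (sl u (al + te)))"
  unfolding cv_def by(rule sum.Sigma[symmetric]) (auto simp: finite_MS finite_submsets)
 finally have 1: "sl (D (D u)) al = (SUM te:MS (2 * K). cv sg sg te (sl u (al + te)))" .
 have "(SUM te:MS (2 * K). wt te (sl u (al + te)))
   = (SUM j<c. SUM te:MS (2 * K). if te = {#j#} then f j *s sl u (al + te) else 0)"
  unfolding wt_def by(rule sum.swap)
 also have "... = (SUM j<c. f j *s sl u (add_mset j al))"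
 proof (rule sum.cong)
  fix j assume "j : {..<c}"
  hence "{#j#} : MS (2 * K)" using K by(simp add: MS_def)
  thus "(SUM te:MS (2 * K). if te = {#j#} then f j *s sl u (al + te) else 0) = f j *s sl u (add_mset j al)"
   by(simp add: finite_MS)
 qed simp
 also have "... = sl (SUM j<c. f j *s S j u) al"
  by(simp add: lin_simps(3)[OF lin_sl] linD(2)[OF lin_sl] sl_S)
 finally have 2: "sl (SUM j<c. f j *s S j u) al = (SUM te:MS (2 * K). wt te (sl u (al + te)))" by simp
 have "sl (D (D u) - (SUM j<c. f j *s S j u)) al
   = (SUM te:MS (2 * K). cv sg sg te (sl u (al + te)) - wt te (sl u (al + te)))"
  by(simp add: lin_simps(2)[OF lin_sl] 1 2 sum_subtractf)
 also have "... : JV (JJ 0)"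
  by(rule ops_sum[OF J]) (auto simp: MS_def intro: cv_wt sl_BT(4)[OF uk])
 finally show "sl (D (D u) - (SUM j<c. f j *s S j u)) al : JV (JJ 0)" .
qed

lemma JJ_mono: "i <= j ==> j <= c ==> JJ i <= JJ j"
proof (induction j)
 case (Suc j)
 thus ?case using JJ(2)[of j] subset_gi_insert[of "JJ j" "f j"] by(cases "i = Suc j") auto
qed simp

lemma f_JJ: "i < j ==> j <= c ==> f i : JJ j"
 using JJ_mono[of "Suc i" j] JJ(2)[of i] gen_inc[of "insert (f i) (JJ i)" "range (*)"] by auto

lemma DD_JJ:
 assumes u: "u : Vs (BT k n)" and k: "k <= j" "j <= c"
 shows "D (D u) : JV (JJ j)"
proof -
 have "(SUM i<c. f i *s S i u) : JV (JJ j)"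
 proof (rule ops_sum[OF smd_JV[OF JJ(1)]])
  fix i
  show "f i *s S i u : JV (JJ j)"
  proof (cases "i < j")
   case True thus ?thesis using f_JJ k by(intro smul_JV[OF JJ(1)]) auto
  next
   case False
   hence "S i u = 0" using k by(intro S_out[OF u]) simp
   thus ?thesis using ops_zero[OF smd_JV[OF JJ(1)]] by simp
  qed
 qed
 moreover have "D (D u) - (SUM i<c. f i *s S i u) : JV (JJ j)"
  by(rule subsetD[OF JV_mono[OF JJ_mono] DD[OF u]]) (use k in auto)
 ultimately show ?thesis using ops_cong[OF smd_JV[OF JJ(1)]] by blast
qed

text \<open>In \<open>DD\<close> the later terms vanish because their variables do not occur, and
  the earlier ones because \<open>f i\<close> is in \<open>JJ j\<close> for
  \<open>i < j\<close>.\<close>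

lemma DD_step:
 assumes u: "u : Vs (BT (Suc j) n)" and j: "j < c"
 shows "D (D u) - f j *s S j u : JV (JJ j)"
proof -
 note J = smd_JV[OF JJ(1)[of j]]
 have "(SUM i<c. f i *s S i u) - f j *s S j u = (SUM i:{..<c} - {j}. f i *s S i u)"
  using j by(simp add: sum.remove[of "{..<c}" j])
 also have "... : JV (JJ j)"
 proof (rule ops_sum[OF J])
  fix i assume i: "i : {..<c} - {j}"
  show "f i *s S i u : JV (JJ j)"
  proof (cases "i < j")
   case True thus ?thesis using f_JJ j by(intro smul_JV[OF JJ(1)]) auto
  next
   case False
   hence "S i u = 0" using i by(intro S_out[OF u]) auto
   thus ?thesis using ops_zero[OF J] by simp
  qed
 qed
 finally have "(SUM i<c. f i *s S i u) - f j *s S j u : JV (JJ j)" .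
 moreover have "D (D u) - (SUM i<c. f i *s S i u) : JV (JJ j)"
  by(rule subsetD[OF JV_mono[OF JJ_mono] DD[OF u]]) (use j in auto)
 ultimately show ?thesis using ops_add[OF J] by fastforce
qed

text \<open>Induction on the number of variables, all modulo \<open>JJ j\<close>. If
  \<open>D u\<close> is \<open>f j\<close> times \<open>v\<close>, applying \<open>D\<close> and
  cancelling the regular element \<open>f j\<close> gives that \<open>S j u\<close> is
  \<open>D v\<close>. Subtracting \<open>D v'\<close> with \<open>S j v' = v\<close> leaves a cycle
  in which the variable \<open>j\<close> does not occur, and the previous case applies.\<close>

lemma D_exact:
 assumes "j <= c" "u : Vs (BT j (Suc n))" "D u : JV (JJ j)"
 shows "EX w:Vs (BT j (Suc (Suc n))). u - D w : JV (JJ j)"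
 using assms
proof (induction j arbitrary: u n)
 case 0
 have u0: "sl u al = 0" if "al \<noteq> {#}" for al using sl_BT(2)[OF 0(2)] that by auto
 have one: "(SUM be:MS K. sg be (h be)) = d (h {#})" if "!!be. be \<noteq> {#} ==> h be = 0" for h
 proof -
  have "(SUM be:MS K. sg be (h be)) = (SUM be:{{#}}. sg be (h be))"
   by(rule sum.mono_neutral_right) (use finite_MS in \<open>auto simp: MS_def that sg_0\<close>)
  thus ?thesis by(simp add: goodD(2)[OF good])
 qed
 have "sl (D u) {#} = d (sl u {#})" unfolding sl_D by(subst one) (auto simp: u0)
 hence "d (sl u {#}) : JV (JJ 0)" using 0(3) JV_sl by metis
 moreover have "sl u {#} : V (Suc n)" by(rule sl_BT(1)[OF 0(2)]) auto
 ultimately obtain w where w: "w : V (Suc (Suc n))" "sl u {#} - d w : JV (JJ 0)" using ex by blast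
 define w' where "w' = (%(al :: nat multiset, x). if al = {#} then w x else (0::'p))"
 have slw: "sl w' al = (if al = {#} then w else 0)" for al by(auto simp: w'_def sl_def)
 have "w' : Vs (BT 0 (Suc (Suc n)))" unfolding Vs_BT_iff using w(1) by(auto simp: slw)
 moreover have "u - D w' : JV (JJ 0)"
  unfolding JV_sl
 proof
  fix al
  show "sl (u - D w') al : JV (JJ 0)"
  proof (cases "al = {#}")
   case True
   hence "sl (D w') al = d w" unfolding sl_D by(subst one) (auto simp: slw)
   thus ?thesis using w(2) True by(simp add: lin_simps(2)[OF lin_sl])
  next
   case False
   hence "sl (D w') al = 0" unfolding sl_D slw by(intro sum.neutral) (auto simp: sg_0)
   thus ?thesis using u0[OF False] ops_zero[OF smd_JV[OF JJ(1)]] by(simp add: lin_simps(2)[OF lin_sl])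
  qed
 qed
 ultimately show ?case by blast
next
 case (Suc j)
 note u = Suc.prems(2) and J = smd_JV[OF JJ(1)[of j]]
 have j: "j < c" using Suc.prems(1) by simp
 have JJj: "JJ (Suc j) = gi (insert (f j) (JJ j))" by(rule JJ(2)[OF j])
 note DJ = lin_JV[OF finite_BT lin_D JJ(1)]
 obtain v where v: "D u - f j *s v : JV (JJ j)" "v : Vs (BT (Suc j) n)"
  using JV_gi_insert[OF JJ(1) Suc.prems(3)[unfolded JJj]] D_BT[OF u] by blast
 have "D (D u - f j *s v) : JV (JJ j)"
  by(rule DJ[OF _ v(1)]) (rule ops_diff[OF smd_Vs D_BT[OF u] smd_smul[OF smd_Vs v(2)]])
 from ops_diff[OF J this DD_step[OF u j]] have "f j *s (S j u - D v) : JV (JJ j)"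
  by(simp add: lin_simps(2)[OF lin_D] linD(2)[OF lin_D] vmod.sc_diff)
 hence SD: "S j u - D v : JV (JJ j)"
  using reg[OF j] by(auto simp: JV_def smul_apply)
 define v' where "v' = (%(al, x). if j \<in># al then v (al - {#j#}, x) else 0)"
 have Sv': "S j v' = v" by(auto simp: S_def v'_def)
 have v': "v' : Vs (BT (Suc j) (Suc (Suc n)))"
 proof -
  have "v' (al, x) = 0" if out: "(al, x) ~: BT (Suc j) (Suc (Suc n))" for al x
  proof (cases "j \<in># al")
   case True
   then obtain be where be: "al = add_mset j be" by(auto dest: multi_member_split)
   hence "(be, x) ~: BT (Suc j) n" using out by(auto simp: BT_def)
   thus ?thesis using v(2) be by(simp add: v'_def Vs_def)
  qed (simp add: v'_def)
  thus ?thesis by(auto simp: Vs_def)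
 qed
 define z where "z = u - D v'"
 have z: "z : Vs (BT (Suc j) (Suc n))" unfolding z_def by(rule ops_diff[OF smd_Vs u D_BT[OF v']])
 \<comment> \<open>The entries of \<open>z\<close> whose exponent contains \<open>j\<close> are
   entries of \<open>S j z\<close> and lie in \<open>JJ j\<close>, so dropping them changes nothing
   modulo \<open>JJ j\<close>.\<close>
 define z0 where "z0 = (%(al, x). if j \<in># al then 0 else z (al, x))"
 have Sz: "S j z : JV (JJ j)" using SD by(simp add: z_def lin_simps(2)[OF lin_S] S_D Sv')
 have zz0: "z - z0 : JV (JJ j)"
 proof -
  have "(z - z0) (al, x) : JJ j" for al x
  proof (cases "j \<in># al")
   case True
   then obtain be where be: "al = add_mset j be" by(auto dest: multi_member_split)
   have "S j z (be, x) : JJ j" using Sz by(auto simp: JV_def)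
   thus ?thesis by(simp add: minus_fun_apply' z0_def be S_def)
  next
   case False thus ?thesis using ops_zero[OF JJ(1)] by(simp add: minus_fun_apply' z0_def)
  qed
  thus ?thesis by(auto simp: JV_def)
 qed
 have z0: "z0 : Vs (BT j (Suc n))"
 proof -
  have "z0 (al, x) = 0" if out: "(al, x) ~: BT j (Suc n)" for al x
  proof (cases "j \<in># al")
   case False
   hence "(al, x) ~: BT (Suc j) (Suc n)" using out by(auto simp: BT_def less_Suc_eq)
   thus ?thesis using z False by(simp add: z0_def Vs_def)
  qed (simp add: z0_def)
  thus ?thesis by(auto simp: Vs_def)
 qed
 have z0': "z0 : Vs (BT (Suc j) (Suc n))" by(rule Vs_mono[OF BT_mono z0]) simp
 have "D (z - z0) : JV (JJ j)" by(rule DJ[OF ops_diff[OF smd_Vs z z0'] zz0])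
 moreover have "D z : JV (JJ j)"
 proof -
  have "(D u - f j *s v) - (D (D v') - f j *s S j v') : JV (JJ j)"
   by(rule ops_diff[OF J v(1) DD_step[OF v' j]])
  thus ?thesis by(simp add: z_def lin_simps(2)[OF lin_D] Sv')
 qed
 ultimately have "D z - D (z - z0) : JV (JJ j)" by(intro ops_diff[OF J])
 hence "D z0 : JV (JJ j)" by(simp add: lin_simps(2)[OF lin_D])
 then obtain w0 where w0: "w0 : Vs (BT j (Suc (Suc n)))" "z0 - D w0 : JV (JJ j)"
  using Suc.IH[OF less_imp_le[OF j] z0] by blast
 have "w0 : Vs (BT (Suc j) (Suc (Suc n)))" by(rule Vs_mono[OF BT_mono w0(1)]) simp
 hence w: "v' + w0 : Vs (BT (Suc j) (Suc (Suc n)))" by(rule ops_add[OF smd_Vs v'])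
 have "u - D (v' + w0) = (z - z0) + (z0 - D w0)" by(simp add: z_def lin_simps(1)[OF lin_D])
 also have "... : JV (JJ j)" by(rule ops_add[OF J zz0 w0(2)])
 also have "JV (JJ j) <= JV (JJ (Suc j))" using j by(intro JV_mono JJ_mono) auto
 finally show ?case using w by(intro bexI)
qed

lemma cplx_D: "cplx (JJ c) (BT c) (%n. D)"
 unfolding cplx_def
proof (intro conjI allI ballI)
 show "D (D v) : JV (JJ c)" if "v : Vs (BT c (Suc (Suc n)))" for v n by(rule DD_JJ[OF that]) auto
qed (simp_all add: finite_BT lin_D D_BT)

lemma exact_D: "exact_at (JJ c) (BT c) (%n. D) n"
 unfolding exact_at_def using D_exact by blast

end

section \<open>Cochains of the total complex and the cohomology operators\<close>

lemma opnoeth_zero: "ops Om U ==> T <= U ==> opnoeth Om T U"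
proof -
 assume U: "ops Om U" and T: "T <= U"
 show ?thesis
  unfolding opnoeth_def
 proof (intro allI impI)
  fix E assume E: "ops Om E & U <= E & E <= T + U"
  have "T + U <= U" by(rule plus_least[OF U T order_refl])
  hence "E <= gen Om ({} Un U)" using E gen_inc[of U Om] by auto
  thus "EX F. finite F & F <= E & E <= gen Om (F Un U)" by(intro exI[of _ "{}"]) auto
 qed
qed

lemma opnoeth_plus:
 assumes add: "!!om. om : Om ==> addm om" and o: "ops Om T" "ops Om T'" "ops Om U"
  and n: "opnoeth Om T U" "opnoeth Om T' U"
 shows "opnoeth Om (T + T') U"
proof (rule opnoeth_extension[OF add o(1,3) _ n(1)])
 show "T <= T + T'" by(rule plus_ge1[OF ops_zero[OF o(2)]])
 have TU: "ops Om (T + U)" by(rule ops_plus[OF add o(1,3)])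
 show "opnoeth Om (T + T') (T + U)"
 proof (rule opnoeth_image[OF n(2) o(2,3) TU, where f = "%x. x"])
  have "T <= T + U" by(rule plus_ge1[OF ops_zero[OF o(3)]])
  hence "T' + T <= T' + (T + U)" by(rule set_plus_mono2[OF order_refl])
  thus "T + T' <= (%x. x) ` T' + (T + U)" by(simp add: add.commute)
  show "(%x. x) ` U <= T + U" using plus_ge2[OF ops_zero[OF o(1)]] by simp
 qed (use add in \<open>auto simp: addm_def\<close>)
qed

definition fsc :: "'p::comm_ring_1 => ('v => 'k => 'p) => 'v => 'k => 'p" where
 "fsc a F = (%u. a *s F u)"

interpretation fmod: smod fsc
 by unfold_locales (auto simp: fsc_def vmod.sc_add vmod.sc_plus vmod.sc_sc vmod.sc_1 fun_eq_iff)

lemma fsc_apply: "fsc a F u = a *s F u"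
 by(simp add: fsc_def)

abbreviation Lin :: "(('z => 'p::comm_ring_1) => 'k => 'p) set" where
 "Lin \<equiv> {F. lin F}"

lemma osub_Lin: "ops (range fsc) Lin"
proof (rule fmod.ops_rangeI)
 show "0 : Lin" by(simp add: lin_def addm_def)
 show "F + G : Lin" if "F : Lin" "G : Lin" for F G :: "('z => 'p::comm_ring_1) => 'k => 'p"
  using that lin_add[of F G] by(simp add: plus_fun_def[of F G])
 show "fsc a F : Lin" if "F : Lin" for a and F :: "('z => 'p::comm_ring_1) => 'k => 'p"
  using that lin_smul by(simp add: fsc_def)
qed

lemma osub_into: "smd rel ==> ops (range fsc) {F. ALL v:T. F v : rel}"
 by(rule fmod.ops_rangeI) (auto simp: fsc_apply ops_zero ops_add smd_smul)

lemma lin_coord: "lin (%v. v b *s (y :: 'k => 'p::comm_ring_1))"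
 by(simp add: lin_def addm_def vmod.sc_plus vmod.sc_sc smul_apply)

lemma ext_agree:
 assumes "finite B" "smd rel" "lin F" "!!b. b : B ==> F (ev b) - y b : rel" "v : Vs B"
 shows "F v - ext B y v : rel"
 by(rule lin_mem[OF assms(1) lin_diff[OF assms(3) lin_ext] assms(2) _ assms(5)])
  (simp add: ext_ev[OF assms(1)] assms(4))

text \<open>Modulo maps with values in \<open>rel\<close> on \<open>Vs B\<close>, a linear map is a
  sum of one coordinate map per basis element, and the coordinate maps of one basis element are an
  image of the Noetherian module of values.\<close>

lemma opnoeth_Lin:
 fixes rel :: "('k => 'p::comm_ring_1) set" and B :: "'z set"
 assumes B: "finite B" and rel: "smd rel" "opnoeth (range smul) UNIV rel"
  and U: "ops (range fsc) U" "!!F. (!!v. v : Vs B ==> F v : rel) ==> F : U"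
 shows "opnoeth (range fsc) Lin U"
proof -
 have add: "addm om" if "om : range (fsc :: 'p => (('z => 'p) => 'k => 'p) => _)" for om
  using that fmod.sc_addm by auto
 have oe: "ops (range fsc) (range (ext C :: _ => ('z => 'p) => 'k => 'p))" for C :: "'z set"
 proof (rule fmod.ops_rangeI)
  show "0 : range (ext C :: _ => ('z => 'p) => 'k => 'p)" by(rule range_eqI[of _ _ "%_. 0"]) (simp add: ext_def fun_eq_iff)
  show "x + y : range (ext C)" if xy: "x : range (ext C)" "y : range (ext C)" for x y :: "('z => 'p) => 'k => 'p"
  proof -
   obtain s t where "x = ext C s" "y = ext C t" using xy by blast
   hence "x + y = ext C (%b. s b + t b)" by(simp add: ext_def fun_eq_iff vmod.sc_add sum.distrib)
   thus ?thesis by(simp only: rangeI)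
  qed
  show "fsc a x : range (ext C)" if x: "x : range (ext C)" for a and x :: "('z => 'p) => 'k => 'p"
  proof -
   obtain s where s: "x = ext C s" using x by blast
   have "fsc a x = ext C (%b. a *s s b)"
    by(rule HOL.ext) (simp add: s ext_def fsc_def vmod.sc_sum vmod.sc_commute[of a])
   thus ?thesis by(simp only: rangeI)
  qed
 qed
 have "opnoeth (range fsc) (range (ext C)) U" if "finite C" for C :: "'z set"
  using that
 proof (induction C rule: finite_induct)
  case empty
  have "ext {} y = (0 :: ('z => 'p) => 'k => 'p)" for y by(simp add: ext_def fun_eq_iff)
  thus ?case by(intro opnoeth_zero[OF U(1)]) (simp only: ops_zero[OF U(1)] image_subset_iff, simp)
 next
  case (insert b C)
  have "opnoeth (range fsc) (range (ext {b})) U"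
  proof (rule opnoeth_image[OF rel(2) ops_UNIV rel(1) U(1), where f = "%y v. v b *s y"])
   show "addm (%(y :: 'k => 'p) v. v b *s y)" by(simp add: addm_def fun_eq_iff vmod.sc_add)
   have "range (ext {b}) <= range (%(y :: 'k => 'p) v. v b *s y)" by(auto simp: ext_def fun_eq_iff)
   thus "range (ext {b}) <= range (%(y :: 'k => 'p) v. v b *s y) + U"
    using plus_ge1[OF ops_zero[OF U(1)], of "range (%(y :: 'k => 'p) v. v b *s y)"] by blast
   show "(%y v. v b *s y) ` rel <= U" using U(2) smd_smul[OF rel(1)] by auto
   show "addm om & (EX om':range fsc. ALL y. (%v. v b *s om y) = om' (%v :: 'z => 'p. v b *s y))"
    if "om : range smul" for om :: "('k => 'p) => _"
   proof -
    obtain a where a: "om = smul a" using \<open>om : range smul\<close> by blast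
    have "(%v. v b *s om y) = fsc a (%v :: 'z => 'p. v b *s y)" for y
     by(simp add: a fsc_def vmod.sc_commute)
    thus ?thesis using vmod.sc_addm a by auto
   qed
  qed (rule add)
  from opnoeth_plus[OF add oe oe U(1) insert.IH this]
  have n: "opnoeth (range fsc) (range (ext C) + range (ext {b})) U" .
  have "range (ext (insert b C)) <= range (ext C) + (range (ext {b}) :: (('z => 'p) => 'k => 'p) set)"
  proof (rule image_subsetI)
   fix y :: "'z => 'k => 'p"
   have "ext (insert b C) y = ext C y + ext {b} y"
    using insert.hyps by(simp add: ext_def fun_eq_iff add.commute)
   thus "ext (insert b C) y : range (ext C) + range (ext {b})" by(rule set_plusI) auto
  qed
  thus ?case by(rule opnoeth_subset[OF n])
 qed
 note n = this[OF B]
 show ?thesis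
 proof (rule opnoeth_image[OF n oe U(1) U(1), where f = "%x. x"])
  show "Lin <= (%x. x) ` range (ext B) + U"
  proof
   fix F :: "('z => 'p) => 'k => 'p" assume "F : Lin"
   hence F: "lin F" by simp
   have "F v - ext B (%b. F (ev b)) v : rel" if "v : Vs B" for v
    by(rule ext_agree[OF B rel(1) F _ that]) (simp add: ops_zero[OF rel(1)])
   hence "F - ext B (%b. F (ev b)) : U" by(intro U(2)) (simp add: minus_fun_apply')
   thus "F : (%x. x) ` range (ext B) + U" by(intro set_plusI[of _ "ext B (%b. F (ev b))"]) auto
  qed
  show "addm (%x. x)" by(simp add: addm_def)
  show "addm om & (EX om':range fsc. ALL x. om x = om' x)" if "om : range fsc" for om :: "(('z => 'p) => 'k => 'p) => _"
   using add[OF that] that by blast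
 qed (use add in simp_all)
qed

lemma (in tmod) imul_plus: "imul (E + F) <= imul E + imul F"
 by(rule lsum_plus) (rule sc_addm)

lemma (in tmod) IP_plus: "IP n (E + F) <= IP n E + IP n F"
proof (induction n)
 case (Suc n)
 have "imul (IP n (E + F)) <= imul (IP n E + IP n F)" by(rule lsum_mono[OF Suc])
 also have "... <= imul (IP n E) + imul (IP n F)" by(rule imul_plus)
 finally show ?case by simp
qed simp

text \<open>The cohomological degree is \<open>Suc k\<close>. The submodule \<open>U\<close>
  presents the coefficient module, \<open>f\<close> is a cocycle modulo \<open>U\<close>, and
  \<open>p\<close> is the annihilator of its class in the ring acting through
  \<open>ph\<close>.\<close>

definition extw :: "('a => 'p::comm_ring_1) => (nat => 'x set) => (nat => ('x => 'p) => 'x => 'p) => nat =>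
  ('k => 'p) set => 'a set => bool" where
 "extw ph B d k U p \<longleftrightarrow> (EX f. lin f & (ALL v:Vs (B (Suc (Suc k))). f (d (Suc k) v) : U) &
   p = {a. EX h. lin h & (ALL v:Vs (B (Suc k)). ph a *s f v - h (d k v) : U)})"

text \<open>For a submodule \<open>Y\<close> this is I^n \<open>Y\<close>, where I is generated by
  the \<open>al l\<close>.\<close>

definition ivec :: "(nat => 'p::comm_ring_1) => nat => nat => ('k => 'p) set => ('k => 'p) set" where
 "ivec al m n Y = (lsum (%l. smul (al l)) {..<m} ^^ n) Y"

locale shamash_dual = shamash JJ BG deg d f c g sg K
 for JJ :: "nat => 'p::comm_ring_1 set" and BG :: "'x set" and deg d f c g sg K +
 fixes ph :: "'a::comm_ring_1 => 'p" and gm :: "nat => 'a" and m :: nat and JA :: "'a set"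
  and rel :: "('k => 'p) set" and e :: nat
 assumes ph: "ph (a + b) = ph a + ph b" "ph (a * b) = ph a * ph b" "ph 1 = 1"
  and JA: "idl JA" "rnoeth JA" "a : JA ==> ph a : JJ c"
  and rel: "smd rel" "JV (JJ c) <= rel" "opnoeth (range smul) UNIV rel"
  and e: "g <= e"
begin

definition tt :: "nat => ((nat multiset * 'x => 'p) => 'k => 'p) => (nat multiset * 'x => 'p) => 'k => 'p" where
 "tt j F = (%u. F (S j u))"

lemma S_comm: "S i (S j u) = S j (S i u)"
 by(rule sl_eqI) (simp add: sl_S add_mset_commute)

sublocale tm: tmod fsc tt c "%l. ph (gm l)" m
 by unfold_locales (auto simp: addm_def tt_def fsc_def fun_eq_iff S_comm)

sublocale ym: tmod "smul :: 'p => ('k => 'p) => 'k => 'p" "%j v. v" c "%l. ph (gm l)" m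
 by unfold_locales (auto simp: addm_def)

abbreviation T :: "nat => (nat multiset * 'x => 'p) set" where "T n \<equiv> Vs (BT c n)"

text \<open>Cochains of all degrees are linear maps on one type; the degree is visible only in the
  relations. \<open>LL i\<close> replaces the space of all linear maps because \<open>core\<close>
  asks for generation by the operators as an equality. Together with \<open>UU i\<close> or
  \<open>UU' i\<close> it still gives everything, by \<open>Lin_LL\<close> and
  \<open>Lin_LL'\<close>.\<close>

definition LL :: "nat => ((nat multiset * 'x => 'p) => 'k => 'p) set" where
 "LL i = (tm.tsum ^^ i) Lin"

text \<open>Steps of 2 match the degree of the operators; since \<open>e\<close> is at least
  \<open>g\<close>, they generate each of these degrees from the preceding one. Consecutive values
  of \<open>e\<close> give both parities.\<close>

definition N0 :: "nat => nat" where "N0 i = 2 * i + e"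

text \<open>\<open>UU\<close> consists of the coboundaries in degree \<open>Suc (N0 i)\<close> and
  \<open>UU'\<close> of the zero cochains one degree higher, both modulo \<open>rel\<close>.\<close>

definition UU :: "nat => ((nat multiset * 'x => 'p) => 'k => 'p) set" where
 "UU i = {F. EX h. lin h & (ALL v:T (Suc (N0 i)). F v - h (D v) : rel)}"

definition UU' :: "nat => ((nat multiset * 'x => 'p) => 'k => 'p) set" where
 "UU' i = {F. ALL v:T (Suc (Suc (N0 i))). F v : rel}"

definition Ux :: "nat => ('k => 'p) set" where
 "Ux n = ym.IP n UNIV + rel"

lemma N0_Suc: "N0 (Suc i) = Suc (Suc (N0 i))"
 by(simp add: N0_def)

lemma smd_Ux: "smd (Ux n)"
 unfolding Ux_def by(rule vmod.ops_range_plus[OF ym.osub_IP[OF ops_UNIV] rel(1)])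

lemma rel_Ux: "rel <= Ux n"
 unfolding Ux_def by(rule plus_ge2[OF ops_zero[OF ym.osub_IP[OF ops_UNIV]]])

lemma osub_LL: "tm.osub (LL i)"
 unfolding LL_def by(induction i) (simp_all add: osub_Lin tm.osub_tsum)

lemma LL_Lin: "LL i <= Lin"
proof (induction i)
 case (Suc i)
 have "tm.tsum (LL i) <= Lin"
 proof (rule lsum_least[OF osub_Lin])
  fix j F assume "F : LL i"
  hence "lin F" using Suc by auto
  thus "tt j F : Lin" using lin_comp[OF _ lin_S] by(simp add: tt_def)
 qed
 thus ?case by(simp add: LL_def)
qed (simp add: LL_def)

lemma UU_I: "(!!v. v : T (Suc (N0 i)) ==> F v : rel) ==> F : UU i"
 unfolding UU_def using lin_zero by fastforce

lemma osub_UU: "tm.osub (UU i)"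
proof (rule fmod.ops_rangeI)
 show "0 : UU i" by(rule UU_I) (simp add: ops_zero[OF rel(1)])
next
 fix F G assume "F : UU i" "G : UU i"
 then obtain h k where h: "lin h" "!!v. v : T (Suc (N0 i)) ==> F v - h (D v) : rel"
  and k: "lin k" "!!v. v : T (Suc (N0 i)) ==> G v - k (D v) : rel" by(auto simp: UU_def)
 have "(F + G) v - (h (D v) + k (D v)) : rel" if "v : T (Suc (N0 i))" for v
  using ops_add[OF rel(1) h(2)[OF that] k(2)[OF that]] by(simp add: algebra_simps)
 thus "F + G : UU i" unfolding UU_def using lin_add[OF h(1) k(1)] by blast
next
 fix a F assume "F : UU i"
 then obtain h where h: "lin h" "!!v. v : T (Suc (N0 i)) ==> F v - h (D v) : rel" by(auto simp: UU_def)
 have "fsc a F v - a *s h (D v) : rel" if "v : T (Suc (N0 i))" for v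
  using smd_smul[OF rel(1) h(2)[OF that], of a] by(simp add: fsc_apply vmod.sc_diff)
 thus "fsc a F : UU i" unfolding UU_def using lin_smul[OF h(1), of a] by blast
qed

lemma tt_UU: "F : UU i ==> tt j F : UU (Suc i)"
proof -
 assume "F : UU i"
 then obtain h where h: "lin h" "!!v. v : T (Suc (N0 i)) ==> F v - h (D v) : rel" by(auto simp: UU_def)
 have "tt j F v - h (S j (D v)) : rel" if "v : T (Suc (N0 (Suc i)))" for v
  unfolding S_D tt_def using that by(intro h(2) S_BT) (simp add: N0_Suc)
 thus ?thesis unfolding UU_def using lin_comp[OF h(1) lin_S[of j]] by blast
qed

text \<open>In degrees above \<open>g\<close> every basis element of the total complex involves one of the variables, so
 the cochains are generated by those of degree 2 less under the operators \<open>tt j\<close>.\<close>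

lemma Lin_step:
 assumes F: "lin F" and n: "g <= n"
 shows "F : tm.tsum Lin + {F. ALL v:T (Suc (Suc n)). F v : rel}"
proof -
 let ?B = "BT c (Suc (Suc n))" and ?C = "BT c n"
 \<comment> \<open>Each basis element is assigned to the smallest variable occurring in it, so that
   \<open>G\<close> reproduces the value of \<open>F\<close> there exactly once.\<close>
 define y where "y j = (%(al, x). if Min_mset (add_mset j al) = j then F (ev (add_mset j al, x)) else 0)" for j
 define G where "G = (SUM j<c. tt j (ext ?C (y j)))"
 have G: "G : tm.tsum Lin" unfolding G_def by(rule lsumI) (simp add: lin_ext)
 have G_lin: "lin G" using G lsum_least[OF osub_Lin, of "{..<c}" Lin tt] lin_comp[OF _ lin_S]
  by(auto simp: tt_def)
 have Gv: "G u = (SUM j<c. ext ?C (y j) (S j u))" for u by(simp add: G_def sum_fun_apply tt_def)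
 have "F (ev b) - G (ev b) : rel" if b: "b : ?B" for b
 proof -
  obtain al x where bx: "b = (al, x)" by(cases b)
  have ax: "set_mset al <= {..<c}" "x : BG" "2 * size al + deg x = Suc (Suc n)" using b by(auto simp: bx BT_def)
  have a0: "al \<noteq> {#}" using ax BG(2)[OF ax(2)] n by auto
  define j0 where "j0 = Min_mset al"
  have j0: "j0 \<in># al" using a0 by(simp add: j0_def)
  have Sj: "S j (ev (al, x)) = (if j \<in># al then ev (al - {#j#}, x) else 0)" for j
  proof
   fix q :: "nat multiset * 'x"
   obtain be z where q: "q = (be, z)" by(cases q)
   show "S j (ev (al, x)) q = (if j \<in># al then ev (al - {#j#}, x) else 0) q"
    by(cases "j \<in># al") (auto simp: S_def ev_def q)
  qed
  have inC: "(al - {#j#}, x) : ?C" if ja: "j \<in># al" for j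
  proof -
   obtain be where be: "al = add_mset j be" using ja by(auto dest: multi_member_split)
   thus ?thesis using ax by(auto simp: BT_def)
  qed
  have "G (ev b) = (SUM j<c. if j = j0 then F (ev b) else 0)"
   unfolding Gv
  proof (rule sum.cong)
   fix j
   show "ext ?C (y j) (S j (ev b)) = (if j = j0 then F (ev b) else 0)"
   proof (cases "j \<in># al")
    case True
    hence "ext ?C (y j) (S j (ev b)) = y j (al - {#j#}, x)"
     by(simp add: bx Sj ext_ev[OF finite_BT inC])
    also have "... = (if Min_mset (add_mset j (al - {#j#})) = j then F (ev (add_mset j (al - {#j#}), x)) else 0)"
     by(simp only: y_def prod.case)
    also have "add_mset j (al - {#j#}) = al" using True by simp
    finally show ?thesis by(auto simp: j0_def bx)
   next
    case False
    thus ?thesis using j0 by(auto simp: bx Sj lin_simps(4)[OF lin_ext])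
   qed
  qed simp
  also have "... = F (ev b)" using j0 ax(1) by auto
  finally show ?thesis by(simp add: ops_zero[OF rel(1)])
 qed
 hence "F v - G v : rel" if "v : T (Suc (Suc n))" for v
  using lin_mem[OF finite_BT lin_diff[OF F G_lin] rel(1) _ that] by blast
 thus ?thesis by(intro set_plusI[of F G "F - G"]) (auto simp: G minus_fun_apply')
qed

lemma Lin_LL_gen:
 assumes Z: "!!i. tm.osub (Z i)" "!!j i F. F : Z i ==> tt j F : Z (Suc i)"
  "!!i F. (!!v. v : T (2 * i + s) ==> F v : rel) ==> F : Z i" and s: "g <= s"
 shows "Lin <= LL i + Z i"
proof (induction i)
 case 0
 show ?case unfolding LL_def using plus_ge1[OF ops_zero[OF Z(1)]] by simp
next
 case (Suc i)
 have s1: "tm.osub (LL (Suc i) + Z (Suc i))" by(rule fmod.ops_range_plus[OF osub_LL Z(1)])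
 have "tm.tsum Lin <= tm.tsum (LL i + Z i)" by(rule lsum_mono[OF Suc])
 also have "... <= tm.tsum (LL i) + tm.tsum (Z i)" by(rule lsum_plus) (auto intro: tm.tt_addm)
 also have "... <= LL (Suc i) + Z (Suc i)"
 proof (rule set_plus_mono2)
  show "tm.tsum (LL i) <= LL (Suc i)" by(simp add: LL_def)
  show "tm.tsum (Z i) <= Z (Suc i)" by(rule lsum_least[OF Z(1,2)])
 qed
 finally have 1: "tm.tsum Lin <= LL (Suc i) + Z (Suc i)" .
 have "{F. ALL v:T (2 * Suc i + s). F v : rel} <= Z (Suc i)" using Z(3) by blast
 hence 2: "{F. ALL v:T (2 * Suc i + s). F v : rel} <= LL (Suc i) + Z (Suc i)"
  using plus_ge2[OF ops_zero[OF osub_LL], of "Z (Suc i)"] by(rule order_trans)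
 show ?case
 proof
  fix F :: "(nat multiset * 'x => 'p) => 'k => 'p" assume "F : Lin"
  hence "F : tm.tsum Lin + {F. ALL v:T (2 * Suc i + s). F v : rel}"
   using Lin_step[of F "2 * i + s"] s by simp
  thus "F : LL (Suc i) + Z (Suc i)" by(rule subsetD[OF plus_least[OF s1 1 2]])
 qed
qed

lemma Lin_LL: "Lin <= LL i + UU i"
 by(rule Lin_LL_gen[where Z = UU and s = "Suc e", OF osub_UU tt_UU]) (use e in \<open>auto intro: UU_I simp: N0_def\<close>)

lemma osub_UU': "tm.osub (UU' i)"
 unfolding UU'_def by(rule osub_into[OF rel(1)])

lemma tt_UU': "F : UU' i ==> tt j F : UU' (Suc i)"
 using S_BT[of _ c "Suc (Suc (N0 i))" j] by(auto simp: UU'_def tt_def N0_Suc)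

lemma Lin_LL': "Lin <= LL i + UU' i"
 by(rule Lin_LL_gen[where Z = UU' and s = "Suc (Suc e)", OF osub_UU' tt_UU']) (use e in \<open>auto simp: UU'_def N0_def\<close>)

text \<open>The values on basis vectors are written with coefficients in I^n. Coordinate maps are
  linear in the value, so the coefficients move from the values to the maps.\<close>

lemma into_IP:
 assumes B: "finite B" and G: "lin G" "!!v. v : Vs B ==> G v : Ux n"
 shows "G : tm.IP n Lin + {F. ALL v:Vs B. F v : rel}"
proof -
 have "EX y. y : ym.IP n UNIV & G (ev b) - y : rel" if b: "b : B" for b
 proof -
  have "G (ev b) : Ux n" by(rule G(2)[OF ev_Vs[OF b]])
  then obtain y r where "G (ev b) = y + r" "y : ym.IP n UNIV" "r : rel"
   unfolding Ux_def by(rule set_plus_elim)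
  thus ?thesis by(intro exI[of _ y]) simp
 qed
 then obtain y where y: "!!b. b : B ==> y b : ym.IP n UNIV & G (ev b) - y b : rel" by metis
 have "(%v. v b *s y b) : tm.IP n Lin" if b: "b : B" for b
 proof -
  have "EX F. F = (%z v. v b *s z) & F (y b) : tm.IP n Lin"
  proof -
   have yb: "y b : (lsum (%l. smul (ph (gm l))) {..<m} ^^ n) UNIV" using y[OF b] by blast
   have "(%z v. v b *s z) (y b) : (lsum (%l. fsc (ph (gm l))) {..<m} ^^ n) Lin"
    using yb
   proof (induction n arbitrary: y)
    case 0 thus ?case using lin_coord by simp
   next
    case (Suc n)
    hence "y b : lsum (%l. smul (ph (gm l))) {..<m} ((lsum (%l. smul (ph (gm l))) {..<m} ^^ n) UNIV)" by simp
    hence "(%z v. v b *s z) (y b) : lsum (%l. fsc (ph (gm l))) {..<m} ((lsum (%l. fsc (ph (gm l))) {..<m} ^^ n) Lin)"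
    proof (rule lsum_map[where h = "%z v. v b *s z"])
     show "addm (%(z :: 'k => 'p) v. v b *s z)" by(simp add: addm_def fun_eq_iff vmod.sc_add)
     show "(%v. v b *s ph (gm k) *s z) = fsc (ph (gm k)) (%v. v b *s z)" for k and z :: "'k => 'p"
      by(simp add: fsc_def vmod.sc_commute)
     show "(%v. v b *s z) : (lsum (%l. fsc (ph (gm l))) {..<m} ^^ n) Lin"
      if "z : (lsum (%l. smul (ph (gm l))) {..<m} ^^ n) UNIV" for z :: "'k => 'p"
      using Suc.IH[of "%_. z"] that by simp
    qed
    thus ?case by simp
   qed
   thus ?thesis by simp
  qed
  thus ?thesis by simp
 qed
 hence "(SUM b:B. (%v. v b *s y b)) : tm.IP n Lin" by(intro ops_sum[OF tm.osub_IP[OF osub_Lin]])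
 moreover have "(SUM b:B. (%v. v b *s y b)) = ext B y" by(simp add: fun_eq_iff ext_def sum_fun_apply)
 moreover have "G v - ext B y v : rel" if "v : Vs B" for v
  by(rule ext_agree[OF B rel(1) G(1) _ that]) (simp add: y)
 ultimately show ?thesis by(intro set_plusI[of G "ext B y" "G - ext B y"]) (auto simp: minus_fun_apply')
qed

lemma IP_value: "F : tm.IP n E ==> F v : ym.IP n UNIV"
proof (induction n arbitrary: F)
 case (Suc n)
 hence "F : tm.imul (tm.IP n E)" by simp
 hence "F v : ym.imul (ym.IP n UNIV)"
  by(rule lsum_map[where g = "%F. F v" and h = "%F. F v"]) (auto simp: addm_def fsc_apply intro: Suc.IH)
 thus ?case by simp
qed simp

lemma IP_Lin:
 assumes "tm.osub Z" "Lin <= LL i + Z"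
 shows "tm.IP n Lin <= tm.IP n (LL i) + Z"
proof -
 have "tm.IP n Lin <= tm.IP n (LL i + Z)" by(rule tm.IP_mono[OF assms(2)])
 also have "... <= tm.IP n (LL i) + tm.IP n Z" by(rule tm.IP_plus)
 also have "... <= tm.IP n (LL i) + Z" by(rule set_plus_mono2[OF order_refl tm.IP_subset[OF assms(1)]])
 finally show ?thesis .
qed

lemma LU_iff:
 assumes "lin F"
 shows "F : tm.IP n (LL i) + UU i \<longleftrightarrow> (EX h. lin h & (ALL v:T (Suc (N0 i)). F v - h (D v) : Ux n))" (is "?l \<longleftrightarrow> ?r")
proof
 assume ?l
 then obtain G H where GH: "F = G + H" "G : tm.IP n (LL i)" "H : UU i" by(rule set_plus_elim)
 obtain h where h: "lin h" "!!v. v : T (Suc (N0 i)) ==> H v - h (D v) : rel" using GH(3) by(auto simp: UU_def)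
 have "F v - h (D v) : Ux n" if "v : T (Suc (N0 i))" for v
  unfolding Ux_def by(rule set_plusI[OF _ IP_value[OF GH(2)] h(2)[OF that]]) (simp add: GH(1))
 thus ?r using h(1) by blast
next
 assume ?r
 then obtain h where h: "lin h" "!!v. v : T (Suc (N0 i)) ==> F v - h (D v) : Ux n" by blast
 have s: "tm.osub (tm.IP n (LL i) + UU i)" by(rule fmod.ops_range_plus[OF tm.osub_IP[OF osub_LL] osub_UU])
 have U: "UU i <= tm.IP n (LL i) + UU i" by(rule plus_ge2[OF ops_zero[OF tm.osub_IP[OF osub_LL]]])
 have hD: "lin (%v. h (D v))" by(rule lin_comp[OF h(1) lin_D])
 have "(%v. F v - h (D v)) : tm.IP n Lin + {F. ALL v:T (Suc (N0 i)). F v : rel}"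
  by(rule into_IP[OF finite_BT lin_diff[OF assms hD] h(2)])
 moreover have "{F. ALL v:T (Suc (N0 i)). F v : rel} <= tm.IP n (LL i) + UU i" using UU_I U by blast
 ultimately have 1: "(%v. F v - h (D v)) : tm.IP n (LL i) + UU i"
  using plus_least[OF s IP_Lin[OF osub_UU Lin_LL]] by blast
 have "(%v. h (D v)) : UU i" unfolding UU_def using h(1) ops_zero[OF rel(1)] by auto
 hence 2: "(%v. h (D v)) : tm.IP n (LL i) + UU i" using U by blast
 have "F = (%v. F v - h (D v)) + (%v. h (D v))" by(rule HOL.ext) simp
 thus ?l using ops_add[OF s 1 2] by simp
qed

lemma LU'_iff:
 assumes "lin F"
 shows "F : tm.IP n (LL i) + UU' i \<longleftrightarrow> (ALL v:T (Suc (Suc (N0 i))). F v : Ux n)" (is "?l \<longleftrightarrow> ?r")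
proof
 assume ?l
 then obtain G H where GH: "F = G + H" "G : tm.IP n (LL i)" "H : UU' i" by(rule set_plus_elim)
 have "F v : Ux n" if "v : T (Suc (Suc (N0 i)))" for v
  unfolding Ux_def by(rule set_plusI[of _ "G v" "H v"]) (use GH that IP_value[OF GH(2)] in \<open>auto simp: UU'_def\<close>)
 thus ?r by blast
next
 assume ?r
 hence "F : tm.IP n Lin + {F. ALL v:T (Suc (Suc (N0 i))). F v : rel}"
  by(intro into_IP[OF finite_BT assms]) auto
 moreover have "UU' i <= tm.IP n (LL i) + UU' i" by(rule plus_ge2[OF ops_zero[OF tm.osub_IP[OF osub_LL]]])
 moreover have "tm.osub (tm.IP n (LL i) + UU' i)" by(rule fmod.ops_range_plus[OF tm.osub_IP[OF osub_LL] osub_UU'])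
 ultimately show ?l using plus_least[OF _ IP_Lin[OF osub_UU' Lin_LL'], of "range fsc" n i "UU' i"] unfolding UU'_def by blast
qed

sublocale co: core fsc tt c ph gm m LL LL UU UU' "%F u. F (D u)" JA
proof unfold_locales
 show "LL (Suc i) = tm.tsum (LL i)" for i by(simp add: LL_def)
 show "opnoeth (range fsc) (LL 0) (UU 0)"
  unfolding LL_def by simp (rule opnoeth_Lin[OF finite_BT rel(1,3) osub_UU UU_I])
 show "opnoeth (range fsc) (LL 0) (UU' 0)"
  unfolding LL_def by simp (rule opnoeth_Lin[OF finite_BT rel(1,3) osub_UU'], auto simp: UU'_def)
 show "fsc (ph a) F : UU i" if "a : JA" "F : LL i" for a F i
  using smul_JV[OF JJ(1) JA(3)[OF that(1)]] rel(2) by(intro UU_I) (auto simp: fsc_apply)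
 show "(%u. tt j F (D u)) = tt j (%u. F (D u))" for j F by(simp add: tt_def S_D)
qed (simp_all add: ph osub_LL osub_UU osub_UU' tt_UU tt_UU' addm_def fun_eq_iff fsc_apply JA)

lemma act_iff: "lin F ==> fsc (ph a) F : tm.IP n (LL i) + UU i \<longleftrightarrow>
  (EX h. lin h & (ALL v:T (Suc (N0 i)). ph a *s F v - h (D v) : Ux n))"
 using LU_iff[of "fsc (ph a) F"] lin_smul[of F "ph a"] by(simp add: fsc_def)

text \<open>By \<open>Lin_LL\<close> every cocycle differs from an element of \<open>LL i\<close> by
  a coboundary modulo \<open>rel\<close>. This changes neither the cocycle condition, as
  \<open>D\<close> squares to zero modulo \<open>JJ c\<close>, nor the annihilator of the
  class.\<close>

lemma W_iff: "co.W n i p \<longleftrightarrow> extw ph (BT c) (%_. D) (N0 i) (Ux n) p"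
proof
 assume "co.W n i p"
 then obtain z where z: "z : LL i" "(%u. z (D u)) : tm.IP n (LL i) + UU' i" "p = {a. fsc (ph a) z : tm.IP n (LL i) + UU i}"
  unfolding co.W_def by blast
 have l: "lin z" using z(1) LL_Lin by blast
 have "ALL v:T (Suc (Suc (N0 i))). z (D v) : Ux n" using z(2) LU'_iff[OF lin_comp[OF l lin_D]] by blast
 thus "extw ph (BT c) (%_. D) (N0 i) (Ux n) p"
  unfolding extw_def using l z(3) act_iff[OF l] by blast
next
 assume "extw ph (BT c) (%_. D) (N0 i) (Ux n) p"
 then obtain f where f: "lin f" "!!v. v : T (Suc (Suc (N0 i))) ==> f (D v) : Ux n"
  "p = {a. EX h. lin h & (ALL v:T (Suc (N0 i)). ph a *s f v - h (D v) : Ux n)}" unfolding extw_def by blast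
 have "f : LL i + UU i" using f(1) Lin_LL by blast
 then obtain z k where zk: "f = z + k" "z : LL i" "k : UU i" by(rule set_plus_elim)
 have l: "lin z" using zk(2) LL_Lin by blast
 have kz: "k v = f v - z v" for v by(simp add: zk(1))
 obtain h0 where h0: "lin h0" "!!v. v : T (Suc (N0 i)) ==> f v - z v - h0 (D v) : rel"
  using zk(3) unfolding UU_def kz by auto
 have "z (D v) : Ux n" if v: "v : T (Suc (Suc (N0 i)))" for v
 proof -
  have Dv: "D v : T (Suc (N0 i))" by(rule D_BT[OF v])
  have "h0 (D (D v)) : JV (JJ c)"
   by(rule lin_JV[OF finite_BT h0(1) JJ(1) D_BT[OF Dv] DD_JJ[OF v]]) auto
  hence "h0 (D (D v)) : Ux n" using rel(2) rel_Ux by blast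
  from ops_diff[OF smd_Ux ops_diff[OF smd_Ux f(2)[OF v] subsetD[OF rel_Ux h0(2)[OF Dv]]] this]
  show ?thesis by simp
 qed
 hence "(%u. z (D u)) : tm.IP n (LL i) + UU' i" using LU'_iff[OF lin_comp[OF l lin_D]] by blast
 moreover have "(EX h. lin h & (ALL v:T (Suc (N0 i)). ph a *s f v - h (D v) : Ux n)) \<longleftrightarrow> fsc (ph a) z : tm.IP n (LL i) + UU i" for a
 proof -
  have a: "ph a *s (f v - z v - h0 (D v)) : Ux n" if "v : T (Suc (N0 i))" for v
   using smd_smul[OF rel(1) h0(2)[OF that]] rel_Ux by blast
  have "(EX h. lin h & (ALL v:T (Suc (N0 i)). ph a *s f v - h (D v) : Ux n)) \<longleftrightarrow>
   (EX h. lin h & (ALL v:T (Suc (N0 i)). ph a *s z v - h (D v) : Ux n))" (is "?l \<longleftrightarrow> ?r")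
  proof
   assume ?l
   then obtain h where h: "lin h" "!!v. v : T (Suc (N0 i)) ==> ph a *s f v - h (D v) : Ux n" by blast
   have "ph a *s z v - (h (D v) - ph a *s h0 (D v)) : Ux n" if "v : T (Suc (N0 i))" for v
    using ops_diff[OF smd_Ux h(2)[OF that] a[OF that]] by(simp add: vmod.sc_diff vmod.sc_add algebra_simps)
   thus ?r using lin_diff[OF h(1) lin_smul[OF h0(1), of "ph a"]] by blast
  next
   assume ?r
   then obtain h where h: "lin h" "!!v. v : T (Suc (N0 i)) ==> ph a *s z v - h (D v) : Ux n" by blast
   have "ph a *s f v - (h (D v) + ph a *s h0 (D v)) : Ux n" if "v : T (Suc (N0 i))" for v
    using ops_add[OF smd_Ux h(2)[OF that] a[OF that]] by(simp add: vmod.sc_diff vmod.sc_add diff_diff_eq add.commute)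
   thus ?l using lin_add[OF h(1) lin_smul[OF h0(1), of "ph a"]] by blast
  qed
  thus ?thesis using act_iff[OF l] by blast
 qed
 ultimately show "co.W n i p" unfolding co.W_def using zk(2) f(3) by blast
qed

lemma extw_stable: "EX n0 i0. ALL n>=n0. ALL i>=i0.
  {p. prm p & extw ph (BT c) (%_. D) (2 * i + e) (Ux n) p} = {p. prm p & extw ph (BT c) (%_. D) (2 * i0 + e) (Ux n0) p}"
 using co.stable_ass unfolding W_iff N0_def .

end

text \<open>Ext does not depend on the resolution. For one direction of the transfer it is enough
  that the maps in degree 0 compose to the identity on one side, which makes
  \<open>be n (al n v) - v\<close> null-homotopic.\<close>

lemma extw_transfer:
 assumes J: "idl J" and U: "smd U" "JV J <= U"
  and cB: "cplx J B d" and cC: "cplx J C e"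
  and eB: "!!n. exact_at J B d n" and eC: "!!n. exact_at J C e n"
  and al0: "lin al0" "!!v. v : Vs (B 0) ==> al0 v : Vs (C 0)"
  "!!v. v : Vs (B 1) ==> EX w:Vs (C 1). al0 (d 0 v) - e 0 w : JV J"
  and be0: "lin be0" "!!v. v : Vs (C 0) ==> be0 v : Vs (B 0)"
  "!!v. v : Vs (C 1) ==> EX w:Vs (B 1). be0 (e 0 v) - d 0 w : JV J"
  and inv: "!!v. v : Vs (B 0) ==> be0 (al0 v) = v"
  and ex: "extw ph B d k U p"
 shows "extw ph C e k U p"
proof -
 note B = cplxD[OF cB] and C = cplxD[OF cC]
 obtain al where al: "al 0 = al0" "!!n. lin (al n)" "!!n v. v : Vs (B n) ==> al n v : Vs (C n)"
  "!!n v. v : Vs (B (Suc n)) ==> e n (al (Suc n) v) - al n (d n v) : JV J"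
  using comparison[OF J cB cC eC al0] by blast
 obtain be where be: "be 0 = be0" "!!n. lin (be n)" "!!n v. v : Vs (C n) ==> be n v : Vs (B n)"
  "!!n v. v : Vs (C (Suc n)) ==> d n (be (Suc n) v) - be n (e n v) : JV J"
  using comparison[OF J cC cB eB be0] by blast
 define \<psi> where "\<psi> n v = be n (al n v) - v" for n v
 have \<psi>_lin: "lin (\<psi> n)" for n unfolding \<psi>_def[abs_def] by(rule lin_diff[OF lin_comp[OF be(2) al(2)] lin_id])
 have "EX h. (ALL n. lin (h n)) & (ALL n v. h n v : Vs (B (Suc (n + 0)))) &
  (ALL v:Vs (B 0). \<psi> 0 v - d 0 (h 0 v) : JV J) &
  (ALL n. ALL v:Vs (B (Suc n)). \<psi> (Suc n) v - d (Suc (n + 0)) (h (Suc n) v) - h n (d n v) : JV J)"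
 proof (rule nullhomotopy[OF J cB cB eB \<psi>_lin])
  show "\<psi> n v : Vs (B (n + 0))" if "v : Vs (B n)" for n v
   using ops_diff[OF smd_Vs be(3)[OF al(3)[OF that]] that] by(simp add: \<psi>_def)
  show "d (n + 0) (\<psi> (Suc n) v) - \<psi> n (d n v) : JV J" if v: "v : Vs (B (Suc n))" for n v
  proof -
   have "e n (al (Suc n) v) - al n (d n v) : Vs (C n)"
    by(rule ops_diff[OF smd_Vs C(3)[OF al(3)[OF v]] al(3)[OF B(3)[OF v]]])
   from lin_JV[OF C(1) be(2) J this al(4)[OF v], of n]
   have "be n (e n (al (Suc n) v)) - be n (al n (d n v)) : JV J" by(simp add: lin_simps(2)[OF be(2)])
   from ops_add[OF smd_JV[OF J] be(4)[OF al(3)[OF v]] this]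
   show ?thesis by(simp add: \<psi>_def lin_simps(2)[OF B(2)])
  qed
  show "EX w:Vs (B (Suc 0)). \<psi> 0 v - d 0 w : JV J" if "v : Vs (B 0)" for v
   using ops_zero[OF smd_JV[OF J]]
   by(intro bexI[of _ 0]) (simp_all add: \<psi>_def al(1) be(1) inv[OF that] lin_simps(4)[OF B(2)] ops_zero[OF smd_Vs])
 qed
 then obtain h where h: "!!n. lin (h n)" "!!n v. h n v : Vs (B (Suc n))"
  "!!n v. v : Vs (B (Suc n)) ==> \<psi> (Suc n) v - d (Suc n) (h (Suc n) v) - h n (d n v) : JV J" by(simp only: add_0_right) blast
 have UJ: "x : U" if "x : JV J" for x using that U(2) by blast
 obtain f where f: "lin f" "!!v. v : Vs (B (Suc (Suc k))) ==> f (d (Suc k) v) : U"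
  "p = {a. EX h. lin h & (ALL v:Vs (B (Suc k)). ph a *s f v - h (d k v) : U)}"
  using ex unfolding extw_def by blast
 define f' where "f' v = f (be (Suc k) v)" for v
 have f'_lin: "lin f'" unfolding f'_def[abs_def] by(rule lin_comp[OF f(1) be(2)])
 have "f' (e (Suc k) v) : U" if v: "v : Vs (C (Suc (Suc k)))" for v
 proof -
  have "d (Suc k) (be (Suc (Suc k)) v) - be (Suc k) (e (Suc k) v) : Vs (B (Suc k))"
   by(rule ops_diff[OF smd_Vs B(3)[OF be(3)[OF v]] be(3)[OF C(3)[OF v]]])
  from UJ[OF lin_JV[OF B(1) f(1) J this be(4)[OF v]]]
  have "f (d (Suc k) (be (Suc (Suc k)) v)) - f' (e (Suc k) v) : U"
   by(simp add: lin_simps(2)[OF f(1)] f'_def)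
  from ops_diff[OF U(1) f(2)[OF be(3)[OF v]] this] show ?thesis by simp
 qed
 moreover have "(EX h. lin h & (ALL v:Vs (B (Suc k)). ph a *s f v - h (d k v) : U)) \<longleftrightarrow>
   (EX h. lin h & (ALL v:Vs (C (Suc k)). ph a *s f' v - h (e k v) : U))" (is "?l \<longleftrightarrow> ?r") for a
 proof
  assume ?l
  then obtain q where q: "lin q" "!!v. v : Vs (B (Suc k)) ==> ph a *s f v - q (d k v) : U" by blast
  have "ph a *s f' v - q (be k (e k v)) : U" if v: "v : Vs (C (Suc k))" for v
  proof -
   have "d k (be (Suc k) v) - be k (e k v) : Vs (B k)"
    by(rule ops_diff[OF smd_Vs B(3)[OF be(3)[OF v]] be(3)[OF C(3)[OF v]]])
   from UJ[OF lin_JV[OF B(1) q(1) J this be(4)[OF v]]]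
   have "q (d k (be (Suc k) v)) - q (be k (e k v)) : U" by(simp add: lin_simps(2)[OF q(1)])
   from ops_add[OF U(1) q(2)[OF be(3)[OF v]] this] show ?thesis by(simp add: f'_def)
  qed
  thus ?r using lin_comp[OF q(1) be(2)] by blast
 next
  assume ?r
  then obtain q where q: "lin q" "!!v. v : Vs (C (Suc k)) ==> ph a *s f' v - q (e k v) : U" by blast
  \<comment> \<open>The correction term comes from the homotopy: since \<open>f\<close> takes
    boundaries into \<open>U\<close>, the difference of \<open>f'\<close> after \<open>al\<close>
    and \<open>f\<close> is the coboundary of \<open>f\<close> after \<open>h k\<close>, up to
    \<open>U\<close>.\<close>
  have "ph a *s f v - (q (al k (d k v)) - ph a *s f (h k (d k v))) : U" if v: "v : Vs (B (Suc k))" for v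
  proof -
   have "e k (al (Suc k) v) - al k (d k v) : Vs (C k)"
    by(rule ops_diff[OF smd_Vs C(3)[OF al(3)[OF v]] al(3)[OF B(3)[OF v]]])
   from UJ[OF lin_JV[OF C(1) q(1) J this al(4)[OF v]]]
   have 1: "q (e k (al (Suc k) v)) - q (al k (d k v)) : U" by(simp add: lin_simps(2)[OF q(1)])
   have "\<psi> (Suc k) v - d (Suc k) (h (Suc k) v) - h k (d k v) : Vs (B (Suc k))"
    unfolding \<psi>_def using B(3)[OF h(2)] h(2) be(3)[OF al(3)[OF v]] v
    by(intro ops_diff[OF smd_Vs]) auto
   from UJ[OF lin_JV[OF B(1) f(1) J this h(3)[OF v]]]
   have "f' (al (Suc k) v) - f v - f (d (Suc k) (h (Suc k) v)) - f (h k (d k v)) : U"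
    by(simp add: \<psi>_def f'_def lin_simps(2)[OF f(1)])
   from ops_add[OF U(1) this f(2)[OF h(2)[of "Suc k" v]]]
   have "f' (al (Suc k) v) - f v - f (h k (d k v)) : U" by(simp add: algebra_simps)
   from smd_smul[OF U(1) this, of "ph a"]
   have 2: "ph a *s f' (al (Suc k) v) - ph a *s f v - ph a *s f (h k (d k v)) : U" by(simp add: vmod.sc_diff)
   from ops_diff[OF U(1) ops_add[OF U(1) q(2)[OF al(3)[OF v]] 1] 2]
   show ?thesis by(simp add: algebra_simps)
  qed
  thus ?l using lin_diff[OF lin_comp[OF q(1) al(2)] lin_smul[OF lin_comp[OF f(1) h(1)]]] by blast
 qed
 ultimately show ?thesis unfolding extw_def using f'_lin f(3) by blast
qed

section \<open>Finite free resolutions over the regular ring\<close>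

definition cover :: "'p::comm_ring_1 set => ('x => 'p) set => nat => (nat => 'x => 'p) => bool" where
 "cover J Z r z \<longleftrightarrow> (ALL s<r. z s : Z) & (ALL v:Z. EX c. v - (SUM s<r. c s *s z s) : JV J) &
   ((EX r z. free_basis J Z r z) --> free_basis J Z r z) & (Z <= JV J --> r = 0)"

text \<open>A basis is taken whenever one exists, and the empty family for a trivial module. These
  two preferences are what makes a resolution built from covers stop.\<close>

lemma cover_exists:
 fixes Z :: "('x => 'p::comm_ring_1) set"
 assumes J: "rnoeth J" "idl J" and B: "finite B" and Z: "smd Z" "Z <= Vs B"
 shows "EX r z. cover J Z r z"
proof -
 consider "Z <= JV J" | "~ Z <= JV J" "EX r z. free_basis J Z r z" | "~ Z <= JV J" "~ (EX r z. free_basis J Z r z)" by blast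
 thus ?thesis
 proof cases
  case 1
  hence "free_basis J Z 0 z" for z by(auto simp: free_basis_def)
  thus ?thesis using 1 unfolding cover_def by(intro exI[of _ 0] exI[of _ undefined]) (auto simp: free_basis_def)
 next
  case 2
  then obtain r z where "free_basis J Z r z" by blast
  hence "cover J Z r z" using 2 unfolding cover_def free_basis_def by blast
  thus ?thesis by blast
 next
  case 3
  obtain F where F: "finite F" "F <= Z + JV J" "Z + JV J <= gen (range smul) (F Un JV J)"
   using opnoethD[OF noeth_vectors[OF J(2,1) B] plus_JV(1-3)[OF J(2) Z]] by blast
  have "ALL f:F. EX g. g : Z & f - g : JV J"
  proof
   fix f assume "f : F"
   hence "f : Z + JV J" using F(2) by auto
   then obtain g j where "f = g + j" "g : Z" "j : JV J" by(rule set_plus_elim)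
   thus "EX g. g : Z & f - g : JV J" by(intro exI[of _ g]) auto
  qed
  from bchoice[OF this] obtain g where g: "ALL f:F. g f : Z & f - g f : JV J" ..
  obtain h where h: "bij_betw h {0..<card F} F" using ex_bij_betw_nat_finite[OF F(1)] by blast
  have hF: "h s : F" if "s < card F" for s using bij_betwE[OF h] that by auto
  have JVs: "smd (JV J :: ('x => 'p) set)" by(rule smd_JV[OF J(2)])
  have "EX c. v - (SUM s<card F. c s *s g (h s)) : JV J" if "v : Z" for v
  proof -
   have im: "h ` {..<card F} = F" using bij_betw_imp_surj_on[OF h] by(simp add: lessThan_atLeast0)
   have "v : gen (range smul) (h ` {..<card F} Un JV J)" using that plus_JV(4)[OF J(2) Z] F(3) im by auto
   from vmod.gen_family[OF _ JVs this] obtain a where a: "v - (SUM s<card F. a s *s h s) : JV J" by auto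
   have "(SUM s<card F. a s *s h s) - (SUM s<card F. a s *s g (h s)) : JV J"
    unfolding sum_subtractf[symmetric] vmod.sc_diff[symmetric]
    using g hF by(intro ops_sum[OF JVs] smd_smul[OF JVs]) auto
   from ops_add[OF JVs a this] show ?thesis by(intro exI[of _ a]) simp
  qed
  hence "cover J Z (card F) (%s. g (h s))" unfolding cover_def using 3 g hF by auto
  thus ?thesis by blast
 qed
qed

text \<open>Covers of successive kernels are chosen. By \<open>syzygy_free\<close> the kernel inside
  term \<open>length xs + 1\<close> is free, its cover is a basis, the next kernel is trivial, and
  the ranks above \<open>length xs + 2\<close> are 0. Basis elements carry their degree as first
  component, so one map \<open>d\<close> serves all degrees.\<close>

theorem finite_free_resolution:
 fixes J :: "'p::comm_ring_1 set" and Z0 :: "(nat * nat => 'p) set"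
 assumes J: "rnoeth J" "idl J" and n: "lcl J \<nn>" "\<nn> = gi (J Un set xs)" "regp J xs"
  and Z0: "smd Z0" "Z0 <= Vs ({0} \<times> {..<b0})"
 shows "EX r d. r 0 = b0 & (ALL n>length xs + 2. r n = 0) & lin d &
  (ALL n. ALL v:Vs ({Suc n} \<times> {..<r (Suc n)}). d v : Vs ({n} \<times> {..<r n})) &
  (ALL v:Vs ({0} \<times> {..<r 0}). d v = 0) &
  (ALL v:Vs ({1} \<times> {..<r 1}). d v : Z0) &
  (ALL v:Z0. EX w:Vs ({1} \<times> {..<r 1}). v - d w : JV J) &
  (ALL n. ALL v:Vs ({Suc (Suc n)} \<times> {..<r (Suc (Suc n))}). d (d v) : JV J) &
  (ALL n. ALL v:Vs ({Suc n} \<times> {..<r (Suc n)}). d v : JV J -->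
   (EX w:Vs ({Suc (Suc n)} \<times> {..<r (Suc (Suc n))}). v - d w : JV J))"
proof -
 note JVs = smd_JV[OF J(2)]
 define dd where "dd n r z = ext ({Suc n} \<times> {..<r}) (%x. z (snd x))"
  for n r and z :: "nat => nat * nat => 'p"
 define Zk where "Zk n r z = {v : Vs ({Suc n} \<times> {..<r}). dd n r z v : JV J}" for n r z
 have dd_lin: "lin (dd n r z)" for n r z by(simp add: dd_def lin_ext)
 have Zk: "smd (Zk n r z)" "Zk n r z <= Vs ({Suc n} \<times> {..<r})" for n r z
  unfolding Zk_def by(rule smd_kernel[OF dd_lin smd_Vs JVs]) auto
 define P where "P = (%n (r, r', z). (ALL s<r'. z s : Vs ({n} \<times> {..<r})) & (n = (0::nat) --> r = b0 & cover J Z0 r' z))"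
 \<comment> \<open>A state of the dependent choice records two consecutive ranks and the vectors
   that define the differential between them.\<close>
 define Q where "Q = (%(n::nat) (r::nat, r', z) (r1, r1', z1). r1 = r' & cover J (Zk n r' z) r1' z1)"
 have "EX s. ALL n. P n (s n) & Q n (s n) (s (Suc n))"
 proof (rule dependent_nat_choice)
  obtain r z where rz: "cover J Z0 r z" using cover_exists[OF J _ Z0] by auto
  hence "P 0 (b0, r, z)" using Z0(2) by(auto simp: P_def cover_def)
  thus "EX x. P 0 x" by blast
 next
  fix x n assume x: "P n x"
  obtain r r' z where xe: "x = (r, r', z)" by(cases x) auto
  obtain r1 z1 where c1: "cover J (Zk n r' z) r1 z1" using cover_exists[OF J _ Zk] by blast
  hence "ALL s<r1. z1 s : Zk n r' z" by(simp add: cover_def)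
  hence "P (Suc n) (r', r1, z1)" using Zk(2)[of n r' z] unfolding P_def by simp blast
  moreover have "Q n x (r', r1, z1)" using c1 by(simp add: Q_def xe)
  ultimately show "EX y. P (Suc n) y & Q n x y" by blast
 qed
 then obtain s where s: "!!n. P n (s n)" "!!n. Q n (s n) (s (Suc n))" by blast
 define r where "r n = fst (s n)" for n
 define z where "z n = snd (snd (s n))" for n
 have step: "s n = (r n, r (Suc n), z n)" for n
  using s(2)[of n] by(cases "s n"; cases "s (Suc n)") (auto simp: Q_def r_def z_def)
 define B where "B n = {n} \<times> {..<r n}" for n
 define de where "de n = dd n (r (Suc n)) (z n)" for n
 have finB: "finite (B n)" for n by(simp add: B_def)
 have de_lin: "lin (de n)" for n by(simp add: de_def dd_lin)
 have zB: "z n t : Vs (B n)" if "t < r (Suc n)" for n t using s(1)[of n] that by(simp add: step P_def B_def)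
 have de_ev: "de n (ev (Suc n, t)) = z n t" if "t < r (Suc n)" for n t
  using that by(simp add: de_def dd_def ext_ev)
 have de_B: "de n v : Vs (B n)" if "v : Vs (B (Suc n))" for n v
  by(rule lin_mem[OF finB de_lin smd_Vs _ that]) (auto simp: B_def[of "Suc n"] de_ev zB)
 have de_sum: "EX w:Vs (B (Suc n)). de n w = (SUM t<r (Suc n). c t *s z n t)" for n c
 proof (rule bexI)
  show "de n (SUM t<r (Suc n). c t *s ev (Suc n, t)) = (SUM t<r (Suc n). c t *s z n t)"
   by(simp add: lin_simps(3)[OF de_lin] linD(2)[OF de_lin] de_ev)
  show "(SUM t<r (Suc n). c t *s ev (Suc n, t)) : Vs (B (Suc n))"
   by(rule ops_sum[OF smd_Vs]) (auto intro!: smd_smul[OF smd_Vs] ev_Vs simp: B_def)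
 qed
 have r0: "r 0 = b0" and cov0: "cover J Z0 (r 1) (z 0)" using s(1)[of 0] by(simp_all add: step P_def)
 have covS: "cover J {v : Vs (B (Suc n)). de n v : JV J} (r (Suc (Suc n))) (z (Suc n))" for n
  using s(2)[of n] by(simp add: step Q_def Zk_def de_def B_def)
 have deZ0: "de 0 v : Z0" if "v : Vs (B 1)" for v
  using cov0 by(intro lin_mem[OF finB de_lin Z0(1) _ that]) (auto simp: B_def de_ev cover_def)
 have dede: "de n (de (Suc n) v) : JV J" if "v : Vs (B (Suc (Suc n)))" for n v
  by(rule lin_mem[OF finB lin_comp[OF de_lin de_lin] JVs _ that])
   (use covS[of n] in \<open>auto simp: B_def[of "Suc (Suc n)"] de_ev cover_def\<close>)
 have deex: "EX w:Vs (B (Suc (Suc n))). v - de (Suc n) w : JV J" if v: "v : Vs (B (Suc n))" "de n v : JV J" for n v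
 proof -
  obtain c where "v - (SUM t<r (Suc (Suc n)). c t *s z (Suc n) t) : JV J" using covS[of n] v unfolding cover_def by blast
  thus ?thesis using de_sum[of "Suc n" c] by metis
 qed
 have ex0: "EX w:Vs (B 1). v - de 0 w : JV J" if v: "v : Z0" for v
 proof -
  obtain c where "v - (SUM t<r 1. c t *s z 0 t) : JV J" using cov0 v unfolding cover_def by blast
  thus ?thesis using de_sum[of 0 c] by(metis One_nat_def)
 qed
 let ?k = "length xs"
 have "EX r z. free_basis J {v : Vs (B (Suc ?k)). de ?k v : JV J} r z"
  by(rule syzygy_free[where B = B and d = de and k = "length xs", OF J n finB de_lin de_B dede deex]) auto
 \<comment> \<open>\<open>cover\<close> prefers a basis, so the family already chosen is
   one.\<close>
 hence fb: "free_basis J {v : Vs (B (Suc ?k)). de ?k v : JV J} (r (?k + 2)) (z (Suc ?k))"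
  using covS[of ?k] unfolding cover_def by simp
 have "{v : Vs (B (Suc (Suc ?k))). de (Suc ?k) v : JV J} <= JV J"
 proof clarify
  fix v assume v: "v : Vs (B (Suc (Suc ?k)))" "de (Suc ?k) v : JV J"
  have "de (Suc ?k) v = (SUM x:B (Suc (Suc ?k)). v x *s de (Suc ?k) (ev x))"
   by(rule lin_expand[OF finB de_lin v(1)])
  also have "... = (SUM t<r (?k + 2). v (Suc (Suc ?k), t) *s z (Suc ?k) t)"
   by(rule sum.reindex_bij_witness[where i = "%t. (Suc (Suc ?k), t)" and j = snd]) (auto simp: B_def de_ev)
  finally have "(SUM t<r (?k + 2). v (Suc (Suc ?k), t) *s z (Suc ?k) t) : JV J" using v(2) by simp
  with fb have "ALL t<r (?k + 2). v (Suc (Suc ?k), t) : J"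
   unfolding free_basis_def by(elim conjE allE[of _ "%t. v (Suc (Suc ?k), t)"]) blast
  hence "v x : J" if "x : B (Suc (Suc ?k))" for x using that by(auto simp: B_def)
  moreover have "v x : J" if "x ~: B (Suc (Suc ?k))" for x
  proof -
   have "v x = 0" using v(1) that unfolding Vs_def by blast
   thus ?thesis using ops_zero[OF J(2)] by simp
  qed
  ultimately have "v x : J" for x by blast
  thus "v : JV J" by(simp add: JV_def)
 qed
 hence rk: "r (?k + 3) = 0" using covS[of "Suc ?k"] by(simp add: cover_def eval_nat_numeral)
 have rS: "r (Suc (Suc n)) = 0" if "r (Suc n) = 0" for n
 proof -
  have "{v : Vs (B (Suc n)). de n v : JV J} <= JV J"
   using that ops_zero[OF J(2)] by(auto simp: B_def Vs_def JV_def)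
  thus ?thesis using covS[of n] by(simp add: cover_def)
 qed
 have rz: "r n = 0" if "n > ?k + 2" for n
 proof -
  have "r (?k + 3 + i) = 0" for i
  proof (induction i)
   case (Suc i) thus ?case using rS[of "?k + 2 + i"] by(simp add: eval_nat_numeral)
  qed (use rk in simp)
  from this[of "n - (?k + 3)"] show ?thesis using that by simp
 qed
 \<comment> \<open>Each \<open>de n\<close> vanishes off its own degree, so the sum restricts to
   \<open>de n\<close> there; in degrees beyond the range of the sum the modules are zero.\<close>
 define d where "d v = (SUM n<=?k + 2. de n v)" for v
 have d_lin: "lin d" unfolding d_def[abs_def] by(rule lin_sum[OF de_lin])
 have de0: "de n v = 0" if "v : Vs (B m)" "m \<noteq> Suc n" for n m v
  unfolding de_def dd_def ext_def using that by(intro sum.neutral) (auto simp: Vs_def B_def)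
 have dde: "d v = de n v" if v: "v : Vs (B (Suc n))" for n v
 proof (cases "n <= ?k + 2")
  case True
  have "d v = (SUM m<=?k + 2. if m = n then de n v else 0)"
   unfolding d_def using de0[OF v] by(intro sum.cong) auto
  thus ?thesis using True by simp
 next
  case False
  hence "v = 0" using rz[of "Suc n"] v by(auto simp: B_def Vs_def fun_eq_iff)
  thus ?thesis by(simp add: lin_simps(4)[OF d_lin] lin_simps(4)[OF de_lin])
 qed
 have d0: "d v = 0" if "v : Vs (B 0)" for v unfolding d_def using de0[OF that] by(intro sum.neutral) auto
 have "ALL n. ALL v:Vs (B (Suc n)). d v : Vs (B n)" "ALL v:Vs (B 0). d v = 0" "ALL v:Vs (B 1). d v : Z0"
  using de_B dde d0 deZ0 by(auto simp: One_nat_def)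
 moreover have "ALL v:Z0. EX w:Vs (B 1). v - d w : JV J" using ex0 dde[of _ 0] by(metis One_nat_def)
 moreover have "ALL n. ALL v:Vs (B (Suc (Suc n))). d (d v) : JV J"
  using dede de_B dde by metis
 moreover have "ALL n. ALL v:Vs (B (Suc n)). d v : JV J --> (EX w:Vs (B (Suc (Suc n))). v - d w : JV J)"
  using deex dde by metis
 ultimately show ?thesis using r0 rz d_lin unfolding B_def by blast
qed

context shamash
begin

lemma sum_MS_zero:
 assumes "!!be. be \<noteq> {#} ==> h be = 0"
 shows "(SUM be:MS K. sg be (h be)) = d (h {#})"
proof -
 have "(SUM be:MS K. sg be (h be)) = (SUM be:{{#}}. sg be (h be))"
  by(rule sum.mono_neutral_right) (use finite_MS in \<open>auto simp: MS_def assms sg_0\<close>)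
 thus ?thesis by(simp add: goodD(2)[OF good])
qed

lemma D_low:
 assumes "!!al. al \<noteq> {#} ==> sl u al = 0"
 shows "sl (D u) al = (if al = {#} then d (sl u {#}) else 0)"
proof (cases "al = {#}")
 case True
 thus ?thesis unfolding sl_D using assms by(subst sum_MS_zero) auto
next
 case False
 hence "sl (D u) al = 0" unfolding sl_D using assms by(intro sum.neutral) (auto simp: sg_0)
 thus ?thesis using False by simp
qed

end

text \<open>The given resolution over the ring modulo \<open>JJ c\<close> and the total complex
  built from a finite resolution over the ring modulo \<open>JJ 0\<close> resolve the same module,
  so \<open>extw\<close> agrees on them, and on the total complex the operators act. The bound is
  \<open>length xs + 2\<close>, the length of the finite resolution.\<close>

theorem complete_intersection_stable:
 fixes JJ :: "nat => 'p::comm_ring_1 set" and ph :: "'a::comm_ring_1 => 'p" and rel :: "('k => 'p) set"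
  and dF :: "nat => (nat => 'p) => nat => 'p"
 assumes J0: "rnoeth (JJ 0)" "lcl (JJ 0) \<nn>" "\<nn> = gi (JJ 0 Un set xs)" "regp (JJ 0) xs"
  and JJ: "!!j. idl (JJ j)" "!!j. j < c ==> JJ (Suc j) = gi (insert (f j) (JJ j))"
  and reg: "!!j a. j < c ==> f j * a : JJ j ==> a : JJ j"
  and F: "cplx (JJ c) (%n. {..<b n}) dF" "!!n. exact_at (JJ c) (%n. {..<b n}) dF n"
  and ph: "!!a b. ph (a + b) = ph a + ph b" "!!a b. ph (a * b) = ph a * ph b" "ph 1 = 1"
  and JA: "idl JA" "rnoeth JA" "!!a. a : JA ==> ph a : JJ c"
  and rel: "smd rel" "JV (JJ c) <= rel" "opnoeth (range smul) UNIV rel"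
 shows "EX g. ALL e>=g. EX n0 i0. ALL n>=n0. ALL i>=i0.
  {p. prm p & extw ph (%n. {..<b n}) dF (2 * i + e) (ivec (%l. ph (gm l)) m n UNIV + rel) p} =
  {p. prm p & extw ph (%n. {..<b n}) dF (2 * i0 + e) (ivec (%l. ph (gm l)) m n0 UNIV + rel) p}"
proof -
 let ?J = "JJ c"
 note F' = cplxD[OF F(1)] and J = smd_JV[OF JJ(1)]
 have JJmono: "i <= j ==> j <= c ==> JJ i <= JJ j" for i j
 proof (induction j)
  case (Suc j)
  thus ?case using JJ(2)[of j] subset_gi_insert[of "JJ j" "f j"] by(cases "i = Suc j") auto
 qed simp
 have fJ: "f j : ?J" if "j < c" for j
  using that JJmono[of "Suc j" c] JJ(2)[of j] gen_inc[of "insert (f j) (JJ j)" "range (*)"] by auto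
 define rx where "rx u = (%s. if s < b 0 then u (0, s) else 0)" for u :: "nat * nat => 'p"
 have rx_lin: "lin rx" by(auto simp: lin_def addm_def rx_def fun_eq_iff smul_apply)
 have rx_V: "rx u : Vs {..<b 0}" for u by(simp add: rx_def Vs_def)
 \<comment> \<open>The relations of the resolved module. They contain \<open>JV ?J\<close>, which is
   the reason why every \<open>f j\<close> annihilates it.\<close>
 define im where "im = {v. EX w:Vs {..<b 1}. v - dF 0 w : JV ?J}"
 have im: "smd im"
 proof (rule vmod.ops_rangeI)
  show "0 : im" unfolding im_def mem_Collect_eq using ops_zero[OF J]
   by(intro bexI[of _ 0]) (simp_all add: lin_simps(4)[OF F'(2)] ops_zero[OF smd_Vs])
  show "x + y : im" if xy: "x : im" "y : im" for x y
  proof -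
   obtain w w' where w: "w : Vs {..<b 1}" "x - dF 0 w : JV ?J" "w' : Vs {..<b 1}" "y - dF 0 w' : JV ?J"
    using xy unfolding im_def by blast
   have "x + y - dF 0 (w + w') : JV ?J"
    using ops_add[OF J w(2,4)] by(simp add: lin_simps(1)[OF F'(2)] algebra_simps)
   thus ?thesis unfolding im_def using ops_add[OF smd_Vs w(1,3)] by blast
  qed
  show "a *s x : im" if x: "x : im" for a x
  proof -
   obtain w where w: "w : Vs {..<b 1}" "x - dF 0 w : JV ?J" using x unfolding im_def by blast
   have "a *s x - dF 0 (a *s w) : JV ?J"
    using smd_smul[OF J w(2), of a] by(simp add: linD(2)[OF F'(2)] vmod.sc_diff)
   thus ?thesis unfolding im_def using smd_smul[OF smd_Vs w(1)] by blast
  qed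
 qed
 have imJ: "JV ?J <= im"
  unfolding im_def using ops_zero[OF smd_Vs] by(auto simp: lin_simps(4)[OF F'(2)] intro!: bexI[of _ 0])
 define Z0 where "Z0 = {u : Vs ({0} \<times> {..<b 0}). rx u : im}"
 have Z0: "smd Z0" "Z0 <= Vs ({0} \<times> {..<b 0})"
  unfolding Z0_def by(rule smd_kernel[OF rx_lin smd_Vs im]) auto
 obtain r d where A: "r 0 = b 0" "ALL n>length xs + 2. r n = 0" "lin d"
  "ALL n. ALL v:Vs ({Suc n} \<times> {..<r (Suc n)}). d v : Vs ({n} \<times> {..<r n})"
  "ALL v:Vs ({0} \<times> {..<r 0}). d v = 0"
  "ALL v:Vs ({1} \<times> {..<r 1}). d v : Z0"
  "ALL v:Z0. EX w:Vs ({1} \<times> {..<r 1}). v - d w : JV (JJ 0)"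
  "ALL n. ALL v:Vs ({Suc (Suc n)} \<times> {..<r (Suc (Suc n))}). d (d v) : JV (JJ 0)"
  "ALL n. ALL v:Vs ({Suc n} \<times> {..<r (Suc n)}). d v : JV (JJ 0) -->
   (EX w:Vs ({Suc (Suc n)} \<times> {..<r (Suc (Suc n))}). v - d w : JV (JJ 0))"
  using finite_free_resolution[OF J0(1) JJ(1) J0(2-4) Z0] by(elim exE conjE) (rule that)
 note r0 = A(1) and rz = A(2)[rule_format] and d_lin = A(3) and d_V = A(4)[rule_format] and d_0 = A(5)[rule_format]
  and d_Z0 = A(6)[rule_format] and Z0_d = A(7)[rule_format] and dd = A(8)[rule_format] and d_ex = A(9)[rule_format]
 define BG where "BG = (SIGMA n:UNIV. {..<r n})"
 have BGn: "{x : BG. fst x = n} = {n} \<times> {..<r n}" for n by(auto simp: BG_def)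
 have BG_deg: "fst x <= length xs + 2" if "x : BG" for x
  using that rz[of "fst x"] by(cases "fst x <= length xs + 2") (auto simp: BG_def)
 have BG_fin: "finite BG"
 proof (rule finite_subset)
  show "BG <= (SIGMA n:{..length xs + 2}. {..<r n})" using BG_deg by(auto simp: BG_def)
 qed simp
 have V1: "Vs ({x : BG. fst x = 1}) = Vs ({1} \<times> {..<r 1})" by(simp only: BGn)
 interpret hh: higher_homotopies JJ BG fst d f c "length xs + 2"
 proof unfold_locales
  show "d (d v) : JV (JJ 0)" if v: "v : Vs BG" for v
  proof (rule lin_mem[OF BG_fin lin_comp[OF d_lin d_lin] J _ v])
   fix x assume x: "x : BG"
   obtain n s where ns: "x = (n, s)" by(cases x)
   have evx: "ev x : (Vs ({n} \<times> {..<r n}) :: (nat * nat => 'p) set)" using x by(intro ev_Vs) (simp add: ns BG_def)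
   consider "n = 0" | "n = 1" | k where "n = Suc (Suc k)" by(cases n; cases "n - 1") auto
   thus "d (d (ev x)) : JV (JJ 0)"
   proof cases
    case 1 thus ?thesis using d_0[of "ev x"] evx ops_zero[OF J] by(simp add: lin_simps(4)[OF d_lin])
   next
    case 2 thus ?thesis using d_0[OF d_V[of "ev x" 0]] evx ops_zero[OF J] by simp
   next
    case 3 thus ?thesis using dd evx by simp
   qed
  qed
  show "EX w:Vs {x : BG. fst x = 1}. f j *s v - d w : JV (JJ 0)"
   if j: "j < c" and v: "v : Vs {x : BG. fst x = 0}" for j v
  proof -
   have "v : Vs ({0} \<times> {..<b 0})" using v by(simp only: BGn r0)
   moreover have "rx (f j *s v) : im"
    unfolding linD(2)[OF rx_lin] by(rule subsetD[OF imJ smul_JV[OF JJ(1) fJ[OF j]]])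
   ultimately have "f j *s v : Z0" unfolding Z0_def using smd_smul[OF smd_Vs] by blast
   thus ?thesis using Z0_d by(simp only: V1)
  qed
 qed (use JJ reg BG_fin BG_deg d_lin d_V d_0 d_ex in \<open>simp_all only: BGn\<close>)
 define K where "K = length xs + 3"
 obtain sg where sg: "hh.good K sg" using hh.good_exists by blast
 interpret sh: shamash JJ BG fst d f c "length xs + 2" sg K
  by unfold_locales (use sg in \<open>auto simp: K_def\<close>)
 have BT0: "sh.BT c 0 = {{#}} \<times> ({0} \<times> {..<b 0})" and BT1: "sh.BT c 1 = {{#}} \<times> ({1} \<times> {..<r 1})"
 proof -
  have "2 * size al + n = 1 \<longleftrightarrow> al = {#} & n = 1" for al :: "nat multiset" and n by(cases al) auto
  thus "sh.BT c 0 = {{#}} \<times> ({0} \<times> {..<b 0})" "sh.BT c 1 = {{#}} \<times> ({1} \<times> {..<r 1})"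
   unfolding sh.BT_def by(auto simp: BG_def r0)
 qed
 \<comment> \<open>In degree 0 both complexes are the free module on \<open>b 0\<close> elements;
   \<open>al0\<close> and \<open>be0\<close> are the identifications.\<close>
 define al0 where "al0 v = (%(al :: nat multiset, (n :: nat, s)). if al = {#} & n = 0 & s < b 0 then v s else 0)"
  for v :: "nat => 'p"
 define be0 where "be0 u = rx (sh.sl u {#})" for u :: "nat multiset \<times> nat * nat => 'p"
 have al0_lin: "lin al0" by(auto simp: lin_def addm_def al0_def fun_eq_iff smul_apply)
 have be0_lin: "lin be0" unfolding be0_def[abs_def] by(rule lin_comp[OF rx_lin sh.lin_sl])
 have al0_V: "al0 v : Vs (sh.BT c 0)" for v unfolding BT0 by(auto simp: al0_def Vs_def)
 have be0_V: "be0 u : Vs {..<b 0}" for u unfolding be0_def by(rule rx_V)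
 have beal: "be0 (al0 v) = v" if "v : Vs {..<b 0}" for v
  using that by(auto simp: be0_def al0_def rx_def sh.sl_def Vs_def fun_eq_iff)
 have albe: "al0 (be0 u) = u" if "u : Vs (sh.BT c 0)" for u
 proof
  fix q :: "nat multiset \<times> nat * nat"
  obtain al n s where q: "q = (al, (n, s))" by(cases q) auto
  show "al0 (be0 u) q = u q"
  proof (cases "q : sh.BT c 0")
   case True thus ?thesis unfolding BT0 by(auto simp: q al0_def be0_def rx_def sh.sl_def)
  next
   case False
   hence "u q = 0" using that unfolding Vs_def by blast
   thus ?thesis using False unfolding BT0 by(auto simp: q al0_def)
  qed
 qed
 have al_im: "EX w:Vs (sh.BT c 1). al0 (dF 0 v) - sh.D w : JV ?J" if v: "v : Vs {..<b 1}" for v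
 proof -
  define u where "u = sh.sl (al0 (dF 0 v)) {#}"
  have dv: "dF 0 v : Vs {..<b 0}" using F'(3)[of v 0] v by simp
  have "rx u = dF 0 v" using beal[OF dv] by(simp add: be0_def u_def)
  moreover have "dF 0 v : im" unfolding im_def using v ops_zero[OF J] by(auto intro!: bexI[of _ v])
  moreover have "u : Vs ({0} \<times> {..<b 0})" by(auto simp: u_def al0_def sh.sl_def Vs_def)
  ultimately have "u : Z0" by(simp add: Z0_def)
  then obtain w0 where w0: "w0 : Vs ({1} \<times> {..<r 1})" "u - d w0 : JV (JJ 0)" using Z0_d by blast
  define w where "w = (%(al :: nat multiset, y). if al = {#} then w0 y else 0)"
  have slw: "sh.sl w al = (if al = {#} then w0 else 0)" for al by(auto simp: w_def sh.sl_def)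
  have "w : Vs (sh.BT c 1)" using w0(1) unfolding BT1 by(auto simp: w_def Vs_def)
  moreover have "al0 (dF 0 v) - sh.D w : JV (JJ 0)"
   unfolding sh.JV_sl
  proof
   fix al
   have "sh.sl (sh.D w) al = (if al = {#} then d w0 else 0)" by(subst sh.D_low) (auto simp: slw)
   moreover have "sh.sl (al0 (dF 0 v)) al = 0" if "al \<noteq> {#}" using that by(auto simp: al0_def sh.sl_def fun_eq_iff)
   moreover have "(0 :: nat * nat => 'p) : JV (JJ 0)" by(rule ops_zero[OF J])
   ultimately show "sh.sl (al0 (dF 0 v) - sh.D w) al : JV (JJ 0)"
    using w0(2) by(simp add: lin_simps(2)[OF sh.lin_sl] u_def)
  qed
  ultimately show ?thesis using JV_mono[OF JJmono[of 0 c]] by blast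
 qed
 have be_im: "EX w:Vs {..<b 1}. be0 (sh.D v) - dF 0 w : JV ?J" if v: "v : Vs (sh.BT c 1)" for v
 proof -
  have v0: "sh.sl v al = 0" if "al \<noteq> {#}" for al
  proof
   fix y
   have "(al, y) ~: sh.BT c 1" unfolding BT1 using that by auto
   hence "v (al, y) = 0" using v unfolding Vs_def by blast
   thus "sh.sl v al y = 0 y" by(simp add: sh.sl_def)
  qed
  have "sh.sl v {#} : Vs ({1} \<times> {..<r 1})" using v unfolding BT1 by(auto simp: Vs_def sh.sl_def)
  hence "d (sh.sl v {#}) : Z0" by(rule d_Z0)
  moreover have "be0 (sh.D v) = rx (d (sh.sl v {#}))" unfolding be0_def by(subst sh.D_low) (auto simp: v0)
  ultimately show ?thesis by(simp add: Z0_def im_def)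
 qed
 show ?thesis
 proof (rule exI[of _ "length xs + 2"], intro allI impI)
  fix e assume e: "length xs + 2 <= e"
  interpret sd: shamash_dual JJ BG fst d f c "length xs + 2" sg K ph gm m JA rel e
   by unfold_locales (use ph JA rel e in auto)
  have Ux: "sd.Ux n = ivec (%l. ph (gm l)) m n UNIV + rel" for n by(simp add: sd.Ux_def ivec_def)
  have UxJ: "JV ?J <= sd.Ux n" for n using sd.rel_Ux rel(2) by blast
  have tr: "extw ph (%n. {..<b n}) dF k (sd.Ux n) p \<longleftrightarrow> extw ph (sh.BT c) (%_. sh.D) k (sd.Ux n) p" for k n p
  proof
   show "extw ph (sh.BT c) (%_. sh.D) k (sd.Ux n) p" if "extw ph (%n. {..<b n}) dF k (sd.Ux n) p"
    by(rule extw_transfer[OF JJ(1) sd.smd_Ux UxJ F(1) sh.cplx_D F(2) sh.exact_D al0_lin al0_V al_im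
     be0_lin be0_V be_im beal that])
   show "extw ph (%n. {..<b n}) dF k (sd.Ux n) p" if "extw ph (sh.BT c) (%_. sh.D) k (sd.Ux n) p"
    by(rule extw_transfer[OF JJ(1) sd.smd_Ux UxJ sh.cplx_D F(1) sh.exact_D F(2) be0_lin be0_V be_im
     al0_lin al0_V al_im albe that])
  qed
  show "EX n0 i0. ALL n>=n0. ALL i>=i0.
   {p. prm p & extw ph (%n. {..<b n}) dF (2 * i + e) (ivec (%l. ph (gm l)) m n UNIV + rel) p} =
   {p. prm p & extw ph (%n. {..<b n}) dF (2 * i0 + e) (ivec (%l. ph (gm l)) m n0 UNIV + rel) p}"
   using sd.extw_stable unfolding tr[symmetric] unfolding Ux .
 qed
qed

section \<open>Completion: flatness and descent of associated primes\<close>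

lemma lsum_funpow_map:
 assumes "addm g" "!!k y. g (ta k y) = ta' k (g y)" "!!y. y : E ==> g y : E'" "x : (lsum ta K ^^ n) E"
 shows "g x : (lsum ta' K ^^ n) E'"
 using assms(4)
proof (induction n arbitrary: x)
 case (Suc n)
 hence "x : lsum ta K ((lsum ta K ^^ n) E)" by simp
 hence "g x : lsum ta' K ((lsum ta' K ^^ n) E')" by(rule lsum_map[where h = g]) (use assms Suc.IH in auto)
 thus ?case by simp
qed (use assms in auto)

text \<open>Both rings are presented: \<open>JA\<close> and \<open>J\<close> are the relations of
  the ring and of its completion, \<open>io\<close> lifts the map between them, and
  \<open>KK n\<close> is the kernel of the projection to the \<open>n\<close>-th quotient. Density,
  completeness and \<open>KK_l\<close> describe the completion up to isomorphism of its
  presentation.\<close>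

locale completion_map =
 fixes io :: "'a::comm_ring_1 => 'p::comm_ring_1" and JA mm :: "'a set" and \<mu> :: "nat => 'a" and s :: nat
  and J :: "'p set" and KK :: "nat => 'p set"
 assumes l_add: "io (a + b) = io a + io b" and l_mult: "io (a * b) = io a * io b" and l_1: "io 1 = 1"
  and JA: "idl JA" "rnoeth JA" and mm: "lcl JA mm" "\<mu> ` {..<s} <= mm"
  and KK: "idl (KK n)" "KK (Suc n) <= KK n" and J: "(\<Inter>n. KK n) = J"
  and KK_l: "io a : KK n \<longleftrightarrow> a : (lsum (%l. (*) (\<mu> l)) {..<s} ^^ n) UNIV + JA"
  and dense: "EX a. x - io a : KK n"
  and complete: "(!!n. io (sq (Suc n) - sq n) : KK n) ==> EX x. ALL n. x - io (sq n) : KK n"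
begin

sublocale rm: tmod "(*) :: 'a => 'a => 'a" "%j v. v" 0 \<mu> s
 by unfold_locales auto

sublocale vm: tmod "smul :: 'a => ('x => 'a) => 'x => 'a" "%j v. v" 0 \<mu> s
 by unfold_locales auto

definition MA :: "nat => 'a set" where "MA n = rm.IP n UNIV + JA"

lemma KK_MA: "io a : KK n \<longleftrightarrow> a : MA n"
 unfolding KK_l MA_def ..

lemma idl_MA: "idl (MA n)"
 unfolding MA_def by(rule rmod.ops_range_plus[OF rm.osub_IP[OF ops_UNIV] JA(1)])

lemma JA_MA: "JA <= MA n"
 unfolding MA_def by(rule plus_ge2[OF ops_zero[OF rm.osub_IP[OF ops_UNIV]]])

lemma KK_mono: "n <= k ==> KK k <= KK n"
 by(rule lift_Suc_antimono_le[where f = KK, OF KK(2)])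

lemma idl_J: "idl J"
 unfolding J[symmetric] by(rule ops_Inter) (use KK in auto)

lemma J_KK: "J <= KK n"
 unfolding J[symmetric] by auto

lemma l_0: "io 0 = 0"
 using l_add[of 0 0] by simp

lemma l_minus: "io (- a) = - io a"
 using l_add[of a "- a"] l_0 by(simp add: add_eq_0_iff2)

lemma l_diff: "io (a - b) = io a - io b"
 using l_add[of a "- b"] l_minus by simp

lemma l_J: "a : JA ==> io a : J"
 unfolding J[symmetric] using KK_MA JA_MA by auto

definition lv :: "('x => 'a) => 'x => 'p" where
 "lv v = (%x. io (v x))"

lemma lv_add: "lv (u + v) = lv u + lv v" and lv_diff: "lv (u - v) = lv u - lv v"
 and lv_smul: "lv (a *s v) = io a *s lv v" and lv_0: "lv 0 = 0"
 by(auto simp: lv_def fun_eq_iff l_add l_diff l_mult l_0 smul_apply minus_fun_apply')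

lemma lv_addm: "addm lv"
 unfolding addm_def using lv_add by blast

lemma lv_sum: "lv (SUM i:S. u i) = (SUM i:S. lv (u i))"
 by(rule addm_sum[OF lv_addm])

lemma lv_ev: "lv (ev x) = ev x"
 by(auto simp: lv_def ev_def l_0 l_1 fun_eq_iff)

lemma lv_Vs: "v : Vs B ==> lv v : Vs B"
 by(auto simp: lv_def Vs_def l_0)

lemma lv_KK: "lv v : JV (KK n) \<longleftrightarrow> v : JV (MA n)"
 by(simp add: lv_def JV_def KK_MA)

lemma lv_J: "v : JV JA ==> lv v : JV J"
 by(auto simp: lv_def JV_def l_J)

lemma JV_KK: "v : JV J ==> v : JV (KK n)"
 using J_KK by(auto simp: JV_def)

lemma JV_INT: "(!!n. v : JV (KK n)) ==> v : JV J"
 unfolding J[symmetric] by(auto simp: JV_def)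

lemma JV_MA_iff:
 assumes "finite C" "v : Vs C" "v : JV (MA n)"
 shows "v : vm.IP n (Vs C) + JV JA"
proof -
 have "ALL y. EX a. a : rm.IP n UNIV & v y - a : JA"
 proof
  fix y
  have "v y : rm.IP n UNIV + JA" using assms(3) by(simp add: JV_def MA_def)
  then obtain a j where "v y = a + j" "a : rm.IP n UNIV" "j : JA" by(rule set_plus_elim)
  thus "EX a. a : rm.IP n UNIV & v y - a : JA" by(intro exI[of _ a]) simp
 qed
 then obtain a where a: "!!y. a y : rm.IP n UNIV" "!!y. v y - a y : JA" by metis
 have "a y *s ev y : vm.IP n (Vs C)" if "y : C" for y
 proof (rule lsum_funpow_map[OF _ _ _ a(1), where g = "%b. b *s ev y"])
  show "addm (%b. b *s (ev y :: _ => 'a))" by(simp add: addm_def vmod.sc_plus)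
  show "(b *s ev y) : Vs C" for b by(rule smd_smul[OF smd_Vs ev_Vs[OF that]])
 qed (simp add: vmod.sc_sc)
 hence "(SUM y:C. a y *s ev y) : vm.IP n (Vs C)" by(intro ops_sum[OF vm.osub_IP[OF smd_Vs]])
 moreover have "v - (SUM y:C. a y *s ev y) : JV JA"
 proof -
  have "v - (SUM y:C. a y *s ev y) = (SUM y:C. (v y - a y) *s ev y)"
   by(subst Vs_expand[OF assms(1,2)]) (simp add: sum_subtractf vmod.sc_diff_left)
  also have "... : JV JA" by(intro ops_sum[OF smd_JV[OF JA(1)]] smul_JV[OF JA(1)] a)
  finally show ?thesis .
 qed
 ultimately show ?thesis by(intro set_plusI[of v]) auto
qed

lemma IP_JV_MA: "v : vm.IP n E ==> v : JV (MA n)"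
proof -
 assume v: "v : vm.IP n E"
 have "v y : rm.IP n UNIV" for y
  by(rule lsum_funpow_map[OF _ _ _ v, where g = "%v. v y"]) (auto simp: addm_def smul_apply)
 thus ?thesis using plus_ge1[OF ops_zero[OF JA(1)], of "rm.IP n UNIV"] by(auto simp: JV_def MA_def)
qed

text \<open>The classical Artin-Rees lemma, as the case \<open>c = 0\<close> without operators of
  the bigraded one, with \<open>T\<close> placed in degree \<open>i = 0\<close>.\<close>

lemma artin_rees_sub:
 fixes T :: "('y => 'a) set"
 assumes T: "smd T" "opnoeth (range smul) T U" and U: "smd U" and F: "smd F" "U <= F"
 shows "EX k. ALL n. F Int (vm.IP (n + k) T + U) <= vm.IP n F + U"
proof -
 define L where "L i = (if i = 0 then T else {0})" for i :: nat
 define E where "E n i = (if i = 0 then F Int (vm.IP n T + U) else U)" for n i :: nat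
 have z: "lsum (%(j :: nat) v. v) {} E = {0 :: 'y => 'a}" for E by(auto simp: lsum_def)
 have PU: "smd (vm.IP n T + U)" for n by(rule vmod.ops_range_plus[OF vm.osub_IP[OF T(1)] U])
 have s0: "smd {0 :: 'y => 'a}" by(rule ops_0) (auto intro: vmod.sc_addm)
 have Uin: "U <= vm.IP n T' + U" if "smd T'" for T' n by(rule plus_ge2[OF ops_zero[OF vm.osub_IP[OF that]]])
 have "EX N. (ALL n>=N. ALL i. E (Suc n) i <= vm.imul (E n i) + U) & (ALL i>=N. ALL n. E n (Suc i) <= vm.tsum (E n i) + U)"
 proof (rule vm.artin_rees)
  show "smd (L i)" for i using T s0 by(simp add: L_def)
  show "L (Suc i) = vm.tsum (L i)" for i by(simp add: L_def z)
  show "smd (E n i)" for n i unfolding E_def using U ops_Int[OF F(1) PU] by simp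
  show "\<mu> l *s x : E (Suc n) i" if l: "l < s" and x: "x : E n i" for n i l x
  proof (cases "i = 0")
   case True
   hence xF: "x : F" "x : vm.IP n T + U" using x by(auto simp: E_def)
   obtain a b where ab: "x = a + b" "a : vm.IP n T" "b : U" using xF(2) by(rule set_plus_elim)
   have "\<mu> l *s a : vm.IP (Suc n) T" using vm.sc_imul[OF l vm.osub_IP[OF T(1)] ab(2)] by simp
   hence "\<mu> l *s x : vm.IP (Suc n) T + U"
    using smd_smul[OF U ab(3)] by(intro set_plusI[of _ "\<mu> l *s a" "\<mu> l *s b"]) (auto simp: ab(1) vmod.sc_add)
   thus ?thesis using True smd_smul[OF F(1) xF(1)] by(simp add: E_def del: funpow.simps)
  next
   case False thus ?thesis using x smd_smul[OF U] by(simp add: E_def)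
  qed
  show "U <= E n i" for n i using F(2) Uin[OF T(1)] by(auto simp: E_def)
  show "E n i <= vm.IP n (L i) + U" for n i
   using Uin[OF s0] by(auto simp: E_def L_def)
  show "opnoeth (range smul) (L 0) U" using T(2) by(simp add: L_def)
 qed (use U smd_smul[OF U] in auto)
 then obtain N where N: "!!n i. n >= N ==> E (Suc n) i <= vm.imul (E n i) + U" by blast
 have "E (n + N) 0 <= vm.IP n F + U" for n
 proof (induction n)
  case 0
  show ?case using plus_ge1[OF ops_zero[OF U], of F] by(auto simp: E_def)
 next
  case (Suc n)
  have "E (Suc n + N) 0 <= vm.imul (E (n + N) 0) + U" using N[of "n + N" 0] by simp
  also have "... <= vm.imul (vm.IP n F + U) + U" by(rule set_plus_mono2[OF lsum_mono[OF Suc] order_refl])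
  also have "... <= (vm.imul (vm.IP n F) + vm.imul U) + U" by(rule set_plus_mono2[OF vm.imul_plus order_refl])
  also have "... <= (vm.IP (Suc n) F + U) + U" by(rule set_plus_mono2[OF set_plus_mono2[OF _ vm.imul_osub[OF U]] order_refl]) simp
  also have "... <= vm.IP (Suc n) F + U"
   by(rule plus_least[OF vmod.ops_range_plus[OF vm.osub_IP[OF F(1)] U] order_refl Uin[OF F(1)]])
  finally show ?case .
 qed
 thus ?thesis by(intro exI[of _ N]) (simp add: E_def)
qed

lemma IP_image:
 assumes "addm f" "!!a x. f (a *s x) = a *s f x" "x : vm.IP n (f ` E)"
 shows "EX y:vm.IP n E. x = f y"
 using assms(3)
proof (induction n arbitrary: x)
 case (Suc n)
 hence "x : vm.imul (vm.IP n (f ` E))" by simp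
 then obtain y where y: "x = (SUM l<s. \<mu> l *s y l)" "ALL l:{..<s}. y l : vm.IP n (f ` E)" by(rule lsumE)
 hence "ALL l:{..<s}. EX z. z : vm.IP n E & y l = f z" using Suc.IH by blast
 from bchoice[OF this] obtain z where z: "ALL l:{..<s}. z l : vm.IP n E & y l = f (z l)" ..
 have "x = f (SUM l<s. \<mu> l *s z l)" using z by(simp add: y(1) addm_sum[OF assms(1)] assms(2))
 moreover have "(SUM l<s. \<mu> l *s z l) : vm.imul (vm.IP n E)" by(rule lsumI) (use z in auto)
 ultimately show ?case by auto
qed auto

text \<open>If \<open>f v\<close> is close to \<open>U\<close>, then \<open>v\<close> is close to
  the preimage of \<open>U\<close>, with a loss \<open>k\<close> that does not depend on
  \<open>n\<close>. This is Artin-Rees for the image of \<open>f\<close> enlarged by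
  \<open>U\<close>.\<close>

lemma artin_rees_map:
 fixes f :: "('x => 'a) => 'y => 'a"
 assumes B: "finite B" and C: "finite C" and f: "lin f" "!!v. v : Vs B ==> f v : Vs C"
  and U: "smd U" "JV JA <= U" "U <= Vs C + JV JA"
 shows "EX k. ALL n. ALL v:Vs B. ALL u:U. f v - u : JV (MA (n + k)) -->
  (EX w:Vs B. f w : U & v - w : JV (MA n))"
proof -
 have J: "smd (JV JA :: ('y => 'a) set)" by(rule smd_JV[OF JA(1)])
 have smdf: "smd (f ` Vs B)"
  by(rule ops_image[OF smd_Vs linD(1)[OF f(1)]]) (auto simp: linD(2)[OF f(1), symmetric])
 let ?F = "f ` Vs B + U"
 have F: "smd ?F" "U <= ?F" by(rule vmod.ops_range_plus[OF smdf U(1)] plus_ge2[OF ops_zero[OF smdf]])+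
 have n: "opnoeth (range smul) (Vs C) U"
  by(rule opnoeth_mod_mono[OF noeth_vectors[OF JA C] U(2) smd_Vs J U(1)]) (auto intro: vmod.sc_addm)
 obtain k where k: "!!n. ?F Int (vm.IP (n + k) (Vs C) + U) <= vm.IP n ?F + U"
  using artin_rees_sub[OF smd_Vs n U(1) F] by blast
 have "EX w:Vs B. f w : U & v - w : JV (MA n)"
  if v: "v : Vs B" and u: "u : U" and fu: "f v - u : JV (MA (n + k))" for n v u
 proof -
  obtain u0 j where u0: "u = u0 + j" "u0 : Vs C" "j : JV JA" using subsetD[OF U(3) u] by(rule set_plus_elim)
  have "u - j : U" using ops_diff[OF U(1) u] u0(3) U(2) by blast
  hence u0U: "u0 : U" by(simp add: u0(1))
  have "j : JV (MA (n + k))" using u0(3) JV_mono[OF JA_MA] by blast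
  from ops_add[OF smd_JV[OF idl_MA] fu this] have "f v - u0 : JV (MA (n + k))" by(simp add: u0(1))
  from JV_MA_iff[OF C ops_diff[OF smd_Vs f(2)[OF v] u0(2)] this]
  obtain x j' where x: "f v - u0 = x + j'" "x : vm.IP (n + k) (Vs C)" "j' : JV JA" by(rule set_plus_elim)
  have "j' + u0 : U" using ops_add[OF U(1) _ u0U] x(3) U(2) by blast
  hence "f v : vm.IP (n + k) (Vs C) + U"
   using x(1) by(intro set_plusI[OF _ x(2)]) (simp add: algebra_simps)
  moreover have "f v : ?F" by(rule subsetD[OF plus_ge1[OF ops_zero[OF U(1)]] imageI[OF v]])
  ultimately have "f v : vm.IP n ?F + U" using k by blast
  also have "vm.IP n ?F + U <= (vm.IP n (f ` Vs B) + vm.IP n U) + U" by(rule set_plus_mono2[OF vm.IP_plus order_refl])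
  also have "... <= (vm.IP n (f ` Vs B) + U) + U"
   by(rule set_plus_mono2[OF set_plus_mono2[OF order_refl vm.IP_subset[OF U(1)]] order_refl])
  also have "... <= vm.IP n (f ` Vs B) + U"
   by(rule plus_least[OF vmod.ops_range_plus[OF vm.osub_IP[OF smdf] U(1)] order_refl
    plus_ge2[OF ops_zero[OF vm.osub_IP[OF smdf]]]])
  finally obtain y u' where y: "f v = y + u'" "y : vm.IP n (f ` Vs B)" "u' : U" by(rule set_plus_elim)
  obtain w where w: "w : vm.IP n (Vs B)" "y = f w" using IP_image[OF linD[OF f(1)] y(2)] by blast
  have "w : Vs B" using w(1) vm.IP_subset[OF smd_Vs] by blast
  hence "v - w : Vs B" by(rule ops_diff[OF smd_Vs v])
  moreover have "f (v - w) = u'" by(simp add: lin_simps(2)[OF f(1)] y(1) w(2))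
  ultimately show ?thesis using y(3) IP_JV_MA[OF w(1)] by(intro bexI[of _ "v - w"]) simp_all
 qed
 thus ?thesis by(intro exI[of _ k]) blast
qed

text \<open>The extension of \<open>U\<close> to the completion. Its compatibility with preimages is
  \<open>flat\<close>, with membership \<open>faithful\<close>, with annihilator conditions
  \<open>colon\<close>.\<close>

definition hat :: "('x => 'a) set => ('x => 'p) set" where
 "hat U = gen (range smul) (lv ` U Un JV J)"

lemma smd_hat: "smd (hat U)"
 unfolding hat_def by(rule ops_gen)

lemma lv_hat: "u : U ==> lv u : hat U"
 unfolding hat_def by(rule subsetD[OF gen_inc]) simp

lemma JV_hat: "JV J <= hat U"
 unfolding hat_def by(rule order_trans[OF _ gen_inc]) simp

lemma hat_least: "smd W ==> (!!u. u : U ==> lv u : W) ==> JV J <= W ==> hat U <= W"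
 unfolding hat_def by(rule gen_least) auto

lemma hat_approx:
 assumes U: "smd U" and v: "v : hat U"
 shows "EX u:U. v - lv u : JV (KK n)"
proof -
 let ?X = "{v. EX u:U. v - lv u : JV (KK n)}"
 note K = smd_JV[OF KK(1)[of n]]
 have "hat U <= ?X"
 proof (rule hat_least)
  show "smd ?X"
  proof (rule vmod.ops_rangeI)
   show "0 : ?X" using ops_zero[OF K] ops_zero[OF U] by(auto intro!: bexI[of _ 0] simp: lv_0)
   show "x + y : ?X" if xy: "x : ?X" "y : ?X" for x y
   proof -
    obtain u w where uw: "u : U" "x - lv u : JV (KK n)" "w : U" "y - lv w : JV (KK n)" using xy by blast
    have "x + y - lv (u + w) : JV (KK n)" using ops_add[OF K uw(2,4)] by(simp add: lv_add algebra_simps)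
    thus ?thesis using ops_add[OF U uw(1,3)] by blast
   qed
   show "c *s x : ?X" if x: "x : ?X" for c x
   proof -
    obtain u where u: "u : U" "x - lv u : JV (KK n)" using x by blast
    obtain a where a: "c - io a : KK n" using dense by blast
    have "c *s x - lv (a *s u) = c *s (x - lv u) + (c - io a) *s lv u"
     by(simp add: lv_smul vmod.sc_diff vmod.sc_diff_left)
    also have "... : JV (KK n)" by(rule ops_add[OF K smd_smul[OF K u(2)] smul_JV[OF KK(1) a]])
    finally show ?thesis using smd_smul[OF U u(1)] by blast
   qed
  qed
  show "lv u : ?X" if "u : U" for u
   using that by(intro CollectI bexI[of _ u]) (simp_all add: ops_zero[OF K])
  show "JV J <= ?X" using JV_KK ops_zero[OF U] by(auto intro!: bexI[of _ 0] simp: lv_0)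
 qed
 thus ?thesis using v by blast
qed

text \<open>Submodules are closed in the adic topology. Successive approximations differ by elements
  of \<open>Z\<close> that are, by Artin-Rees, combinations of the generators \<open>z t\<close>
  with coefficients in increasing powers; the sums of these coefficients converge by
  completeness.\<close>

lemma hat_closed:
 fixes Z :: "('x => 'a) set"
 assumes B: "finite B" and Z: "smd Z" "Z <= Vs B" and v: "!!n. EX w:Z. v - lv w : JV (KK n)"
 shows "v : hat Z"
proof -
 have JJ: "smd (JV JA :: ('x => 'a) set)" by(rule smd_JV[OF JA(1)])
 note KKs = smd_JV[OF KK(1)]
 obtain r z where cv: "cover JA Z r z" using cover_exists[OF JA(2,1) B Z] by(elim exE)
 have z: "ALL t<r. z t : Z" "ALL v:Z. EX c. v - (SUM t<r. c t *s z t) : JV JA" using cv by(simp_all add: cover_def)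
 define f where "f = ext {..<r} z"
 have f: "lin f" unfolding f_def by(rule lin_ext)
 have fV: "f c : Vs B" for c unfolding f_def ext_def using z(1) Z(2) by(intro ops_sum[OF smd_Vs] smd_smul[OF smd_Vs]) auto
 have fE: "f c = (SUM t<r. c t *s z t)" for c by(simp add: f_def ext_def)
 have "JV JA <= Vs B + JV JA" by(rule plus_ge2[OF ops_zero[OF smd_Vs]])
 from artin_rees_map[OF finite_lessThan B f fV JJ order_refl this, of r]
 obtain k where k: "!!n c u. c : Vs {..<r} ==> u : JV JA ==> f c - u : JV (MA (n + k)) ==>
   EX w:Vs {..<r}. f w : JV JA & c - w : JV (MA n)" by blast
 \<comment> \<open>An element of \<open>Z\<close> with entries in the power \<open>n + k\<close> has
   coefficients in the power \<open>n\<close> with respect to the generators.\<close>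
 have ar: "EX a. a : JV (MA n) & w - f a : JV JA" if w: "w : Z" "w : JV (MA (n + k))" for w n
 proof -
  obtain c0 where c0: "w - (SUM t<r. c0 t *s z t) : JV JA" using z(2) w(1) by blast
  define c where "c t = (if t < r then c0 t else 0)" for t
  have c: "c : Vs {..<r}" "w - f c : JV JA" using c0 by(auto simp: c_def Vs_def fE cong: sum.cong_simp)
  have "w - f c : JV (MA (n + k))" using c(2) JV_mono[OF JA_MA] by blast
  from ops_diff[OF smd_JV[OF idl_MA] w(2) this] have "f c - 0 : JV (MA (n + k))" by simp
  from k[OF c(1) ops_zero[OF JJ] this] obtain b where b: "f b : JV JA" "c - b : JV (MA n)" by blast
  have "w - f (c - b) = (w - f c) + f b" by(simp add: lin_simps(2)[OF f])
  also have "... : JV JA" by(rule ops_add[OF JJ c(2) b(1)])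
  finally show ?thesis using b(2) by blast
 qed
 have "ALL n. EX w. w : Z & v - lv w : JV (KK (n + k))" using v by blast
 then obtain w where w: "!!n. w n : Z" "!!n. v - lv (w n) : JV (KK (n + k))" by metis
 have "EX a. a : JV (MA n) & (w (Suc n) - w n) - f a : JV JA" for n
 proof (rule ar[OF ops_diff[OF Z(1) w(1) w(1)]])
  have "v - lv (w (Suc n)) : JV (KK (n + k))" using w(2)[of "Suc n"] JV_mono[OF KK(2)[of "n + k"]] by auto
  from ops_diff[OF KKs w(2)[of n] this] have "lv (w (Suc n) - w n) : JV (KK (n + k))" by(simp add: lv_diff)
  thus "w (Suc n) - w n : JV (MA (n + k))" by(simp only: lv_KK)
 qed
 then obtain a where a: "!!n. a n : JV (MA n)" "!!n. (w (Suc n) - w n) - f (a n) : JV JA" by metis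
 obtain b0 where b0: "w 0 - f b0 : JV JA" using z(2) w(1) unfolding fE by blast
 define b where "b n = b0 + (SUM i<n. a i)" for n
 have wb: "w n - f (b n) : JV JA" for n
 proof (induction n)
  case 0
  have "b 0 = b0" by(simp add: b_def)
  thus ?case using b0 by(simp only:)
 next
  case (Suc n)
  have "f (b (Suc n)) = f (b n) + f (a n)" by(simp add: b_def lin_simps(1)[OF f] add.assoc[symmetric])
  hence "w (Suc n) - f (b (Suc n)) = (w n - f (b n)) + ((w (Suc n) - w n) - f (a n))"
   by(simp only: diff_diff_eq add_diff_eq diff_add_eq) (simp only: add.commute add_diff_cancel_left' add_diff_cancel_right' algebra_simps)
  thus ?case using ops_add[OF JJ Suc a(2)[of n]] by(simp only:)
 qed
 have "ALL t. EX x. ALL n. x - io (b n t) : KK n"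
 proof
  fix t
  have "io (b (Suc n) t - b n t) : KK n" for n
   using a(1)[of n] by(simp add: b_def KK_MA JV_def)
  thus "EX x. ALL n. x - io (b n t) : KK n" by(rule complete)
 qed
 then obtain x where x: "!!t n. x t - io (b n t) : KK n" by metis
 have "v - (SUM t<r. x t *s lv (z t)) : JV J"
 proof (rule JV_INT)
  fix n
  have 1: "v - lv (w n) : JV (KK n)" using w(2)[of n] JV_mono[OF KK_mono[of n "n + k"]] by auto
  have 2: "lv (w n) - (SUM t<r. io (b n t) *s lv (z t)) : JV (KK n)"
   using JV_KK[OF lv_J[OF wb[of n]], of n] by(simp add: lv_diff fE lv_sum lv_smul)
  have 3: "(SUM t<r. (x t - io (b n t)) *s lv (z t)) : JV (KK n)"
   by(intro ops_sum[OF KKs] smul_JV[OF KK(1)] x)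
  from ops_diff[OF KKs ops_add[OF KKs 1 2] 3]
  show "v - (SUM t<r. x t *s lv (z t)) : JV (KK n)" by(simp add: vmod.sc_diff_left sum_subtractf)
 qed
 hence "v - (SUM t<r. x t *s lv (z t)) : hat Z" using JV_hat by blast
 moreover have "(SUM t<r. x t *s lv (z t)) : hat Z"
  using z(1) by(intro ops_sum[OF smd_hat] smd_smul[OF smd_hat] lv_hat) auto
 ultimately show ?thesis using ops_cong[OF smd_hat] by blast
qed

text \<open>Extension of scalars of \<open>f\<close> on \<open>Vs B\<close>.\<close>

definition fhat :: "'x set => (('x => 'a) => 'y => 'a) => ('x => 'p) => 'y => 'p" where
 "fhat B f = ext B (%x. lv (f (ev x)))"

lemma fhat_lin: "lin (fhat B f)"
 unfolding fhat_def by(rule lin_ext)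

lemma fhat_lv:
 assumes "finite B" "lin f" "v : Vs B"
 shows "fhat B f (lv v) = lv (f v)"
proof -
 have "lv (f v) = (SUM x:B. io (v x) *s lv (f (ev x)))"
  by(subst lin_expand[OF assms]) (simp add: lv_sum lv_smul)
 thus ?thesis by(simp add: fhat_def ext_def lv_def[of v])
qed

text \<open>Flatness in the form of compatibility with preimages. Each approximation of
  \<open>v\<close> over the original ring is corrected by \<open>artin_rees_map\<close> to one in
  the preimage of \<open>U\<close>; \<open>hat_closed\<close> then applies.\<close>

lemma flat:
 fixes f :: "('x => 'a) => 'y => 'a"
 assumes B: "finite B" and C: "finite C" and f: "lin f" "!!v. v : Vs B ==> f v : Vs C"
  and U: "smd U" "JV JA <= U" "U <= Vs C + JV JA"
  and v: "v : Vs B" "fhat B f v : hat U"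
 shows "v : hat {w : Vs B. f w : U}"
proof (rule hat_closed[OF B])
 let ?Z = "{w : Vs B. f w : U}"
 show "smd ?Z" by(rule smd_kernel[OF f(1) smd_Vs U(1)])
 show "?Z <= Vs B" by auto
 fix n
 note KKs = smd_JV[OF KK(1)]
 obtain k where k: "!!n v u. v : Vs B ==> u : U ==> f v - u : JV (MA (n + k)) ==>
   EX w:Vs B. f w : U & v - w : JV (MA n)" using artin_rees_map[OF B C f U] by blast
 have "ALL x. EX a. v x - io a : KK (n + k) & (x ~: B --> a = 0)"
 proof
  fix x show "EX a. v x - io a : KK (n + k) & (x ~: B --> a = 0)"
  proof (cases "x : B")
   case False thus ?thesis using v(1) ops_zero[OF KK(1)] by(intro exI[of _ 0]) (simp add: Vs_def l_0)
  qed (use dense in blast)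
 qed
 from choice[OF this] obtain w0 where "ALL x. v x - io (w0 x) : KK (n + k) & (x ~: B --> w0 x = 0)" ..
 hence w0: "!!x. v x - io (w0 x) : KK (n + k)" "w0 : Vs B" by(simp_all add: Vs_def)
 have vw0: "v - lv w0 : JV (KK (n + k))" using w0(1) by(simp add: JV_def lv_def minus_fun_apply')
 obtain u where u: "u : U" "fhat B f v - lv u : JV (KK (n + k))" using hat_approx[OF U(1) v(2)] by blast
 have "fhat B f (v - lv w0) : JV (KK (n + k))"
  by(rule lin_JV[OF B fhat_lin KK(1) ops_diff[OF smd_Vs v(1) lv_Vs[OF w0(2)]] vw0])
 from ops_diff[OF KKs u(2) this]
 have "lv (f w0 - u) : JV (KK (n + k))"
  by(simp add: lin_simps(2)[OF fhat_lin] fhat_lv[OF B f(1) w0(2)] lv_diff)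
 then obtain w where w: "w : Vs B" "f w : U" "w0 - w : JV (MA n)" using k[OF w0(2) u(1)] unfolding lv_KK by blast
 have "v - lv w0 : JV (KK n)" using vw0 JV_mono[OF KK_mono[of n "n + k"]] by auto
 moreover have "lv (w0 - w) : JV (KK n)" using w(3) by(simp only: lv_KK)
 ultimately have "(v - lv w0) + lv (w0 - w) : JV (KK n)" by(rule ops_add[OF KKs])
 hence "v - lv w : JV (KK n)" by(simp add: lv_diff)
 thus "EX w:?Z. v - lv w : JV (KK n)" using w by blast
qed

lemma MA_1: "MA 1 <= mm"
proof -
 have m: "idl mm" "JA <= mm" using mm(1) by(simp_all add: lcl_def)
 have "rm.imul UNIV <= mm" by(rule lsum_least[OF m(1)]) (use mm(2) in \<open>auto intro: idl_mult_right[OF m(1)]\<close>)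
 thus ?thesis unfolding MA_def using m(2) by(intro plus_least[OF m(1)]) auto
qed

text \<open>Artin-Rees is applied to multiplication by \<open>y\<close>: since \<open>y\<close> is
  close to \<open>U\<close>, the scalar 1 is close to a scalar whose product with \<open>y\<close>
  lies in \<open>U\<close>. Such a scalar is a unit.\<close>

lemma faithful:
 fixes U :: "('y => 'a) set"
 assumes C: "finite C" and U: "smd U" "JV JA <= U" "U <= Vs C + JV JA"
  and y: "y : Vs C" "lv y : hat U"
 shows "y : U"
proof -
 define f where "f v = v () *s y" for v
 have f: "lin f" unfolding f_def[abs_def] by(rule lin_coord)
 have fC: "f v : Vs C" for v unfolding f_def by(rule smd_smul[OF smd_Vs y(1)])
 obtain k where k: "!!n v u. v : Vs {()} ==> u : U ==> f v - u : JV (MA (n + k)) ==>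
   EX w:Vs {()}. f w : U & v - w : JV (MA n)" using artin_rees_map[OF _ C f fC U, of "{()}"] by blast
 obtain u where u: "u : U" "lv y - lv u : JV (KK (1 + k))" using hat_approx[OF U(1) y(2)] by blast
 have "f (ev ()) = y" by(simp add: f_def ev_def vmod.sc_1)
 moreover have "y - u : JV (MA (1 + k))" using u(2) by(simp only: lv_diff[symmetric] lv_KK)
 ultimately obtain w where w: "f w : U" "ev () - w : JV (MA 1)" using k[OF ev_Vs u(1), of "()" 1] by auto
 have "1 - w () : mm" using w(2) MA_1 by(auto simp: JV_def ev_def minus_fun_apply' dest!: spec[of _ "()"])
 moreover have "1 ~: mm" "idl mm" using mm(1) by(simp_all add: lcl_def)
 ultimately have "w () ~: mm" using ops_add[of "range (*)" mm "1 - w ()" "w ()"] by auto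
 then obtain b where b: "w () * b - 1 : JA" using mm(1) unfolding lcl_def by blast
 have "b *s f w - y = (w () * b - 1) *s y" by(simp add: f_def vmod.sc_sc vmod.sc_diff_left vmod.sc_1 mult.commute)
 also have "... : U" using smul_JV[OF JA(1) b] U(2) by blast
 finally show ?thesis using smd_smul[OF U(1) w(1), of b] ops_cong[OF U(1)] by blast
qed

end

context completion_map
begin

lemma hat_mono: "U <= U' ==> hat U <= hat U'"
 unfolding hat_def by(rule gen_mono) auto

lemma fhat_JV: "v : JV J ==> fhat B f v : JV J"
 unfolding fhat_def ext_def by(intro ops_sum[OF smd_JV[OF idl_J]] smul_JV[OF idl_J]) (simp add: JV_def)

lemma fhat_hat:
 assumes B: "finite B" and f: "lin f" and W: "W <= Vs B" and im: "!!w. w : W ==> f w : W'" and v: "v : hat W"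
 shows "fhat B f v : hat W'"
proof -
 have "hat W <= {v. fhat B f v : hat W'}"
 proof (rule hat_least)
  show "smd {v. fhat B f v : hat W'}"
   by(rule ops_vimage[OF smd_hat linD(1)[OF fhat_lin]]) (auto simp: linD(2)[OF fhat_lin] intro: smd_smul[OF smd_hat])
  show "lv u : {v. fhat B f v : hat W'}" if u: "u : W" for u
   using fhat_lv[OF B f] W u lv_hat[OF im[OF u]] by auto
  show "JV J <= {v. fhat B f v : hat W'}" using fhat_JV JV_hat by blast
 qed
 thus ?thesis using v by blast
qed

lemma Vs_hat:
 assumes "finite B" "v : Vs B" shows "v : hat (Vs B)"
proof -
 have "(SUM x:B. v x *s lv (ev x)) : hat (Vs B)"
  by(intro ops_sum[OF smd_hat] smd_smul[OF smd_hat] lv_hat ev_Vs)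
 thus ?thesis using Vs_expand[OF assms] by(simp add: lv_ev)
qed

text \<open>\<open>Z\<close> is covered by a free module on finitely many generators, and
  \<open>flat\<close> is applied to \<open>a\<close> times this covering.\<close>

lemma colon:
 fixes Z :: "('x => 'a) set"
 assumes C: "finite C" and Z: "smd Z" "Z <= Vs C" and N: "smd N" "JV JA <= N" "N <= Vs C + JV JA"
  and c: "c : hat Z" "io a *s c : hat N"
 shows "c : hat {u : Z. a *s u : N}"
proof -
 note JJ = smd_JV[OF idl_J]
 obtain r z where cv: "cover JA Z r z" using cover_exists[OF JA(2,1) C Z] by(elim exE)
 have z: "ALL t<r. z t : Z" "ALL v:Z. EX c. v - (SUM t<r. c t *s z t) : JV JA" using cv by(simp_all add: cover_def)
 define h where "h = ext {..<r} z"
 have h: "lin h" unfolding h_def by(rule lin_ext)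
 have hZ: "h v : Z" for v unfolding h_def ext_def using z(1) by(intro ops_sum[OF Z(1)] smd_smul[OF Z(1)]) auto
 let ?H = "fhat {..<r} h"
 have "hat Z <= {v. EX w:Vs {..<r}. v - ?H w : JV J}"
 proof (rule hat_least)
  show "smd {v. EX w:Vs {..<r}. v - ?H w : JV J}"
  proof (rule vmod.ops_rangeI)
   show "0 : {v. EX w:Vs {..<r}. v - ?H w : JV J}" unfolding mem_Collect_eq
    by(rule bexI[of _ 0]) (simp_all add: lin_simps(4)[OF fhat_lin] ops_zero[OF JJ] ops_zero[OF smd_Vs])
   show "x + y : {v. EX w:Vs {..<r}. v - ?H w : JV J}"
    if xy: "x : {v. EX w:Vs {..<r}. v - ?H w : JV J}" "y : {v. EX w:Vs {..<r}. v - ?H w : JV J}" for x y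
   proof -
    obtain u w where uw: "u : Vs {..<r}" "x - ?H u : JV J" "w : Vs {..<r}" "y - ?H w : JV J" using xy by blast
    have "x + y - ?H (u + w) = (x - ?H u) + (y - ?H w)" by(simp add: lin_simps(1)[OF fhat_lin])
    also have "... : JV J" by(rule ops_add[OF JJ uw(2,4)])
    finally show ?thesis using ops_add[OF smd_Vs uw(1,3)] by blast
   qed
   show "b *s x : {v. EX w:Vs {..<r}. v - ?H w : JV J}"
    if x: "x : {v. EX w:Vs {..<r}. v - ?H w : JV J}" for b x
   proof -
    obtain u where u: "u : Vs {..<r}" "x - ?H u : JV J" using x by blast
    have "b *s x - ?H (b *s u) = b *s (x - ?H u)" by(simp add: linD(2)[OF fhat_lin] vmod.sc_diff)
    also have "... : JV J" by(rule smd_smul[OF JJ u(2)])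
    finally show ?thesis using smd_smul[OF smd_Vs u(1)] by blast
   qed
  qed
  show "lv u : {v. EX w:Vs {..<r}. v - ?H w : JV J}" if u: "u : Z" for u
  proof -
   obtain e0 where e0: "u - (SUM t<r. e0 t *s z t) : JV JA" using z(2) u by blast
   define e where "e t = (if t < r then e0 t else 0)" for t
   have e: "e : Vs {..<r}" "u - h e : JV JA" using e0 by(auto simp: e_def Vs_def h_def ext_def cong: sum.cong_simp)
   have "lv u - ?H (lv e) = lv (u - h e)" by(simp add: fhat_lv[OF _ h e(1)] lv_diff)
   also have "... : JV J" by(rule lv_J[OF e(2)])
   finally show ?thesis using lv_Vs[OF e(1)] by blast
  qed
  show "JV J <= {v. EX w:Vs {..<r}. v - ?H w : JV J}"
  proof
   fix v :: "'x => 'p" assume "v : JV J"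
   thus "v : {v. EX w:Vs {..<r}. v - ?H w : JV J}" unfolding mem_Collect_eq
    by(intro bexI[of _ 0]) (simp_all add: lin_simps(4)[OF fhat_lin] ops_zero[OF smd_Vs])
  qed
 qed
 then obtain w where w: "w : Vs {..<r}" "c - ?H w : JV J" using c(1) by blast
 define f where "f v = a *s h v" for v
 have f: "lin f" unfolding f_def[abs_def] by(rule lin_smul[OF h])
 have fC: "f v : Vs C" for v unfolding f_def using hZ Z(2) smd_smul[OF smd_Vs] by blast
 have "fhat {..<r} f w = io a *s ?H w"
  by(simp add: fhat_def ext_def f_def lv_smul vmod.sc_sum vmod.sc_commute[of "io a"])
 moreover have "io a *s ?H w : hat N"
 proof -
  have "io a *s c - io a *s ?H w : hat N"
   using smd_smul[OF JJ w(2), of "io a"] JV_hat by(auto simp: vmod.sc_diff)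
  thus ?thesis using ops_cong[OF smd_hat] c(2) by blast
 qed
 ultimately have "w : hat {v : Vs {..<r}. f v : N}" using flat[OF _ C f fC N w(1)] by simp
 hence "?H w : hat {u : Z. a *s u : N}"
  by(rule fhat_hat[OF _ h, rotated -1]) (auto simp: f_def hZ)
 moreover have "c - ?H w : hat {u : Z. a *s u : N}" using w(2) JV_hat by blast
 ultimately show ?thesis using ops_cong[OF smd_hat] by blast
qed

lemma ann_idl: "smd N ==> idl {a. a *s u : N}"
 by(rule rmod.ops_rangeI)
  (auto simp: ops_zero vmod.sc_plus ops_add smd_smul simp flip: vmod.sc_sc)

text \<open>From left to right this is \<open>faithful\<close>. Conversely, \<open>colon\<close>
  puts \<open>c\<close> into the extension of the submodule of \<open>Z\<close> killed by
  \<open>p\<close> modulo \<open>N\<close>. If no element of \<open>Z\<close> had annihilator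
  \<open>p\<close>, each element of that submodule would be killed by something outside
  \<open>p\<close>, and hence so would \<open>c\<close>.\<close>

theorem ass_transfer:
 fixes Z :: "('x => 'a) set"
 assumes C: "finite C" and Z: "smd Z" "Z <= Vs C" and N: "smd N" "JV JA <= N" "N <= Vs C + JV JA" and p: "prm p"
 shows "(EX c:Z. p = {a. a *s c : N}) \<longleftrightarrow> (EX c:hat Z. p = {a. io a *s c : hat N})"
proof
 assume "EX c:Z. p = {a. a *s c : N}"
 then obtain c where c: "c : Z" "p = {a. a *s c : N}" by blast
 have "io a *s lv c : hat N \<longleftrightarrow> a *s c : N" for a
 proof
  assume "io a *s lv c : hat N"
  hence "lv (a *s c) : hat N" by(simp add: lv_smul)
  moreover have "a *s c : Vs C" using c(1) Z(2) smd_smul[OF smd_Vs] by blast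
  ultimately show "a *s c : N" by(intro faithful[OF C N])
 qed (auto simp: lv_smul[symmetric] intro: lv_hat)
 thus "EX c:hat Z. p = {a. io a *s c : hat N}" using c by(intro bexI[of _ "lv c"] lv_hat) auto
next
 assume "EX c:hat Z. p = {a. io a *s c : hat N}"
 then obtain c where c: "c : hat Z" "p = {a. io a *s c : hat N}" by blast
 have JAp: "JA <= p" unfolding c(2) using smul_JV[OF idl_J l_J] JV_hat by blast
 obtain F where F: "finite F" "F <= p" "p <= gen (range (*)) (F Un JA)"
  using opnoethD[OF JA(2)[unfolded rnoeth_def] prmD(1)[OF p] JAp] plus_ge1[OF ops_zero[OF JA(1)], of UNIV] by auto
 have "c : hat {u : Z. ALL b:F. b *s u : N}"
  using F(1,2)
 proof (induction F rule: finite_induct)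
  case empty thus ?case using c(1) by simp
 next
  case (insert b F)
  let ?Z = "{u : Z. ALL b:F. b *s u : N}"
  have "smd ?Z"
   by(rule vmod.ops_rangeI)
    (auto simp: ops_zero[OF Z(1)] ops_zero[OF N(1)] vmod.sc_add vmod.sc_commute
     intro: ops_add[OF Z(1)] ops_add[OF N(1)] smd_smul[OF Z(1)] smd_smul[OF N(1)])
  moreover have "io b *s c : hat N" using insert.prems c(2) by blast
  ultimately have "c : hat {u : ?Z. b *s u : N}"
   using insert Z(2) by(intro colon[OF C _ _ N]) auto
  also have "{u : ?Z. b *s u : N} = {u : Z. ALL b:insert b F. b *s u : N}" by auto
  finally show ?case .
 qed
 note cF = this
 show "EX c:Z. p = {a. a *s c : N}"
 proof (rule ccontr)
  assume no: "~ (EX c:Z. p = {a. a *s c : N})"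
  let ?X = "{v. EX t. t ~: p & io t *s v : hat N}"
  have "hat {u : Z. ALL b:F. b *s u : N} <= ?X"
  proof (rule hat_least)
   show "smd ?X"
   proof (rule vmod.ops_rangeI)
    show "0 : ?X" using prmD(2)[OF p] ops_zero[OF smd_hat] by auto
    show "x + y : ?X" if xy: "x : ?X" "y : ?X" for x y
    proof -
     obtain t u where tu: "t ~: p" "io t *s x : hat N" "u ~: p" "io u *s y : hat N" using xy by blast
     have "io (t * u) *s (x + y) = io u *s (io t *s x) + io t *s (io u *s y)"
      by(simp add: l_mult vmod.sc_add vmod.sc_sc mult.commute)
     also have "... : hat N" by(intro ops_add[OF smd_hat] smd_smul[OF smd_hat] tu)
     finally show ?thesis using prmD(3)[OF p] tu(1,3) by blast
    qed
    show "b *s x : ?X" if x: "x : ?X" for b x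
     using x smd_smul[OF smd_hat, of _ N b] by(auto simp: vmod.sc_commute[of _ b])
   qed
   show "JV J <= ?X" using prmD(2)[OF p] JV_hat smd_smul[OF smd_JV[OF idl_J]] by blast
   fix u assume u: "u : {u : Z. ALL b:F. b *s u : N}"
   have "gen (range (*)) (F Un JA) <= {a. a *s u : N}"
    by(rule gen_least[OF ann_idl[OF N(1)]]) (use u smul_JV[OF JA(1)] N(2) in auto)
   hence "p <= {a. a *s u : N}" using F(3) by blast
   moreover have "p \<noteq> {a. a *s u : N}" using no u by blast
   ultimately obtain t where t: "t ~: p" "t *s u : N" by blast
   have "io t *s lv u : hat N" using lv_hat[OF t(2)] by(simp add: lv_smul)
   thus "lv u : ?X" using t(1) by blast
  qed
  then obtain t where "t ~: p" "io t *s c : hat N" using cF by blast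
  thus False using c(2) by blast
 qed
qed

end

section \<open>Ext by matrices, over the ring and over its completion\<close>

definition cut :: "nat => (nat => 'p::zero) => nat => 'p" where
 "cut g w = (%y. if y < g then w y else 0)"

definition row :: "nat => (nat * nat => 'p::zero) => nat => nat => 'p" where
 "row g c x = (%y. if y < g then c (x, y) else 0)"

lemma lin_cut: "lin (cut g)" and lin_row: "lin (%c. row g c x)"
 by(auto simp: lin_def addm_def cut_def row_def fun_eq_iff smul_apply)

lemma cut_Vs: "cut g w : Vs {..<g}" and row_Vs: "row g c x : Vs {..<g}"
 by(auto simp: cut_def row_def Vs_def)

lemma cut_cut: "cut g (cut g w) = cut g w"
 by(auto simp: cut_def)

lemma cut_diff_JV:
 assumes "idl J" "w : Vs {..<g} + JV J" shows "w - cut g w : JV J"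
proof -
 obtain a b where "w = a + b" "a : Vs {..<g}" "b : JV J" using assms(2) by(rule set_plus_elim)
 thus ?thesis using ops_zero[OF assms(1)] by(auto simp: cut_def JV_def Vs_def minus_fun_apply')
qed

text \<open>A cochain with values in \<open>g\<close> coordinates is a matrix with one row per basis
  element; \<open>dl\<close> is the differential it undergoes, multiplication by the transpose of
  \<open>d k\<close>.\<close>

definition dl :: "(nat => nat) => (nat => (nat => 'a) => nat => 'a::comm_ring_1) => nat => nat => (nat * nat => 'a) => nat * nat => 'a" where
 "dl b d g k c = (%(x, y). if x < b (Suc k) & y < g then SUM z<b k. d k (ev x) z * c (z, y) else 0)"

abbreviation Q :: "(nat => nat) => nat => nat => (nat * nat) set" where
 "Q b g k \<equiv> {..<b k} \<times> {..<g}"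

definition VU :: "'a::comm_ring_1 set => (nat => nat) => nat => nat => (nat => 'a) set => (nat * nat => 'a) set" where
 "VU J b g k U = {c : Vs (Q b g k) + JV J. ALL x<b k. row g c x : U}"

text \<open>The counterpart of \<open>extw\<close> with finite matrices instead of linear maps, so
  that the results on extending submodules of finite free modules apply.\<close>

definition extv :: "'a::comm_ring_1 set => (nat => nat) => (nat => (nat => 'a) => nat => 'a) => nat => nat => (nat => 'a) set => 'a set => bool" where
 "extv J b d g k U p \<longleftrightarrow> (EX c:Vs (Q b g (Suc k)). dl b d g (Suc k) c : VU J b g (Suc (Suc k)) U &
   p = {a. EX h:Vs (Q b g k). a *s c - dl b d g k h : VU J b g (Suc k) U})"

lemma lin_dl: "lin (dl b d g k)"
 by(auto simp: lin_def addm_def dl_def fun_eq_iff smul_apply sum.distrib distrib_left sum_distrib_left mult.left_commute)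

lemma dl_Vs: "dl b d g k c : Vs (Q b g (Suc k))"
 by(auto simp: dl_def Vs_def)

locale completion_ext = completion_map io JA mm \<mu> s J KK
 for io :: "'a::comm_ring_1 => 'p::comm_ring_1" and JA mm \<mu> s J KK +
 fixes b :: "nat => nat" and d :: "nat => (nat => 'a) => nat => 'a" and g :: nat
 assumes cplxA: "cplx JA (%n. {..<b n}) d" and exactA: "exact_at JA (%n. {..<b n}) d n"
begin

lemmas A = cplxD[OF cplxA]

definition dR :: "nat => (nat => 'p) => nat => 'p" where
 "dR n = fhat {..<b (Suc n)} (d n)"

lemma dR_lin: "lin (dR n)"
 unfolding dR_def by(rule fhat_lin)

lemma dR_ev: "x < b (Suc n) ==> dR n (ev x) = lv (d n (ev x))"
 by(simp add: dR_def fhat_def ext_ev)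

lemma dR_Vs: "v : Vs {..<b (Suc n)} ==> dR n v : Vs {..<b n}"
 by(rule lin_mem[OF A(1)[of "Suc n"] dR_lin smd_Vs]) (auto simp: dR_ev intro: lv_Vs A(3) ev_Vs)

lemma cplxR: "cplx J (%n. {..<b n}) dR"
 unfolding cplx_def
proof (intro conjI allI ballI)
 fix n and v :: "nat => 'p" assume v: "v : Vs {..<b (Suc (Suc n))}"
 show "dR n (dR (Suc n) v) : JV J"
 proof (rule lin_mem[OF A(1)[of "Suc (Suc n)"] lin_comp[OF dR_lin dR_lin] smd_JV[OF idl_J] _ v])
  fix x assume x: "x : {..<b (Suc (Suc n))}"
  have "dR n (lv (d (Suc n) (ev x))) = lv (d n (d (Suc n) (ev x)))"
   unfolding dR_def by(rule fhat_lv[OF _ A(2) A(3)[OF ev_Vs[OF x]]]) simp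
  thus "dR n (dR (Suc n) (ev x)) : JV J" using x lv_J[OF A(4)[OF ev_Vs[OF x]]] by(simp add: dR_ev)
 qed
qed (auto simp: dR_lin dR_Vs)

text \<open>\<open>flat\<close> identifies the kernel over the completion with the extension of the
  kernel over the ring, and the latter is covered by \<open>d (Suc n)\<close>.\<close>

lemma exactR: "exact_at J (%n. {..<b n}) dR n"
 unfolding exact_at_def
proof (intro ballI impI)
 fix v assume v: "v : Vs {..<b (Suc n)}" "dR n v : JV J"
 note JJ = smd_JV[OF JA(1)]
 have "dR n v : hat (JV JA)" using v(2) JV_hat by blast
 hence "v : hat {w : Vs {..<b (Suc n)}. d n w : JV JA}"
  using v(1) unfolding dR_def
  by(intro flat[OF _ _ A(2) A(3) JJ order_refl plus_ge2[OF ops_zero[OF smd_Vs]]]) auto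
 moreover have "hat {w : Vs {..<b (Suc n)}. d n w : JV JA}
   <= dR (Suc n) ` Vs {..<b (Suc (Suc n))} + JV J"
 proof (rule hat_least)
  have im: "smd (dR (Suc n) ` Vs {..<b (Suc (Suc n))})"
   by(rule ops_image[OF smd_Vs linD(1)[OF dR_lin]]) (auto simp: linD(2)[OF dR_lin, symmetric])
  show "smd (dR (Suc n) ` Vs {..<b (Suc (Suc n))} + JV J)" by(rule vmod.ops_range_plus[OF im smd_JV[OF idl_J]])
  show "JV J <= dR (Suc n) ` Vs {..<b (Suc (Suc n))} + JV J" by(rule plus_ge2[OF ops_zero[OF im]])
  fix w assume "w : {w : Vs {..<b (Suc n)}. d n w : JV JA}"
  then obtain u where u: "u : Vs {..<b (Suc (Suc n))}" "w - d (Suc n) u : JV JA"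
   using exact_atD[OF exactA] by blast
  have "dR (Suc n) (lv u) = lv (d (Suc n) u)" unfolding dR_def by(rule fhat_lv[OF _ A(2) u(1)]) simp
  hence "lv w = dR (Suc n) (lv u) + lv (w - d (Suc n) u)" by(simp add: lv_diff)
  thus "lv w : dR (Suc n) ` Vs {..<b (Suc (Suc n))} + JV J"
   by(rule set_plusI[OF _ imageI[OF lv_Vs[OF u(1)]] lv_J[OF u(2)]])
 qed
 ultimately obtain y j where y: "v = y + j" "y : dR (Suc n) ` Vs {..<b (Suc (Suc n))}" "j : JV J"
  by(meson set_plus_elim subsetD)
 then obtain w where "w : Vs {..<b (Suc (Suc n))}" "y = dR (Suc n) w" by blast
 thus "EX w:Vs {..<b (Suc (Suc n))}. v - dR (Suc n) w : JV J" using y(1,3) by(intro bexI[of _ w]) simp_all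
qed

definition dlh :: "nat => (nat * nat => 'p) => nat * nat => 'p" where
 "dlh k = fhat (Q b g k) (dl b d g k)"

lemma dlh_lin: "lin (dlh k)"
 unfolding dlh_def by(rule fhat_lin)

definition cf :: "nat => ((nat => 'p) => nat => 'p) => nat * nat => 'p" where
 "cf k f = (%(x, y). if x < b k & y < g then f (ev x) y else 0)"

definition fc :: "nat => (nat * nat => 'p) => (nat => 'p) => nat => 'p" where
 "fc k c = ext {..<b k} (row g c)"

lemma fc_lin: "lin (fc k c)"
 unfolding fc_def by(rule lin_ext)

lemma cf_fc: "c : Vs (Q b g k) ==> cf k (fc k c) = c"
 by(auto simp: cf_def fc_def ext_ev row_def Vs_def fun_eq_iff)

lemma cf_Vs: "cf k f : Vs (Q b g k)"
 by(auto simp: cf_def Vs_def)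

lemma row_cf: "x < b k ==> row g (cf k f) x = cut g (f (ev x))"
 by(auto simp: row_def cf_def cut_def)

lemma dlh_apply:
 assumes "x < b (Suc k)" "y < g"
 shows "dlh k c (x, y) = (SUM z<b k. io (d k (ev x) z) * c (z, y))"
proof -
 have 1: "dl b d g k (ev (z, y')) (x, y) = (if y = y' then d k (ev x) z else 0)" if "z < b k" for z y'
 proof -
  have "(SUM t<b k. d k (ev x) t * ev (z, y') (t, y)) = (SUM t<b k. if t = z then (if y = y' then d k (ev x) z else 0) else 0)"
   by(rule sum.cong) (auto simp: ev_def)
  thus ?thesis using that assms by(simp add: dl_def)
 qed
 have "dlh k c (x, y) = (SUM (z, y'):Q b g k. c (z, y') * io (dl b d g k (ev (z, y')) (x, y)))"
  unfolding dlh_def fhat_def ext_def sum_fun_apply by(rule sum.cong) (auto simp: smul_apply lv_def)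
 also have "... = (SUM z<b k. SUM y'<g. c (z, y') * io (dl b d g k (ev (z, y')) (x, y)))"
  by(rule sum.cartesian_product[symmetric])
 also have "... = (SUM z<b k. SUM y'<g. if y' = y then io (d k (ev x) z) * c (z, y) else 0)"
  by(intro sum.cong) (auto simp: 1 l_0 mult.commute)
 also have "... = (SUM z<b k. io (d k (ev x) z) * c (z, y))" using assms(2) by simp
 finally show ?thesis .
qed

lemma row_dlh:
 assumes f: "lin f" and x: "x < b (Suc k)"
 shows "row g (dlh k (cf k f)) x = cut g (f (dR k (ev x)))"
proof
 fix y
 have dx: "lv (d k (ev x)) : Vs {..<b k}" using x by(intro lv_Vs A(3) ev_Vs) simp
 have "f (dR k (ev x)) = (SUM z<b k. lv (d k (ev x)) z *s f (ev z))"
  unfolding dR_ev[OF x] by(rule lin_expand[OF _ f dx]) simp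
 thus "row g (dlh k (cf k f)) x y = cut g (f (dR k (ev x))) y"
  using x by(auto simp: row_def cut_def dlh_apply cf_def sum_fun_apply smul_apply lv_def intro!: sum.cong)
qed

lemma dlh_Vs: "dlh k c : Vs (Q b g (Suc k))"
 unfolding dlh_def fhat_def ext_def
 by(intro ops_sum[OF smd_Vs] smd_smul[OF smd_Vs] lv_Vs dl_Vs)

end

locale completion_coeff = completion_ext io JA mm \<mu> s J KK b d g
 for io :: "'a::comm_ring_1 => 'p::comm_ring_1" and JA mm \<mu> s J KK b d g +
 fixes U :: "(nat => 'a) set"
 assumes U: "smd U" "JV JA <= U" "U <= Vs {..<g} + JV JA"
begin

lemma hat_U: "hat U <= Vs {..<g} + JV J"
proof (rule hat_least)
 show "smd (Vs {..<g} + JV J)" by(rule vmod.ops_range_plus[OF smd_Vs smd_JV[OF idl_J]])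
 show "JV J <= Vs {..<g} + JV J" by(rule plus_ge2[OF ops_zero[OF smd_Vs]])
 fix u assume "u : U"
 hence "u : Vs {..<g} + JV JA" using U(3) by blast
 then obtain v j where "u = v + j" "v : Vs {..<g}" "j : JV JA" by(rule set_plus_elim)
 thus "lv u : Vs {..<g} + JV J" by(intro set_plusI[of _ "lv v" "lv j"]) (auto simp: lv_add lv_Vs lv_J)
qed

lemma cut_hat: "w : hat U ==> cut g w : hat U"
proof -
 assume w: "w : hat U"
 hence "w - cut g w : hat U" using cut_diff_JV[OF idl_J] hat_U JV_hat by blast
 thus ?thesis using ops_cong[OF smd_hat] w by blast
qed

text \<open>\<open>extw\<close> takes values in all functions on \<open>nat\<close>. Putting no
  condition on the coordinates from \<open>g\<close> on makes the quotient a module with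
  \<open>g\<close> generators.\<close>

definition UR :: "(nat => 'p) set" where "UR = {w. cut g w : hat U}"

lemma smd_UR: "smd UR"
 unfolding UR_def by(rule ops_vimage[OF smd_hat linD(1)[OF lin_cut]]) (auto simp: linD(2)[OF lin_cut] intro: smd_smul[OF smd_hat])

lemma hat_UR: "hat U <= UR"
 unfolding UR_def using cut_hat by blast

lemma VU: "smd (VU JA b g k U)" "JV JA <= VU JA b g k U" "VU JA b g k U <= Vs (Q b g k) + JV JA"
proof -
 have "smd ((Vs (Q b g k) + JV JA) Int (\<Inter>x\<in>{..<b k}. {c. row g c x : U}))"
 proof (rule ops_Int[OF vmod.ops_range_plus[OF smd_Vs smd_JV[OF JA(1)]] ops_Inter])
  fix E assume "E : (%x. {c. row g c x : U}) ` {..<b k}"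
  then obtain x where E: "E = {c. row g c x : U}" by blast
  show "smd E" unfolding E
   by(rule ops_vimage[OF U(1) linD(1)[OF lin_row]]) (auto simp: linD(2)[OF lin_row] intro: smd_smul[OF U(1)])
 qed
 thus "smd (VU JA b g k U)" by(simp add: VU_def Int_def lessThan_def)
 show "VU JA b g k U <= Vs (Q b g k) + JV JA" by(auto simp: VU_def)
 show "JV JA <= VU JA b g k U"
 proof
  fix c :: "nat * nat => 'a" assume c: "c : JV JA"
  hence "row g c x : U" for x using U(2) ops_zero[OF JA(1)] by(auto simp: row_def JV_def subset_iff)
  thus "c : VU JA b g k U"
   using subsetD[OF plus_ge2[OF ops_zero[OF smd_Vs]] c] by(simp add: VU_def)
 qed
qed

text \<open>Extension to the completion commutes with finite direct sums, here with the sum over the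
  rows.\<close>

lemma hat_VU_iff:
 assumes c: "c : Vs (Q b g k)"
 shows "c : hat (VU JA b g k U) \<longleftrightarrow> (ALL x<b k. row g c x : hat U)"
proof
 assume h: "c : hat (VU JA b g k U)"
 show "ALL x<b k. row g c x : hat U"
 proof (intro allI impI)
  fix x assume x: "x < b k"
  have "hat (VU JA b g k U) <= {c. row g c x : hat U}"
  proof (rule hat_least)
   show "smd {c. row g c x : hat U}"
    by(rule ops_vimage[OF smd_hat linD(1)[OF lin_row]]) (auto simp: linD(2)[OF lin_row] intro: smd_smul[OF smd_hat])
   have e: "row g (lv u) x = lv (row g u x)" for u by(auto simp: row_def lv_def l_0)
   show "lv u : {c. row g c x : hat U}" if "u : VU JA b g k U" for u
    using that x by(auto simp: e VU_def intro: lv_hat)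
   show "JV J <= {c. row g c x : hat U}"
    using JV_hat[of U] ops_zero[OF idl_J] by(auto simp: row_def JV_def subset_iff)
  qed
  thus "row g c x : hat U" using h by blast
 qed
next
 assume r: "ALL x<b k. row g c x : hat U"
 define em where "em x w = (%(t, y). if t = x & y < g then w y else 0 :: 'p)" for x :: nat and w :: "nat => 'p"
 define ea where "ea x w = (%(t, y). if t = x & y < g then w y else 0 :: 'a)" for x :: nat and w :: "nat => 'a"
 have em_lin: "lin (em x)" for x by(auto simp: lin_def addm_def em_def fun_eq_iff smul_apply)
 have "em x w : hat (VU JA b g k U)" if x: "x < b k" and w: "w : hat U" for x w
 proof -
  have "hat U <= {w. em x w : hat (VU JA b g k U)}"
  proof (rule hat_least)
   show "smd {w. em x w : hat (VU JA b g k U)}"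
    by(rule ops_vimage[OF smd_hat linD(1)[OF em_lin]]) (auto simp: linD(2)[OF em_lin] intro: smd_smul[OF smd_hat])
   show "JV J <= {w. em x w : hat (VU JA b g k U)}"
    using JV_hat[of "VU JA b g k U"] ops_zero[OF idl_J] by(auto simp: em_def JV_def subset_iff)
   fix u assume u: "u : U"
   have "em x (lv u) = lv (ea x u)" by(auto simp: em_def ea_def lv_def l_0 fun_eq_iff)
   moreover have "ea x u : VU JA b g k U"
   proof -
    have "ea x u : Vs (Q b g k)" using x by(auto simp: ea_def Vs_def)
    hence "ea x u : Vs (Q b g k) + JV JA" using plus_ge1[OF ops_zero[OF smd_JV[OF JA(1)]]] by blast
    moreover have "row g (ea x u) t : U" for t
    proof (cases "t = x")
     case True
     have "u - cut g u : U" using cut_diff_JV[OF JA(1)] u U by blast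
     hence "cut g u : U" using ops_cong[OF U(1)] u by blast
     moreover have "row g (ea x u) t = cut g u" using True by(auto simp: row_def ea_def cut_def)
     ultimately show ?thesis by simp
    next
     case False
     hence "row g (ea x u) t = 0" by(auto simp: row_def ea_def fun_eq_iff)
     thus ?thesis using ops_zero[OF U(1)] by simp
    qed
    ultimately show ?thesis by(simp add: VU_def)
   qed
   ultimately show "lv u : {w. em x w : hat (VU JA b g k U)}" using lv_hat by simp
  qed
  thus ?thesis using w by blast
 qed
 hence "(SUM x<b k. em x (row g c x)) : hat (VU JA b g k U)" using r by(intro ops_sum[OF smd_hat]) auto
 moreover have "(SUM x<b k. em x (row g c x)) = c"
 proof
  fix q :: "nat * nat"
  obtain t y where q: "q = (t, y)" by(cases q)
  have "(SUM x<b k. em x (row g c x)) q = (SUM x<b k. if x = t then (if y < g then c (t, y) else 0) else 0)"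
   unfolding sum_fun_apply by(rule sum.cong) (auto simp: q em_def row_def)
  thus "(SUM x<b k. em x (row g c x)) q = c q" using c by(auto simp: q Vs_def)
 qed
 ultimately show "c : hat (VU JA b g k U)" by simp
qed

definition Zk :: "nat => (nat * nat => 'a) set" where
 "Zk k = {c : Vs (Q b g (Suc k)). dl b d g (Suc k) c : VU JA b g (Suc (Suc k)) U}"

definition Nk :: "nat => (nat * nat => 'a) set" where
 "Nk k = dl b d g k ` Vs (Q b g k) + VU JA b g (Suc k) U"

lemma extv_iff: "extv JA b d g k U p \<longleftrightarrow> (EX c:Zk k. p = {a. a *s c : Nk k})"
proof -
 have "a *s c : Nk k \<longleftrightarrow> (EX h:Vs (Q b g k). a *s c - dl b d g k h : VU JA b g (Suc k) U)" for a c
 proof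
  assume "a *s c : Nk k"
  then obtain x y where "a *s c = x + y" "x : dl b d g k ` Vs (Q b g k)" "y : VU JA b g (Suc k) U"
   unfolding Nk_def by(rule set_plus_elim)
  then obtain h where "h : Vs (Q b g k)" "a *s c = dl b d g k h + y" by blast
  thus "EX h:Vs (Q b g k). a *s c - dl b d g k h : VU JA b g (Suc k) U"
   using \<open>y : _\<close> by(intro bexI[of _ h]) simp_all
 next
  assume "EX h:Vs (Q b g k). a *s c - dl b d g k h : VU JA b g (Suc k) U"
  then obtain h where h: "h : Vs (Q b g k)" "a *s c - dl b d g k h : VU JA b g (Suc k) U" by blast
  show "a *s c : Nk k" unfolding Nk_def by(rule set_plusI[OF _ imageI[OF h(1)] h(2)]) simp
 qed
 thus ?thesis by(auto simp: extv_def Zk_def)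
qed

lemma Zk: "smd (Zk k)" "Zk k <= Vs (Q b g (Suc k))"
 unfolding Zk_def by(rule smd_kernel[OF lin_dl smd_Vs VU(1)]) auto

lemma dl_im: "smd (dl b d g k ` Vs (Q b g k))"
 by(rule ops_image[OF smd_Vs linD(1)[OF lin_dl]]) (auto simp: linD(2)[OF lin_dl, symmetric])

lemma Nk: "smd (Nk k)" "JV JA <= Nk k" "Nk k <= Vs (Q b g (Suc k)) + JV JA"
proof -
 show "smd (Nk k)" unfolding Nk_def by(rule vmod.ops_range_plus[OF dl_im VU(1)])
 show "JV JA <= Nk k" unfolding Nk_def
  by(rule order_trans[OF VU(2) plus_ge2[OF ops_zero[OF dl_im]]])
 have "dl b d g k ` Vs (Q b g k) <= Vs (Q b g (Suc k)) + JV JA"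
  using dl_Vs[of b d g k] plus_ge1[OF ops_zero[OF smd_JV[OF JA(1)]], of "Vs (Q b g (Suc k))"] by blast
 thus "Nk k <= Vs (Q b g (Suc k)) + JV JA" unfolding Nk_def
  by(rule plus_least[OF vmod.ops_range_plus[OF smd_Vs smd_JV[OF JA(1)]] _ VU(3)])
qed

text \<open>From left to right this is \<open>flat\<close> for the kernel of \<open>dl\<close>, from
  right to left the functoriality \<open>fhat_hat\<close>.\<close>

lemma cocycle_iff:
 assumes f: "lin f"
 shows "(ALL v:Vs {..<b (Suc (Suc k))}. f (dR (Suc k) v) : UR) \<longleftrightarrow> cf (Suc k) f : hat (Zk k)" (is "?l \<longleftrightarrow> ?r")
proof
 assume l: ?l
 have "ALL x<b (Suc (Suc k)). row g (dlh (Suc k) (cf (Suc k) f)) x : hat U"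
 proof (intro allI impI)
  fix x assume x: "x < b (Suc (Suc k))"
  have "f (dR (Suc k) (ev x)) : UR" using l x ev_Vs[of x "{..<b (Suc (Suc k))}"] by blast
  thus "row g (dlh (Suc k) (cf (Suc k) f)) x : hat U" by(simp add: row_dlh[OF f x] UR_def)
 qed
 hence "dlh (Suc k) (cf (Suc k) f) : hat (VU JA b g (Suc (Suc k)) U)" using hat_VU_iff[OF dlh_Vs] by blast
 thus ?r unfolding Zk_def dlh_def by(intro flat[OF _ _ lin_dl dl_Vs VU cf_Vs]) auto
next
 assume r: ?r
 have "dlh (Suc k) (cf (Suc k) f) : hat (VU JA b g (Suc (Suc k)) U)"
  unfolding dlh_def by(rule fhat_hat[OF _ lin_dl _ _ r]) (auto simp: Zk_def)
 hence rw: "ALL x<b (Suc (Suc k)). row g (dlh (Suc k) (cf (Suc k) f)) x : hat U" using hat_VU_iff[OF dlh_Vs] by blast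
 show ?l
 proof
  fix v :: "nat => 'p" assume v: "v : Vs {..<b (Suc (Suc k))}"
  show "f (dR (Suc k) v) : UR"
   by(rule lin_mem[OF _ lin_comp[OF f dR_lin] smd_UR _ v]) (use rw in \<open>auto simp: UR_def row_dlh[OF f]\<close>)
 qed
qed

text \<open>For the direction from matrices to maps, being a coboundary row by row up to
  \<open>hat U\<close> is stable under combinations over the completion, so it is checked on the
  image of \<open>Nk k\<close> only.\<close>

lemma boundary_iff:
 assumes f: "lin f"
 shows "(EX h. lin h & (ALL v:Vs {..<b (Suc k)}. f v - h (dR k v) : UR)) \<longleftrightarrow> cf (Suc k) f : hat (Nk k)" (is "?l \<longleftrightarrow> ?r")
proof
 assume ?l
 then obtain h where h: "lin h" "!!v. v : Vs {..<b (Suc k)} ==> f v - h (dR k v) : UR" by blast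
 have "ALL x<b (Suc k). row g (cf (Suc k) f - dlh k (cf k h)) x : hat U"
 proof (intro allI impI)
  fix x assume x: "x < b (Suc k)"
  have "f (ev x) - h (dR k (ev x)) : UR" using h(2)[OF ev_Vs] x by simp
  thus "row g (cf (Suc k) f - dlh k (cf k h)) x : hat U"
   by(simp add: lin_simps(2)[OF lin_row] row_dlh[OF h(1) x] row_cf[OF x] UR_def lin_simps(2)[OF lin_cut])
 qed
 hence "cf (Suc k) f - dlh k (cf k h) : hat (VU JA b g (Suc k) U)"
  using hat_VU_iff[OF ops_diff[OF smd_Vs cf_Vs dlh_Vs]] by blast
 moreover have "hat (VU JA b g (Suc k) U) <= hat (Nk k)"
  unfolding Nk_def by(rule hat_mono[OF plus_ge2[OF ops_zero[OF dl_im]]])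
 ultimately have 1: "cf (Suc k) f - dlh k (cf k h) : hat (Nk k)" by blast
 have "dl b d g k ` Vs (Q b g k) <= Nk k" unfolding Nk_def by(rule plus_ge1[OF ops_zero[OF VU(1)]])
 hence "dlh k (cf k h) : hat (Nk k)"
  unfolding dlh_def by(intro fhat_hat[OF _ lin_dl order_refl _ Vs_hat[OF _ cf_Vs]]) auto
 thus ?r using 1 ops_cong[OF smd_hat] by blast
next
 assume r: ?r
 let ?S = "{v. EX h:Vs (Q b g k). ALL x<b (Suc k). row g (v - dlh k h) x : hat U}"
 have "hat (Nk k) <= ?S"
 proof (rule hat_least)
  note rs = lin_simps[OF lin_row] and ds = lin_simps[OF dlh_lin]
  show "smd ?S"
  proof (rule vmod.ops_rangeI)
   show "0 : ?S" unfolding mem_Collect_eq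
    by(rule bexI[of _ 0]) (simp_all add: rs ds ops_zero[OF smd_hat] ops_zero[OF smd_Vs])
   show "x + y : ?S" if xy: "x : ?S" "y : ?S" for x y
   proof -
    obtain h h' where h: "h : Vs (Q b g k)" "!!t. t < b (Suc k) ==> row g (x - dlh k h) t : hat U"
     "h' : Vs (Q b g k)" "!!t. t < b (Suc k) ==> row g (y - dlh k h') t : hat U" using xy by blast
    have "row g (x + y - dlh k (h + h')) t : hat U" if "t < b (Suc k)" for t
    proof -
     have "x + y - dlh k (h + h') = (x - dlh k h) + (y - dlh k h')" by(simp add: ds(1))
     hence "row g (x + y - dlh k (h + h')) t = row g (x - dlh k h) t + row g (y - dlh k h') t" by(simp only: rs(1))
     thus ?thesis using ops_add[OF smd_hat h(2)[OF that] h(4)[OF that]] by simp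
    qed
    thus ?thesis using ops_add[OF smd_Vs h(1,3)] by blast
   qed
   show "e *s x : ?S" if x: "x : ?S" for e x
   proof -
    obtain h where h: "h : Vs (Q b g k)" "!!t. t < b (Suc k) ==> row g (x - dlh k h) t : hat U" using x by blast
    have "row g (e *s x - dlh k (e *s h)) t : hat U" if "t < b (Suc k)" for t
    proof -
     have "e *s x - dlh k (e *s h) = e *s (x - dlh k h)" by(simp add: linD(2)[OF dlh_lin] vmod.sc_diff)
     hence "row g (e *s x - dlh k (e *s h)) t = e *s row g (x - dlh k h) t" by(simp only: linD(2)[OF lin_row])
     thus ?thesis using smd_smul[OF smd_hat h(2)[OF that]] by simp
    qed
    thus ?thesis using smd_smul[OF smd_Vs h(1)] by blast
   qed
  qed
  show "JV J <= ?S"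
  proof
   fix v :: "nat * nat => 'p" assume v: "v : JV J"
   hence "row g v x : hat U" for x using JV_hat[of U] ops_zero[OF idl_J] by(auto simp: row_def JV_def subset_iff)
   thus "v : ?S" unfolding mem_Collect_eq
    by(intro bexI[of _ 0]) (simp_all add: ds(4) ops_zero[OF smd_Vs])
  qed
  fix u assume "u : Nk k"
  then obtain x y where u: "u = x + y" "x : dl b d g k ` Vs (Q b g k)" "y : VU JA b g (Suc k) U"
   unfolding Nk_def by(rule set_plus_elim)
  obtain h where h: "h : Vs (Q b g k)" "x = dl b d g k h" using u(2) by blast
  have "lv u - dlh k (lv h) = lv y" by(simp add: u(1) h(2) lv_add dlh_def fhat_lv[OF _ lin_dl h(1)])
  moreover have "row g (lv y) t : hat U" if "t < b (Suc k)" for t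
  proof -
   have "row g (lv y) t = lv (row g y t)" by(auto simp: row_def lv_def l_0)
   thus ?thesis using u(3) that by(simp add: VU_def lv_hat)
  qed
  ultimately show "lv u : ?S" unfolding mem_Collect_eq by(intro bexI[OF _ lv_Vs[OF h(1)]]) simp
 qed
 then obtain h where h: "h : Vs (Q b g k)" "!!x. x < b (Suc k) ==> row g (cf (Suc k) f - dlh k h) x : hat U"
  using r by blast
 have "f v - fc k h (dR k v) : UR" if v: "v : Vs {..<b (Suc k)}" for v
 proof (rule lin_mem[OF _ lin_diff[OF f lin_comp[OF fc_lin dR_lin]] smd_UR _ v])
  fix x assume "x : {..<b (Suc k)}"
  hence x: "x < b (Suc k)" by simp
  have "row g (dlh k h) x = cut g (fc k h (dR k (ev x)))"
   using row_dlh[OF fc_lin x, of k h] by(simp add: cf_fc[OF h(1)])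
  thus "f (ev x) - fc k h (dR k (ev x)) : UR"
   using h(2)[OF x] by(simp add: UR_def lin_simps(2)[OF lin_row] lin_simps(2)[OF lin_cut] row_cf[OF x])
 qed simp
 thus ?l using fc_lin by blast
qed

lemma cf_smul: "cf k (%v. a *s f v) = a *s cf k f"
 by(auto simp: cf_def smul_apply fun_eq_iff)

text \<open>\<open>cf\<close> and \<open>fc\<close> translate between maps and matrices, up to
  \<open>JV J\<close>; the prime is brought down from the completion by
  \<open>ass_transfer\<close>.\<close>

theorem extw_extv:
 assumes p: "prm p"
 shows "extw io (%n. {..<b n}) dR k UR p \<longleftrightarrow> extv JA b d g k U p"
proof -
 have b_iff: "(EX h. lin h & (ALL v:Vs {..<b (Suc k)}. io a *s f v - h (dR k v) : UR)) \<longleftrightarrow> io a *s cf (Suc k) f : hat (Nk k)"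
  if "lin f" for a f
  using boundary_iff[OF lin_smul[OF that, of "io a"]] by(simp add: cf_smul)
 have "extw io (%n. {..<b n}) dR k UR p \<longleftrightarrow> (EX c:hat (Zk k). p = {a. io a *s c : hat (Nk k)})"
 proof
  assume "extw io (%n. {..<b n}) dR k UR p"
  then obtain f where f: "lin f" "ALL v:Vs {..<b (Suc (Suc k))}. f (dR (Suc k) v) : UR"
   "p = {a. EX h. lin h & (ALL v:Vs {..<b (Suc k)}. io a *s f v - h (dR k v) : UR)}" unfolding extw_def by blast
  thus "EX c:hat (Zk k). p = {a. io a *s c : hat (Nk k)}"
   using cocycle_iff[OF f(1)] b_iff[OF f(1)] by blast
 next
  assume "EX c:hat (Zk k). p = {a. io a *s c : hat (Nk k)}"
  then obtain c where c: "c : hat (Zk k)" "p = {a. io a *s c : hat (Nk k)}" by blast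
  define f where "f = fc (Suc k) c"
  have f: "lin f" unfolding f_def by(rule fc_lin)
  have "hat (Zk k) <= {c. c - cf (Suc k) (fc (Suc k) c) : JV J}"
  proof (rule hat_least)
   have l: "lin (%c. c - cf (Suc k) (fc (Suc k) c))"
    by(rule lin_diff[OF lin_id])
     (auto simp: lin_def addm_def cf_def fc_def fun_eq_iff smul_apply ext_ev row_def)
   show "smd {c. c - cf (Suc k) (fc (Suc k) c) : JV J}"
    using smd_kernel[OF l ops_UNIV smd_JV[OF idl_J]] by simp
   show "lv u : {c. c - cf (Suc k) (fc (Suc k) c) : JV J}" if u: "u : Zk k" for u
   proof -
    have "lv u : Vs (Q b g (Suc k))" using u Zk(2) lv_Vs by blast
    thus ?thesis using ops_zero[OF smd_JV[OF idl_J]] by(simp add: cf_fc)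
   qed
   show "JV J <= {c. c - cf (Suc k) (fc (Suc k) c) : JV J}"
    using ops_zero[OF idl_J] by(auto simp: JV_def cf_def fc_def ext_ev row_def minus_fun_apply')
  qed
  hence "c - cf (Suc k) f : JV J" using c(1) by(auto simp: f_def)
  hence cj: "c - cf (Suc k) f : hat E" for E :: "(nat * nat => 'a) set" using JV_hat by blast
  have "cf (Suc k) f : hat (Zk k)" using ops_cong[OF smd_hat cj] c(1) by blast
  moreover have "io a *s c : hat (Nk k) \<longleftrightarrow> io a *s cf (Suc k) f : hat (Nk k)" for a
   using ops_cong[OF smd_hat, of "io a *s c" "io a *s cf (Suc k) f"] smd_smul[OF smd_hat cj]
   by(simp add: vmod.sc_diff)
  ultimately show "extw io (%n. {..<b n}) dR k UR p"
   unfolding extw_def using cocycle_iff[OF f] b_iff[OF f] f c(2) by blast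
 qed
 also have "... \<longleftrightarrow> (EX c:Zk k. p = {a. a *s c : Nk k})"
  by(rule ass_transfer[OF _ Zk Nk p, symmetric]) simp
 finally show ?thesis by(simp add: extv_iff)
qed

end

context completion_ext
begin

text \<open>Powers of I commute with extension to the completion. Vectors that vanish in the first
  \<open>g\<close> coordinates lie in both sides.\<close>

lemma hat_ivec:
 fixes gm :: "nat => 'a"
 assumes rel: "smd rel" "JV JA <= rel" "rel <= Vs {..<g} + JV JA"
 shows "ivec (%l. io (gm l)) m n UNIV + {w. cut g w : hat rel} = {w. cut g w : hat (ivec gm m n (Vs {..<g}) + rel)}"
proof -
 interpret ya: tmod "smul :: 'a => (nat => 'a) => nat => 'a" "%j v. v" 0 gm m by unfold_locales auto
 interpret yp: tmod "smul :: 'p => (nat => 'p) => nat => 'p" "%j v. v" 0 "%l. io (gm l)" m by unfold_locales auto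
 interpret cr: completion_coeff io JA mm \<mu> s J KK b d g rel by unfold_locales (use rel in auto)
 have va: "smd (ivec gm m n (Vs {..<g}))" unfolding ivec_def by(rule ya.osub_IP[OF smd_Vs])
 have vp: "smd (ivec (%l. io (gm l)) m n (UNIV :: (nat => 'p) set))" unfolding ivec_def by(rule yp.osub_IP[OF ops_UNIV])
 have UV: "ivec gm m n (Vs {..<g}) <= Vs {..<g}" unfolding ivec_def by(rule ya.IP_subset[OF smd_Vs])
 have hat_pow: "w : hat (ivec gm m n (Vs {..<g}))" if "w : ivec (%l. io (gm l)) m n (Vs {..<g})" for w
  using that
 proof (induction n arbitrary: w)
  case 0 thus ?case by(simp add: ivec_def Vs_hat)
 next
  case (Suc n)
  have "yp.imul (ivec (%l. io (gm l)) m n (Vs {..<g})) <= hat (ivec gm m (Suc n) (Vs {..<g}))"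
  proof (rule yp.imul_least[OF smd_hat])
   fix l x assume l: "l < m" and x: "x : ivec (%l. io (gm l)) m n (Vs {..<g})"
   have "hat (ivec gm m n (Vs {..<g})) <= {x. io (gm l) *s x : hat (ivec gm m (Suc n) (Vs {..<g}))}"
   proof (rule hat_least)
    show "smd {x. io (gm l) *s x : hat (ivec gm m (Suc n) (Vs {..<g}))}"
     using smd_kernel[OF lin_smul[OF lin_id] ops_UNIV smd_hat] by simp
    show "lv u : {x. io (gm l) *s x : hat (ivec gm m (Suc n) (Vs {..<g}))}" if u: "u : ivec gm m n (Vs {..<g})" for u
    proof -
     have "gm l *s u : ivec gm m (Suc n) (Vs {..<g})"
      using ya.sc_imul[OF l ya.osub_IP[OF smd_Vs], of u n "{..<g}"] u by(simp add: ivec_def)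
     from lv_hat[OF this] show ?thesis by(simp add: lv_smul)
    qed
    show "JV J <= {x. io (gm l) *s x : hat (ivec gm m (Suc n) (Vs {..<g}))}"
     using JV_hat smd_smul[OF smd_hat] by blast
   qed
   thus "io (gm l) *s x : hat (ivec gm m (Suc n) (Vs {..<g}))" using Suc.IH[OF x] by blast
  qed
  moreover have "w : yp.imul (ivec (%l. io (gm l)) m n (Vs {..<g}))" using Suc.prems by(simp add: ivec_def)
  ultimately show ?case by blast
 qed
 have cut_pow: "cut g y : ivec (%l. io (gm l)) m n (Vs {..<g})" if "y : ivec (%l. io (gm l)) m n UNIV" for y
  using that unfolding ivec_def
  by(intro lsum_funpow_map[OF linD(1)[OF lin_cut], where E = UNIV and ta = "%l. smul (io (gm l))"])
   (auto simp: linD(2)[OF lin_cut] cut_Vs)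
 show ?thesis
 proof (intro equalityI subsetI)
  fix w assume "w : ivec (%l. io (gm l)) m n UNIV + {w. cut g w : hat rel}"
  then obtain y r where yr: "w = y + r" "y : ivec (%l. io (gm l)) m n UNIV" "r : {w. cut g w : hat rel}" by(rule set_plus_elim)
  have "cut g y : hat (ivec gm m n (Vs {..<g}) + rel)"
   using hat_pow[OF cut_pow[OF yr(2)]] hat_mono[OF plus_ge1[OF ops_zero[OF rel(1)]]] by blast
  moreover have "cut g r : hat (ivec gm m n (Vs {..<g}) + rel)"
   using yr(3) hat_mono[OF plus_ge2[OF ops_zero[OF va]]] by blast
  ultimately show "w : {w. cut g w : hat (ivec gm m n (Vs {..<g}) + rel)}"
   by(simp add: yr(1) lin_simps(1)[OF lin_cut] ops_add[OF smd_hat])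
 next
  fix w assume w: "w : {w. cut g w : hat (ivec gm m n (Vs {..<g}) + rel)}"
  let ?S = "ivec (%l. io (gm l)) m n UNIV + {w. cut g w : hat rel}"
  have S: "smd ?S" using vmod.ops_range_plus[OF vp cr.smd_UR] unfolding cr.UR_def .
  have rS: "{w. cut g w : hat rel} <= ?S" by(rule plus_ge2[OF ops_zero[OF vp]])
  have hr: "hat rel <= ?S" using cr.hat_UR rS unfolding cr.UR_def by blast
  have "hat (ivec gm m n (Vs {..<g}) + rel) <= ?S"
  proof (rule hat_least[OF S])
   show "JV J <= ?S" using JV_hat hr by blast
   fix u assume "u : ivec gm m n (Vs {..<g}) + rel"
   then obtain y r where yr: "u = y + r" "y : ivec gm m n (Vs {..<g})" "r : rel" by(rule set_plus_elim)
   have "lv y : ivec (%l. io (gm l)) m n UNIV"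
    using yr(2) unfolding ivec_def
    by(intro lsum_funpow_map[OF lv_addm, where E = "Vs {..<g}" and ta = "%l. smul (gm l)"]) (auto simp: lv_smul)
   thus "lv u : ?S"
    using lv_hat[OF yr(3)] cr.hat_UR unfolding cr.UR_def
    by(intro set_plusI[of "lv u" "lv y" "lv r"]) (auto simp: yr(1) lv_add)
  qed
  hence "cut g w : ?S" using w by blast
  moreover have "w - cut g w : ?S"
  proof (rule subsetD[OF rS])
   have "cut g (w - cut g w) = 0" by(simp add: lin_simps(2)[OF lin_cut] cut_cut)
   thus "w - cut g w : {w. cut g w : hat rel}" by(simp add: ops_zero[OF smd_hat])
  qed
  ultimately show "w : ?S" using ops_cong[OF S] by blast
 qed
qed

text \<open>\<open>complete_intersection_stable\<close> is applied to the completed resolution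
  \<open>dR\<close>, and for each \<open>n\<close> the locale is instantiated with the relations of
  that \<open>n\<close> to return to matrices over the original ring.\<close>

theorem extv_stable:
 fixes JJ :: "nat => 'p set" and gm :: "nat => 'a"
 assumes J0: "rnoeth (JJ 0)" "lcl (JJ 0) \<nn>" "\<nn> = gi (JJ 0 Un set xs)" "regp (JJ 0) xs"
  and JJ: "!!j. idl (JJ j)" "!!j. j < c ==> JJ (Suc j) = gi (insert (f j) (JJ j))" "JJ c = J" "JJ 0 <= J"
  and reg: "!!j a. j < c ==> f j * a : JJ j ==> a : JJ j"
  and rel: "smd rel" "JV JA <= rel" "rel <= Vs {..<g} + JV JA"
 shows "EX e0. ALL e>=e0. EX n0 i0. ALL n>=n0. ALL i>=i0.
  {p. prm p & extv JA b d g (2 * i + e) (ivec gm m n (Vs {..<g}) + rel) p} =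
  {p. prm p & extv JA b d g (2 * i0 + e) (ivec gm m n0 (Vs {..<g}) + rel) p}"
proof -
 interpret ya: tmod "smul :: 'a => (nat => 'a) => nat => 'a" "%j v. v" 0 gm m by unfold_locales auto
 interpret cr: completion_coeff io JA mm \<mu> s J KK b d g rel by unfold_locales (use rel in auto)
 have JVJ: "smd (JV J :: (nat => 'p) set)" by(rule smd_JV[OF idl_J])
 have JUR: "JV J <= cr.UR" using JV_hat cr.hat_UR by blast
 have rn: "rnoeth J" by(rule rnoeth_mono[OF J0(1) JJ(1) idl_J JJ(4)])
 have n: "opnoeth (range smul) (UNIV :: (nat => 'p) set) cr.UR"
 proof (rule opnoeth_image[where T = "Vs {..<g}" and f = "%x. x"])
  show "opnoeth (range smul) (Vs {..<g}) (JV J :: (nat => 'p) set)" by(rule noeth_vectors[OF idl_J rn]) simp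
  show "UNIV <= (%x. x) ` Vs {..<g} + cr.UR"
  proof
   fix w :: "nat => 'p"
   have "cut g (w - cut g w) = 0" by(simp add: lin_simps(2)[OF lin_cut] cut_cut)
   hence "w - cut g w : cr.UR" by(simp add: cr.UR_def ops_zero[OF smd_hat])
   thus "w : (%x. x) ` Vs {..<g} + cr.UR" by(intro set_plusI[of w "cut g w" "w - cut g w"]) (auto simp: cut_Vs)
  qed
 qed (use JUR cr.smd_UR JVJ smd_Vs vmod.sc_addm in \<open>auto simp: addm_def[of "%x. x"]\<close>)
 have st: "EX e0. ALL e>=e0. EX n0 i0. ALL n>=n0. ALL i>=i0.
  {p. prm p & extw io (%n. {..<b n}) dR (2 * i + e) (ivec (%l. io (gm l)) m n UNIV + cr.UR) p} =
  {p. prm p & extw io (%n. {..<b n}) dR (2 * i0 + e) (ivec (%l. io (gm l)) m n0 UNIV + cr.UR) p}"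
 proof (rule complete_intersection_stable[OF J0 JJ(1,2) reg, where JA = JA])
  show "cplx (JJ c) (%n. {..<b n}) dR" "!!n. exact_at (JJ c) (%n. {..<b n}) dR n"
   "!!a. a : JA ==> io a : JJ c" "JV (JJ c) <= cr.UR"
   unfolding JJ(3) by(rule cplxR exactR l_J JUR; assumption?)+
 qed (use l_add l_mult l_1 JA cr.smd_UR n in simp_all)
 have "{p. prm p & extw io (%n. {..<b n}) dR k (ivec (%l. io (gm l)) m n UNIV + cr.UR) p} =
  {p. prm p & extv JA b d g k (ivec gm m n (Vs {..<g}) + rel) p}" for k n
 proof -
  have va: "smd (ivec gm m n (Vs {..<g}))" unfolding ivec_def by(rule ya.osub_IP[OF smd_Vs])
  have UV: "ivec gm m n (Vs {..<g}) <= Vs {..<g}" unfolding ivec_def by(rule ya.IP_subset[OF smd_Vs])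
  have VJ: "smd (Vs {..<g} + JV JA)" by(rule vmod.ops_range_plus[OF smd_Vs smd_JV[OF JA(1)]])
  interpret cu: completion_coeff io JA mm \<mu> s J KK b d g "ivec gm m n (Vs {..<g}) + rel"
  proof unfold_locales
   show "smd (ivec gm m n (Vs {..<g}) + rel)" by(rule vmod.ops_range_plus[OF va rel(1)])
   show "JV JA <= ivec gm m n (Vs {..<g}) + rel"
    by(rule order_trans[OF rel(2) plus_ge2[OF ops_zero[OF va]]])
   show "ivec gm m n (Vs {..<g}) + rel <= Vs {..<g} + JV JA"
    using UV plus_ge1[OF ops_zero[OF smd_JV[OF JA(1)]]] by(intro plus_least[OF VJ _ rel(3)]) blast
  qed
  have "ivec (%l. io (gm l)) m n UNIV + cr.UR = cu.UR" unfolding cr.UR_def cu.UR_def by(rule hat_ivec[OF rel])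
  thus ?thesis using cu.extw_extv by auto
 qed
 thus ?thesis using st by simp
qed

end

section \<open>Free commutative rings\<close>

text \<open>Ring terms over the elements of a type. Modulo provable equality they form a ring whose
  carrier is a whole type, as the class \<open>comm_ring_1\<close> demands, whatever the carrier of
  the ring to be presented.\<close>

datatype 'a rterm = RVar 'a | RZero | ROne | RNeg "'a rterm" | RAdd "'a rterm" "'a rterm" | RMul "'a rterm" "'a rterm"

inductive req :: "'a rterm => 'a rterm => bool" where
 refl: "req s s"
| sym: "req s t ==> req t s"
| trans: "req s t ==> req t u ==> req s u"
| cNeg: "req s t ==> req (RNeg s) (RNeg t)"
| cAdd: "req s t ==> req s' t' ==> req (RAdd s s') (RAdd t t')"
| cMul: "req s t ==> req s' t' ==> req (RMul s s') (RMul t t')"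
| add_assoc: "req (RAdd (RAdd s t) u) (RAdd s (RAdd t u))"
| add_comm: "req (RAdd s t) (RAdd t s)"
| add_zero: "req (RAdd RZero s) s"
| add_neg: "req (RAdd (RNeg s) s) RZero"
| mul_assoc: "req (RMul (RMul s t) u) (RMul s (RMul t u))"
| mul_comm: "req (RMul s t) (RMul t s)"
| mul_one: "req (RMul ROne s) s"
| distr: "req (RMul (RAdd s t) u) (RAdd (RMul s u) (RMul t u))"

text \<open>The type class requires \<open>0 \<noteq> 1\<close>, which is detected by evaluation in the integers.\<close>

primrec ieval :: "'a rterm => int" where
 "ieval (RVar a) = 0" | "ieval RZero = 0" | "ieval ROne = 1" | "ieval (RNeg s) = - ieval s"
| "ieval (RAdd s t) = ieval s + ieval t" | "ieval (RMul s t) = ieval s * ieval t"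

lemma req_ieval: "req s t ==> ieval s = ieval t"
 by(induction rule: req.induct) (simp_all add: algebra_simps)

quotient_type 'a fr = "'a rterm" / req
 by(rule equivpI) (auto simp: reflp_def symp_def transp_def intro: req.refl req.sym req.trans)

instantiation fr :: (type) comm_ring_1
begin

lift_definition zero_fr :: "'a fr" is RZero .
lift_definition one_fr :: "'a fr" is ROne .
lift_definition uminus_fr :: "'a fr => 'a fr" is RNeg by(rule req.cNeg)
lift_definition plus_fr :: "'a fr => 'a fr => 'a fr" is RAdd by(rule req.cAdd)
lift_definition minus_fr :: "'a fr => 'a fr => 'a fr" is "%s t. RAdd s (RNeg t)" by(rule req.cAdd[OF _ req.cNeg])
lift_definition times_fr :: "'a fr => 'a fr => 'a fr" is RMul by(rule req.cMul)

instance
proof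
 fix a b c :: "'a fr"
 show "a + b + c = a + (b + c)" by transfer (rule req.add_assoc)
 show "a + b = b + a" by transfer (rule req.add_comm)
 show "0 + a = a" by transfer (rule req.add_zero)
 show "- a + a = 0" by transfer (rule req.add_neg)
 show "a - b = a + - b" by transfer (rule req.refl)
 show "a * b * c = a * (b * c)" by transfer (rule req.mul_assoc)
 show "a * b = b * a" by transfer (rule req.mul_comm)
 show "1 * a = a" by transfer (rule req.mul_one)
 show "(a + b) * c = a * c + b * c" by transfer (rule req.distr)
 show "0 \<noteq> (1 :: 'a fr)" by transfer (auto dest: req_ieval)
qed

end

lift_definition var :: "'a => 'a fr" is RVar .

lemma fr_induct [case_names var zero one neg add mul]:
 assumes "!!a. P (var a)" "P 0" "P 1" "!!x. P x ==> P (- x)" "!!x y. P x ==> P y ==> P (x + y)"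
  "!!x y. P x ==> P y ==> P (x * y)"
 shows "P x"
proof -
 have "P (abs_fr t)" for t
 proof (induction t)
  case (RVar a) thus ?case using assms(1) by(simp add: var.abs_eq)
 next
  case RZero thus ?case using assms(2) by(simp add: zero_fr.abs_eq)
 next
  case ROne thus ?case using assms(3) by(simp add: one_fr.abs_eq)
 next
  case (RNeg t) thus ?case using assms(4) by(metis uminus_fr.abs_eq)
 next
  case (RAdd s t) thus ?case using assms(5) by(metis plus_fr.abs_eq)
 next
  case (RMul s t) thus ?case using assms(6) by(metis times_fr.abs_eq)
 qed
 thus ?thesis by(metis Quotient3_abs_rep Quotient3_fr)
qed

primrec teval :: "('a => 'p::comm_ring_1) => 'a rterm => 'p" where
 "teval h (RVar a) = h a" | "teval h RZero = 0" | "teval h ROne = 1" | "teval h (RNeg s) = - teval h s"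
| "teval h (RAdd s t) = teval h s + teval h t" | "teval h (RMul s t) = teval h s * teval h t"

lemma req_teval: "req s t ==> teval h s = teval h t"
 by(induction rule: req.induct) (simp_all add: algebra_simps)

lift_definition subst :: "('a => 'p::comm_ring_1) => 'a fr => 'p" is teval by(rule req_teval)

lemma subst_simps: "subst h (var a) = h a" "subst h 0 = 0" "subst h 1 = 1" "subst h (- x) = - subst h x"
 "subst h (x + y) = subst h x + subst h y" "subst h (x * y) = subst h x * subst h y"
 by(transfer, simp)+

section \<open>Presentation of a ring by the free ring on its elements\<close>

context cring
begin

text \<open>Variables outside the carrier are sent to zero, which makes evaluation total with values
  in the carrier.\<close>

primrec reval :: "'a rterm => 'a" where
 "reval (RVar a) = (if a : carrier R then a else \<zero>)" | "reval RZero = \<zero>" | "reval ROne = \<one>"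
| "reval (RNeg s) = \<ominus> reval s" | "reval (RAdd s t) = reval s \<oplus> reval t" | "reval (RMul s t) = reval s \<otimes> reval t"

lemma reval_carrier: "reval t : carrier R"
 by(induction t) auto

lemma req_reval: "req s t ==> reval s = reval t"
 by(induction rule: req.induct) (simp_all add: reval_carrier a_ac m_ac l_neg r_neg l_distr r_distr)

definition feval :: "'a fr => 'a" where
 "feval x = reval (rep_fr x)"

lemma feval_abs: "feval (abs_fr t) = reval t"
 unfolding feval_def by(rule req_reval) (metis Quotient3_fr Quotient3_rep_abs req.refl)

lemma feval_carrier [simp]: "feval x : carrier R"
 by(simp add: feval_def reval_carrier)

lemma fr_abs: "EX t. x = abs_fr t"
 by(metis Quotient3_abs_rep Quotient3_fr)

lemma feval_var: "a : carrier R ==> feval (var a) = a" "a ~: carrier R ==> feval (var a) = \<zero>"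
 by(simp_all add: var.abs_eq feval_abs)

lemma feval_0: "feval 0 = \<zero>" and feval_1: "feval 1 = \<one>"
 by(simp_all add: zero_fr.abs_eq one_fr.abs_eq feval_abs)

lemma feval_neg: "feval (- x) = \<ominus> feval x"
 using fr_abs[of x] by(auto simp: uminus_fr.abs_eq feval_abs)

lemma feval_add: "feval (x + y) = feval x \<oplus> feval y" and feval_mult: "feval (x * y) = feval x \<otimes> feval y"
 using fr_abs[of x] fr_abs[of y] by(auto simp: plus_fr.abs_eq times_fr.abs_eq feval_abs)

lemma feval_diff: "feval (x - y) = feval x \<ominus> feval y"
 using feval_add[of x "- y"] by(simp add: feval_neg a_minus_def)

definition fker :: "'a fr set" where
 "fker = {x. feval x = \<zero>}"

lemma feval_eq_iff: "feval x = feval y \<longleftrightarrow> x - y : fker"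
 by(simp add: fker_def feval_diff)

definition pre :: "'a set => 'a fr set" where
 "pre I = {x. feval x : I}"

lemma fker_pre: "fker = pre {\<zero>}"
 by(simp add: fker_def pre_def)

lemma idl_pre: "ideal I R ==> idl (pre I)"
proof -
 assume "ideal I R"
 then interpret I: ideal I R .
 show ?thesis by(rule rmod.ops_rangeI) (auto simp: pre_def feval_0 feval_add feval_mult I.I_l_closed)
qed

lemma idl_fker: "idl fker"
 unfolding fker_pre by(rule idl_pre[OF zeroideal])

lemma fker_sub_pre: "ideal I R ==> fker <= pre I"
 by(auto simp: fker_def pre_def additive_subgroup.zero_closed ideal.axioms(1))

lemma feval_surj: "a : carrier R ==> EX x. feval x = a"
 using feval_var(1) by blast

lemma ideal_image: "idl E ==> ideal (feval ` E) R"
proof (rule idealI[OF ring_axioms])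
 assume E: "idl E"
 show "subgroup (feval ` E) (add_monoid R)"
 proof (rule add.subgroupI)
  show "feval ` E \<noteq> {}" using ops_zero[OF E] by blast
  show "\<ominus> a : feval ` E" if "a : feval ` E" for a
   using that ops_minus[OF E] by(auto simp: feval_neg[symmetric])
  show "a \<oplus> b : feval ` E" if "a : feval ` E" "b : feval ` E" for a b
   using that ops_add[OF E] by(auto simp: feval_add[symmetric])
 qed auto
 fix a x assume a: "a : feval ` E" and x: "x : carrier R"
 obtain e y where "a = feval e" "e : E" "x = feval y" using a feval_surj[OF x] by blast
 thus "x \<otimes> a : feval ` E" "a \<otimes> x : feval ` E"
  using idl_mult[OF E] idl_mult_right[OF E] by(auto simp: feval_mult[symmetric])
qed

lemma pre_image: "idl E ==> fker <= E ==> pre (feval ` E) = E"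
proof (intro equalityI subsetI)
 fix x assume E: "idl E" "fker <= E" and "x : pre (feval ` E)"
 then obtain y where "feval x = feval y" "y : E" by(auto simp: pre_def)
 thus "x : E" using ops_cong[OF E(1)] E(2) feval_eq_iff by blast
qed (auto simp: pre_def)

lemma image_pre: "I <= carrier R ==> feval ` pre I = I"
 using feval_surj by(force simp: pre_def)

lemma pre_genideal:
 assumes "S <= carrier R" "feval ` F = S"
 shows "pre (genideal R S) = gi (fker Un F)"
proof
 have G: "idl (gi (fker Un F))" by(rule idl_gi)
 have inc: "fker Un F <= gi (fker Un F)" by(rule gen_inc)
 have "genideal R S <= feval ` gi (fker Un F)"
  by(rule genideal_minimal[OF ideal_image[OF G]]) (use inc assms(2) in blast)
 hence "pre (genideal R S) <= pre (feval ` gi (fker Un F))" by(auto simp: pre_def)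
 also have "... = gi (fker Un F)" by(rule pre_image[OF G]) (use inc in blast)
 finally show "pre (genideal R S) <= gi (fker Un F)" .
 have I: "ideal (genideal R S) R" by(rule genideal_ideal[OF assms(1)])
 have "F <= pre (genideal R S)" using genideal_self[OF assms(1)] assms(2) by(auto simp: pre_def)
 thus "gi (fker Un F) <= pre (genideal R S)"
  using fker_sub_pre[OF I] by(intro gen_least[OF idl_pre[OF I]]) auto
qed

lemma rnoeth_fker:
 assumes "noetherian_ring R" shows "rnoeth fker"
 unfolding rnoeth_def opnoeth_def
proof (intro allI impI)
 fix E assume "idl E & fker <= E & E <= UNIV + fker"
 hence E: "idl E" "fker <= E" by auto
 obtain S where S: "S <= carrier R" "finite S" "feval ` E = genideal R S"
  using noetherian_ring.finetely_gen[OF assms ideal_image[OF E(1)]] by blast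
 have vS: "feval ` (var ` S) = S" using S(1) by(force simp: feval_var)
 have EF: "E = gi (fker Un var ` S)" using pre_genideal[OF S(1) vS] pre_image[OF E] S(3) by simp
 have "var ` S <= E" unfolding EF using gen_inc[of "fker Un var ` S" "range (*)"] by auto
 thus "EX F. finite F & F <= E & E <= gen (range (*)) (F Un fker)"
  using S(2) EF by(intro exI[of _ "var ` S"]) (simp add: Un_commute)
qed

lemma prm_pre: "primeideal P R \<longleftrightarrow> P <= carrier R & prm (pre P) & fker <= pre P"
proof
 assume "primeideal P R"
 then interpret P: primeideal P R .
 have i: "ideal P R" by(rule P.is_ideal)
 have "\<one> ~: P" using P.I_notcarr P.one_imp_carrier by blast
 hence "prm (pre P)"
  unfolding prm_def using idl_pre[OF i] P.I_prime by(auto simp: pre_def feval_1 feval_mult)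
 thus "P <= carrier R & prm (pre P) & fker <= pre P" using fker_sub_pre[OF i] P.a_subset by blast
next
 assume p: "P <= carrier R & prm (pre P) & fker <= pre P"
 hence P: "feval ` pre P = P" by(simp add: image_pre)
 have i: "ideal P R" using ideal_image[OF prmD(1), of "pre P"] p P by simp
 have "\<one> ~: P" using prmD(2)[of "pre P"] p by(auto simp: pre_def feval_1)
 thus "primeideal P R"
 proof (intro primeidealI[OF i is_cring])
  show "carrier R \<noteq> P" using \<open>\<one> ~: P\<close> by auto
  fix a b assume ab: "a : carrier R" "b : carrier R" "a \<otimes> b : P"
  hence "var a * var b : pre P" by(simp add: pre_def feval_mult feval_var)
  hence "var a : pre P | var b : pre P" using prmD(3)[of "pre P"] p by blast
  thus "a : P | b : P" using ab by(simp add: pre_def feval_var)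
 qed
qed

text \<open>For a non-invertible \<open>a\<close>, an ideal maximal among those that contain
  \<open>a\<close> but not 1 maps to a maximal ideal. This is the only one, so \<open>a\<close> lies
  in its preimage.\<close>

lemma lcl_pre:
 assumes "noetherian_ring R" "maximalideal \<mm> R" "!!J. maximalideal J R ==> J = \<mm>"
 shows "lcl fker (pre \<mm>)"
proof -
 interpret M: maximalideal \<mm> R by fact
 have i: "ideal \<mm> R" by(rule M.is_ideal)
 have "EX b. a * b - 1 : fker" if a: "a ~: pre \<mm>" for a
 proof (rule ccontr)
  assume no: "\<nexists>b. a * b - 1 : fker"
  let ?F = "{E. idl E & fker <= E & 1 ~: E & a : E}"
  have "1 ~: gi (insert a fker)"
  proof
   assume "1 : gi (insert a fker)"
   then obtain j r where "1 = j + r * a" "j : fker" unfolding gi_insert[OF idl_fker] by blast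
   hence "a * r - 1 = - j" by(simp add: algebra_simps)
   thus False using no ops_minus[OF idl_fker \<open>j : fker\<close>] by metis
  qed
  hence "gi (insert a fker) : ?F" using idl_gi gen_inc[of "insert a fker" "range (*)"] by auto
  from rnoeth_maximal[OF rnoeth_fker[OF assms(1)] idl_fker this]
  obtain E where E: "E : ?F" "ALL E':?F. E <= E' --> E' = E" by blast
  hence E': "idl E" "fker <= E" "1 ~: E" "a : E" by auto
  have pE: "pre (feval ` E) = E" by(rule pre_image[OF E'(1,2)])
  have "maximalideal (feval ` E) R"
  proof (rule maximalidealI[OF ideal_image[OF E'(1)]])
   show "carrier R \<noteq> feval ` E" using E'(3) pE feval_1 by(metis mem_Collect_eq one_closed pre_def)
   fix K assume K: "ideal K R" "feval ` E <= K" "K <= carrier R"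
   show "K = feval ` E | K = carrier R"
   proof (cases "1 : pre K")
    case True
    hence "\<one> : K" by(simp add: pre_def feval_1)
    thus ?thesis using ideal.one_imp_carrier[OF K(1)] by blast
   next
    case False
    have "E <= pre K" using K(2) by(auto simp: pre_def)
    hence "pre K : ?F" using False idl_pre[OF K(1)] E' by blast
    hence "pre K = E" using E(2) \<open>E <= pre K\<close> by blast
    thus ?thesis using image_pre[OF K(3)] by blast
   qed
  qed
  hence "feval ` E = \<mm>" by(rule assms(3))
  thus False using a E'(4) by(auto simp: pre_def)
 qed
 moreover have "1 ~: pre \<mm>" using M.I_notcarr ideal.one_imp_carrier[OF i] by(auto simp: pre_def feval_1)
 ultimately show ?thesis unfolding lcl_def using idl_pre[OF i] fker_sub_pre[OF i] by blast
qed

text \<open>Powers in the monoid of ideals become iterated applications of \<open>lsum\<close>, up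
  to the kernel \<open>fker\<close>. Multiplying generators with one factor at a time is enough
  because the other factor ranges over an ideal.\<close>

lemma pre_pow:
 fixes gm :: "nat => 'a fr" and n :: nat
 assumes I: "ideal I R" and gm: "pre I = gi (fker Un gm ` {..<m})"
 shows "ideal (I [^]\<^bsub>ideals_set R\<^esub> n) R"
  "pre (I [^]\<^bsub>ideals_set R\<^esub> n) = (lsum (%l. (*) (gm l)) {..<m} ^^ n) UNIV + fker"
proof -
 interpret rm: tmod "(*) :: 'a fr => 'a fr => 'a fr" "%j v. v" 0 gm m by unfold_locales auto
 interpret S: semiring "ideals_set R" by(rule ideals_set_is_semiring)
 have Ic: "I : carrier (ideals_set R)" using I by(simp add: ideals_set_def)
 have pw: "I [^]\<^bsub>ideals_set R\<^esub> n : carrier (ideals_set R)" for n :: nat using Ic by simp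
 thus i: "ideal (I [^]\<^bsub>ideals_set R\<^esub> n) R" for n :: nat by(simp add: ideals_set_def)
 have sub: "pre (I [^]\<^bsub>ideals_set R\<^esub> Suc n) = rm.imul (pre (I [^]\<^bsub>ideals_set R\<^esub> n)) + fker" for n :: nat
 proof -
  let ?P = "I [^]\<^bsub>ideals_set R\<^esub> n"
  have Suc: "I [^]\<^bsub>ideals_set R\<^esub> Suc n = ideal_prod R ?P I" by(simp add: ideals_set_def)
  have T: "idl (rm.imul (pre ?P) + fker)" by(rule rmod.ops_range_plus[OF rm.osub_imul[OF idl_pre[OF i]] idl_fker])
  have fT: "fker <= rm.imul (pre ?P) + fker" by(rule plus_ge2[OF ops_zero[OF rm.osub_imul[OF idl_pre[OF i]]]])
  have prodT: "x * y : rm.imul (pre ?P) + fker" if x: "x : pre ?P" and y: "y : pre I" for x y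
  proof -
   have "gi (fker Un gm ` {..<m}) <= {y. x * y : rm.imul (pre ?P) + fker}"
   proof (rule gen_least)
    show "idl {y. x * y : rm.imul (pre ?P) + fker}"
     by(rule ops_vimage[OF T]) (auto simp: addm_def distrib_left mult.left_commute intro: idl_mult[OF T])
    show "fker Un gm ` {..<m} <= {y. x * y : rm.imul (pre ?P) + fker}"
    proof
     fix y assume "y : fker Un gm ` {..<m}"
     thus "y : {y. x * y : rm.imul (pre ?P) + fker}"
     proof
      assume "y : fker" thus ?thesis using fT idl_mult[OF idl_fker] by blast
     next
      assume "y : gm ` {..<m}"
      then obtain l where l: "l < m" "y = gm l" by blast
      have "gm l * x : rm.imul (pre ?P)" by(rule rm.sc_imul[OF l(1) idl_pre[OF i] x])
      thus ?thesis using plus_ge1[OF ops_zero[OF idl_fker], of "rm.imul (pre ?P)"] by(auto simp: l(2) mult.commute)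
     qed
    qed
   qed
   thus ?thesis using y gm by blast
  qed
  have "x : feval ` (rm.imul (pre ?P) + fker)" if "x : ideal_prod R ?P I" for x
   using that
  proof (induction rule: ideal_prod.induct)
   case (prod a b)
   hence c: "a : carrier R" "b : carrier R" using ideal.Icarr[OF i] ideal.Icarr[OF I] by blast+
   hence "var a : pre ?P" "var b : pre I" using prod by(simp_all add: pre_def feval_var)
   from imageI[OF prodT[OF this], of feval] show ?case using c by(simp add: feval_mult feval_var)
  next
   case (sum a b)
   then obtain x y where "a = feval x" "b = feval y" "x : rm.imul (pre ?P) + fker" "y : rm.imul (pre ?P) + fker" by blast
   thus ?case using ops_add[OF T] by(auto simp: feval_add[symmetric])
  qed
  hence "pre (ideal_prod R ?P I) <= pre (feval ` (rm.imul (pre ?P) + fker))" by(auto simp: pre_def)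
  also have "... = rm.imul (pre ?P) + fker" by(rule pre_image[OF T fT])
  finally have 1: "pre (I [^]\<^bsub>ideals_set R\<^esub> Suc n) <= rm.imul (pre ?P) + fker" unfolding Suc .
  have i2: "idl (pre (I [^]\<^bsub>ideals_set R\<^esub> Suc n))" by(rule idl_pre[OF i])
  have "rm.imul (pre ?P) <= pre (I [^]\<^bsub>ideals_set R\<^esub> Suc n)"
  proof (rule rm.imul_least[OF i2])
   fix l x assume l: "l < m" and x: "x : pre ?P"
   have "gm l : pre I" unfolding gm using l by(intro subsetD[OF gen_inc]) auto
   hence "feval x \<otimes> feval (gm l) : ideal_prod R ?P I" using x by(intro ideal_prod.prod) (auto simp: pre_def)
   thus "gm l * x : pre (I [^]\<^bsub>ideals_set R\<^esub> Suc n)" unfolding Suc by(simp add: pre_def feval_mult m_comm)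
  qed
  thus ?thesis using 1 plus_least[OF i2 _ fker_sub_pre[OF i]] by blast
 qed
 show "pre (I [^]\<^bsub>ideals_set R\<^esub> n) = rm.IP n UNIV + fker"
 proof (induction n)
  case 0
  have "I [^]\<^bsub>ideals_set R\<^esub> (0::nat) = carrier R" by(simp add: ideals_set_def)
  thus ?case using plus_ge1[OF ops_zero[OF idl_fker], of UNIV] by(auto simp: pre_def)
 next
  case (Suc n)
  have s: "idl (rm.IP (Suc n) UNIV + fker)"
   by(rule rmod.ops_range_plus[OF rm.osub_IP[OF ops_UNIV] idl_fker])
  have f: "fker <= rm.IP (Suc n) UNIV + fker" by(rule plus_ge2[OF ops_zero[OF rm.osub_IP[OF ops_UNIV]]])
  have "rm.imul (rm.IP n UNIV + fker) <= rm.imul (rm.IP n UNIV) + rm.imul fker" by(rule rm.imul_plus)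
  also have "... <= rm.IP (Suc n) UNIV + fker"
   by(rule set_plus_mono2[OF _ rm.imul_osub[OF idl_fker]]) simp
  finally have "rm.imul (rm.IP n UNIV + fker) + fker <= rm.IP (Suc n) UNIV + fker" by(rule plus_least[OF s _ f])
  moreover have "rm.IP (Suc n) UNIV + fker <= rm.imul (rm.IP n UNIV + fker) + fker"
  proof (rule set_plus_mono2[OF _ order_refl])
   show "rm.IP (Suc n) UNIV <= rm.imul (rm.IP n UNIV + fker)"
    using lsum_mono[OF plus_ge1[OF ops_zero[OF idl_fker], of "rm.IP n UNIV"]] by simp
  qed
  ultimately show ?case unfolding sub Suc.IH by blast
 qed
qed

end

section \<open>Ext in terms of vectors\<close>

lemma Vs_induct: "finite B ==> v : Vs B ==> smd S ==> (!!x. x : B ==> ev x : S) ==> v : S"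
 using lin_mem[OF _ lin_id] by blast

context module
begin

lemma quot_facts:
 assumes H: "submodule H R M"
 shows "u : carrier M ==> H +>\<^bsub>M\<^esub> u = H \<longleftrightarrow> u : H"
  "u : carrier M ==> v : carrier M ==> (H +>\<^bsub>M\<^esub> u) \<oplus>\<^bsub>quot_module M H\<^esub> (H +>\<^bsub>M\<^esub> v) = H +>\<^bsub>M\<^esub> (u \<oplus>\<^bsub>M\<^esub> v)"
  "a : carrier R ==> u : carrier M ==> a \<odot>\<^bsub>quot_module M H\<^esub> (H +>\<^bsub>M\<^esub> u) = H +>\<^bsub>M\<^esub> (a \<odot>\<^bsub>M\<^esub> u)"
  "\<zero>\<^bsub>quot_module M H\<^esub> = H" "carrier (quot_module M H) = (%u. H +>\<^bsub>M\<^esub> u) ` carrier M"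
proof -
 note E = submoduleE[OF H]
 interpret S: additive_subgroup H M using H by(intro additive_subgroup.intro) (simp add: submodule_def)
 interpret S: abelian_subgroup H M
  by(rule abelian_subgroupI3) (rule S.additive_subgroup_axioms, rule M.abelian_group_axioms)
 show "\<zero>\<^bsub>quot_module M H\<^esub> = H" "carrier (quot_module M H) = (%u. H +>\<^bsub>M\<^esub> u) ` carrier M"
  by(auto simp: quot_module_def A_RCOSETS_def')
 show "u : carrier M ==> H +>\<^bsub>M\<^esub> u = H \<longleftrightarrow> u : H"
  using S.a_rcos_self[of u] M.a_coset_join2[OF _ S.a_subgroup, of u] by auto
 show "(H +>\<^bsub>M\<^esub> u) \<oplus>\<^bsub>quot_module M H\<^esub> (H +>\<^bsub>M\<^esub> v) = H +>\<^bsub>M\<^esub> (u \<oplus>\<^bsub>M\<^esub> v)"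
  if "u : carrier M" "v : carrier M" using S.a_rcos_sum[OF that] by(simp add: quot_module_def)
 assume a: "a : carrier R" and u: "u : carrier M"
 have "H +>\<^bsub>M\<^esub> (a \<odot>\<^bsub>M\<^esub> x) = H +>\<^bsub>M\<^esub> (a \<odot>\<^bsub>M\<^esub> u)" if x: "x : H +>\<^bsub>M\<^esub> u" for x
 proof -
  obtain h where h: "h : H" "x = h \<oplus>\<^bsub>M\<^esub> u" using x by(auto simp: a_r_coset_def r_coset_def)
  have "a \<odot>\<^bsub>M\<^esub> x = a \<odot>\<^bsub>M\<^esub> h \<oplus>\<^bsub>M\<^esub> a \<odot>\<^bsub>M\<^esub> u" using h a u E(1) by(auto simp: smult_r_distr)
  hence "a \<odot>\<^bsub>M\<^esub> x : H +>\<^bsub>M\<^esub> (a \<odot>\<^bsub>M\<^esub> u)" using E(4)[OF a h(1)] by(auto simp: a_r_coset_def r_coset_def)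
  thus ?thesis using M.a_repr_independence[of "a \<odot>\<^bsub>M\<^esub> x" H "a \<odot>\<^bsub>M\<^esub> u"] a u by(simp add: S.a_subgroup)
 qed
 hence "(\<Union>x\<in>H +>\<^bsub>M\<^esub> u. H +>\<^bsub>M\<^esub> (a \<odot>\<^bsub>M\<^esub> x)) = H +>\<^bsub>M\<^esub> (a \<odot>\<^bsub>M\<^esub> u)"
  using S.a_rcos_self[OF u] by blast
 thus "a \<odot>\<^bsub>quot_module M H\<^esub> (H +>\<^bsub>M\<^esub> u) = H +>\<^bsub>M\<^esub> (a \<odot>\<^bsub>M\<^esub> u)"
  by(simp add: quot_module_def)
qed

lemma quot_eq_iff:
 assumes H: "submodule H R M" and u: "u : carrier M" and v: "v : carrier M"
 shows "H +>\<^bsub>M\<^esub> u = H +>\<^bsub>M\<^esub> v \<longleftrightarrow> u \<ominus>\<^bsub>M\<^esub> v : H"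
proof -
 interpret X: module R "quot_module M H" by(rule quot_module_is_module[OF H])
 note q = quot_facts[OF H]
 have c: "H +>\<^bsub>M\<^esub> w : carrier (quot_module M H)" if "w : carrier M" for w using that by(simp add: q)
 have "u \<ominus>\<^bsub>M\<^esub> v \<oplus>\<^bsub>M\<^esub> v = u" using u v by(simp add: a_minus_def M.a_assoc M.l_neg)
 hence "H +>\<^bsub>M\<^esub> u = (H +>\<^bsub>M\<^esub> (u \<ominus>\<^bsub>M\<^esub> v)) \<oplus>\<^bsub>quot_module M H\<^esub> (H +>\<^bsub>M\<^esub> v)"
  using u v by(simp add: q(2))
 hence "H +>\<^bsub>M\<^esub> u = H +>\<^bsub>M\<^esub> v \<longleftrightarrow> H +>\<^bsub>M\<^esub> (u \<ominus>\<^bsub>M\<^esub> v) = \<zero>\<^bsub>quot_module M H\<^esub>"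
  using c[of "u \<ominus>\<^bsub>M\<^esub> v"] c[OF v] u v by(simp add: X.M.add.r_cancel_one)
 thus ?thesis using q(1,4) u v by simp
qed

lemma ass_quot:
 assumes H: "submodule H R M"
 shows "associated_primes R (quot_module M H) = {P. primeideal P R & (EX x:carrier M. P = {a : carrier R. a \<odot>\<^bsub>M\<^esub> x : H})}"
proof -
 note q = quot_facts[OF H]
 have "{a : carrier R. a \<odot>\<^bsub>quot_module M H\<^esub> (H +>\<^bsub>M\<^esub> x) = \<zero>\<^bsub>quot_module M H\<^esub>} = {a : carrier R. a \<odot>\<^bsub>M\<^esub> x : H}"
  if x: "x : carrier M" for x
  by(rule Collect_cong) (simp add: q(3)[OF _ x] q(4) q(1) x cong: conj_cong)
 thus ?thesis unfolding associated_primes_def q(5) by(simp cong: bex_cong)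
qed

end

context cring
begin

abbreviation FM :: "nat => ('a, nat => 'a) module" where "FM \<equiv> free_module R"

text \<open>\<open>red\<close> evaluates a vector over the free ring and \<open>lft\<close> chooses
  a preimage by variables. The choice is linear only modulo \<open>fker\<close>.\<close>

definition red :: "nat => (nat => 'a fr) => nat => 'a" where "red k v = (\<lambda>j\<in>{..<k}. feval (v j))"
definition lft :: "nat => (nat => 'a) => nat => 'a fr" where "lft k v = (%j. if j < k then var (v j) else 0)"

lemma red_simps: "red k v : carrier (FM k)" "red k (u + v) = red k u \<oplus>\<^bsub>FM k\<^esub> red k v"
 "red k (a *s v) = feval a \<odot>\<^bsub>FM k\<^esub> red k v" "red k 0 = \<zero>\<^bsub>FM k\<^esub>"
 by(auto simp: red_def free_module_simps feval_add feval_mult feval_0 smul_apply)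

lemma lft_Vs: "lft k v : Vs {..<k}"
 by(simp add: lft_def Vs_def)

lemma red_lft: "v : carrier (FM k) ==> red k (lft k v) = v"
 by(auto simp: red_def lft_def free_module_simps feval_var fun_eq_iff PiE_iff extensional_def)

lemma red_eq_iff: "red k u = red k v \<longleftrightarrow> (ALL j<k. u j - v j : fker)"
 by(auto simp: red_def fun_eq_iff feval_eq_iff[symmetric] restrict_def)

lemma red_zero_iff: "u : Vs {..<k} ==> red k u = \<zero>\<^bsub>FM k\<^esub> \<longleftrightarrow> u : JV fker"
proof -
 assume u: "u : Vs {..<k}"
 have "u j : fker" if "~ j < k" for j using u that ops_zero[OF idl_fker] by(simp add: Vs_def)
 hence "(ALL j<k. u j : fker) \<longleftrightarrow> (ALL j. u j : fker)" by blast
 thus ?thesis using red_eq_iff[of k u 0] by(simp add: red_simps(4)[symmetric] JV_def)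
qed

lemma red_hom:
 assumes E: "module R E" and f: "f : mod_hom R (FM k) E"
 shows "f (red k v) : carrier E" "f (red k (u + v)) = f (red k u) \<oplus>\<^bsub>E\<^esub> f (red k v)"
  "f (red k (a *s v)) = feval a \<odot>\<^bsub>E\<^esub> f (red k v)" "f (red k 0) = \<zero>\<^bsub>E\<^esub>" "f (red k (u - v)) = f (red k u) \<ominus>\<^bsub>E\<^esub> f (red k v)"
proof -
 interpret E: module R E by fact
 show c: "f (red k v) : carrier E" for v using f red_simps(1) by(auto simp: mod_hom_def)
 show p: "f (red k (u + v)) = f (red k u) \<oplus>\<^bsub>E\<^esub> f (red k v)" for u v using f red_simps(1) by(simp add: mod_hom_def red_simps(2))
 show s: "f (red k (a *s v)) = feval a \<odot>\<^bsub>E\<^esub> f (red k v)" for a v using f red_simps(1) by(simp add: mod_hom_def red_simps(3))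
 show "f (red k 0) = \<zero>\<^bsub>E\<^esub>" using s[of 0 0] c[of 0] by(simp add: feval_0)
 have "f (red k u) = f (red k (u - v)) \<oplus>\<^bsub>E\<^esub> f (red k v)" using p[of "u - v" v] by simp
 thus "f (red k (u - v)) = f (red k u) \<ominus>\<^bsub>E\<^esub> f (red k v)"
  using c[of v] c[of "u - v"] by(simp add: a_minus_def E.M.a_assoc E.M.r_neg)
qed

lemma smd_hom:
 assumes "module R E" "f : mod_hom R (FM k) E" "submodule S R E"
 shows "smd {v. f (red k v) : S}"
proof -
 interpret E: module R E by fact
 show ?thesis
  by(rule vmod.ops_rangeI)
   (use E.submodule_zero[OF assms(3)] E.submoduleE(4,5)[OF assms(3)] in \<open>auto simp: red_hom[OF assms(1,2)]\<close>)
qed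

lemma hom_eqI:
 assumes E: "module R E" "f : mod_hom R (FM k) E" "f' : mod_hom R (FM k) E"
  and ev: "!!x. x < k ==> f (red k (ev x)) = f' (red k (ev x))" and v: "v : carrier (FM k)"
 shows "f v = f' v"
proof -
 interpret E: module R E by fact
 have "smd {v. f (red k v) = f' (red k v)}"
  by(rule vmod.ops_rangeI) (auto simp: red_hom[OF E(1,2)] red_hom[OF E(1,3)])
 from Vs_induct[OF _ lft_Vs this, of k v] ev have "f (red k (lft k v)) = f' (red k (lft k v))" by auto
 thus ?thesis by(simp add: red_lft[OF v])
qed

end

locale resolution = cring R for R :: "('a, 'k) ring_scheme" (structure) +
 fixes b :: "nat => nat" and d :: "nat => (nat => 'a) => nat => 'a"
 assumes d_hom: "d n : mod_hom R (FM (b (Suc n))) (FM (b n))"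
  and d_exact: "d (Suc n) ` carrier (FM (b (Suc (Suc n)))) = mod_kernel (FM (b (Suc n))) (FM (b n)) (d n)"
begin

lemma FM: "module R (FM k)"
 by(rule free_module_is_module[OF is_cring])

text \<open>The lift of \<open>d n\<close> to the free ring, chosen on basis vectors so as to be
  linear.\<close>

definition dA :: "nat => (nat => 'a fr) => nat => 'a fr" where
 "dA n = ext {..<b (Suc n)} (%x. lft (b n) (d n (red (b (Suc n)) (ev x))))"

lemma dA_lin: "lin (dA n)"
 unfolding dA_def by(rule lin_ext)

lemma dA_Vs: "dA n v : Vs {..<b n}"
 unfolding dA_def ext_def by(intro ops_sum[OF smd_Vs] smd_smul[OF smd_Vs] lft_Vs)

lemma dA_red:
 assumes v: "v : Vs {..<b (Suc n)}" shows "red (b n) (dA n v) = d n (red (b (Suc n)) v)"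
proof -
 interpret F: module R "FM (b n)" by(rule FM)
 note h = red_hom[OF FM d_hom[of n]] and l = lin_simps[OF dA_lin[of n]]
 have "smd {v. red (b n) (dA n v) = d n (red (b (Suc n)) v)}"
  by(rule vmod.ops_rangeI) (simp_all add: h l red_simps(2-4)[where k = "b n"] linD(2)[OF dA_lin])
 moreover have "red (b n) (dA n (ev x)) = d n (red (b (Suc n)) (ev x))" if "x < b (Suc n)" for x
  using that h(1) by(simp add: dA_def ext_ev red_lft)
 ultimately show ?thesis using Vs_induct[OF _ v, of "{v. red (b n) (dA n v) = d n (red (b (Suc n)) v)}"] by auto
qed

lemma cplx_dA: "cplx fker (%n. {..<b n}) dA"
 unfolding cplx_def
proof (intro conjI allI ballI)
 fix n and v :: "nat => 'a fr" assume v: "v : Vs {..<b (Suc (Suc n))}"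
 have "d (Suc n) (red (b (Suc (Suc n))) v) : mod_kernel (FM (b (Suc n))) (FM (b n)) (d n)"
  using d_exact[of n] red_simps(1) by blast
 hence "red (b n) (dA n (dA (Suc n) v)) = \<zero>\<^bsub>FM (b n)\<^esub>" by(simp add: dA_red[OF dA_Vs] dA_red[OF v] mod_kernel_def)
 thus "dA n (dA (Suc n) v) : JV fker" by(simp add: red_zero_iff[OF dA_Vs])
qed (simp_all add: dA_lin dA_Vs)

lemma exact_dA: "exact_at fker (%n. {..<b n}) dA n"
 unfolding exact_at_def
proof (intro ballI impI)
 fix v :: "nat => 'a fr" assume v: "v : Vs {..<b (Suc n)}" "dA n v : JV fker"
 have "d n (red (b (Suc n)) v) = \<zero>\<^bsub>FM (b n)\<^esub>" using v(2) by(simp add: red_zero_iff[OF dA_Vs] dA_red[OF v(1), symmetric])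
 hence "red (b (Suc n)) v : d (Suc n) ` carrier (FM (b (Suc (Suc n))))"
  unfolding d_exact by(simp add: mod_kernel_def red_simps(1))
 then obtain w where w: "w : carrier (FM (b (Suc (Suc n))))" "red (b (Suc n)) v = d (Suc n) w" by blast
 let ?w = "lft (b (Suc (Suc n))) w"
 have "red (b (Suc n)) v = red (b (Suc n)) (dA (Suc n) ?w)" by(simp add: dA_red[OF lft_Vs] red_lft[OF w(1)] w(2))
 hence "red (b (Suc n)) (v - dA (Suc n) ?w) = red (b (Suc n)) 0" unfolding red_eq_iff by(simp add: minus_fun_apply')
 hence "v - dA (Suc n) ?w : JV fker"
  using red_zero_iff[OF ops_diff[OF smd_Vs v(1) dA_Vs]] by(simp add: red_simps(4))
 thus "EX w:Vs {..<b (Suc (Suc n))}. v - dA (Suc n) w : JV fker" using lft_Vs by blast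
qed

end

locale cochains = resolution R b d + N: module R N
 for R :: "('a, 'k) ring_scheme" (structure) and b d and N :: "('a, 'n, 'j) module_scheme" (structure) +
 fixes g :: nat and f :: "(nat => 'a) => 'n" and H :: "'n set"
 assumes f_hom: "f : mod_hom R (FM g) N" and f_surj: "f ` carrier (FM g) = carrier N"
  and H: "submodule H R N"
begin

abbreviation NH where "NH \<equiv> quot_module N H"
abbreviation HM where "HM k \<equiv> Hom_module R (FM (b k)) (quot_module N H)"

lemmas fh = red_hom[OF N.module_axioms f_hom]

definition UH :: "(nat => 'a fr) set" where
 "UH = {w : Vs {..<g} + JV fker. f (red g w) : H}"

definition vl :: "nat => (nat * nat => 'a fr) => (nat => 'a fr) => 'n" where
 "vl k c v = f (red g (ext {..<b k} (row g c) v))"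

text \<open>The homomorphism to the quotient of \<open>N\<close> by \<open>H\<close> described by
  the matrix \<open>c\<close>. Every homomorphism arises in this way (\<open>Fc_surj\<close>), and
  two matrices give the same one exactly when their difference lies in \<open>VU\<close>
  (\<open>Fc_eq_iff\<close>).\<close>

definition Fc :: "nat => (nat * nat => 'a fr) => (nat => 'a) => 'n set" where
 "Fc k c = (\<lambda>v\<in>carrier (FM (b k)). H +>\<^bsub>N\<^esub> vl k c (lft (b k) v))"

lemma ext_c: "ext B (row g (c + c')) v = ext B (row g c) v + ext B (row g c') v"
 "ext B (row g (a *s c)) v = a *s ext B (row g c) v"
 by(simp_all add: ext_def lin_simps(1)[OF lin_row] linD(2)[OF lin_row] vmod.sc_add sum.distrib vmod.sc_sum vmod.sc_commute[of a])

lemma vl_simps: "vl k c v : carrier N" "vl k c (u + v) = vl k c u \<oplus>\<^bsub>N\<^esub> vl k c v" "vl k c (a *s v) = feval a \<odot>\<^bsub>N\<^esub> vl k c v"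
 "vl k (a *s c) v = feval a \<odot>\<^bsub>N\<^esub> vl k c v" "vl k c (u - v) = vl k c u \<ominus>\<^bsub>N\<^esub> vl k c v"
 by(simp_all add: vl_def lin_simps[OF lin_ext] linD(2)[OF lin_ext] fh ext_c)

lemma vl_diff: "vl k (c - c') v = vl k c v \<ominus>\<^bsub>N\<^esub> vl k c' v"
proof -
 have "ext {..<b k} (row g (c - c')) v = ext {..<b k} (row g c) v - ext {..<b k} (row g c') v"
  using ext_c(1)[of "{..<b k}" "c - c'" c' v] by simp
 thus ?thesis by(simp add: vl_def fh(5))
qed

lemma vl_JV: "v : JV fker ==> vl k c v = \<zero>\<^bsub>N\<^esub>"
proof -
 assume "v : JV fker"
 hence "ext {..<b k} (row g c) v : JV fker"
  unfolding ext_def by(intro ops_sum[OF smd_JV[OF idl_fker]] smul_JV[OF idl_fker]) (simp add: JV_def)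
 hence "red g (ext {..<b k} (row g c) v) = red g 0" unfolding red_eq_iff by(simp add: JV_def)
 thus ?thesis unfolding vl_def using fh(4) by simp
qed

lemma vl_ev: "x < b k ==> vl k c (ev x) = f (red g (row g c x))"
 by(simp add: vl_def ext_ev)

lemma lft_red: "v : Vs {..<k} ==> lft k (red k v) - v : JV fker"
proof -
 assume v: "v : Vs {..<k}"
 have "red k (lft k (red k v)) = red k v" by(rule red_lft[OF red_simps(1)])
 hence "ALL j<k. lft k (red k v) j - v j : fker" by(simp only: red_eq_iff)
 hence "lft k (red k v) j - v j : fker" for j
  using v ops_zero[OF idl_fker] by(cases "j < k") (simp_all add: lft_def Vs_def)
 thus ?thesis by(simp add: JV_def minus_fun_apply')
qed

lemma vl_lft: "v : Vs {..<b k} ==> vl k c (lft (b k) (red (b k) v)) = vl k c v"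
proof -
 assume "v : Vs {..<b k}"
 from vl_JV[OF lft_red[OF this]] show ?thesis
  using vl_simps(2)[of k c "lft (b k) (red (b k) v) - v" v] vl_simps(1) by simp
qed

lemma XM: "module R NH"
 by(rule N.quot_module_is_module[OF H])

lemmas q = N.quot_facts[OF H]

lemma Fc_apply: "v : Vs {..<b k} ==> Fc k c (red (b k) v) = H +>\<^bsub>N\<^esub> vl k c v"
 by(simp add: Fc_def red_simps(1) vl_lft)

lemma FM_cases: "v : carrier (FM k) ==> EX u:Vs {..<k}. v = red k u"
 using red_lft lft_Vs by metis

lemma Fc_hom: "Fc k c : carrier (HM k)"
proof -
 have "Fc k c (red (b k) u \<oplus>\<^bsub>FM (b k)\<^esub> red (b k) v) = Fc k c (red (b k) u) \<oplus>\<^bsub>NH\<^esub> Fc k c (red (b k) v)"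
  if "u : Vs {..<b k}" "v : Vs {..<b k}" for u v
  using that ops_add[OF smd_Vs that] by(simp add: red_simps(2)[symmetric] Fc_apply q(2) vl_simps)
 moreover have "Fc k c (feval a \<odot>\<^bsub>FM (b k)\<^esub> red (b k) v) = feval a \<odot>\<^bsub>NH\<^esub> Fc k c (red (b k) v)"
  if "v : Vs {..<b k}" for a v
  using that smd_smul[OF smd_Vs that] by(simp add: red_simps(3)[symmetric] Fc_apply q(3) vl_simps)
 ultimately show ?thesis
  unfolding Hom_module_simps mod_hom_def
  by(auto dest!: FM_cases feval_surj) (auto simp: Fc_apply q(5) vl_simps, simp add: Fc_def)
qed

lemma VU_iff:
 assumes c: "c : Vs (Q b g k)"
 shows "c : VU fker b g k UH \<longleftrightarrow> (ALL v. vl k c v : H)"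
proof -
 have r: "row g c x : Vs {..<g} + JV fker" for x
  using row_Vs plus_ge1[OF ops_zero[OF smd_JV[OF idl_fker]]] by blast
 have "c : VU fker b g k UH \<longleftrightarrow> (ALL x<b k. vl k c (ev x) : H)"
  using c plus_ge1[OF ops_zero[OF smd_JV[OF idl_fker]], of "Vs (Q b g k)"] r
  by(auto simp: VU_def UH_def vl_ev)
 also have "... \<longleftrightarrow> (ALL v. vl k c v : H)"
 proof (intro iffI allI impI)
  fix v assume e: "ALL x<b k. vl k c (ev x) : H"
  have "smd {w. f (red g w) : H}" by(rule smd_hom[OF N.module_axioms f_hom H])
  moreover have "f (red g (row g c x)) : H" if "x < b k" for x using e that by(simp add: vl_ev)
  ultimately have "(SUM x:{..<b k}. v x *s row g c x) : {w. f (red g w) : H}"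
   by(intro ops_sum smd_smul) auto
  thus "vl k c v : H" by(simp add: vl_def ext_def)
 qed blast
 finally show ?thesis .
qed

lemma Fc_eq_iff:
 assumes c: "c : Vs (Q b g k)" "c' : Vs (Q b g k)"
 shows "Fc k c = Fc k c' \<longleftrightarrow> c - c' : VU fker b g k UH"
proof -
 have e: "vl k (c - c') v : H \<longleftrightarrow> H +>\<^bsub>N\<^esub> vl k c v = H +>\<^bsub>N\<^esub> vl k c' v" for v
  using N.quot_eq_iff[OF H vl_simps(1) vl_simps(1)] by(simp add: vl_diff)
 have "Fc k c = Fc k c' \<longleftrightarrow> (ALL v. vl k (c - c') v : H)"
 proof
  assume F: "Fc k c = Fc k c'"
  show "ALL v. vl k (c - c') v : H"
  proof
   fix v :: "nat => 'a fr"
   define u where "u = (%x. if x < b k then v x else 0)"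
   have u: "u : Vs {..<b k}" by(simp add: u_def Vs_def)
   have "vl k c'' v = vl k c'' u" for c'' by(simp add: vl_def ext_def u_def cong: sum.cong_simp)
   thus "vl k (c - c') v : H" using F Fc_apply[OF u] unfolding e by metis
  qed
 next
  assume "ALL v. vl k (c - c') v : H"
  thus "Fc k c = Fc k c'" by(simp add: e Fc_def)
 qed
 thus ?thesis using VU_iff[OF ops_diff[OF smd_Vs c]] by simp
qed

lemma Fc_surj:
 assumes F: "F : carrier (HM k)" shows "EX c:Vs (Q b g k). F = Fc k c"
proof -
 have Fh: "F : mod_hom R (FM (b k)) NH" "F : extensional (carrier (FM (b k)))" using F by(auto simp: Hom_module_simps)
 have "EX w. F (red (b k) (ev x)) = H +>\<^bsub>N\<^esub> f (red g w)" for x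
 proof -
  have "F (red (b k) (ev x)) : carrier NH" by(rule red_hom(1)[OF XM Fh(1)])
  then obtain y where "y : carrier N" "F (red (b k) (ev x)) = H +>\<^bsub>N\<^esub> y" unfolding q(5) by blast
  moreover obtain z where "z : carrier (FM g)" "y = f z" using f_surj \<open>y : carrier N\<close> by blast
  moreover obtain w where "z = red g w" using FM_cases[OF \<open>z : _\<close>] by blast
  ultimately show ?thesis by blast
 qed
 then obtain w where w: "!!x. F (red (b k) (ev x)) = H +>\<^bsub>N\<^esub> f (red g (w x))" by metis
 define c where "c = (%(x, y). if x < b k & y < g then w x y else 0)"
 have c: "c : Vs (Q b g k)" by(auto simp: c_def Vs_def)
 have Fc: "Fc k c : mod_hom R (FM (b k)) NH" "Fc k c : extensional (carrier (FM (b k)))"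
  using Fc_hom[of k c] by(auto simp: Hom_module_simps)
 have "F v = Fc k c v" if v: "v : carrier (FM (b k))" for v
 proof (rule hom_eqI[OF XM Fh(1) Fc(1) _ v])
  fix x assume x: "x < b k"
  have "red g (row g c x) = red g (w x)" using x by(auto simp: red_eq_iff row_def c_def ops_zero[OF idl_fker])
  thus "F (red (b k) (ev x)) = Fc k c (red (b k) (ev x))" using x by(simp add: w Fc_apply ev_Vs vl_ev)
 qed
 hence "F = Fc k c" by(rule extensionalityI[OF Fh(2) Fc(2)])
 thus ?thesis using c by blast
qed

lemma Fc_cobd: "coboundary R b d k (Fc k c) = Fc (Suc k) (dl b dA g k c)"
proof -
 have "Fc k c (d k v) = Fc (Suc k) (dl b dA g k c) v" if v: "v : carrier (FM (b (Suc k)))" for v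
 proof -
  obtain u where u: "u : Vs {..<b (Suc k)}" "v = red (b (Suc k)) u" using FM_cases[OF v] by blast
  have "lin (%v. ext {..<b k} (row g c) (dA k v) - ext {..<b (Suc k)} (row g (dl b dA g k c)) v)"
   by(rule lin_diff[OF lin_comp[OF lin_ext dA_lin] lin_ext])
  hence "ext {..<b k} (row g c) (dA k u) - ext {..<b (Suc k)} (row g (dl b dA g k c)) u : {0}"
  proof (rule lin_mem[OF finite_lessThan _ _ _ u(1)])
   show "smd {0 :: nat => 'a fr}" by(rule ops_0) (auto intro: vmod.sc_addm)
   fix x assume x: "x : {..<b (Suc k)}"
   have "ext {..<b k} (row g c) (dA k (ev x)) = row g (dl b dA g k c) x"
    using x by(auto simp: ext_def row_def dl_def sum_fun_apply smul_apply fun_eq_iff)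
   thus "ext {..<b k} (row g c) (dA k (ev x)) - ext {..<b (Suc k)} (row g (dl b dA g k c)) (ev x) : {0}"
    using x by(simp add: ext_ev)
  qed
  hence "vl k c (dA k u) = vl (Suc k) (dl b dA g k c) u" by(simp add: vl_def)
  thus ?thesis using u by(simp add: dA_red[symmetric] Fc_apply dA_Vs)
 qed
 thus ?thesis
  using Fc_hom[of "Suc k" "dl b dA g k c"]
  by(intro extensionalityI[of _ "carrier (FM (b (Suc k)))"]) (auto simp: coboundary_def Hom_module_simps compose_def)
qed

lemma Fc_smul: "feval a \<odot>\<^bsub>HM k\<^esub> Fc k c = Fc k (a *s c)"
 unfolding Hom_module_simps by(rule HOL.ext) (simp add: Fc_def q(3) vl_simps restrict_def)

lemma Fc_zero: "\<zero>\<^bsub>HM k\<^esub> = Fc k 0"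
proof -
 have "vl k 0 v = \<zero>\<^bsub>N\<^esub>" for v using vl_simps(4)[of k 0 0 v] vl_simps(1)[of k 0 v] by(simp add: feval_0)
 thus ?thesis using q(1)[of "\<zero>\<^bsub>N\<^esub>"] N.submodule_zero[OF H] by(auto simp: Hom_module_simps q(4) Fc_def)
qed

text \<open>Cocycles, coboundaries and annihilators are translated through \<open>Fc\<close>. The
  degree is \<open>Suc k\<close>, where the coboundaries are the image of the preceding
  cochains.\<close>

theorem ass_cohomology:
 assumes res: "free_resolution R E b d \<epsilon>"
 shows "associated_primes R (Hom_cohomology R NH b d (Suc k)) = {P. primeideal P R & extv fker b dA g k UH (pre P)}"
proof -
 note cb = coboundary_hom[OF is_cring XM res] and sub = coboundaries_subset_cocycles[OF is_cring XM res]
 have mH: "module R (HM j)" for j by(intro Hom_module_is_module FM XM)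
 let ?C = "cocycles R NH b d (Suc k)" and ?B = "coboundaries R NH b d (Suc k)"
 interpret HS: module R "HM (Suc k)" by(rule mH)
 have Zs: "submodule ?C R (HM (Suc k))" unfolding cocycles_def by(rule mod_kernel_submodule[OF mH mH cb])
 have Bs: "submodule ?B R (HM (Suc k))" using mod_image_submodule[OF mH mH cb, of k] by simp
 interpret Z: module R "HM (Suc k)\<lparr>carrier := ?C\<rparr>" by(rule submodule.submodule_is_module[OF Zs HS.module_axioms])
 have "module R (HM (Suc k)\<lparr>carrier := ?C\<rparr>\<lparr>carrier := ?B\<rparr>)"
  using submodule.submodule_is_module[OF Bs HS.module_axioms] by simp
 hence BZ: "submodule ?B R (HM (Suc k)\<lparr>carrier := ?C\<rparr>)"
  using sub[of "Suc k"] by(intro Z.module_incl_imp_submodule) simp_all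
 have cyc: "Fc (Suc k) c : ?C \<longleftrightarrow> dl b dA g (Suc k) c : VU fker b g (Suc (Suc k)) UH" for c
  using Fc_eq_iff[OF dl_Vs ops_zero[OF smd_Vs]] Fc_hom
  by(simp add: cocycles_def mod_kernel_def Fc_cobd Fc_zero)
 have bd: "Fc (Suc k) c : ?B \<longleftrightarrow> (EX h:Vs (Q b g k). c - dl b dA g k h : VU fker b g (Suc k) UH)"
  if c: "c : Vs (Q b g (Suc k))" for c
 proof -
  have "carrier (HM k) = Fc k ` Vs (Q b g k)" using Fc_surj[of _ k] Fc_hom[of k] by blast
  hence "?B = (%h. Fc (Suc k) (dl b dA g k h)) ` Vs (Q b g k)" by(simp add: image_image Fc_cobd)
  thus ?thesis using Fc_eq_iff[OF c dl_Vs[of b dA g k]] by(auto simp: image_iff)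
 qed
 have eq: "P = {a : carrier R. a \<odot>\<^bsub>HM (Suc k)\<^esub> Fc (Suc k) c : ?B} \<longleftrightarrow>
   pre P = {a. EX h:Vs (Q b g k). a *s c - dl b dA g k h : VU fker b g (Suc k) UH}"
  if P: "P <= carrier R" and c: "c : Vs (Q b g (Suc k))" for P c
 proof -
  let ?S = "{a : carrier R. a \<odot>\<^bsub>HM (Suc k)\<^esub> Fc (Suc k) c : ?B}"
  have pS: "pre ?S = {a. feval a \<odot>\<^bsub>HM (Suc k)\<^esub> Fc (Suc k) c : ?B}" by(simp add: pre_def del: coboundaries.simps)
  have fS: "feval ` pre ?S = ?S" by(rule image_pre) blast
  have "P = ?S \<longleftrightarrow> pre P = pre ?S"
  proof
   assume "pre P = pre ?S"
   hence "feval ` pre P = feval ` pre ?S" by(rule arg_cong)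
   thus "P = ?S" unfolding fS image_pre[OF P] .
  qed (rule arg_cong)
  hence "P = ?S \<longleftrightarrow> pre P = {a. feval a \<odot>\<^bsub>HM (Suc k)\<^esub> Fc (Suc k) c : ?B}" unfolding pS .
  thus ?thesis unfolding Fc_smul bd[OF smd_smul[OF smd_Vs c]] .
 qed
 have "(EX F:?C. P = {a : carrier R. a \<odot>\<^bsub>HM (Suc k)\<^esub> F : ?B}) \<longleftrightarrow> extv fker b dA g k UH (pre P)"
  if P: "P <= carrier R" for P
 proof -
  have "?C = Fc (Suc k) ` {c : Vs (Q b g (Suc k)). dl b dA g (Suc k) c : VU fker b g (Suc (Suc k)) UH}"
  proof (intro equalityI subsetI)
   fix F assume F: "F : ?C"
   hence "F : carrier (HM (Suc k))" by(simp add: cocycles_def mod_kernel_def)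
   then obtain c where "c : Vs (Q b g (Suc k))" "F = Fc (Suc k) c" using Fc_surj by blast
   thus "F : Fc (Suc k) ` {c : Vs (Q b g (Suc k)). dl b dA g (Suc k) c : VU fker b g (Suc (Suc k)) UH}"
    using F cyc by blast
  qed (use cyc in blast)
  thus ?thesis unfolding extv_def using eq[OF P] by auto
 qed
 moreover have "P <= carrier R" if "primeideal P R" for P using that prm_pre by blast
 ultimately show ?thesis unfolding Hom_cohomology_def Z.ass_quot[OF BZ] by auto
qed

end

text \<open>The preimage of the product of the ideal with the module is that product in the free
  module, plus the kernel of the covering. This isolates the dependence on \<open>n\<close> in
  \<open>ivec\<close>, with a fixed module of relations beside it.\<close>

lemma (in module) UH_ivec:
 fixes gm :: "nat => 'a fr" and n :: nat
 assumes f: "f : mod_hom R (FM g) M" "f ` carrier (FM g) = carrier M"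
  and P: "P <= carrier R" "pre P = (lsum (%l. (*) (gm l)) {..<m} ^^ n) UNIV + fker"
 shows "{w : Vs {..<g} + JV fker. f (red g w) : ideal_smult R P M} =
  ivec gm m n (Vs {..<g}) + {w : Vs {..<g} + JV fker. f (red g w) : {\<zero>\<^bsub>M\<^esub>}}"
proof -
 interpret ya: tmod "smul :: 'a fr => (nat => 'a fr) => nat => 'a fr" "%j v. v" 0 gm m by unfold_locales auto
 let ?H = "ideal_smult R P M" and ?G = "{a \<odot>\<^bsub>M\<^esub> x | a x. a : P & x : carrier M}" and ?V = "ivec gm m n (Vs {..<g})"
 note fh = red_hom[OF module_axioms f(1)]
 have JV: "smd (JV fker :: (nat => 'a fr) set)" by(rule smd_JV[OF idl_fker])
 have VJ: "smd (Vs {..<g} + JV fker)" by(rule vmod.ops_range_plus[OF smd_Vs JV])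
 have V: "smd ?V" unfolding ivec_def by(rule ya.osub_IP[OF smd_Vs])
 have VV: "?V <= Vs {..<g}" unfolding ivec_def by(rule ya.IP_subset[OF smd_Vs])
 have G: "?G <= carrier M" using P(1) by auto
 have H: "submodule ?H R M" unfolding ideal_smult_def by(rule mod_span_submodule[OF G])
 have sH: "smd {w. f (red g w) : ?H}" by(rule smd_hom[OF module_axioms f(1) H])
 have yH: "f (red g y) : ?H" if y: "y : ?V" for y
 proof -
  have "y j : (lsum (%l. (*) (gm l)) {..<m} ^^ n) UNIV" for j
   by(rule lsum_funpow_map[OF _ _ _ y[unfolded ivec_def], where g = "%v. v j"]) (auto simp: addm_def smul_apply)
  hence yP: "feval (y j) : P" for j
   using plus_ge1[OF ops_zero[OF idl_fker]] P(2) by(auto simp: pre_def)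
  have yV: "y : Vs {..<g}" using y VV by blast
  have "(SUM j:{..<g}. y j *s ev j) : {w. f (red g w) : ?H}"
  proof (rule ops_sum[OF sH])
   fix j
   have "feval (y j) \<odot>\<^bsub>M\<^esub> f (red g (ev j)) : ?G" using yP fh(1) by blast
   thus "y j *s ev j : {w. f (red g w) : ?H}" using mod_span_incl[of ?G] by(auto simp: fh ideal_smult_def)
  qed
  thus ?thesis using Vs_expand[OF _ yV] by simp
 qed
 have "submodule ((%y. f (red g y)) ` ?V) R M"
 proof (rule submoduleI)
  show "(%y. f (red g y)) ` ?V <= carrier M" using fh(1) by blast
  show "\<zero>\<^bsub>M\<^esub> : (%y. f (red g y)) ` ?V" using fh(4)[symmetric] ops_zero[OF V] by blast
  fix u assume "u : (%y. f (red g y)) ` ?V"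
  then obtain y where y: "u = f (red g y)" "y : ?V" by blast
  show "a \<odot>\<^bsub>M\<^esub> u : (%y. f (red g y)) ` ?V" if "a : carrier R" for a
   using feval_surj[OF that] smd_smul[OF V y(2)] fh(3) y(1) by(metis image_eqI)
  from this[of "\<ominus> \<one>"] show "\<ominus>\<^bsub>M\<^esub> u : (%y. f (red g y)) ` ?V" using fh(1) y(1) by(simp add: smult_l_minus)
  fix v assume "v : (%y. f (red g y)) ` ?V"
  thus "u \<oplus>\<^bsub>M\<^esub> v : (%y. f (red g y)) ` ?V" using y ops_add[OF V] fh(2)[symmetric] by auto
 qed
 moreover have "?G <= (%y. f (red g y)) ` ?V"
 proof clarify
  fix a x assume a: "a : P" and x: "x : carrier M"
  obtain z where z: "z : carrier (FM g)" "x = f z" using x f(2) by blast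
  have "var a : pre P" using a P(1) by(auto simp: pre_def feval_var)
  then obtain a1 j where aj: "var a = a1 + j" "a1 : (lsum (%l. (*) (gm l)) {..<m} ^^ n) UNIV" "j : fker"
   unfolding P(2) by(rule set_plus_elim)
  have "a : carrier R" using a P(1) by blast
  moreover have "feval (var a) = feval a1" using aj(1,3) unfolding feval_eq_iff by simp
  ultimately have "feval a1 = a" by(simp add: feval_var)
  moreover have "a1 *s lft g z : ?V"
   unfolding ivec_def by(rule lsum_funpow_map[OF _ _ _ aj(2), where g = "%e. e *s lft g z"])
    (auto simp: addm_def vmod.sc_plus vmod.sc_sc intro: smd_smul[OF smd_Vs lft_Vs])
  ultimately show "a \<odot>\<^bsub>M\<^esub> x : (%y. f (red g y)) ` ?V"
   using fh(3)[of a1 "lft g z"] by(intro image_eqI[of _ _ "a1 *s lft g z"]) (simp_all add: red_lft[OF z(1)] z(2))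
 qed
 ultimately have HV: "?H <= (%y. f (red g y)) ` ?V" unfolding ideal_smult_def by(rule mod_span_min)
 have VinVJ: "?V <= Vs {..<g} + JV fker" using VV plus_ge1[OF ops_zero[OF JV]] by blast
 show ?thesis
 proof (intro equalityI subsetI)
  fix w assume "w : {w : Vs {..<g} + JV fker. f (red g w) : ?H}"
  hence w: "w : Vs {..<g} + JV fker" "f (red g w) : ?H" by auto
  then obtain y where y: "y : ?V" "f (red g w) = f (red g y)" using HV by blast
  have "w - y : {w : Vs {..<g} + JV fker. f (red g w) : {\<zero>\<^bsub>M\<^esub>}}"
   using ops_diff[OF VJ w(1)] y VinVJ fh(1) by(auto simp: fh(5) a_minus_def M.r_neg)
  thus "w : ?V + {w : Vs {..<g} + JV fker. f (red g w) : {\<zero>\<^bsub>M\<^esub>}}" by(rule set_plusI[OF _ y(1), rotated]) simp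
 next
  fix w assume "w : ?V + {w : Vs {..<g} + JV fker. f (red g w) : {\<zero>\<^bsub>M\<^esub>}}"
  then obtain y r where yr: "w = y + r" "y : ?V" "r : {w : Vs {..<g} + JV fker. f (red g w) : {\<zero>\<^bsub>M\<^esub>}}" by(rule set_plus_elim)
  hence "y + r : Vs {..<g} + JV fker" using ops_add[OF VJ] VinVJ by blast
  moreover have "f (red g (y + r)) = f (red g y)" using yr(3) fh(1) by(simp add: fh(2))
  ultimately show "w : {w : Vs {..<g} + JV fker. f (red g w) : ?H}" using yH[OF yr(2)] by(simp add: yr(1))
 qed
qed

section \<open>Regular local rings and completions\<close>

context cring
begin

text \<open>The dimension provides a chain of primes at least as long as the number \<open>D\<close>
  of minimal generators; its upper part is made to end at the maximal ideal, as
  \<open>regular_imp_regp\<close> requires.\<close>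

lemma regular_regp:
 assumes "regular_local_ring R \<nn>"
 shows "EX xs. lcl fker (pre \<nn>) & pre \<nn> = gi (fker Un set xs) & regp fker xs"
proof -
 have N: "noetherian_ring R" and max: "maximalideal \<nn> R" and loc: "!!J. maximalideal J R ==> J = \<nn>"
  and dim: "krull_dim R = enat (min_generators R \<nn>)"
  using assms by(auto simp: regular_local_ring_def noetherian_local_ring_def)
 interpret M: maximalideal \<nn> R by(rule max)
 have lc: "lcl fker (pre \<nn>)" by(rule lcl_pre[OF N max loc])
 define D where "D = min_generators R \<nn>"
 let ?P = "%k. EX S. S <= carrier R & finite S & card S = k & genideal R S = \<nn>"
 have "EX k. ?P k" using noetherian_ring.finetely_gen[OF N M.is_ideal] by metis
 hence "?P D" unfolding D_def min_generators_def by(rule LeastI_ex)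
 then obtain S where S: "S <= carrier R" "finite S" "card S = D" "genideal R S = \<nn>" by blast
 obtain ys where ys: "set ys = S" "distinct ys" using finite_distinct_list[OF S(2)] by blast
 define xs where "xs = map var ys"
 have len: "length xs = D" using ys S(3) distinct_card by(fastforce simp: xs_def)
 have "feval ` set xs = S" using S(1) ys(1) by(force simp: xs_def feval_var)
 hence gen: "pre \<nn> = gi (fker Un set xs)" using pre_genideal[OF S(1)] S(4) by simp
 let ?ch = "%n P. (ALL i<=n. primeideal (P i) R) & (ALL i<n. P i \<subset> P (Suc i))"
 \<comment> \<open>If all chains were shorter than \<open>D\<close>, their supremum would be too;
   for \<open>D = 0\<close> the maximal ideal alone is a chain.\<close>
 have "EX n>=D. EX P. ?ch n P"
 proof (cases D)
  case 0
  have "?ch 0 (%_. \<nn>)" using maximalideal_prime[OF max] by simp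
  thus ?thesis using 0 by(intro exI[of _ 0]) auto
 next
  case (Suc D')
  show ?thesis
  proof (rule ccontr)
   assume no: "~ (EX n>=D. EX P. ?ch n P)"
   have "krull_dim R <= enat D'"
    unfolding krull_dim_def
   proof (rule Sup_least)
    fix x assume "x : {enat n |n. EX P. ?ch n P}"
    then obtain n P where "x = enat n" "?ch n P" by blast
    thus "x <= enat D'"
     using no Suc by(metis enat_ord_simps(1) not_less_eq_eq)
   qed
   thus False using dim Suc by(simp add: D_def)
  qed
 qed
 then obtain n P where n: "n >= D" and P: "!!i. i <= n ==> primeideal (P i) R" "!!i. i < n ==> P i \<subset> P (Suc i)" by blast
 have pp: "prm (pre (P i))" "fker <= pre (P i)" "P i <= carrier R" if "i <= n" for i
  using P(1)[OF that] prm_pre by blast+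
 have strict: "pre (P i) \<subset> pre (P (Suc i))" if "i < n" for i
 proof
  show "pre (P i) <= pre (P (Suc i))" using P(2)[OF that] by(auto simp: pre_def)
  show "pre (P i) \<noteq> pre (P (Suc i))"
   using P(2)[OF that] image_pre[OF pp(3)[of i]] image_pre[OF pp(3)[of "Suc i"]] that by(metis Suc_leI less_imp_le psubset_eq)
 qed
 have top: "pre (P n) <= pre \<nn>"
 proof (rule ccontr)
  assume "~ pre (P n) <= pre \<nn>"
  then obtain a where a: "a : pre (P n)" "a ~: pre \<nn>" by blast
  then obtain e where "a * e - 1 : fker" using lc unfolding lcl_def by blast
  hence "a * e - 1 : pre (P n)" using pp(2) by blast
  thus False
   using ops_cong[OF prmD(1)[OF pp(1)]] idl_mult_right[OF prmD(1)[OF pp(1)] a(1)] prmD(2)[OF pp(1)] by blast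
 qed
 \<comment> \<open>The last \<open>D\<close> steps of the chain, with the top prime enlarged to the
   maximal ideal; enlarging the top keeps the last inclusion strict.\<close>
 define C where "C i = (if i < D then pre (P (n - D + i)) else pre \<nn>)" for i
 have "pchain fker (length xs) C"
  unfolding pchain_def len
 proof (intro conjI allI impI)
  fix i assume i: "i <= D"
  show "prm (C i)" using pp(1) lcl_prm[OF lc] i n by(auto simp: C_def)
  show "fker <= C i" using pp(2) fker_sub_pre[OF M.is_ideal] i n by(auto simp: C_def)
 next
  fix i assume i: "i < D"
  have "pre (P (n - D + i)) \<subset> pre (P (Suc (n - D + i)))" using i n by(intro strict) simp
  moreover have "pre (P (Suc (n - D + i))) <= C (Suc i)"
  proof (cases "Suc i < D")
   case False
   hence "Suc (n - D + i) = n" "C (Suc i) = pre \<nn>" using i n by(simp_all add: C_def)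
   thus ?thesis using top by(simp only:)
  qed (simp add: C_def)
  ultimately show "C i \<subset> C (Suc i)" using i by(simp add: C_def psubset_subset_trans)
 qed
 moreover have "C (length xs) = pre \<nn>" by(simp add: C_def len)
 ultimately have "regp fker xs" by(rule regular_imp_regp[OF rnoeth_fker[OF N] idl_fker lc gen])
 thus ?thesis using lc gen by blast
qed

lemma regular_sequence_pre:
 assumes "regular_sequence R fs"
 defines "JJ \<equiv> %j. pre (genideal R (set (take j fs)))"
 shows "idl (JJ j)" "j < length fs ==> JJ (Suc j) = gi (insert (var (fs ! j)) (JJ j))" "JJ 0 = fker"
  "j < length fs ==> var (fs ! j) * a : JJ j ==> a : JJ j"
proof -
 have fs: "set fs <= carrier R" using assms(1) by(simp add: regular_sequence_def)
 have tk: "set (take j fs) <= carrier R" for j using set_take_subset fs by(rule subset_trans)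
 have "feval (var a) = a" if "a : set (take j fs)" for a j using subsetD[OF tk that] by(rule feval_var(1))
 hence img: "feval ` var ` set (take j fs) = set (take j fs)" for j
  unfolding image_image by(metis (no_types, lifting) image_cong image_ident)
 have e: "JJ j = gi (fker Un var ` set (take j fs))" for j
  unfolding JJ_def by(rule pre_genideal[OF tk img])
 show "idl (JJ j)" unfolding e by(rule idl_gi)
 show "JJ 0 = fker" unfolding e using gen_opsub[OF idl_fker] by simp
 show "JJ (Suc j) = gi (insert (var (fs ! j)) (JJ j))" if "j < length fs"
 proof
  have s: "var ` set (take (Suc j) fs) = insert (var (fs ! j)) (var ` set (take j fs))"
   using that by(simp add: take_Suc_conv_app_nth)
  have "fker Un var ` set (take j fs) <= JJ j" unfolding e by(rule gen_inc)
  moreover have "insert (var (fs ! j)) (JJ j) <= gi (insert (var (fs ! j)) (JJ j))" by(rule gen_inc)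
  ultimately show "JJ (Suc j) <= gi (insert (var (fs ! j)) (JJ j))"
   unfolding e[of "Suc j"] s by(intro gen_least[OF idl_gi]) blast
  have "fker Un var ` set (take (Suc j) fs) <= JJ (Suc j)" unfolding e by(rule gen_inc)
  moreover have "JJ j <= JJ (Suc j)" unfolding e s by(rule gen_mono) blast
  ultimately show "gi (insert (var (fs ! j)) (JJ j)) <= JJ (Suc j)"
   unfolding s by(intro gen_least[OF idl_gi[of "fker Un var ` set (take (Suc j) fs)", folded e]]) auto
 qed
 show "a : JJ j" if "j < length fs" "var (fs ! j) * a : JJ j"
 proof -
  have "feval (var (fs ! j) * a) = fs ! j \<otimes> feval a" using fs that(1) by(auto simp: feval_mult feval_var subset_iff)
  thus ?thesis using assms(1) that unfolding regular_sequence_def JJ_def pre_def by auto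
 qed
qed

lemma carrier_Quot: "carrier (R Quot I) = range (%a. I +> feval a)"
proof -
 have "carrier (R Quot I) = (%a. I +> a) ` carrier R" by(auto simp: FactRing_def A_RCOSETS_def')
 also have "carrier R = range feval" using feval_surj by auto
 finally show ?thesis by(simp add: image_image)
qed

end

text \<open>The isomorphism identifies the completion, made of coherent sequences of cosets, with a
  quotient of the free ring on \<open>Q\<close>. The map \<open>io\<close> is chosen on variables
  and extended by freeness, so that it respects the operations whatever the choice.\<close>

lemma completion_map_exists:
 fixes A :: "('a, 'k) ring_scheme" and Q :: "('q, 'l) ring_scheme"
 assumes A: "cring A" "ideal \<mm> A" "rnoeth (cring.fker A)" "lcl (cring.fker A) (cring.pre A \<mm>)"
  "cring.pre A \<mm> = gi (cring.fker A Un \<mu> ` {..<s})"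
  and Q: "cring Q" "ideal K Q" and h: "h : ring_iso (completion A \<mm>) (Q Quot K)"
 shows "EX io KK. completion_map io (cring.fker A) (cring.pre A \<mm>) \<mu> s (cring.pre Q K) KK"
proof -
 interpret A: cring A by fact
 interpret Q: cring Q by fact
 interpret K: ideal K Q by fact
 interpret rm: tmod "(*) :: 'a fr => 'a fr => 'a fr" "%j v. v" 0 \<mu> s by unfold_locales auto
 let ?C = "completion A \<mm>"
 define p where "p n = ideal_pow A \<mm> n" for n
 define MA where "MA n = A.pre (p n)" for n
 have p: "ideal (p n) A" "MA n = rm.IP n UNIV + A.fker" for n
  unfolding MA_def p_def by(rule A.pre_pow[OF A(2,5)])+
 have MA: "idl (MA n)" for n unfolding MA_def by(rule A.idl_pre[OF p(1)])
 have MAS: "MA (Suc n) <= MA n" for n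
  unfolding p(2) by(rule set_plus_mono2[OF rm.IP_decr[OF ops_UNIV] order_refl]) simp
 have pS: "p (Suc n) <= p n" for n
 proof -
  have "p k <= carrier A" for k by(rule additive_subgroup.a_subset[OF ideal.axioms(1)[OF p(1)]])
  thus ?thesis using image_mono[OF MAS[of n], of A.feval] by(simp add: MA_def A.image_pre)
 qed
 \<comment> \<open>Coherent sequences of representatives; \<open>cl\<close> below gives the element
   of the completion they define.\<close>
 define ok where "ok a \<longleftrightarrow> (ALL n. a (Suc n) - a n : MA n)" for a
 define cl where "cl a = (%n. p n +>\<^bsub>A\<^esub> A.feval (a n))" for a
 have co: "p n +>\<^bsub>A\<^esub> A.feval a = p n +>\<^bsub>A\<^esub> A.feval b \<longleftrightarrow> a - b : MA n" for a b n
  using A.quotient_eq_iff_same_a_r_cos[OF p(1), of "A.feval a" "A.feval b" n]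
  by(simp add: MA_def A.pre_def A.feval_diff)
 have absorb: "p n <+>\<^bsub>A\<^esub> (p (Suc n) +>\<^bsub>A\<^esub> a) = p n +>\<^bsub>A\<^esub> a" if a: "a : carrier A" for n a
 proof -
  interpret I: ideal "p n" A by(rule p(1))
  interpret I': ideal "p (Suc n)" A by(rule p(1))
  show ?thesis
  proof (intro equalityI subsetI)
   fix x assume "x : p n <+>\<^bsub>A\<^esub> (p (Suc n) +>\<^bsub>A\<^esub> a)"
   then obtain u v where "u : p n" "v : p (Suc n)" "x = u \<oplus>\<^bsub>A\<^esub> (v \<oplus>\<^bsub>A\<^esub> a)"
    by(auto simp: set_add_def' a_r_coset_def')
   thus "x : p n +>\<^bsub>A\<^esub> a"
    using pS a I.Icarr I'.Icarr I.a_closed by(auto simp: a_r_coset_def' A.a_assoc[symmetric] intro!: bexI[of _ "u \<oplus>\<^bsub>A\<^esub> v"])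
  next
   fix x assume "x : p n +>\<^bsub>A\<^esub> a"
   then obtain u where u: "u : p n" "x = u \<oplus>\<^bsub>A\<^esub> a" by(auto simp: a_r_coset_def')
   have "a : p (Suc n) +>\<^bsub>A\<^esub> a" using I'.zero_closed a by(force simp: a_r_coset_def')
   thus "x : p n <+>\<^bsub>A\<^esub> (p (Suc n) +>\<^bsub>A\<^esub> a)" using u unfolding set_add_def' by blast
  qed
 qed
 have Ccar: "carrier ?C = {x. ALL n. x n : carrier (A Quot p n) & p n <+>\<^bsub>A\<^esub> x (Suc n) = x n}"
  by(simp add: completion_def p_def)
 have Qc: "carrier (A Quot p n) = range (%a. p n +>\<^bsub>A\<^esub> A.feval a)" for n
  by(rule A.carrier_Quot)
 have cl_C: "cl a : carrier ?C" if "ok a" for a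
  using that by(auto simp: Ccar cl_def Qc absorb co ok_def)
 have cl_surj: "EX a. ok a & y = cl a" if y: "y : carrier ?C" for y
 proof -
  have "ALL n. EX a. y n = p n +>\<^bsub>A\<^esub> A.feval a" using y unfolding Ccar Qc by blast
  then obtain a where a: "!!n. y n = p n +>\<^bsub>A\<^esub> A.feval (a n)" by metis
  have "p n <+>\<^bsub>A\<^esub> y (Suc n) = y n" for n using y unfolding Ccar by blast
  hence "ok a" unfolding ok_def by(simp add: a absorb co)
  thus ?thesis using a by(auto simp: cl_def)
 qed
 have cl_eq: "cl a = cl b \<longleftrightarrow> (ALL n. a n - b n : MA n)" for a b by(auto simp: cl_def fun_eq_iff co)
 have cl_add: "cl a \<oplus>\<^bsub>?C\<^esub> cl b = cl (%n. a n + b n)" for a b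
  by(auto simp: completion_def cl_def FactRing_def p_def[symmetric] A.feval_add ideal.a_rcos_sum[OF p(1)])
 have cl_mult: "cl a \<otimes>\<^bsub>?C\<^esub> cl b = cl (%n. a n * b n)" for a b
  by(auto simp: completion_def cl_def FactRing_def p_def[symmetric] A.feval_mult ideal.rcoset_mult_add[OF p(1)])
 have cl_one: "\<one>\<^bsub>?C\<^esub> = cl (%n. 1)"
  by(auto simp: completion_def cl_def FactRing_def p_def[symmetric] A.feval_1)
 have ok_add: "ok (%n. a n + b n)" if "ok a" "ok b" for a b
  unfolding ok_def
 proof
  fix n show "a (Suc n) + b (Suc n) - (a n + b n) : MA n"
   using that ops_add[OF MA, of "a (Suc n) - a n" n "b (Suc n) - b n"] by(simp add: ok_def algebra_simps)
 qed
 have ok_mult: "ok (%n. a n * b n)" if "ok a" "ok b" for a b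
  unfolding ok_def
 proof
  fix n
  have "a (Suc n) * (b (Suc n) - b n) + (a (Suc n) - a n) * b n : MA n"
   using that by(intro ops_add[OF MA] idl_mult[OF MA] idl_mult_right[OF MA]) (auto simp: ok_def)
  thus "a (Suc n) * b (Suc n) - a n * b n : MA n" by(simp add: algebra_simps)
 qed
 have ok_const: "ok (%n. x)" for x using ops_zero[OF MA] by(simp add: ok_def)
 note hm = ring_iso_memE[OF h]
 \<comment> \<open>\<open>rl x a\<close> says that \<open>x\<close>, on the side of
   \<open>Q\<close>, and the sequence \<open>a\<close> represent the same element of the completion.
   All structure is transported along this relation, which is total in both directions.\<close>
 define rl where "rl x a \<longleftrightarrow> ok a & K +>\<^bsub>Q\<^esub> Q.feval x = h (cl a)" for x a
 have D: "carrier (Q Quot K) = range (%x. K +>\<^bsub>Q\<^esub> Q.feval x)" by(rule Q.carrier_Quot)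
 have bij: "bij_betw h (carrier ?C) (carrier (Q Quot K))" by(rule hm(5))
 have rl1: "EX a. rl x a" for x
 proof -
  have "K +>\<^bsub>Q\<^esub> Q.feval x : h ` carrier ?C" using bij_betw_imp_surj_on[OF bij] D by blast
  thus ?thesis using cl_surj unfolding rl_def by blast
 qed
 have rl2: "EX x. rl x a" if "ok a" for a
 proof -
  have "h (cl a) : carrier (Q Quot K)" using hm(1)[OF cl_C[OF that]] .
  thus ?thesis using that unfolding D rl_def by auto
 qed
 have rl_add: "rl (x + y) (%n. a n + b n)" if "rl x a" "rl y b" for x y a b
 proof -
  have "h (cl (%n. a n + b n)) = h (cl a) <+>\<^bsub>Q\<^esub> h (cl b)"
   using hm(3)[OF cl_C cl_C, of a b] that by(simp add: rl_def cl_add FactRing_def)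
  thus ?thesis using that ok_add by(simp add: rl_def Q.feval_add K.a_rcos_sum[symmetric])
 qed
 have rl_mult: "rl (x * y) (%n. a n * b n)" if "rl x a" "rl y b" for x y a b
 proof -
  have "h (cl (%n. a n * b n)) = rcoset_mult Q K (h (cl a)) (h (cl b))"
   using hm(2)[OF cl_C cl_C, of a b] that by(simp add: rl_def cl_mult FactRing_def)
  thus ?thesis using that ok_mult by(simp add: rl_def Q.feval_mult K.rcoset_mult_add[symmetric])
 qed
 have rl_one: "rl 1 (%n. 1)" using hm(4) ok_const by(simp add: rl_def cl_one FactRing_def Q.feval_1)
 have rl_uniq: "a n - b n : MA n" if "rl x a" "rl x b" for x a b n
 proof -
  have "cl a = cl b" using that bij_betw_imp_inj_on[OF bij] cl_C by(auto simp: rl_def inj_on_def)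
  thus ?thesis unfolding cl_eq by blast
 qed
 have rl_cong: "rl x b" if "rl x a" "ok b" "!!n. a n - b n : MA n" for x a b
 proof -
  have "cl a = cl b" using that(3) unfolding cl_eq by blast
  thus ?thesis using that by(simp add: rl_def)
 qed
 have rl_zero: "rl 0 (%n. 0)"
 proof -
  obtain a where a: "rl 0 a" using rl1 by blast
  from rl_uniq[OF rl_add[OF a a, simplified] a] have "a n - 0 : MA n" for n by simp
  thus ?thesis using rl_cong[OF a ok_const] by blast
 qed
 have rl_neg: "rl (- x) (%n. - a n)" if a: "rl x a" for x a
 proof -
  obtain e where e: "rl (- x) e" using rl1 by blast
  from rl_uniq[OF rl_add[OF e a, simplified] rl_zero] have "e n - - a n : MA n" for n by simp
  moreover have "ok (%n. - a n)" using a ops_minus[OF MA] unfolding rl_def ok_def by fastforce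
  ultimately show ?thesis using rl_cong[OF e] by blast
 qed
 have "ALL a. EX x. rl x (%n. var a)" using rl2[OF ok_const] by blast
 from choice[OF this] obtain io0 where io0: "ALL a. rl (io0 a) (%n. var a)" ..
 define io where "io = subst io0"
 have io: "rl (io x) (%n. x)" for x
  by(induction x rule: fr_induct) (use io0 rl_zero rl_one rl_neg rl_add rl_mult in \<open>auto simp: io_def subst_simps\<close>)
 \<comment> \<open>The kernel of the projection to the \<open>n\<close>-th quotient; by
   \<open>rl_uniq\<close> any sequence representing \<open>x\<close> decides membership.\<close>
 define KK where "KK n = {x. EX a. rl x a & a n : MA n}" for n
 have KK: "x : KK n \<longleftrightarrow> a n : MA n" if "rl x a" for x a n
  using that rl_uniq[OF that] ops_cong[OF MA] unfolding KK_def by blast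
 have rl_diff: "rl (x - y) (%n. a n - b n)" if "rl x a" "rl y b" for x y a b
  using rl_add[OF that(1) rl_neg[OF that(2)]] by simp
 have "completion_map io A.fker (A.pre \<mm>) \<mu> s (Q.pre K) KK"
 proof unfold_locales
  show "io (a + b) = io a + io b" "io (a * b) = io a * io b" "io 1 = 1" for a b by(simp_all add: io_def subst_simps)
  show "\<mu> ` {..<s} <= A.pre \<mm>" unfolding A(5) using gen_inc[of "A.fker Un \<mu> ` {..<s}" "range (*)"] by auto
  show "idl (KK n)" for n
  proof (rule rmod.ops_rangeI)
   show "0 : KK n" using KK[OF rl_zero] ops_zero[OF MA] by simp
   show "x + y : KK n" if "x : KK n" "y : KK n" for x y
    using that rl_add ops_add[OF MA] unfolding KK_def by blast
   show "c * x : KK n" if "x : KK n" for c x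
    using that rl1[of c] rl_mult idl_mult[OF MA] unfolding KK_def by blast
  qed
  show "KK (Suc n) <= KK n" for n
  proof
   fix x assume "x : KK (Suc n)"
   then obtain a where a: "rl x a" "a (Suc n) : MA (Suc n)" unfolding KK_def by blast
   hence "a (Suc n) : MA n" "a (Suc n) - a n : MA n" using MAS by(auto simp: rl_def ok_def)
   thus "x : KK n" using ops_cong[OF MA] KK[OF a(1)] by blast
  qed
  show "(\<Inter>n. KK n) = Q.pre K"
  proof (intro equalityI subsetI)
   fix x assume x: "x : (\<Inter>n. KK n)"
   obtain a where a: "rl x a" using rl1 by blast
   have "a n - 0 : MA n" for n using x KK[OF a] by auto
   hence "rl x (%n. 0)" using rl_cong[OF a ok_const] by blast
   hence "K +>\<^bsub>Q\<^esub> Q.feval x = K +>\<^bsub>Q\<^esub> Q.feval 0" using rl_zero by(simp add: rl_def)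
   thus "x : Q.pre K" using Q.quotient_eq_iff_same_a_r_cos[OF Q(2), of "Q.feval x" "Q.feval 0"]
    by(simp add: Q.pre_def Q.feval_diff[symmetric])
  next
   fix x assume "x : Q.pre K"
   hence "K +>\<^bsub>Q\<^esub> Q.feval x = K +>\<^bsub>Q\<^esub> Q.feval 0"
    using Q.quotient_eq_iff_same_a_r_cos[OF Q(2), of "Q.feval x" "Q.feval 0"] by(simp add: Q.pre_def Q.feval_diff[symmetric])
   hence "rl x (%n. 0)" using rl_zero by(simp add: rl_def)
   thus "x : (\<Inter>n. KK n)" using KK ops_zero[OF MA] by auto
  qed
  show "io a : KK n \<longleftrightarrow> a : rm.IP n UNIV + A.fker" for a n using KK[OF io] by(simp add: p(2))
  show "EX a. x - io a : KK n" for x n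
  proof -
   obtain a where a: "rl x a" using rl1 by blast
   show ?thesis using KK[OF rl_diff[OF a io[of "a n"]], of n] ops_zero[OF MA] by auto
  qed
  show "EX x. ALL n. x - io (sq n) : KK n" if sq: "!!n. io (sq (Suc n) - sq n) : KK n" for sq
  proof -
   have "ok sq" using sq KK[OF io] unfolding ok_def by blast
   then obtain x where x: "rl x sq" using rl2 by blast
   have "x - io (sq n) : KK n" for n using KK[OF rl_diff[OF x io[of "sq n"]], of n] ops_zero[OF MA] by simp
   thus ?thesis by blast
  qed
 qed (rule A.idl_fker A(3,4))+
 thus ?thesis by blast
qed

lemma (in cring) pre_finitely_generated:
 assumes "noetherian_ring R" "ideal I R"
 shows "EX gm (m::nat). pre I = gi (fker Un gm ` {..<m})"
proof -
 obtain S where S: "S <= carrier R" "finite S" "I = genideal R S"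
  using noetherian_ring.finetely_gen[OF assms] by metis
 obtain ys where ys: "set ys = S" using finite_list[OF S(2)] by blast
 have im: "(%j. var (ys ! j)) ` {..<length ys} = var ` S"
  unfolding ys[symmetric] set_conv_nth by blast
 have "feval (var a) = a" if "a : S" for a using that S(1) by(intro feval_var(1)) blast
 hence "feval ` var ` S = S" by(simp add: image_image)
 hence "pre I = gi (fker Un (%j. var (ys ! j)) ` {..<length ys})"
  unfolding S(3) im by(rule pre_genideal[OF S(1)])
 thus ?thesis by blast
qed

text \<open>With the additional \<open>Suc\<close>, which stems from the shift between
  \<open>extv\<close> and the degree of Ext, the offset \<open>2 * e + 1\<close> reaches the even
  degrees and \<open>2 * e\<close> the odd ones.\<close>

lemma parity_stable:
 fixes F :: "nat => nat => 'x"
 assumes "EX n0 i0. ALL n>=n0. ALL i>=i0. F (Suc (2 * i + (2 * e + 1))) n = F (Suc (2 * i0 + (2 * e + 1))) n0"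
  and "EX n0 i0. ALL n>=n0. ALL i>=i0. F (Suc (2 * i + 2 * e)) n = F (Suc (2 * i0 + 2 * e)) n0"
 shows "EX n0 i0. ALL n>=n0. ALL i>=i0. F (2 * i) n = F (2 * i0) n0 & F (2 * i + 1) n = F (2 * i0 + 1) n0"
proof -
 obtain n1 i1 where 1: "!!n i. n >= n1 ==> i >= i1 ==> F (Suc (2 * i + (2 * e + 1))) n = F (Suc (2 * i1 + (2 * e + 1))) n1"
  using assms(1) by blast
 obtain n2 i2 where 2: "!!n i. n >= n2 ==> i >= i2 ==> F (Suc (2 * i + 2 * e)) n = F (Suc (2 * i2 + 2 * e)) n2"
  using assms(2) by blast
 have *: "F (2 * i) n = F (Suc (2 * i1 + (2 * e + 1))) n1 & F (2 * i + 1) n = F (Suc (2 * i2 + 2 * e)) n2"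
  if "n >= n1 + n2" "i >= i1 + i2 + e + 1" for n i
 proof -
  have "Suc (2 * (i - e - 1) + (2 * e + 1)) = 2 * i" "Suc (2 * (i - e) + 2 * e) = 2 * i + 1"
   using that by auto
  thus ?thesis using 1[of n "i - e - 1"] 2[of n "i - e"] that by simp
 qed
 thus ?thesis by(intro exI[of _ "n1 + n2"] exI[of _ "i1 + i2 + e + 1"] allI impI) (simp only: *)
qed

text \<open>The resolution fixed in \<open>Ext\<close> depends on \<open>M\<close> alone, so one
  choice serves all coefficient modules and all degrees.\<close>

lemma Ext_Hom_cohomology:
 fixes A :: "('a, 'k) ring_scheme"
 assumes "cring A" "noetherian_ring A" "module A M" "finitely_generated A M"
 shows "EX b d \<epsilon>. free_resolution A M b d \<epsilon> & (ALL i. ALL Y :: ('a, 'n, 'j) module_scheme. Ext A i M Y = Hom_cohomology A Y b d i)"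
proof -
 define s where "s = (SOME (b, d). EX \<epsilon>. free_resolution A M b d \<epsilon>)"
 obtain b d where s: "s = (b, d)" by force
 have "case s of (b, d) => EX \<epsilon>. free_resolution A M b d \<epsilon>"
  unfolding s_def by(rule someI_ex) (use free_resolution_exists[OF assms] in auto)
 hence "EX \<epsilon>. free_resolution A M b d \<epsilon>" by(simp add: s)
 moreover have "Ext A i M Y = Hom_cohomology A Y b d i" for i and Y :: "('a, 'n, 'j) module_scheme"
  unfolding Ext_def s_def[symmetric] by(simp add: s)
 ultimately show ?thesis by blast
qed

theorem corollary3p3p4:
  fixes A :: "('a, 'k) ring_scheme" and \<mm> I :: "'a set"
    and M :: "('a, 'm, 'l) module_scheme" and N :: "('a, 'n, 'j) module_scheme"
  assumes "local_complete_intersection TYPE('q) A \<mm>"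
    and "module A M" and "finitely_generated A M"
    and "module A N" and "finitely_generated A N"
    and "ideal I A"
  shows "\<exists>n\<^sub>0 i\<^sub>0 :: nat. \<forall>n \<ge> n\<^sub>0. \<forall>i \<ge> i\<^sub>0.
    associated_primes A (Ext A (2 * i) M (quot_module N (ideal_smult A (ideal_pow A I n) N))) =
    associated_primes A (Ext A (2 * i\<^sub>0) M (quot_module N (ideal_smult A (ideal_pow A I n\<^sub>0) N))) \<and>
    associated_primes A (Ext A (2 * i + 1) M (quot_module N (ideal_smult A (ideal_pow A I n) N))) =
    associated_primes A (Ext A (2 * i\<^sub>0 + 1) M (quot_module N (ideal_smult A (ideal_pow A I n\<^sub>0) N)))"
proof -
 obtain Q :: "'q ring" and \<nn> fs where A: "cring A" "noetherian_ring A" "maximalideal \<mm> A" "!!J. maximalideal J A ==> J = \<mm>"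
  and Q: "regular_local_ring Q \<nn>" "regular_sequence Q fs" "completion A \<mm> \<simeq> Q Quot genideal Q (set fs)"
  using assms(1) unfolding local_complete_intersection_def noetherian_local_ring_def by blast
 have cQ: "cring Q" "noetherian_ring Q" using Q(1) by(auto simp: regular_local_ring_def noetherian_local_ring_def)
 interpret A: cring A by(rule A(1))
 interpret Q: cring Q by(rule cQ(1))
 interpret N: module A N by(rule assms(4))
 let ?K = "genideal Q (set fs)" and ?JJ = "%j. Q.pre (genideal Q (set (take j fs)))"
 have fsQ: "set fs <= carrier Q" using Q(2) by(simp add: regular_sequence_def)
 have \<mm>: "ideal \<mm> A" by(rule maximalideal.axioms(1)[OF A(3)])
 have lA: "lcl A.fker (A.pre \<mm>)" by(rule A.lcl_pre[OF A(2,3,4)])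
 obtain \<mu> s where \<mu>: "A.pre \<mm> = gi (A.fker Un \<mu> ` {..<s::nat})" using A.pre_finitely_generated[OF A(2) \<mm>] by blast
 obtain gm m where gm: "A.pre I = gi (A.fker Un gm ` {..<m::nat})" using A.pre_finitely_generated[OF A(2) assms(6)] by blast
 obtain h where h: "h : ring_iso (completion A \<mm>) (Q Quot ?K)" using Q(3) by(auto simp: is_ring_iso_def)
 obtain io KK where cm: "completion_map io A.fker (A.pre \<mm>) \<mu> s (Q.pre ?K) KK"
  using completion_map_exists[OF A(1) \<mm> A.rnoeth_fker[OF A(2)] lA \<mu> cQ(1) Q.genideal_ideal[OF fsQ] h] by blast
 obtain xs where xs: "lcl Q.fker (Q.pre \<nn>)" "Q.pre \<nn> = gi (Q.fker Un set xs)" "regp Q.fker xs"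
  using Q.regular_regp[OF Q(1)] by blast
 note JJ = Q.regular_sequence_pre[OF Q(2)]
 obtain b d \<epsilon> where res: "free_resolution A M b d \<epsilon>"
  and ext: "!!i (Y :: ('a, 'n set) module). Ext A i M Y = Hom_cohomology A Y b d i"
  using Ext_Hom_cohomology[OF A(1,2) assms(2,3)] by blast
 obtain S where S: "S <= carrier N" "finite S" "mod_span A N S = carrier N"
  using assms(5) by(auto simp: finitely_generated_def)
 \<comment> \<open>A covering of \<open>N\<close> by a free module of rank \<open>g\<close>; its
   kernel, pulled back to the free ring, becomes \<open>rel\<close>.\<close>
 obtain g f where f: "f : mod_hom A (free_module A g) N" "f ` carrier (free_module A g) = carrier N"
  using N.free_cover[OF S(2,1)] S(3) by metis
 interpret r: resolution A b d by unfold_locales (use res in \<open>auto simp: free_resolution_def\<close>)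
 interpret completion_ext io A.fker "A.pre \<mm>" \<mu> s "Q.pre ?K" KK b r.dA g
  using cm r.cplx_dA r.exact_dA by(simp add: completion_ext_def completion_ext_axioms_def)
 define rel where "rel = {w : Vs {..<g} + JV A.fker. f (A.red g w) : {\<zero>\<^bsub>N\<^esub>}}"
 have rel: "smd rel" "JV A.fker <= rel" "rel <= Vs {..<g} + JV A.fker"
 proof -
  have J: "smd (JV A.fker :: (nat => 'a fr) set)" by(rule smd_JV[OF A.idl_fker])
  have z: "submodule {\<zero>\<^bsub>N\<^esub>} A N" by(rule N.submoduleI) auto
  have e: "rel = (Vs {..<g} + JV A.fker) Int {w. f (A.red g w) : {\<zero>\<^bsub>N\<^esub>}}" by(auto simp: rel_def)
  show "smd rel" unfolding e
   by(intro ops_Int vmod.ops_range_plus smd_Vs J A.smd_hom[OF assms(4) f(1) z])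
  show "rel <= Vs {..<g} + JV A.fker" by(auto simp: rel_def)
  show "JV A.fker <= rel"
  proof
   fix u :: "nat => 'a fr" assume u: "u : JV A.fker"
   hence "A.red g u = A.red g 0" by(simp add: A.red_eq_iff JV_def)
   hence "f (A.red g u) = \<zero>\<^bsub>N\<^esub>" using A.red_hom(4)[OF assms(4) f(1)] by simp
   thus "u : rel" using u plus_ge2[OF ops_zero[OF smd_Vs]] by(auto simp: rel_def)
  qed
 qed
 define F where "F k n = associated_primes A (Ext A k M (quot_module N (ideal_smult A (ideal_pow A I n) N)))" for k n
 define G where "G k n = {p. prm p & extv A.fker b r.dA g k (ivec gm m n (Vs {..<g}) + rel) p}" for k n
 \<comment> \<open>All quotients of \<open>N\<close> share the covering \<open>f\<close>, and their
   relations depend on \<open>n\<close> through \<open>ivec\<close> only. Primes of \<open>A\<close>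
   correspond to their preimages in the free ring.\<close>
 have FG: "F (Suc k) n = {P. primeideal P A & A.pre P : G k n}" for k n
 proof -
  let ?P = "ideal_pow A I n"
  let ?H = "ideal_smult A ?P N"
  have P: "ideal ?P A" "A.pre ?P = (lsum (%l. (*) (gm l)) {..<m} ^^ n) UNIV + A.fker"
   by(rule A.pre_pow[OF assms(6) gm])+
  have Pc: "?P <= carrier A" by(rule additive_subgroup.a_subset[OF ideal.axioms(1)[OF P(1)]])
  have "{a \<odot>\<^bsub>N\<^esub> x |a x. a : ?P & x : carrier N} <= carrier N" using Pc N.smult_closed by blast
  hence H: "submodule ?H A N" unfolding ideal_smult_def by(rule N.mod_span_submodule)
  interpret c: cochains A b d N g f ?H
   by(intro cochains.intro cochains_axioms.intro r.resolution_axioms assms(4) f H)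
  have "c.UH = ivec gm m n (Vs {..<g}) + rel"
   unfolding c.UH_def rel_def by(rule N.UH_ivec[OF f Pc P(2)])
  thus ?thesis
   using c.ass_cohomology[OF res, of k] by(auto simp: F_def G_def ext A.prm_pre)
 qed
 \<comment> \<open>The ideals of initial segments of \<open>fs\<close> form the chain
   \<open>?JJ\<close>, which starts at the kernel of the presentation of \<open>Q\<close> and ends
   at the preimage of \<open>?K\<close>.\<close>
 have "EX e0. ALL e>=e0. EX n0 i0. ALL n>=n0. ALL i>=i0. G (2 * i + e) n = G (2 * i0 + e) n0"
  unfolding G_def
 proof (rule extv_stable[OF Q.rnoeth_fker[OF cQ(2), folded JJ(3)] xs[folded JJ(3)] JJ(1,2) _ _ JJ(4) rel(1,2,3)])
  show "Q.pre (genideal Q (set (take (length fs) fs))) = Q.pre ?K" by simp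
  show "Q.pre (genideal Q (set (take 0 fs))) <= Q.pre ?K"
   unfolding JJ(3) by(rule Q.fker_sub_pre[OF Q.genideal_ideal[OF fsQ]])
 qed
 then obtain e0 where e0: "!!e. e >= e0 ==> EX n0 i0. ALL n>=n0. ALL i>=i0. G (2 * i + e) n = G (2 * i0 + e) n0" by blast
 have F: "EX n0 i0. ALL n>=n0. ALL i>=i0. F (Suc (2 * i + e)) n = F (Suc (2 * i0 + e)) n0" if "e >= e0" for e
 proof -
  obtain n0 i0 where st: "!!n i. n >= n0 ==> i >= i0 ==> G (2 * i + e) n = G (2 * i0 + e) n0"
   using e0[OF \<open>e >= e0\<close>] by blast
  have "F (Suc (2 * i + e)) n = F (Suc (2 * i0 + e)) n0" if "n >= n0" "i >= i0" for n i
   unfolding FG st[OF that] ..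
  thus ?thesis by blast
 qed
 \<comment> \<open>Both offsets \<open>2 * e0\<close> and \<open>2 * e0 + 1\<close> are at least
   \<open>e0\<close>.\<close>
 show ?thesis
  unfolding F_def[symmetric] by(rule parity_stable[where e = e0, OF F F]) simp_all
qed

end
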